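(* Let $(M,\nabla,\langle\cdot,\cdot\rangle)$ be an affine-Riemann manifold with Koszul forms $\alpha$ and $\xi$, and let $(TM,J_1,g_1)$ be its canonical Hermitian structure. The Lee form $\theta_1$ of $(TM,J_1,g_1)$ is given by $$\theta_1=\pi_1^*(\alpha-\xi).$$ In particular, $(TM,J_1,g_1)$ is balanced if and only if $\alpha=\xi$, which is also equivalent to $\mathrm{tr}_{\langle,\rangle}(\gamma^*-\gamma)=0$. Moreover, $(TM,J_1,g_1)$ is locally conformally balanced if and only if $d\xi=0$.
   Context: An affine-Riemann manifold $(M,\nabla,\langle\cdot,\cdot\rangle)$ is a manifold $M$ of dimension $n$ with a flat torsionless connection $\nabla$ and a Riemannian metric $\langle\cdot,\cdot\rangle$. $D$ is the Levi-Civita connection of the metric; the difference tensor is $\gamma_XY=D_XY-\nabla_XY$, and $\gamma^*$ is defined by $\langle\gamma^*_XY,Z\rangle=\langle Y,\gamma_XZ\rangle$. For a local orthonormal frame $(E_i)$, $\mathrm{tr}_{\langle,\rangle}(\gamma)=\sum_i\gamma_{E_i}E_i$ and $\mathrm{tr}_{\langle,\rangle}(\gamma^* )=\sum_i\gamma^*_{E_i}E_i$. The Koszul forms are $\alpha(X)=\langle\mathrm{tr}_{\langle,\rangle}(\gamma^* ),X\rangle$ and $\xi(X)=\langle\mathrm{tr}_{\langle,\rangle}(\gamma),X\rangle$. Canonical Hermitian structure: $\pi_1:TM\to M$ is the projection; for a vector field $X$ on $M$, $X^h$ is the horizontal lift with respect to $\nabla$ and $X^v$ the vertical lift; $J_1X^h=X^v$,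 $J_1X^v=-X^h$; $g_1(X^h,Y^h)=g_1(X^v,Y^v)=\langle X,Y\rangle\circ\pi_1$, $g_1(X^h,Y^v)=0$. For a Hermitian manifold $(N,J,g)$: fundamental form $\omega=g(J\cdot,\cdot)$; $d^*\eta(X_1,\dots,X_{p-1})=-\sum_i(\nabla^{LC}_{E_i}\eta)(E_i,X_1,\dots,X_{p-1})$ with $\nabla^{LC}$ the Levi-Civita connection of $g$ and $(E_i)$ a local $g$-orthonormal frame; Lee form $\theta=-d^*\omega\circ J$. $(N,J,g)$ is balanced if $\theta=0$ and locally conformally balanced if $d\theta=0$. *)

theory Defs
  imports "HOL-Analysis.Analysis"
begin

section \<open>Smooth manifolds\<close>

text \<open>The set \<open>S\<close> is meant to be open.\<close>

primrec Ck_on :: "nat \<Rightarrow> 'e::euclidean_space set \<Rightarrow> ('e \<Rightarrow> 'f::real_normed_vector) \<Rightarrow> bool" where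
  "Ck_on 0 S f \<longleftrightarrow> continuous_on S f"
| "Ck_on (Suc k) S f \<longleftrightarrow>
     f differentiable_on S \<and> (\<forall>v. Ck_on k S (\<lambda>x. frechet_derivative f (at x) v))"

definition smooth_on :: "'e::euclidean_space set \<Rightarrow> ('e \<Rightarrow> 'f::real_normed_vector) \<Rightarrow> bool" where
  "smooth_on S f \<longleftrightarrow> (\<forall>k. Ck_on k S f)"

text \<open>A manifold of dimension \<open>DIM('e)\<close> is given by a (not necessarily maximal) smooth atlas. Its
  points are those covered by the charts, and its topology is the one that makes the charts
  homeomorphisms onto open subsets of the model space.\<close>

type_synonym ('a, 'e) chart = "'a set \<times> ('a \<Rightarrow> 'e)"

definition pts :: "('a, 'e) chart set \<Rightarrow> 'a set" where
  "pts A = (\<Union>(U, \<phi>)\<in>A. U)"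

definition mtop :: "('a, 'e::euclidean_space) chart set \<Rightarrow> 'a topology" where
  "mtop A = topology (\<lambda>V. V \<subseteq> pts A \<and> (\<forall>(U, \<phi>)\<in>A. open (\<phi> ` (V \<inter> U))))"

definition smooth_atlas :: "('a, 'e::euclidean_space) chart set \<Rightarrow> bool" where
  "smooth_atlas A \<longleftrightarrow>
     (\<forall>(U, \<phi>)\<in>A. inj_on \<phi> U \<and> open (\<phi> ` U)) \<and>
     (\<forall>(U, \<phi>)\<in>A. \<forall>(V, \<psi>)\<in>A.
        open (\<phi> ` (U \<inter> V)) \<and> smooth_on (\<phi> ` (U \<inter> V)) (\<psi> \<circ> inv_into U \<phi>))"

definition manifold :: "('a, 'e::euclidean_space) chart set \<Rightarrow> bool" where
  "manifold A \<longleftrightarrow>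
     smooth_atlas A \<and> Hausdorff_space (mtop A) \<and> second_countable (mtop A)"

definition smooth_fun_on :: "('a, 'e::euclidean_space) chart set \<Rightarrow> 'a set \<Rightarrow> ('a \<Rightarrow> real) \<Rightarrow> bool" where
  "smooth_fun_on A U f \<longleftrightarrow>
     openin (mtop A) U \<and> (\<forall>(V, \<phi>)\<in>A. smooth_on (\<phi> ` (U \<inter> V)) (f \<circ> inv_into V \<phi>))"

definition smooth_near :: "('a, 'e::euclidean_space) chart set \<Rightarrow> 'a \<Rightarrow> ('a \<Rightarrow> real) \<Rightarrow> bool" where
  "smooth_near A p f \<longleftrightarrow> (\<exists>U. p \<in> U \<and> smooth_fun_on A U f)"


section \<open>Tangent vectors and vector fields\<close>

text \<open>A tangent vector at \<open>p\<close> is a derivation at \<open>p\<close> on the functions that are smooth near \<open>p\<close>,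
  extended by zero to all other functions. Dependence on the germ of the function only is a
  consequence: if \<open>f\<close> vanishes on a neighbourhood \<open>U\<close> of \<open>p\<close>, then \<open>f = h * f\<close> for the indicator
  function \<open>h\<close> of the complement of \<open>U\<close>, which is smooth near \<open>p\<close>, and the Leibniz rule gives
  \<open>v f = 0\<close>.\<close>

type_synonym 'a tvec = "('a \<Rightarrow> real) \<Rightarrow> real"
type_synonym 'a vfield = "'a \<Rightarrow> 'a tvec"

definition tangent_space :: "('a, 'e::euclidean_space) chart set \<Rightarrow> 'a \<Rightarrow> 'a tvec set" where
  "tangent_space A p = {v.
     (\<forall>f. \<not> smooth_near A p f \<longrightarrow> v f = 0) \<and>
     (\<forall>f h. smooth_near A p f \<and> smooth_near A p h \<longrightarrow>
        v (\<lambda>q. f q + h q) = v f + v h \<and>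
        v (\<lambda>q. f q * h q) = f p * v h + h p * v f) \<and>
     (\<forall>f c. smooth_near A p f \<longrightarrow> v (\<lambda>q. c * f q) = c * v f)}"

definition tzero :: "'a tvec" where
  "tzero = (\<lambda>f. 0)"

definition tadd :: "'a tvec \<Rightarrow> 'a tvec \<Rightarrow> 'a tvec" where
  "tadd v w = (\<lambda>f. v f + w f)"

definition tdiff :: "'a tvec \<Rightarrow> 'a tvec \<Rightarrow> 'a tvec" where
  "tdiff v w = (\<lambda>f. v f - w f)"

definition tscale :: "real \<Rightarrow> 'a tvec \<Rightarrow> 'a tvec" where
  "tscale c v = (\<lambda>f. c * v f)"

definition tsum :: "('i \<Rightarrow> 'a tvec) \<Rightarrow> 'i set \<Rightarrow> 'a tvec" where
  "tsum v I = (\<lambda>f. \<Sum>i\<in>I. v i f)"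

text \<open>Vector fields are total functions; being a smooth vector field on an open set \<open>U\<close> constrains
  the values on \<open>U\<close> only.\<close>

definition vfield_on :: "('a, 'e::euclidean_space) chart set \<Rightarrow> 'a set \<Rightarrow> 'a vfield \<Rightarrow> bool" where
  "vfield_on A U X \<longleftrightarrow>
     openin (mtop A) U \<and> (\<forall>p\<in>U. X p \<in> tangent_space A p) \<and>
     (\<forall>V f. V \<subseteq> U \<and> smooth_fun_on A V f \<longrightarrow> smooth_fun_on A V (\<lambda>p. X p f))"

text \<open>The guards here and in the next definition keep the values zero on functions that are not
  smooth near the point in question.\<close>

definition lie_bracket :: "('a, 'e::euclidean_space) chart set \<Rightarrow> 'a vfield \<Rightarrow> 'a vfield \<Rightarrow> 'a vfield" where
  "lie_bracket A X Y p f =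
     (if smooth_near A p f then X p (\<lambda>q. Y q f) - Y p (\<lambda>q. X q f) else 0)"

definition differential ::
    "('b, 'f::euclidean_space) chart set \<Rightarrow> ('a \<Rightarrow> 'b) \<Rightarrow> 'a \<Rightarrow> 'a tvec \<Rightarrow> 'b tvec" where
  "differential B \<Phi> p v = (\<lambda>f. if smooth_near B (\<Phi> p) f then v (f \<circ> \<Phi>) else 0)"


section \<open>Connections and Riemannian metrics\<close>

text \<open>A connection acts on vector fields defined on open subsets. That \<open>D X Y\<close> on \<open>U\<close> depends only
  on the restrictions of \<open>X\<close> and \<open>Y\<close> to \<open>U\<close> follows from the axioms, by the argument given for
  tangent vectors.\<close>

definition connection ::
    "('a, 'e::euclidean_space) chart set \<Rightarrow> ('a vfield \<Rightarrow> 'a vfield \<Rightarrow> 'a vfield) \<Rightarrow> bool" where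
  "connection A D \<longleftrightarrow>
     (\<forall>U X Y. vfield_on A U X \<and> vfield_on A U Y \<longrightarrow> vfield_on A U (D X Y)) \<and>
     (\<forall>U X X' Y. vfield_on A U X \<and> vfield_on A U X' \<and> vfield_on A U Y \<longrightarrow>
        (\<forall>p\<in>U. D (\<lambda>q. tadd (X q) (X' q)) Y p = tadd (D X Y p) (D X' Y p))) \<and>
     (\<forall>U f X Y. smooth_fun_on A U f \<and> vfield_on A U X \<and> vfield_on A U Y \<longrightarrow>
        (\<forall>p\<in>U. D (\<lambda>q. tscale (f q) (X q)) Y p = tscale (f p) (D X Y p))) \<and>
     (\<forall>U X Y Y'. vfield_on A U X \<and> vfield_on A U Y \<and> vfield_on A U Y' \<longrightarrow>
        (\<forall>p\<in>U. D X (\<lambda>q. tadd (Y q) (Y' q)) p = tadd (D X Y p) (D X Y' p))) \<and>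
     (\<forall>U f X Y. smooth_fun_on A U f \<and> vfield_on A U X \<and> vfield_on A U Y \<longrightarrow>
        (\<forall>p\<in>U. D X (\<lambda>q. tscale (f q) (Y q)) p
                = tadd (tscale (X p f) (Y p)) (tscale (f p) (D X Y p))))"

definition torsion_free ::
    "('a, 'e::euclidean_space) chart set \<Rightarrow> ('a vfield \<Rightarrow> 'a vfield \<Rightarrow> 'a vfield) \<Rightarrow> bool" where
  "torsion_free A D \<longleftrightarrow>
     (\<forall>U X Y. vfield_on A U X \<and> vfield_on A U Y \<longrightarrow>
        (\<forall>p\<in>U. tdiff (D X Y p) (D Y X p) = lie_bracket A X Y p))"

definition flat ::
    "('a, 'e::euclidean_space) chart set \<Rightarrow> ('a vfield \<Rightarrow> 'a vfield \<Rightarrow> 'a vfield) \<Rightarrow> bool" where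
  "flat A D \<longleftrightarrow>
     (\<forall>U X Y Z. vfield_on A U X \<and> vfield_on A U Y \<and> vfield_on A U Z \<longrightarrow>
        (\<forall>p\<in>U. tdiff (tdiff (D X (D Y Z) p) (D Y (D X Z) p)) (D (lie_bracket A X Y) Z p) = tzero))"

definition riemannian_metric ::
    "('a, 'e::euclidean_space) chart set \<Rightarrow> ('a \<Rightarrow> 'a tvec \<Rightarrow> 'a tvec \<Rightarrow> real) \<Rightarrow> bool" where
  "riemannian_metric A g \<longleftrightarrow>
     (\<forall>p\<in>pts A. \<forall>x\<in>tangent_space A p. \<forall>y\<in>tangent_space A p.
        g p x y = g p y x \<and>
        (\<forall>z\<in>tangent_space A p. g p (tadd x y) z = g p x z + g p y z) \<and>
        (\<forall>c. g p (tscale c x) y = c * g p x y) \<and>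
        (x \<noteq> tzero \<longrightarrow> g p x x > 0)) \<and>
     (\<forall>U X Y. vfield_on A U X \<and> vfield_on A U Y \<longrightarrow> smooth_fun_on A U (\<lambda>p. g p (X p) (Y p)))"

definition metric_connection ::
    "('a, 'e::euclidean_space) chart set \<Rightarrow> ('a \<Rightarrow> 'a tvec \<Rightarrow> 'a tvec \<Rightarrow> real) \<Rightarrow>
      ('a vfield \<Rightarrow> 'a vfield \<Rightarrow> 'a vfield) \<Rightarrow> bool" where
  "metric_connection A g D \<longleftrightarrow>
     (\<forall>U X Y Z. vfield_on A U X \<and> vfield_on A U Y \<and> vfield_on A U Z \<longrightarrow>
        (\<forall>p\<in>U. X p (\<lambda>q. g q (Y q) (Z q)) = g p (D X Y p) (Z p) + g p (Y p) (D X Z p)))"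

text \<open>The choice below is unique as far as the values on \<open>U\<close> for vector fields smooth on \<open>U\<close> are
  concerned.\<close>

definition levi_civita ::
    "('a, 'e::euclidean_space) chart set \<Rightarrow> ('a \<Rightarrow> 'a tvec \<Rightarrow> 'a tvec \<Rightarrow> real) \<Rightarrow>
      'a vfield \<Rightarrow> 'a vfield \<Rightarrow> 'a vfield" where
  "levi_civita A g = (SOME D. connection A D \<and> torsion_free A D \<and> metric_connection A g D)"

definition orthonormal_frame_on ::
    "('a, 'e::euclidean_space) chart set \<Rightarrow> ('a \<Rightarrow> 'a tvec \<Rightarrow> 'a tvec \<Rightarrow> real) \<Rightarrow> 'a set \<Rightarrow>
      (nat \<Rightarrow> 'a vfield) \<Rightarrow> bool" where
  "orthonormal_frame_on (A :: ('a, 'e) chart set) g U E \<longleftrightarrow>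
     (\<forall>i<DIM('e). vfield_on A U (E i)) \<and>
     (\<forall>i<DIM('e). \<forall>j<DIM('e). \<forall>p\<in>U. g p (E i p) (E j p) = (if i = j then 1 else 0))"


section \<open>Differential forms of degree one\<close>

definition form_eq ::
    "('a, 'e::euclidean_space) chart set \<Rightarrow> ('a \<Rightarrow> 'a tvec \<Rightarrow> real) \<Rightarrow> ('a \<Rightarrow> 'a tvec \<Rightarrow> real) \<Rightarrow> bool" where
  "form_eq A \<eta> \<eta>' \<longleftrightarrow> (\<forall>p\<in>pts A. \<forall>x\<in>tangent_space A p. \<eta> p x = \<eta>' p x)"

definition ext_deriv ::
    "('a, 'e::euclidean_space) chart set \<Rightarrow> ('a \<Rightarrow> 'a tvec \<Rightarrow> real) \<Rightarrow> 'a vfield \<Rightarrow> 'a vfield \<Rightarrow> 'a \<Rightarrow> real" where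
  "ext_deriv A \<eta> X Y p =
     X p (\<lambda>q. \<eta> q (Y q)) - Y p (\<lambda>q. \<eta> q (X q)) - \<eta> p (lie_bracket A X Y p)"

definition closed_form :: "('a, 'e::euclidean_space) chart set \<Rightarrow> ('a \<Rightarrow> 'a tvec \<Rightarrow> real) \<Rightarrow> bool" where
  "closed_form A \<eta> \<longleftrightarrow>
     (\<forall>U X Y. vfield_on A U X \<and> vfield_on A U Y \<longrightarrow> (\<forall>p\<in>U. ext_deriv A \<eta> X Y p = 0))"

definition pullback_form ::
    "('b, 'f::euclidean_space) chart set \<Rightarrow> ('a \<Rightarrow> 'b) \<Rightarrow> ('b \<Rightarrow> 'b tvec \<Rightarrow> real) \<Rightarrow> 'a \<Rightarrow> 'a tvec \<Rightarrow> real" where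
  "pullback_form B \<Phi> \<eta> p x = \<eta> (\<Phi> p) (differential B \<Phi> p x)"


section \<open>Lee form of a Hermitian manifold\<close>

definition fundamental_form ::
    "('a \<Rightarrow> 'a tvec \<Rightarrow> 'a tvec) \<Rightarrow> ('a \<Rightarrow> 'a tvec \<Rightarrow> 'a tvec \<Rightarrow> real) \<Rightarrow> 'a \<Rightarrow> 'a tvec \<Rightarrow> 'a tvec \<Rightarrow> real" where
  "fundamental_form J g p x y = g p (J p x) y"

definition cov_deriv_form2 ::
    "('a vfield \<Rightarrow> 'a vfield \<Rightarrow> 'a vfield) \<Rightarrow> ('a \<Rightarrow> 'a tvec \<Rightarrow> 'a tvec \<Rightarrow> real) \<Rightarrow>
      'a vfield \<Rightarrow> 'a vfield \<Rightarrow> 'a vfield \<Rightarrow> 'a \<Rightarrow> real" where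
  "cov_deriv_form2 D \<omega> Z X Y p =
     Z p (\<lambda>q. \<omega> q (X q) (Y q)) - \<omega> p (D Z X p) (Y p) - \<omega> p (X p) (D Z Y p)"

text \<open>The codifferential of a 2-form, evaluated at a tangent vector \<open>x\<close>. The value does not depend on
  the local orthonormal frame \<open>E\<close> nor on the local extension \<open>X\<close> of \<open>x\<close>.\<close>

definition codiff2 ::
    "('a, 'e::euclidean_space) chart set \<Rightarrow> ('a \<Rightarrow> 'a tvec \<Rightarrow> 'a tvec \<Rightarrow> real) \<Rightarrow>
      ('a \<Rightarrow> 'a tvec \<Rightarrow> 'a tvec \<Rightarrow> real) \<Rightarrow> 'a \<Rightarrow> 'a tvec \<Rightarrow> real" where
  "codiff2 (A :: ('a, 'e) chart set) g \<omega> p x = (THE c. \<forall>U E X.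
     p \<in> U \<and> orthonormal_frame_on A g U E \<and> vfield_on A U X \<and> X p = x \<longrightarrow>
     c = - (\<Sum>i<DIM('e). cov_deriv_form2 (levi_civita A g) \<omega> (E i) (E i) X p))"

definition lee_form ::
    "('a, 'e::euclidean_space) chart set \<Rightarrow> ('a \<Rightarrow> 'a tvec \<Rightarrow> 'a tvec) \<Rightarrow>
      ('a \<Rightarrow> 'a tvec \<Rightarrow> 'a tvec \<Rightarrow> real) \<Rightarrow> 'a \<Rightarrow> 'a tvec \<Rightarrow> real" where
  "lee_form A J g p x = - codiff2 A g (fundamental_form J g) p (J p x)"

definition balanced ::
    "('a, 'e::euclidean_space) chart set \<Rightarrow> ('a \<Rightarrow> 'a tvec \<Rightarrow> 'a tvec) \<Rightarrow>
      ('a \<Rightarrow> 'a tvec \<Rightarrow> 'a tvec \<Rightarrow> real) \<Rightarrow> bool" where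
  "balanced A J g \<longleftrightarrow> form_eq A (lee_form A J g) (\<lambda>p x. 0)"

definition locally_conformally_balanced ::
    "('a, 'e::euclidean_space) chart set \<Rightarrow> ('a \<Rightarrow> 'a tvec \<Rightarrow> 'a tvec) \<Rightarrow>
      ('a \<Rightarrow> 'a tvec \<Rightarrow> 'a tvec \<Rightarrow> real) \<Rightarrow> bool" where
  "locally_conformally_balanced A J g \<longleftrightarrow> closed_form A (lee_form A J g)"


section \<open>Affine-Riemann manifolds and Koszul forms\<close>

definition affine_riemann_manifold ::
    "('a, 'e::euclidean_space) chart set \<Rightarrow> ('a vfield \<Rightarrow> 'a vfield \<Rightarrow> 'a vfield) \<Rightarrow>
      ('a \<Rightarrow> 'a tvec \<Rightarrow> 'a tvec \<Rightarrow> real) \<Rightarrow> bool" where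
  "affine_riemann_manifold A nab g \<longleftrightarrow>
     manifold A \<and> connection A nab \<and> torsion_free A nab \<and> flat A nab \<and> riemannian_metric A g"

definition diff_tensor ::
    "('a, 'e::euclidean_space) chart set \<Rightarrow> ('a vfield \<Rightarrow> 'a vfield \<Rightarrow> 'a vfield) \<Rightarrow>
      ('a \<Rightarrow> 'a tvec \<Rightarrow> 'a tvec \<Rightarrow> real) \<Rightarrow> 'a vfield \<Rightarrow> 'a vfield \<Rightarrow> 'a vfield" where
  "diff_tensor A nab g X Y p = tdiff (levi_civita A g X Y p) (nab X Y p)"

definition adjoint_tensor ::
    "('a, 'e::euclidean_space) chart set \<Rightarrow> ('a \<Rightarrow> 'a tvec \<Rightarrow> 'a tvec \<Rightarrow> real) \<Rightarrow>
      ('a vfield \<Rightarrow> 'a vfield \<Rightarrow> 'a vfield) \<Rightarrow> 'a vfield \<Rightarrow> 'a vfield \<Rightarrow> 'a vfield" where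
  "adjoint_tensor A g \<gamma> X Y p = (THE w. w \<in> tangent_space A p \<and>
     (\<forall>U Z. p \<in> U \<and> vfield_on A U Z \<longrightarrow> g p w (Z p) = g p (Y p) (\<gamma> X Z p)))"

text \<open>The value does not depend on the local orthonormal frame \<open>E\<close> if \<open>B\<close> is tensorial.\<close>

definition metric_trace ::
    "('a, 'e::euclidean_space) chart set \<Rightarrow> ('a \<Rightarrow> 'a tvec \<Rightarrow> 'a tvec \<Rightarrow> real) \<Rightarrow>
      ('a vfield \<Rightarrow> 'a vfield \<Rightarrow> 'a vfield) \<Rightarrow> 'a vfield" where
  "metric_trace (A :: ('a, 'e) chart set) g B p = (THE v. \<forall>U E.
     p \<in> U \<and> orthonormal_frame_on A g U E \<longrightarrow> v = tsum (\<lambda>i. B (E i) (E i) p) {..<DIM('e)})"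

definition koszul_alpha ::
    "('a, 'e::euclidean_space) chart set \<Rightarrow> ('a vfield \<Rightarrow> 'a vfield \<Rightarrow> 'a vfield) \<Rightarrow>
      ('a \<Rightarrow> 'a tvec \<Rightarrow> 'a tvec \<Rightarrow> real) \<Rightarrow> 'a \<Rightarrow> 'a tvec \<Rightarrow> real" where
  "koszul_alpha A nab g p x =
     g p (metric_trace A g (adjoint_tensor A g (diff_tensor A nab g)) p) x"

definition koszul_xi ::
    "('a, 'e::euclidean_space) chart set \<Rightarrow> ('a vfield \<Rightarrow> 'a vfield \<Rightarrow> 'a vfield) \<Rightarrow>
      ('a \<Rightarrow> 'a tvec \<Rightarrow> 'a tvec \<Rightarrow> real) \<Rightarrow> 'a \<Rightarrow> 'a tvec \<Rightarrow> real" where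
  "koszul_xi A nab g p x = g p (metric_trace A g (diff_tensor A nab g) p) x"


section \<open>Tangent bundle and its canonical Hermitian structure\<close>

text \<open>A point of the tangent bundle is a pair \<open>(p, v)\<close> with \<open>v\<close> tangent at \<open>p\<close>; the projection is
  \<open>fst\<close>. In the chart induced by \<open>\<phi>\<close> its coordinates are \<open>\<phi> p\<close> and the components of \<open>v\<close>, which
  are the values of \<open>v\<close> on the coordinate functions of \<open>\<phi>\<close>.\<close>

type_synonym 'a tpoint = "'a \<times> 'a tvec"

definition tangent_chart ::
    "('a, 'e::euclidean_space) chart set \<Rightarrow> ('a, 'e) chart \<Rightarrow> ('a tpoint, 'e \<times> 'e) chart" where
  "tangent_chart A = (\<lambda>(U, \<phi>).
     ({(p, v). p \<in> U \<and> v \<in> tangent_space A p},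
      \<lambda>(p, v). (\<phi> p, \<Sum>b\<in>Basis. v (\<lambda>q. \<phi> q \<bullet> b) *\<^sub>R b)))"

definition tangent_bundle ::
    "('a, 'e::euclidean_space) chart set \<Rightarrow> ('a tpoint, 'e \<times> 'e) chart set" where
  "tangent_bundle A = tangent_chart A ` A"

definition vertical_lift ::
    "('a, 'e::euclidean_space) chart set \<Rightarrow> 'a tpoint \<Rightarrow> 'a tvec \<Rightarrow> 'a tpoint tvec" where
  "vertical_lift A u x = (\<lambda>F.
     if smooth_near (tangent_bundle A) u F
     then deriv (\<lambda>t::real. F (fst u, tadd (snd u) (tscale t x))) 0 else 0)"

text \<open>The horizontal space at \<open>u\<close> consists of the velocities \<open>dY(x)\<close> of the local sections \<open>Y\<close> of the
  tangent bundle through \<open>u\<close> whose covariant derivative in the direction \<open>x\<close> vanishes at the base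
  point.\<close>

definition horizontal_space ::
    "('a, 'e::euclidean_space) chart set \<Rightarrow> ('a vfield \<Rightarrow> 'a vfield \<Rightarrow> 'a vfield) \<Rightarrow>
      'a tpoint \<Rightarrow> 'a tpoint tvec set" where
  "horizontal_space A nab u = {w. \<exists>U X Y.
     fst u \<in> U \<and> vfield_on A U X \<and> vfield_on A U Y \<and>
     Y (fst u) = snd u \<and> nab X Y (fst u) = tzero \<and>
     w = differential (tangent_bundle A) (\<lambda>q. (q, Y q)) (fst u) (X (fst u))}"

definition horizontal_lift ::
    "('a, 'e::euclidean_space) chart set \<Rightarrow> ('a vfield \<Rightarrow> 'a vfield \<Rightarrow> 'a vfield) \<Rightarrow>
      'a tpoint \<Rightarrow> 'a tvec \<Rightarrow> 'a tpoint tvec" where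
  "horizontal_lift A nab u x =
     (THE w. w \<in> horizontal_space A nab u \<and> differential A fst u w = x)"

definition canonical_J ::
    "('a, 'e::euclidean_space) chart set \<Rightarrow> ('a vfield \<Rightarrow> 'a vfield \<Rightarrow> 'a vfield) \<Rightarrow>
      'a tpoint \<Rightarrow> 'a tpoint tvec \<Rightarrow> 'a tpoint tvec" where
  "canonical_J A nab u w = (THE w'.
     \<exists>x\<in>tangent_space A (fst u). \<exists>y\<in>tangent_space A (fst u).
       w = tadd (horizontal_lift A nab u x) (vertical_lift A u y) \<and>
       w' = tdiff (vertical_lift A u x) (horizontal_lift A nab u y))"

definition canonical_g ::
    "('a, 'e::euclidean_space) chart set \<Rightarrow> ('a vfield \<Rightarrow> 'a vfield \<Rightarrow> 'a vfield) \<Rightarrow>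
      ('a \<Rightarrow> 'a tvec \<Rightarrow> 'a tvec \<Rightarrow> real) \<Rightarrow>
      'a tpoint \<Rightarrow> 'a tpoint tvec \<Rightarrow> 'a tpoint tvec \<Rightarrow> real" where
  "canonical_g A nab g u w w' = (THE r.
     \<exists>x\<in>tangent_space A (fst u). \<exists>y\<in>tangent_space A (fst u).
     \<exists>x'\<in>tangent_space A (fst u). \<exists>y'\<in>tangent_space A (fst u).
       w = tadd (horizontal_lift A nab u x) (vertical_lift A u y) \<and>
       w' = tadd (horizontal_lift A nab u x') (vertical_lift A u y') \<and>
       r = g (fst u) x x' + g (fst u) y y')"

end

theory Submission
  imports Defs
begin

text \<open>
  On the tangent bundle the horizontal and vertical lifts of vector fields satisfy
  \<open>[X\<^sup>h, Y\<^sup>v] = (nab X Y)\<^sup>v\<close> and \<open>[X\<^sup>v, Y\<^sup>v] = 0\<close>, while \<open>[X\<^sup>h, Y\<^sup>h]\<close> projects to \<open>[X, Y]\<close>. If \<open>(E\<^sub>i)\<close> is a local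
  orthonormal frame, then so is \<open>(E\<^sub>i\<^sup>h, E\<^sub>i\<^sup>v)\<close>, and these brackets together with the Koszul formula give
  \<open>\<theta>\<^sub>1(E\<^sub>k\<^sup>v) = 0\<close> and
  \<open>\<theta>\<^sub>1(E\<^sub>k\<^sup>h) = \<Sum>\<^sub>i \<langle>nab E\<^sub>i E\<^sub>i, E\<^sub>k\<rangle> - \<langle>[E\<^sub>k, E\<^sub>i], E\<^sub>i\<rangle> - \<langle>nab E\<^sub>k E\<^sub>i, E\<^sub>i\<rangle> = (\<alpha> - \<xi>)(E\<^sub>k)\<close>.
  The form \<open>\<alpha>\<close> is minus the trace of the connection matrix of \<open>nab\<close> in the frame, so it is closed by
  flatness, and \<open>\<pi>\<^sub>1\<^sup>*(\<alpha> - \<xi>)\<close> is closed if and only if \<open>\<xi>\<close> is.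
\<close>

section \<open>Calculus of smooth functions\<close>

text \<open>The encoding shapes the proof in two ways. Vector fields live on open sets and tangent
  vectors are derivations, so an identity must hold near a point before it may be differentiated
  there, and independence of extensions is obtained from tensoriality, that is, additivity and
  homogeneity over smooth functions. The Levi-Civita connection, the codifferential, the traces, the
  horizontal lift, \<open>canonical_J\<close> and \<open>canonical_g\<close> are given by
  description operators, so existence or uniqueness precedes each computation. The Riemannian theory
  is set up over an arbitrary smooth atlas because it is applied twice, to M and to its tangent
  bundle.

  Upstairs the full Levi-Civita connection D is never computed. It enters through the components
  g_1(D_{e_a} e_a, e_c), which are brackets by skew-symmetry, and through differences of D_{e_i} J_1
  e_i and D_{J_1 e_i} e_i, which are brackets because the torsion vanishes. The bracket [X^h, Y^h]
  is paired with horizontal vectors, so its projection is all that matters.\<close>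

lemma linear_eq_sum_Basis:
  fixes f :: "'e::euclidean_space \<Rightarrow> 'f::real_vector"
  assumes "linear f"
  shows "f w = (\<Sum>b\<in>Basis. (w \<bullet> b) *\<^sub>R f b)"
proof -
  have "f w = f (\<Sum>b\<in>Basis. (w \<bullet> b) *\<^sub>R b)" by (simp add: euclidean_representation)
  also have "\<dots> = (\<Sum>b\<in>Basis. (w \<bullet> b) *\<^sub>R f b)" by (simp add: linear_sum[OF assms] linear_cmul[OF assms])
  finally show ?thesis .
qed

text \<open>\<open>frechet_derivative f (at x)\<close> looks at a full neighbourhood of
  \<open>x\<close>; openness of \<open>S\<close> lets this neighbourhood shrink into the set where
  the two functions agree.\<close>

lemma Ck_on_cong:
  assumes "open S" "Ck_on k S f" "\<And>x. x \<in> S \<Longrightarrow> f x = h x"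
  shows "Ck_on k S h"
  using assms(2,3)
proof (induction k arbitrary: f h)
  case 0
  then show ?case using continuous_on_cong by fastforce
next
  case (Suc k)
  have d: "f differentiable (at x)" if "x \<in> S" for x
    using Suc.prems(1) that at_within_open[OF that assms(1)] unfolding Ck_on.simps differentiable_on_def
    by metis
  have D: "(h has_derivative frechet_derivative f (at x)) (at x)" if "x \<in> S" for x
    using has_derivative_transform_within_open[OF _ assms(1) that Suc.prems(2)] d[OF that]
    by (simp add: frechet_derivative_works)
  then have "h differentiable_on S"
    by (meson differentiable_at_imp_differentiable_on differentiable_def)
  moreover have "Ck_on k S (\<lambda>x. frechet_derivative h (at x) v)" for v
    by (rule Suc.IH[of "\<lambda>x. frechet_derivative f (at x) v"])
      (use Suc.prems(1) frechet_derivative_at[OF D] in auto)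
  ultimately show ?case by simp
qed

text \<open>Trades the choice operator hidden in \<open>frechet_derivative\<close> for any
  explicitly known derivative. The closure properties below all pass through this rule.\<close>

lemma Ck_on_Suc:
  assumes "open S" "\<And>x. x \<in> S \<Longrightarrow> (f has_derivative f' x) (at x)" "\<And>v. Ck_on k S (\<lambda>x. f' x v)"
  shows "Ck_on (Suc k) S f"
proof -
  have "f differentiable_on S"
    using assms(2) by (meson differentiable_at_imp_differentiable_on differentiable_def)
  moreover have "Ck_on k S (\<lambda>x. frechet_derivative f (at x) v)" for v
    by (rule Ck_on_cong[OF assms(1) assms(3)[of v]]) (use frechet_derivative_at[OF assms(2)] in metis)
  ultimately show ?thesis by simp
qed

lemma Ck_on_has_derivative:
  assumes "open S" "Ck_on (Suc k) S f" "x \<in> S"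
  shows "(f has_derivative frechet_derivative f (at x)) (at x)"
proof -
  have "f differentiable (at x within S)" using assms(2,3) by (simp add: differentiable_on_def)
  then have "f differentiable (at x)" by (simp only: at_within_open[OF assms(3,1)])
  then show ?thesis by (simp only: frechet_derivative_works)
qed

lemma Ck_on_Suc_imp: "Ck_on (Suc k) S f \<Longrightarrow> Ck_on k S f"
proof (induction k arbitrary: f)
  case 0
  then show ?case by (simp add: differentiable_imp_continuous_on)
next
  case (Suc k)
  then show ?case by (metis Ck_on.simps(2))
qed

lemma Ck_on_continuous: "Ck_on k S f \<Longrightarrow> continuous_on S f"
proof (induction k)
  case (Suc k)
  then show ?case using Ck_on_Suc_imp by blast
qed simp

lemma Ck_on_subset: "Ck_on k S f \<Longrightarrow> T \<subseteq> S \<Longrightarrow> Ck_on k T f"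
  by (induction k arbitrary: f) (auto intro: continuous_on_subset differentiable_on_subset)

lemma Ck_on_local:
  assumes "open S" "\<And>x. x \<in> S \<Longrightarrow> \<exists>T. open T \<and> x \<in> T \<and> Ck_on k T f"
  shows "Ck_on k S f"
  using assms(2)
proof (induction k arbitrary: f)
  case 0
  then show ?case
    using assms(1) by (auto simp: continuous_on_eq_continuous_at) (meson continuous_on_eq_continuous_at)
next
  case (Suc k)
  have "f differentiable_on S"
    using Suc.prems unfolding differentiable_on_def Ck_on.simps
    by (metis at_within_open differentiable_at_withinI)
  moreover have "Ck_on k S (\<lambda>x. frechet_derivative f (at x) v)" for v
    by (rule Suc.IH) (use Suc.prems in force)
  ultimately show ?case by simp
qed

lemma Ck_on_const: "open S \<Longrightarrow> Ck_on k S (\<lambda>x. c)"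
proof (induction k arbitrary: c)
  case (Suc k)
  show ?case by (rule Ck_on_Suc[where f' = "\<lambda>x v. 0"]) (use Suc in auto)
qed auto

lemma Ck_on_linear: "open S \<Longrightarrow> bounded_linear f \<Longrightarrow> Ck_on k S f"
proof (cases k)
  case (Suc k)
  assume "open S" "bounded_linear f"
  then show ?thesis unfolding Suc
    by (intro Ck_on_Suc[where f' = "\<lambda>x v. f v"])
      (auto intro: bounded_linear_imp_has_derivative Ck_on_const)
qed (simp add: linear_continuous_on)

lemma Ck_on_add:
  assumes "open S" "Ck_on k S f" "Ck_on k S h"
  shows "Ck_on k S (\<lambda>x. f x + h x)"
  using assms(2,3)
proof (induction k arbitrary: f h)
  case 0
  then show ?case by (auto intro: continuous_on_add)
next
  case (Suc k)
  show ?case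
  proof (rule Ck_on_Suc[OF assms(1)])
    fix x assume "x \<in> S"
    then show "((\<lambda>x. f x + h x) has_derivative
        (\<lambda>v. frechet_derivative f (at x) v + frechet_derivative h (at x) v)) (at x)"
      by (intro has_derivative_add Ck_on_has_derivative[OF assms(1), of k] Suc.prems)
  qed (use Suc in auto)
qed

text \<open>One induction for products of reals, scalar multiples and inner products. Both factors
  are generalised, since the product rule returns the form \<open>mul\<close> applied to other pairs
  of functions.\<close>

lemma Ck_on_bilinear:
  assumes "bounded_bilinear mul" "open S" "Ck_on k S f" "Ck_on k S h"
  shows "Ck_on k S (\<lambda>x. mul (f x) (h x))"
  using assms(3,4)
proof (induction k arbitrary: f h)
  case 0
  then show ?case by (auto intro: bounded_bilinear.continuous_on[OF assms(1)])
next
  case (Suc k)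
  note fh = Suc.prems[THEN Ck_on_Suc_imp]
  show ?case
  proof (rule Ck_on_Suc[OF assms(2)])
    fix x assume "x \<in> S"
    then show "((\<lambda>x. mul (f x) (h x)) has_derivative
        (\<lambda>v. mul (f x) (frechet_derivative h (at x) v) + mul (frechet_derivative f (at x) v) (h x)))
        (at x)"
      by (intro bounded_bilinear.FDERIV[OF assms(1)] Ck_on_has_derivative[OF assms(2), of k] Suc.prems)
  next
    fix v
    show "Ck_on k S (\<lambda>x. mul (f x) (frechet_derivative h (at x) v) +
        mul (frechet_derivative f (at x) v) (h x))"
      using Suc.prems fh by (auto intro!: Ck_on_add assms(2) Suc.IH)
  qed
qed

lemma Ck_on_sum:
  assumes "open S" "\<And>i. i \<in> I \<Longrightarrow> Ck_on k S (f i)"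
  shows "Ck_on k S (\<lambda>x. \<Sum>i\<in>I. f i x)"
  using assms(2)
  by (induction I rule: infinite_finite_induct) (auto intro: Ck_on_const Ck_on_add assms(1))

lemma Ck_on_compose:
  fixes f :: "'d::euclidean_space \<Rightarrow> 'e::euclidean_space" and h :: "'e \<Rightarrow> 'f::real_normed_vector"
  assumes "open S" "open T" "f ` S \<subseteq> T" "Ck_on k S f" "Ck_on k T h"
  shows "Ck_on k S (\<lambda>x. h (f x))"
  using assms(4,5)
proof (induction k arbitrary: h)
  case 0
  then show ?case using assms(3) continuous_on_compose2 by (metis Ck_on.simps(1))
next
  case (Suc k)
  \<comment> \<open>In the plain chain rule the direction in which \<open>h\<close> is
    differentiated depends on \<open>x\<close>, while the induction hypothesis speaks of fixed
    directions. Expanding in \<open>Basis\<close> separates the two: real coefficients times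
    derivatives of \<open>h\<close> in constant directions.\<close>
  let ?D = "\<lambda>x v. \<Sum>b\<in>Basis. (frechet_derivative f (at x) v \<bullet> b) *\<^sub>R frechet_derivative h (at (f x)) b"
  show ?case
  proof (rule Ck_on_Suc[OF assms(1), where f' = ?D])
    fix x assume x: "x \<in> S"
    then have fx: "f x \<in> T" using assms(3) by auto
    note dh = Ck_on_has_derivative[OF assms(2) Suc.prems(2) fx]
    have "((\<lambda>x. h (f x)) has_derivative
        (\<lambda>v. frechet_derivative h (at (f x)) (frechet_derivative f (at x) v))) (at x)"
      using diff_chain_at[OF Ck_on_has_derivative[OF assms(1) Suc.prems(1) x] dh]
      by (simp add: o_def)
    moreover have "(\<lambda>v. frechet_derivative h (at (f x)) (frechet_derivative f (at x) v)) = ?D x"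
      by (rule ext, rule linear_eq_sum_Basis) (use dh has_derivative_linear in blast)
    ultimately show "((\<lambda>x. h (f x)) has_derivative ?D x) (at x)" by simp
  next
    fix v
    have "Ck_on k S (\<lambda>x. frechet_derivative f (at x) v \<bullet> b)" for b
      by (rule Ck_on_bilinear[OF bounded_bilinear_inner assms(1)])
        (use Suc.prems in \<open>auto intro: Ck_on_const assms(1)\<close>)
    moreover have "Ck_on k S (\<lambda>x. frechet_derivative h (at (f x)) b)" for b
      by (rule Suc.IH[OF Ck_on_Suc_imp[OF Suc.prems(1)]]) (use Suc.prems(2) in simp)
    ultimately show "Ck_on k S (\<lambda>x. ?D x v)"
      by (intro Ck_on_sum Ck_on_bilinear[OF bounded_bilinear_scaleR] assms(1)) auto
  qed
qed

text \<open>The derivative is a product of the inverse itself, taken twice, with a derivative of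
  \<open>f\<close>, so regularity of the inverse at level \<open>k\<close> lifts itself to level
  \<open>Suc k\<close>.\<close>

lemma Ck_on_inverse:
  fixes f :: "'e::euclidean_space \<Rightarrow> real"
  assumes "open S" "Ck_on k S f" "\<And>x. x \<in> S \<Longrightarrow> f x \<noteq> 0"
  shows "Ck_on k S (\<lambda>x. inverse (f x))"
  using assms(2)
proof (induction k)
  case 0
  then show ?case using assms(3) by (auto intro: continuous_on_inverse)
next
  case (Suc k)
  have IH: "Ck_on k S (\<lambda>x. inverse (f x))" using Suc Ck_on_Suc_imp by blast
  show ?case
  proof (rule Ck_on_Suc[OF assms(1)])
    fix x assume "x \<in> S"
    then show "((\<lambda>x. inverse (f x)) has_derivative
      (\<lambda>v. - 1 * (inverse (f x) * frechet_derivative f (at x) v * inverse (f x)))) (at x)"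
      using Deriv.has_derivative_inverse[OF assms(3) Ck_on_has_derivative[OF assms(1) Suc.prems]]
      by auto
  next
    fix v
    show "Ck_on k S (\<lambda>x. - 1 * (inverse (f x) * frechet_derivative f (at x) v * inverse (f x)))"
      using Suc.prems by (intro Ck_on_bilinear[OF bounded_bilinear_mult] IH assms(1) Ck_on_const) auto
  qed
qed

lemma Ck_on_sqrt:
  assumes "open S" "Ck_on k S f" "\<And>x. x \<in> S \<Longrightarrow> f x > 0"
  shows "Ck_on k S (\<lambda>x. sqrt (f x))"
  using assms(2)
proof (induction k)
  case 0
  then show ?case by (auto intro: continuous_on_real_sqrt)
next
  case (Suc k)
  have IH: "Ck_on k S (\<lambda>x. sqrt (f x))" using Suc Ck_on_Suc_imp by blast
  have inv: "Ck_on k S (\<lambda>x. inverse (sqrt (f x)))"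
    by (rule Ck_on_inverse[OF assms(1) IH]) (use assms(3) in force)
  show ?case
  proof (rule Ck_on_Suc[OF assms(1)])
    fix x assume x: "x \<in> S"
    show "((\<lambda>x. sqrt (f x)) has_derivative
      (\<lambda>v. (1/2) * (inverse (sqrt (f x)) * frechet_derivative f (at x) v))) (at x)"
      using has_derivative_real_sqrt[OF assms(3) Ck_on_has_derivative[OF assms(1) Suc.prems], OF x x]
      by (simp add: field_simps)
  next
    fix v
    show "Ck_on k S (\<lambda>x. (1/2) * (inverse (sqrt (f x)) * frechet_derivative f (at x) v))"
      using Suc.prems by (intro Ck_on_bilinear[OF bounded_bilinear_mult] inv assms(1) Ck_on_const) auto
  qed
qed

lemma smooth_on_cong: "open S \<Longrightarrow> smooth_on S f \<Longrightarrow> (\<And>x. x \<in> S \<Longrightarrow> f x = h x) \<Longrightarrow> smooth_on S h"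
  unfolding smooth_on_def by (meson Ck_on_cong)

lemma smooth_on_subset: "smooth_on S f \<Longrightarrow> T \<subseteq> S \<Longrightarrow> smooth_on T f"
  unfolding smooth_on_def by (meson Ck_on_subset)

lemma smooth_on_local:
  assumes "open S" "\<And>x. x \<in> S \<Longrightarrow> \<exists>T. open T \<and> x \<in> T \<and> smooth_on T f"
  shows "smooth_on S f"
  unfolding smooth_on_def
proof
  fix k
  show "Ck_on k S f"
    by (rule Ck_on_local[OF assms(1)]) (meson assms(2) smooth_on_def)
qed

lemma smooth_on_const: "open S \<Longrightarrow> smooth_on S (\<lambda>x. c)"
  by (simp add: smooth_on_def Ck_on_const)

lemma smooth_on_linear: "open S \<Longrightarrow> bounded_linear f \<Longrightarrow> smooth_on S f"
  by (simp add: smooth_on_def Ck_on_linear)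

lemma smooth_on_add: "open S \<Longrightarrow> smooth_on S f \<Longrightarrow> smooth_on S h \<Longrightarrow> smooth_on S (\<lambda>x. f x + h x)"
  by (simp add: smooth_on_def Ck_on_add)

lemma smooth_on_bilinear:
  "bounded_bilinear mul \<Longrightarrow> open S \<Longrightarrow> smooth_on S f \<Longrightarrow> smooth_on S h \<Longrightarrow>
    smooth_on S (\<lambda>x. mul (f x) (h x))"
  by (simp add: smooth_on_def Ck_on_bilinear)

lemma smooth_on_sum: "open S \<Longrightarrow> (\<And>i. i \<in> I \<Longrightarrow> smooth_on S (f i)) \<Longrightarrow> smooth_on S (\<lambda>x. \<Sum>i\<in>I. f i x)"
  by (simp add: smooth_on_def Ck_on_sum)

lemma smooth_on_compose:
  fixes f :: "'d::euclidean_space \<Rightarrow> 'e::euclidean_space"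
  shows "open S \<Longrightarrow> open T \<Longrightarrow> f ` S \<subseteq> T \<Longrightarrow> smooth_on S f \<Longrightarrow> smooth_on T h \<Longrightarrow> smooth_on S (\<lambda>x. h (f x))"
  by (simp add: smooth_on_def Ck_on_compose)

lemma smooth_on_inverse:
  fixes f :: "'e::euclidean_space \<Rightarrow> real"
  shows "open S \<Longrightarrow> smooth_on S f \<Longrightarrow> (\<And>x. x \<in> S \<Longrightarrow> f x \<noteq> 0) \<Longrightarrow> smooth_on S (\<lambda>x. inverse (f x))"
  by (simp add: smooth_on_def Ck_on_inverse)

lemma smooth_on_sqrt:
  "open S \<Longrightarrow> smooth_on S f \<Longrightarrow> (\<And>x. x \<in> S \<Longrightarrow> f x > 0) \<Longrightarrow> smooth_on S (\<lambda>x. sqrt (f x))"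
  by (simp add: smooth_on_def Ck_on_sqrt)

lemma smooth_on_frechet:
  "smooth_on S f \<Longrightarrow> smooth_on S (\<lambda>x. frechet_derivative f (at x) v)"
  unfolding smooth_on_def by (metis Ck_on.simps(2))

lemma smooth_on_has_derivative:
  "open S \<Longrightarrow> smooth_on S f \<Longrightarrow> x \<in> S \<Longrightarrow> (f has_derivative frechet_derivative f (at x)) (at x)"
  by (auto simp: smooth_on_def intro: Ck_on_has_derivative)

lemma smooth_on_continuous: "smooth_on S f \<Longrightarrow> continuous_on S f"
  by (simp add: smooth_on_def Ck_on_continuous)

lemma smooth_on_componentwise:
  fixes f :: "'d::euclidean_space \<Rightarrow> 'e::euclidean_space"
  assumes "open S" "\<And>b. b \<in> Basis \<Longrightarrow> smooth_on S (\<lambda>x. f x \<bullet> b)"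
  shows "smooth_on S f"
proof -
  have "smooth_on S (\<lambda>x. \<Sum>b\<in>Basis. (f x \<bullet> b) *\<^sub>R b)"
    by (intro smooth_on_sum smooth_on_bilinear[OF bounded_bilinear_scaleR] smooth_on_const assms)
  then show ?thesis by (simp add: euclidean_representation)
qed

section \<open>Parameter integrals along segments and Hadamard's lemma\<close>

lemma Ck_on_integral_segment:
  fixes F :: "'e::euclidean_space \<Rightarrow> real"
  assumes "Ck_on k (ball a r) F"
  shows "Ck_on k (ball a r) (\<lambda>x. integral {0..1} (\<lambda>t. t ^ j * F (a + t *\<^sub>R (x - a))))"
  using assms
\<comment> \<open>Differentiating \<open>F (a + t *\<^sub>R (x - a))\<close> in \<open>x\<close>
  brings out a factor \<open>t\<close> and replaces \<open>F\<close> by a partial derivative. The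
  weight \<open>t ^ j\<close> absorbs this factor, so both \<open>j\<close> and \<open>F\<close>
  must vary in the induction.\<close>
proof (induction k arbitrary: F j)
  have seg: "a + t *\<^sub>R (x - a) \<in> ball a r" if "x \<in> ball a r" "t \<in> {0..1}" for x t
  proof -
    have "dist a (a + t *\<^sub>R (x - a)) = \<bar>t\<bar> * dist a x"
      by (simp add: dist_norm norm_minus_commute)
    also have "\<dots> \<le> 1 * dist a x" using that by (intro mult_right_mono) auto
    finally show ?thesis using that by auto
  qed
  have cont: "continuous_on (ball a r \<times> {0..1}) (\<lambda>(x,t). t ^ j * F (a + t *\<^sub>R (x - a)))"
    if "continuous_on (ball a r) F" for F :: "'e \<Rightarrow> real" and j
    unfolding split_beta
    by (intro continuous_intros continuous_on_compose2[OF that]) (use seg in auto)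
  {
    case 0
    then show ?case
      using integral_continuous_on_param[of "ball a r" 0 1 "\<lambda>x t. t ^ j * F (a + t *\<^sub>R (x - a))"]
        cont[of F j] by auto
  next
    case (Suc k)
    \<comment> \<open>\<open>leibniz_rule\<close> requires the derivative in \<open>x\<close> as a
      continuous family of bounded linear maps, hence \<open>Blinfun\<close>. In finite dimension
      continuity can be checked one direction at a time, which is how \<open>c'\<close> follows from
      \<open>c\<close>.\<close>
    let ?fx = "\<lambda>x t. Blinfun (\<lambda>v. t ^ j * (frechet_derivative F (at (a + t *\<^sub>R (x - a))) (t *\<^sub>R v)))"
    let ?I = "\<lambda>x. integral {0..1} (\<lambda>t. t ^ j * F (a + t *\<^sub>R (x - a)))"
    have dF: "((\<lambda>x. t ^ j * F (a + t *\<^sub>R (x - a))) has_derivative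
        (\<lambda>v. t ^ j * (frechet_derivative F (at (a + t *\<^sub>R (x - a))) (t *\<^sub>R v)))) (at x)"
      if "x \<in> ball a r" "t \<in> {0..1}" for x t
    proof -
      have "((\<lambda>x. a + t *\<^sub>R (x - a)) has_derivative (\<lambda>v. t *\<^sub>R v)) (at x)"
        by (auto intro!: derivative_eq_intros)
      from diff_chain_at[OF this Ck_on_has_derivative[OF open_ball Suc.prems seg[OF that]]]
      show ?thesis by (auto intro!: has_derivative_mult_right simp: o_def)
    qed
    have bl: "blinfun_apply (?fx x t) =
        (\<lambda>v. t ^ j * (frechet_derivative F (at (a + t *\<^sub>R (x - a))) (t *\<^sub>R v)))"
      if "x \<in> ball a r" "t \<in> {0..1}" for x t
      using bounded_linear_Blinfun_apply[OF has_derivative_bounded_linear[OF dF[OF that]]] .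
    have bl': "blinfun_apply (?fx x t) v = t ^ Suc j * frechet_derivative F (at (a + t *\<^sub>R (x - a))) v"
      if "x \<in> ball a r" "t \<in> {0..1}" for x t v
    proof -
      have "linear (frechet_derivative F (at (a + t *\<^sub>R (x - a))))"
        using Ck_on_has_derivative[OF open_ball Suc.prems seg[OF that]] has_derivative_linear by blast
      then show ?thesis unfolding bl[OF that] by (simp add: linear_cmul)
    qed
    have Fv: "Ck_on k (ball a r) (\<lambda>x. frechet_derivative F (at x) v)" for v
      using Suc.prems by simp
    have c: "continuous_on (ball a r \<times> {0..1}) (\<lambda>(x,t). blinfun_apply (?fx x t) v)" for v
      using cont[OF Ck_on_continuous[OF Fv], of "Suc j" v]
      by (rule continuous_on_eq) (use bl' in auto)
    have c': "continuous_on (ball a r \<times> {0..1}) (\<lambda>(x,t). ?fx x t)"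
      by (rule continuous_on_blinfun_componentwise) (use c in \<open>auto simp: split_beta\<close>)
    have int: "(\<lambda>t. t ^ j * F (a + t *\<^sub>R (x - a))) integrable_on {0..1}" if "x \<in> ball a r" for x
    proof -
      have "continuous_on {0..1} (Pair x)" "Pair x ` {0..1} \<subseteq> ball a r \<times> {0..1::real}"
        using that by (auto intro!: continuous_intros)
      from continuous_on_compose2[OF cont[OF Ck_on_continuous[OF Suc.prems], of j] this]
      show ?thesis by (auto intro: integrable_continuous_interval)
    qed
    have der: "(?I has_derivative integral {0..1} (?fx x)) (at x)" if x: "x \<in> ball a r" for x
    proof -
      have "((\<lambda>x. integral (cbox 0 1) (\<lambda>t. t ^ j * F (a + t *\<^sub>R (x - a)))) has_derivative
         integral (cbox 0 1) (?fx x)) (at x within ball a r)"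
      proof (rule leibniz_rule)
        fix x t assume xt: "x \<in> ball a r" "t \<in> cbox 0 (1::real)"
        show "((\<lambda>x. t ^ j * F (a + t *\<^sub>R (x - a))) has_derivative blinfun_apply (?fx x t))
            (at x within ball a r)"
          using dF[of x t] bl[of x t] xt by (auto intro: has_derivative_at_withinI)
      qed (use int c' x in \<open>auto\<close>)
      then show ?thesis using x by (simp add: at_within_open[OF x open_ball])
    qed
    have int_apply: "blinfun_apply (integral {0..1} (?fx x)) v =
        integral {0..1} (\<lambda>t. t ^ Suc j * frechet_derivative F (at (a + t *\<^sub>R (x - a))) v)"
      if x: "x \<in> ball a r" for x v
    proof -
      have "continuous_on {0..1} (Pair x)" "Pair x ` {0..1} \<subseteq> ball a r \<times> {0..1::real}"
        using x by (auto intro!: continuous_intros)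
      from continuous_on_compose2[OF c' this] have "?fx x integrable_on {0..1}"
        by (auto intro: integrable_continuous_interval)
      then have "blinfun_apply (integral {0..1} (?fx x)) v = integral {0..1} (\<lambda>t. blinfun_apply (?fx x t) v)"
        by (rule blinfun_apply_integral)
      also have "\<dots> = integral {0..1} (\<lambda>t. t ^ Suc j * frechet_derivative F (at (a + t *\<^sub>R (x - a))) v)"
        by (rule integral_cong) (use bl' x in auto)
      finally show ?thesis .
    qed
    show ?case
    proof (rule Ck_on_Suc[OF open_ball der])
      fix v
      show "Ck_on k (ball a r) (\<lambda>x. blinfun_apply (integral {0..1} (?fx x)) v)"
        by (rule Ck_on_cong[OF open_ball Suc.IH[OF Fv[of v], of "Suc j"]]) (use int_apply in auto)
    qed
  }
qed

lemma smooth_on_hadamard: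
  fixes f :: "'e::euclidean_space \<Rightarrow> real"
  assumes "smooth_on (ball a r) f"
  obtains h where "\<And>b. smooth_on (ball a r) (h b)"
    and "\<And>x. x \<in> ball a r \<Longrightarrow> f x = f a + (\<Sum>b\<in>Basis. ((x - a) \<bullet> b) * h b x)"
proof -
  \<comment> \<open>The mean of the partial derivative over the segment from \<open>a\<close> to
    \<open>x\<close>. The fundamental theorem of calculus along this segment gives the expansion,
    and the factor \<open>t ^ 0\<close> matches the shape of
    \<open>Ck_on_integral_segment\<close>.\<close>
  define h where "h b x = integral {0..1} (\<lambda>t. t ^ 0 * frechet_derivative f (at (a + t *\<^sub>R (x - a))) b)" for b x
  have "smooth_on (ball a r) (h b)" for b
    unfolding h_def smooth_on_def
    by (intro allI Ck_on_integral_segment) (use smooth_on_frechet[OF assms] in \<open>auto simp: smooth_on_def\<close>)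
  moreover have "f x = f a + (\<Sum>b\<in>Basis. ((x - a) \<bullet> b) * h b x)" if x: "x \<in> ball a r" for x
  proof -
    have seg: "a + t *\<^sub>R (x - a) \<in> ball a r" if "t \<in> {0..1}" for t
    proof -
      have "dist a (a + t *\<^sub>R (x - a)) = \<bar>t\<bar> * dist a x"
        by (simp add: dist_norm norm_minus_commute)
      also have "\<dots> \<le> 1 * dist a x" using that by (intro mult_right_mono) auto
      finally show ?thesis using x by auto
    qed
    have der: "((\<lambda>t. f (a + t *\<^sub>R (x - a))) has_vector_derivative
        (\<Sum>b\<in>Basis. ((x - a) \<bullet> b) * frechet_derivative f (at (a + t *\<^sub>R (x - a))) b)) (at t within {0..1})"
      if t: "t \<in> {0..1}" for t
    proof -
      have df: "(f has_derivative frechet_derivative f (at (a + t *\<^sub>R (x - a)))) (at (a + t *\<^sub>R (x - a)))"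
        using smooth_on_has_derivative[OF open_ball assms seg[OF t]] .
      have "((\<lambda>t. a + t *\<^sub>R (x - a)) has_derivative (\<lambda>s. s *\<^sub>R (x - a))) (at t)"
        by (auto intro!: derivative_eq_intros)
      from diff_chain_at[OF this df]
      have "((\<lambda>t. f (a + t *\<^sub>R (x - a))) has_derivative
          (\<lambda>s. frechet_derivative f (at (a + t *\<^sub>R (x - a))) (s *\<^sub>R (x - a)))) (at t)"
        by (simp add: o_def)
      moreover have "frechet_derivative f (at (a + t *\<^sub>R (x - a))) (s *\<^sub>R (x - a)) =
          s *\<^sub>R (\<Sum>b\<in>Basis. ((x - a) \<bullet> b) * frechet_derivative f (at (a + t *\<^sub>R (x - a))) b)" for s
        using linear_eq_sum_Basis[OF has_derivative_linear[OF df], of "x - a"]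
        by (simp add: linear_cmul[OF has_derivative_linear[OF df]])
      ultimately show ?thesis
        unfolding has_vector_derivative_def by (simp add: has_derivative_at_withinI)
    qed
    have cont: "continuous_on {0..1} (\<lambda>t. frechet_derivative f (at (a + t *\<^sub>R (x - a))) b)" for b
      by (rule continuous_on_compose2[OF smooth_on_continuous[OF smooth_on_frechet[OF assms, of b]]])
        (use seg in \<open>auto intro!: continuous_intros\<close>)
    have I1: "((\<lambda>t. \<Sum>b\<in>Basis. ((x - a) \<bullet> b) * frechet_derivative f (at (a + t *\<^sub>R (x - a))) b)
        has_integral (f x - f a)) {0..1}"
      using fundamental_theorem_of_calculus[OF _ der] by auto
    have I2: "((\<lambda>t. \<Sum>b\<in>Basis. ((x - a) \<bullet> b) * frechet_derivative f (at (a + t *\<^sub>R (x - a))) b)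
        has_integral (\<Sum>b\<in>Basis. ((x - a) \<bullet> b) * h b x)) {0..1}"
      unfolding h_def
      by (intro has_integral_sum has_integral_mult_right)
        (auto intro!: integrable_integral integrable_continuous_interval cont)
    show ?thesis using has_integral_unique[OF I1 I2] by simp
  qed
  ultimately show ?thesis using that by blast
qed

section \<open>Charts and smooth functions\<close>

text \<open>A locale rather than a fixed atlas, because it is interpreted a second time for the
  charts of the tangent bundle.\<close>

locale atlas =
  fixes A :: "('a, 'e::euclidean_space) chart set"
  assumes atlas: "smooth_atlas A"
begin

lemma chart_inj: "(U, \<phi>) \<in> A \<Longrightarrow> inj_on \<phi> U"
  using atlas by (auto simp: smooth_atlas_def)

lemma chart_open: "(U, \<phi>) \<in> A \<Longrightarrow> open (\<phi> ` U)"
  using atlas by (auto simp: smooth_atlas_def)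

lemma overlap_open: "(U, \<phi>) \<in> A \<Longrightarrow> (V, \<psi>) \<in> A \<Longrightarrow> open (\<phi> ` (U \<inter> V))"
  using atlas by (fastforce simp: smooth_atlas_def)

lemma transition_smooth:
  "(U, \<phi>) \<in> A \<Longrightarrow> (V, \<psi>) \<in> A \<Longrightarrow> smooth_on (\<phi> ` (U \<inter> V)) (\<psi> \<circ> inv_into U \<phi>)"
  using atlas by (fastforce simp: smooth_atlas_def)

lemma chart_inv: "(U, \<phi>) \<in> A \<Longrightarrow> p \<in> U \<Longrightarrow> inv_into U \<phi> (\<phi> p) = p"
  using chart_inj by (simp add: inv_into_f_f)

lemma pts_iff: "p \<in> pts A \<longleftrightarrow> (\<exists>U \<phi>. (U, \<phi>) \<in> A \<and> p \<in> U)"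
  by (auto simp: pts_def)

lemma chart_pts: "(U, \<phi>) \<in> A \<Longrightarrow> p \<in> U \<Longrightarrow> p \<in> pts A"
  using pts_iff by blast

text \<open>\<open>mtop\<close> is given through the abstraction function \<open>topology\<close>,
  so its defining predicate must first be shown to be a topology. Injectivity of the charts makes
  images commute with intersections.\<close>

lemma openin_mtop_iff:
  "openin (mtop A) V \<longleftrightarrow> V \<subseteq> pts A \<and> (\<forall>U \<phi>. (U, \<phi>) \<in> A \<longrightarrow> open (\<phi> ` (V \<inter> U)))"
proof -
  let ?P = "\<lambda>V. V \<subseteq> pts A \<and> (\<forall>(U, \<phi>)\<in>A. open (\<phi> ` (V \<inter> U)))"
  have "istopology ?P"
    unfolding istopology_def
  proof (intro conjI allI impI)
    fix S T assume S: "?P S" and T: "?P T"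
    have "\<phi> ` (S \<inter> T \<inter> U) = \<phi> ` (S \<inter> U) \<inter> \<phi> ` (T \<inter> U)" if "(U, \<phi>) \<in> A" for U \<phi>
      using inj_on_image_Int[OF chart_inj[OF that], of "S \<inter> U" "T \<inter> U"] by (simp add: Int_ac)
    with S T show "S \<inter> T \<subseteq> pts A" "\<forall>(U, \<phi>)\<in>A. open (\<phi> ` (S \<inter> T \<inter> U))" by fastforce+
  next
    fix K assume K: "\<forall>S\<in>K. ?P S"
    have "\<phi> ` (\<Union> K \<inter> U) = (\<Union>S\<in>K. \<phi> ` (S \<inter> U))" for U and \<phi> :: "'a \<Rightarrow> 'e" by auto
    with K show "\<Union> K \<subseteq> pts A" "\<forall>(U, \<phi>)\<in>A. open (\<phi> ` (\<Union> K \<inter> U))" by (auto intro!: open_UN)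
  qed
  then show ?thesis by (auto simp: mtop_def topology_inverse')
qed

lemma openin_chart_preimage:
  assumes c: "(U, \<phi>) \<in> A" and S: "open S"
  shows "openin (mtop A) {p \<in> U. \<phi> p \<in> S}"
  unfolding openin_mtop_iff
proof (intro conjI allI impI)
  show "{p \<in> U. \<phi> p \<in> S} \<subseteq> pts A" using chart_pts[OF c] by auto
  fix V \<psi> assume d: "(V, \<psi>) \<in> A"
  let ?t = "\<phi> \<circ> inv_into V \<psi>"
  have "\<psi> ` ({p \<in> U. \<phi> p \<in> S} \<inter> V) = \<psi> ` (V \<inter> U) \<inter> ?t -` S"
    using chart_inv[OF d] by (auto simp: image_iff)
  moreover have "open (\<psi> ` (V \<inter> U) \<inter> ?t -` S)"
    using smooth_on_continuous[OF transition_smooth[OF d c]] overlap_open[OF d c] S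
    by (rule continuous_open_preimage)
  ultimately show "open (\<psi> ` ({p \<in> U. \<phi> p \<in> S} \<inter> V))" by simp
qed

lemma openin_chart: "(U, \<phi>) \<in> A \<Longrightarrow> openin (mtop A) U"
  using openin_chart_preimage[of U \<phi> UNIV] by auto

lemma topspace_mtop: "topspace (mtop A) = pts A"
proof -
  have "openin (mtop A) (pts A)"
    unfolding openin_mtop_iff
  proof (intro conjI allI impI)
    fix U \<phi> assume c: "(U, \<phi>) \<in> A"
    then have "pts A \<inter> U = U" using chart_pts by auto
    then show "open (\<phi> ` (pts A \<inter> U))" using chart_open[OF c] by simp
  qed simp
  then show ?thesis
    by (metis openin_mtop_iff openin_subset openin_topspace subset_antisym)
qed

text \<open>Local arguments run through this filter, so that finitely many neighbourhoods are
  intersected by \<open>eventually_elim\<close> instead of by hand.\<close>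

abbreviation near :: "'a \<Rightarrow> 'a filter" where
  "near p \<equiv> nhdsin (mtop A) p"

lemma eventually_near:
  "p \<in> pts A \<Longrightarrow> eventually P (near p) \<longleftrightarrow> (\<exists>W. openin (mtop A) W \<and> p \<in> W \<and> (\<forall>q\<in>W. P q))"
  by (auto simp: eventually_nhdsin topspace_mtop)

lemma eventually_near_open: "openin (mtop A) W \<Longrightarrow> p \<in> W \<Longrightarrow> eventually (\<lambda>q. q \<in> W) (near p)"
  by (auto simp: eventually_nhdsin)

lemma openin_pts: "openin (mtop A) W \<Longrightarrow> p \<in> W \<Longrightarrow> p \<in> pts A"
  by (auto simp: openin_mtop_iff)

lemma near_self: "p \<in> pts A \<Longrightarrow> eventually P (near p) \<Longrightarrow> P p"
  by (auto simp: eventually_near)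

lemma smooth_near_pts: "smooth_near A p f \<Longrightarrow> p \<in> pts A"
  by (auto simp: smooth_near_def smooth_fun_on_def openin_mtop_iff)

lemma smooth_near_chartD:
  assumes "(U, \<phi>) \<in> A" "p \<in> U" "smooth_near A p f"
  obtains S where "open S" "\<phi> p \<in> S" "S \<subseteq> \<phi> ` U" "smooth_on S (f \<circ> inv_into U \<phi>)"
proof -
  obtain W where W: "p \<in> W" "smooth_fun_on A W f" using assms(3) by (auto simp: smooth_near_def)
  show ?thesis
    by (rule that[of "\<phi> ` (W \<inter> U)"]) (use W assms in \<open>auto simp: smooth_fun_on_def openin_mtop_iff\<close>)
qed

text \<open>In any other chart the function is its expression in the given chart composed with a
  smooth transition map, so a single chart decides.\<close>

lemma smooth_fun_on_chartI:
  assumes c: "(U, \<phi>) \<in> A" and S: "open S" "smooth_on S (f \<circ> inv_into U \<phi>)" "S \<subseteq> \<phi> ` U"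
  shows "smooth_fun_on A {p \<in> U. \<phi> p \<in> S} f"
  unfolding smooth_fun_on_def
proof (intro conjI ballI openin_chart_preimage[OF c S(1)], clarify)
  fix V \<psi> assume d: "(V, \<psi>) \<in> A"
  let ?W = "{p \<in> U. \<phi> p \<in> S}"
  have o: "open (\<psi> ` (?W \<inter> V))"
    using openin_chart_preimage[OF c S(1)] d by (auto simp: openin_mtop_iff)
  have "smooth_on (\<psi> ` (?W \<inter> V)) (\<phi> \<circ> inv_into V \<psi>)"
    by (rule smooth_on_subset[OF transition_smooth[OF d c]]) auto
  then have "smooth_on (\<psi> ` (?W \<inter> V)) (\<lambda>x. (f \<circ> inv_into U \<phi>) ((\<phi> \<circ> inv_into V \<psi>) x))"
    by (intro smooth_on_compose[OF o S(1) _ _ S(2)]) (auto simp: chart_inv[OF d] o_def)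
  then show "smooth_on (\<psi> ` (?W \<inter> V)) (f \<circ> inv_into V \<psi>)"
    by (rule smooth_on_cong[OF o]) (auto simp: chart_inv[OF d] chart_inv[OF c])
qed

lemma smooth_near_chartI:
  assumes "(U, \<phi>) \<in> A" "p \<in> U" "open S" "\<phi> p \<in> S" "smooth_on S (f \<circ> inv_into U \<phi>)"
  shows "smooth_near A p f"
proof -
  have "open (S \<inter> \<phi> ` U)" "smooth_on (S \<inter> \<phi> ` U) (f \<circ> inv_into U \<phi>)"
    using assms chart_open by (auto intro: smooth_on_subset)
  from smooth_fun_on_chartI[OF assms(1) this] have "smooth_fun_on A {p \<in> U. \<phi> p \<in> S \<inter> \<phi> ` U} f" by simp
  then show ?thesis unfolding smooth_near_def using assms(2,4) by (intro exI conjI) auto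
qed

lemma smooth_fun_on_iff:
  "smooth_fun_on A U f \<longleftrightarrow> openin (mtop A) U \<and> (\<forall>p\<in>U. smooth_near A p f)"
proof
  assume r: "openin (mtop A) U \<and> (\<forall>p\<in>U. smooth_near A p f)"
  show "smooth_fun_on A U f"
    unfolding smooth_fun_on_def
  proof (intro conjI ballI, use r in blast, clarify)
    fix V \<psi> assume d: "(V, \<psi>) \<in> A"
    show "smooth_on (\<psi> ` (U \<inter> V)) (f \<circ> inv_into V \<psi>)"
    proof (rule smooth_on_local)
      show "open (\<psi> ` (U \<inter> V))" using r d by (auto simp: openin_mtop_iff)
      fix x assume "x \<in> \<psi> ` (U \<inter> V)"
      then obtain p where p: "p \<in> U" "p \<in> V" "x = \<psi> p" by auto
      then show "\<exists>T. open T \<and> x \<in> T \<and> smooth_on T (f \<circ> inv_into V \<psi>)"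
        using smooth_near_chartD[OF d p(2)] r by metis
    qed
  qed
qed (auto simp: smooth_near_def smooth_fun_on_def)

lemma smooth_near_eventually:
  assumes "smooth_near A p f" shows "eventually (\<lambda>q. smooth_near A q f) (near p)"
proof -
  obtain W where "p \<in> W" "smooth_fun_on A W f" using assms by (auto simp: smooth_near_def)
  then show ?thesis
    using smooth_near_pts[OF assms] by (auto simp: eventually_near smooth_fun_on_iff)
qed

lemma smooth_near_cong:
  assumes "smooth_near A p f" "eventually (\<lambda>q. f q = h q) (near p)"
  shows "smooth_near A p h"
proof -
  have p: "p \<in> pts A" using smooth_near_pts[OF assms(1)] .
  obtain W where W: "openin (mtop A) W" "p \<in> W" "\<And>q. q \<in> W \<Longrightarrow> f q = h q"
    using assms(2) by (auto simp: eventually_near[OF p])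
  obtain U \<phi> where c: "(U, \<phi>) \<in> A" "p \<in> U" using p by (auto simp: pts_iff)
  obtain S where S: "open S" "\<phi> p \<in> S" "S \<subseteq> \<phi> ` U" "smooth_on S (f \<circ> inv_into U \<phi>)"
    using smooth_near_chartD[OF c assms(1)] .
  have o: "open (S \<inter> \<phi> ` (W \<inter> U))" using S W c by (auto simp: openin_mtop_iff)
  have "smooth_on (S \<inter> \<phi> ` (W \<inter> U)) (f \<circ> inv_into U \<phi>)" using S(4) by (rule smooth_on_subset) auto
  then have "smooth_on (S \<inter> \<phi> ` (W \<inter> U)) (h \<circ> inv_into U \<phi>)"
    by (rule smooth_on_cong[OF o]) (use W(3) chart_inv[OF c(1)] in auto)
  then show ?thesis by (intro smooth_near_chartI[OF c o]) (use S W c in auto)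
qed

lemma smooth_near_cong_iff:
  assumes "eventually (\<lambda>q. f q = h q) (near p)"
  shows "smooth_near A p f \<longleftrightarrow> smooth_near A p h"
  using smooth_near_cong[of p f h] smooth_near_cong[of p h f] assms by (auto simp: eq_commute)

lemma smooth_near_binary:
  assumes "\<And>S f h. open S \<Longrightarrow> smooth_on S f \<Longrightarrow> smooth_on S h \<Longrightarrow> smooth_on S (\<lambda>x::'e. opr (f x) (h x))"
    and "smooth_near A p f" "smooth_near A p h"
  shows "smooth_near A p (\<lambda>q. opr (f q) (h q))"
proof -
  obtain U \<phi> where c: "(U, \<phi>) \<in> A" "p \<in> U" using smooth_near_pts[OF assms(2)] by (auto simp: pts_iff)
  obtain S where S: "open S" "\<phi> p \<in> S" "smooth_on S (f \<circ> inv_into U \<phi>)"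
    using smooth_near_chartD[OF c assms(2)] by metis
  obtain T where T: "open T" "\<phi> p \<in> T" "smooth_on T (h \<circ> inv_into U \<phi>)"
    using smooth_near_chartD[OF c assms(3)] by metis
  have o: "open (S \<inter> T)" using S T by auto
  have "smooth_on (S \<inter> T) (\<lambda>x. opr ((f \<circ> inv_into U \<phi>) x) ((h \<circ> inv_into U \<phi>) x))"
    by (rule assms(1)[OF o]) (use S T smooth_on_subset in blast)+
  then show ?thesis
    by (intro smooth_near_chartI[OF c o]) (use S T in \<open>auto simp: o_def\<close>)
qed

lemma smooth_near_add: "smooth_near A p f \<Longrightarrow> smooth_near A p h \<Longrightarrow> smooth_near A p (\<lambda>q. f q + h q)"
  by (rule smooth_near_binary) (auto intro: smooth_on_add)

lemma smooth_near_mult: "smooth_near A p f \<Longrightarrow> smooth_near A p h \<Longrightarrow> smooth_near A p (\<lambda>q. f q * h q)"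
  by (rule smooth_near_binary) (auto intro: smooth_on_bilinear[OF bounded_bilinear_mult])

lemma smooth_near_chart:
  assumes "(U, \<phi>) \<in> A" "p \<in> U" "open S" "\<phi> p \<in> S" "smooth_on S k"
  shows "smooth_near A p (\<lambda>q. k (\<phi> q))"
proof -
  have o: "open (S \<inter> \<phi> ` U)" using assms chart_open by auto
  have "smooth_on (S \<inter> \<phi> ` U) k" using assms(5) by (rule smooth_on_subset) auto
  then have "smooth_on (S \<inter> \<phi> ` U) ((\<lambda>q. k (\<phi> q)) \<circ> inv_into U \<phi>)"
    by (rule smooth_on_cong[OF o]) (auto simp: chart_inv[OF assms(1)])
  then show ?thesis by (rule smooth_near_chartI[OF assms(1,2) o, rotated]) (use assms in auto)
qed

lemma smooth_near_coord: "(U, \<phi>) \<in> A \<Longrightarrow> p \<in> U \<Longrightarrow> smooth_near A p (\<lambda>q. \<phi> q \<bullet> b)"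
  by (rule smooth_near_chart[of U \<phi> p UNIV "\<lambda>x. x \<bullet> b"])
    (auto intro: smooth_on_linear bounded_linear_inner_left)

lemma smooth_near_const: "p \<in> pts A \<Longrightarrow> smooth_near A p (\<lambda>q. c)"
  using smooth_near_chart[where S = UNIV and k = "\<lambda>x. c"] smooth_on_const[OF open_UNIV]
  by (metis UNIV_I open_UNIV pts_iff)

lemma smooth_near_uminus: "smooth_near A p f \<Longrightarrow> smooth_near A p (\<lambda>q. - f q)"
  using smooth_near_mult[OF smooth_near_const[OF smooth_near_pts], of p f f "-1"] by simp

lemma smooth_near_diff: "smooth_near A p f \<Longrightarrow> smooth_near A p h \<Longrightarrow> smooth_near A p (\<lambda>q. f q - h q)"
  using smooth_near_add[OF _ smooth_near_uminus, of p f h] by simp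

lemma smooth_near_sum:
  "p \<in> pts A \<Longrightarrow> (\<And>i. i \<in> I \<Longrightarrow> smooth_near A p (f i)) \<Longrightarrow> smooth_near A p (\<lambda>q. \<Sum>i\<in>I. f i q)"
  by (induction I rule: infinite_finite_induct) (auto intro: smooth_near_const smooth_near_add)

text \<open>The open set \<open>T\<close> is where \<open>opr\<close> may be applied; continuity of
  \<open>f\<close> allows the coordinate neighbourhood to be cut down to the preimage of
  \<open>T\<close>.\<close>

lemma smooth_near_unary:
  fixes opr :: "real \<Rightarrow> real"
  assumes "\<And>S f. open S \<Longrightarrow> smooth_on S f \<Longrightarrow> (\<And>x. x \<in> S \<Longrightarrow> f x \<in> T) \<Longrightarrow> smooth_on S (\<lambda>x::'e. opr (f x))"
    and "open T" "f p \<in> T" "smooth_near A p f"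
  shows "smooth_near A p (\<lambda>q. opr (f q))"
proof -
  obtain U \<phi> where c: "(U, \<phi>) \<in> A" "p \<in> U" using smooth_near_pts[OF assms(4)] by (auto simp: pts_iff)
  obtain S where S: "open S" "\<phi> p \<in> S" "smooth_on S (f \<circ> inv_into U \<phi>)"
    using smooth_near_chartD[OF c assms(4)] by metis
  let ?S = "S \<inter> (f \<circ> inv_into U \<phi>) -` T"
  have o: "open ?S"
    using smooth_on_continuous[OF S(3)] S(1) assms(2) by (rule continuous_open_preimage)
  have "smooth_on ?S (\<lambda>x. opr ((f \<circ> inv_into U \<phi>) x))"
    by (rule assms(1)[OF o smooth_on_subset[OF S(3)]]) auto
  then show ?thesis
    by (intro smooth_near_chartI[OF c o]) (use S assms(3) chart_inv[OF c] in \<open>auto simp: o_def\<close>)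
qed

lemma smooth_near_inverse_sqrt:
  assumes "smooth_near A p f" "f p > 0"
  shows "smooth_near A p (\<lambda>q. inverse (sqrt (f q)))"
  by (rule smooth_near_unary[where T = "{0<..}"])
    (use assms in \<open>force intro: smooth_on_inverse smooth_on_sqrt\<close>)+

lemma smooth_near_continuous:
  assumes "smooth_near A p f" "open T" "f p \<in> T"
  shows "eventually (\<lambda>q. f q \<in> T) (near p)"
proof -
  have p: "p \<in> pts A" using smooth_near_pts[OF assms(1)] .
  obtain U \<phi> where c: "(U, \<phi>) \<in> A" "p \<in> U" using p by (auto simp: pts_iff)
  obtain S where S: "open S" "\<phi> p \<in> S" "smooth_on S (f \<circ> inv_into U \<phi>)"
    using smooth_near_chartD[OF c assms(1)] by metis
  let ?S = "S \<inter> (f \<circ> inv_into U \<phi>) -` T"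
  have "open ?S"
    using smooth_on_continuous[OF S(3)] S(1) assms(2) by (rule continuous_open_preimage)
  from openin_chart_preimage[OF c(1) this] show ?thesis
    unfolding eventually_near[OF p] using c S assms(3) chart_inv[OF c(1)]
    by (intro exI[of _ "{p \<in> U. \<phi> p \<in> ?S}"]) auto
qed

section \<open>Tangent vectors in coordinates\<close>

lemma tangent_add:
  "v \<in> tangent_space A p \<Longrightarrow> smooth_near A p f \<Longrightarrow> smooth_near A p h \<Longrightarrow> v (\<lambda>q. f q + h q) = v f + v h"
  by (auto simp: tangent_space_def)

lemma tangent_mult:
  "v \<in> tangent_space A p \<Longrightarrow> smooth_near A p f \<Longrightarrow> smooth_near A p h \<Longrightarrow>
    v (\<lambda>q. f q * h q) = f p * v h + h p * v f"
  by (auto simp: tangent_space_def)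

lemma tangent_scale:
  "v \<in> tangent_space A p \<Longrightarrow> smooth_near A p f \<Longrightarrow> v (\<lambda>q. c * f q) = c * v f"
  by (auto simp: tangent_space_def)

lemma tangent_not_smooth: "v \<in> tangent_space A p \<Longrightarrow> \<not> smooth_near A p f \<Longrightarrow> v f = 0"
  by (auto simp: tangent_space_def)

text \<open>Since smoothness is demanded near \<open>p\<close> alone, the indicator function
  \<open>c\<close> of a neighbourhood can replace a bump function. From \<open>c * c = c\<close> the
  Leibniz rule gives \<open>v c = 2 * v c\<close>, hence \<open>v c = 0\<close>, and then
  \<open>c * f = c * h\<close> gives the claim.\<close>

lemma tangent_cong:
  assumes v: "v \<in> tangent_space A p" and p: "p \<in> pts A"
    and ev: "eventually (\<lambda>q. f q = h q) (near p)"
  shows "v f = v h"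
proof (cases "smooth_near A p f")
  case False
  then show ?thesis using smooth_near_cong_iff[OF ev] tangent_not_smooth[OF v] by metis
next
  case f: True
  then have h: "smooth_near A p h" using ev by (rule smooth_near_cong)
  obtain W where W: "openin (mtop A) W" "p \<in> W" "\<And>q. q \<in> W \<Longrightarrow> f q = h q"
    using ev by (auto simp: eventually_near[OF p])
  define c where "c q = (if q \<in> W then 1 else 0 :: real)" for q
  have "eventually (\<lambda>q. 1 = c q) (near p)"
    using eventually_near_open[OF W(1,2)] by eventually_elim (auto simp: c_def)
  from smooth_near_cong[OF smooth_near_const[OF p] this] have c: "smooth_near A p c" .
  have cp: "c p = 1" using W by (simp add: c_def)
  have "(\<lambda>q. c q * c q) = c" by (auto simp: c_def)
  then have vc: "v c = 0" using tangent_mult[OF v c c] cp by simp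
  have "(\<lambda>q. c q * f q) = (\<lambda>q. c q * h q)" using W(3) by (auto simp: c_def)
  then show ?thesis using tangent_mult[OF v c f] tangent_mult[OF v c h] cp vc by simp
qed

lemma tangent_const:
  assumes "v \<in> tangent_space A p" "p \<in> pts A" shows "v (\<lambda>q. c) = 0"
  using tangent_mult[OF assms(1) smooth_near_const[OF assms(2)] smooth_near_const[OF assms(2)], of 1 1]
    tangent_scale[OF assms(1) smooth_near_const[OF assms(2)], of c 1]
  by simp

lemma tangent_diff:
  assumes "v \<in> tangent_space A p" "smooth_near A p f" "smooth_near A p h"
  shows "v (\<lambda>q. f q - h q) = v f - v h"
  using tangent_add[OF assms(1,2) smooth_near_uminus[OF assms(3)]] tangent_scale[OF assms(1,3), of "-1"]
  by simp

lemma tangent_sum: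
  assumes "v \<in> tangent_space A p" "p \<in> pts A" "\<And>i. i \<in> I \<Longrightarrow> smooth_near A p (f i)"
  shows "v (\<lambda>q. \<Sum>i\<in>I. f i q) = (\<Sum>i\<in>I. v (f i))"
  using assms(3)
proof (induction I rule: infinite_finite_induct)
  case (insert i I)
  have "v (\<lambda>q. f i q + (\<Sum>i\<in>I. f i q)) = v (f i) + v (\<lambda>q. \<Sum>i\<in>I. f i q)"
    using insert.prems by (intro tangent_add[OF assms(1)] smooth_near_sum assms(2)) auto
  then show ?case using insert by simp
qed (use tangent_const[OF assms(1,2)] in auto)

lemma tzero_tangent: "tzero \<in> tangent_space A p"
  by (simp add: tangent_space_def tzero_def)

lemma tadd_tangent: "v \<in> tangent_space A p \<Longrightarrow> w \<in> tangent_space A p \<Longrightarrow> tadd v w \<in> tangent_space A p"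
  by (simp add: tangent_space_def tadd_def algebra_simps)

lemma tscale_tangent: "v \<in> tangent_space A p \<Longrightarrow> tscale c v \<in> tangent_space A p"
  by (simp add: tangent_space_def tscale_def algebra_simps)

lemma tdiff_tangent: "v \<in> tangent_space A p \<Longrightarrow> w \<in> tangent_space A p \<Longrightarrow> tdiff v w \<in> tangent_space A p"
  by (simp add: tangent_space_def tdiff_def algebra_simps)

lemma tsum_tangent: "(\<And>i. i \<in> I \<Longrightarrow> v i \<in> tangent_space A p) \<Longrightarrow> tsum v I \<in> tangent_space A p"
proof (induction I rule: infinite_finite_induct)
  case (insert i I)
  then have "tsum v (insert i I) = tadd (v i) (tsum v I)" by (simp add: tsum_def tadd_def)
  then show ?case using insert by (auto intro: tadd_tangent)
qed (auto simp: tsum_def tzero_tangent[unfolded tzero_def])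

text \<open>Hadamard's lemma expresses \<open>f\<close> near \<open>p\<close> through products of coordinate functions vanishing at \<open>p\<close>
  with smooth functions, which the Leibniz rule evaluates.\<close>

lemma tangent_eqI:
  assumes v: "v \<in> tangent_space A p" and w: "w \<in> tangent_space A p"
    and c: "(U, \<phi>) \<in> A" "p \<in> U" and eq: "\<And>b. b \<in> Basis \<Longrightarrow> v (\<lambda>q. \<phi> q \<bullet> b) = w (\<lambda>q. \<phi> q \<bullet> b)"
  shows "v = w"
proof
  fix f
  have p: "p \<in> pts A" using c by (auto simp: pts_iff)
  show "v f = w f"
  proof (cases "smooth_near A p f")
    case False
    then show ?thesis using v w tangent_not_smooth by metis
  next
    case True
    obtain S where S: "open S" "\<phi> p \<in> S" "S \<subseteq> \<phi> ` U" "smooth_on S (f \<circ> inv_into U \<phi>)"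
      using smooth_near_chartD[OF c True] .
    obtain r where r: "r > 0" "ball (\<phi> p) r \<subseteq> S" using S open_contains_ball by blast
    obtain h where h: "\<And>b. smooth_on (ball (\<phi> p) r) (h b)"
      and eqh: "\<And>x. x \<in> ball (\<phi> p) r \<Longrightarrow> (f \<circ> inv_into U \<phi>) x =
        (f \<circ> inv_into U \<phi>) (\<phi> p) + (\<Sum>b\<in>Basis. ((x - \<phi> p) \<bullet> b) * h b x)"
      using smooth_on_hadamard[OF smooth_on_subset[OF S(4) r(2)]] by metis
    have hs: "smooth_near A p (\<lambda>q. h b (\<phi> q))" for b
      by (rule smooth_near_chart[OF c open_ball _ h]) (use r in auto)
    have ds: "smooth_near A p (\<lambda>q. \<phi> q \<bullet> b - \<phi> p \<bullet> b)" for b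
      by (intro smooth_near_diff smooth_near_coord[OF c] smooth_near_const p)
    have ev: "eventually (\<lambda>q. f q = f p + (\<Sum>b\<in>Basis. (\<phi> q \<bullet> b - \<phi> p \<bullet> b) * h b (\<phi> q))) (near p)"
      unfolding eventually_near[OF p]
    proof (intro exI[of _ "{q \<in> U. \<phi> q \<in> ball (\<phi> p) r}"] conjI openin_chart_preimage[OF c(1)] ballI)
      fix q assume "q \<in> {q \<in> U. \<phi> q \<in> ball (\<phi> p) r}"
      then show "f q = f p + (\<Sum>b\<in>Basis. (\<phi> q \<bullet> b - \<phi> p \<bullet> b) * h b (\<phi> q))"
        using eqh[of "\<phi> q"] by (simp add: chart_inv[OF c(1)] c(2) inner_diff_left)
    qed (use c r in auto)
    have "u f = (\<Sum>b\<in>Basis. h b (\<phi> p) * u (\<lambda>q. \<phi> q \<bullet> b))" if u: "u \<in> tangent_space A p" for u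
    proof -
      have "u f = u (\<lambda>q. f p + (\<Sum>b\<in>Basis. (\<phi> q \<bullet> b - \<phi> p \<bullet> b) * h b (\<phi> q)))"
        by (rule tangent_cong[OF u p ev])
      also have "\<dots> = u (\<lambda>q. \<Sum>b\<in>Basis. (\<phi> q \<bullet> b - \<phi> p \<bullet> b) * h b (\<phi> q))"
        by (subst tangent_add[OF u])
          (auto simp: tangent_const[OF u p] intro!: smooth_near_const smooth_near_sum smooth_near_mult p hs ds)
      also have "\<dots> = (\<Sum>b\<in>Basis. u (\<lambda>q. (\<phi> q \<bullet> b - \<phi> p \<bullet> b) * h b (\<phi> q)))"
        by (rule tangent_sum[OF u p smooth_near_mult[OF ds hs]])
      also have "\<dots> = (\<Sum>b\<in>Basis. h b (\<phi> p) * u (\<lambda>q. \<phi> q \<bullet> b))"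
      proof (rule sum.cong[OF refl])
        fix b
        have "u (\<lambda>q. \<phi> q \<bullet> b - \<phi> p \<bullet> b) = u (\<lambda>q. \<phi> q \<bullet> b)"
          by (subst tangent_diff[OF u])
            (auto simp: tangent_const[OF u p] intro!: smooth_near_coord smooth_near_const c p)
        then show "u (\<lambda>q. (\<phi> q \<bullet> b - \<phi> p \<bullet> b) * h b (\<phi> q)) = h b (\<phi> p) * u (\<lambda>q. \<phi> q \<bullet> b)"
          using tangent_mult[OF u ds hs, of b b] by simp
      qed
      finally show ?thesis .
    qed
    from this[OF v] this[OF w] show ?thesis using eq by simp
  qed
qed

text \<open>The tangent vector whose coordinates in the chart form the vector \<open>x\<close>. With
  \<open>x\<close> fixed and \<open>p\<close> varying it is the constant-coefficient coordinate
  field, the standard local extension of a single vector. The guard is forced by the convention that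
  tangent vectors vanish on functions that are not smooth near \<open>p\<close>.\<close>

definition coord_vec :: "'a set \<Rightarrow> ('a \<Rightarrow> 'e) \<Rightarrow> 'a \<Rightarrow> 'e \<Rightarrow> 'a tvec" where
  "coord_vec U \<phi> p x =
     (\<lambda>f. if smooth_near A p f then frechet_derivative (f \<circ> inv_into U \<phi>) (at (\<phi> p)) x else 0)"

lemma chart_has_derivative:
  assumes "(U, \<phi>) \<in> A" "p \<in> U" "smooth_near A p f"
  shows "((f \<circ> inv_into U \<phi>) has_derivative frechet_derivative (f \<circ> inv_into U \<phi>) (at (\<phi> p))) (at (\<phi> p))"
  using smooth_near_chartD[OF assms] smooth_on_has_derivative by metis

lemma coord_vec_tangent:
  assumes c: "(U, \<phi>) \<in> A" "p \<in> U"
  shows "coord_vec U \<phi> p x \<in> tangent_space A p"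
proof -
  have p: "p \<in> pts A" using c by (auto simp: pts_iff)
  note D = chart_has_derivative[OF c]
  have "frechet_derivative ((\<lambda>q. f q + h q) \<circ> inv_into U \<phi>) (at (\<phi> p)) x =
      frechet_derivative (f \<circ> inv_into U \<phi>) (at (\<phi> p)) x + frechet_derivative (h \<circ> inv_into U \<phi>) (at (\<phi> p)) x"
    if "smooth_near A p f" "smooth_near A p h" for f h
    using frechet_derivative_at[OF has_derivative_add[OF D[OF that(1)] D[OF that(2)]]]
    unfolding o_def by metis
  moreover have "frechet_derivative ((\<lambda>q. f q * h q) \<circ> inv_into U \<phi>) (at (\<phi> p)) x =
      f p * frechet_derivative (h \<circ> inv_into U \<phi>) (at (\<phi> p)) x + h p * frechet_derivative (f \<circ> inv_into U \<phi>) (at (\<phi> p)) x"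
    if "smooth_near A p f" "smooth_near A p h" for f h
    using fun_cong[OF frechet_derivative_at[OF has_derivative_mult[OF D[OF that(1)] D[OF that(2)]]], of x]
    by (simp add: o_def chart_inv[OF c] mult.commute)
  moreover have "frechet_derivative ((\<lambda>q. k * f q) \<circ> inv_into U \<phi>) (at (\<phi> p)) x =
      k * frechet_derivative (f \<circ> inv_into U \<phi>) (at (\<phi> p)) x" if "smooth_near A p f" for f k
    using fun_cong[OF frechet_derivative_at[OF has_derivative_mult_right[OF D[OF that], of k]], of x]
    by (simp add: o_def)
  ultimately show ?thesis
    unfolding tangent_space_def coord_vec_def
    using smooth_near_add smooth_near_mult smooth_near_mult[OF smooth_near_const[OF p]] by auto
qed

lemma coord_vec_chart_fun:
  assumes c: "(U, \<phi>) \<in> A" "p \<in> U" and S: "open S" "\<phi> p \<in> S" "smooth_on S k"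
  shows "coord_vec U \<phi> p x (\<lambda>q. k (\<phi> q)) = frechet_derivative k (at (\<phi> p)) x"
proof -
  have o: "open (S \<inter> \<phi> ` U)" using assms chart_open by auto
  have "(k has_derivative frechet_derivative k (at (\<phi> p))) (at (\<phi> p))"
    by (rule smooth_on_has_derivative[OF S(1,3,2)])
  then have "(((\<lambda>q. k (\<phi> q)) \<circ> inv_into U \<phi>) has_derivative frechet_derivative k (at (\<phi> p))) (at (\<phi> p))"
    by (rule has_derivative_transform_within_open[OF _ o]) (use c S chart_inv[OF c(1)] in auto)
  then show ?thesis
    unfolding coord_vec_def using frechet_derivative_at smooth_near_chart[OF c S] by metis
qed

lemma coord_vec_coord:
  assumes c: "(U, \<phi>) \<in> A" "p \<in> U"
  shows "coord_vec U \<phi> p x (\<lambda>q. \<phi> q \<bullet> b) = x \<bullet> b"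
proof -
  have "((\<lambda>y::'e. y \<bullet> b) has_derivative (\<lambda>y. y \<bullet> b)) (at (\<phi> p))"
    by (rule bounded_linear_imp_has_derivative) (rule bounded_linear_inner_left)
  then show ?thesis
    using coord_vec_chart_fun[OF c open_UNIV, of "\<lambda>y. y \<bullet> b" x]
    by (simp add: frechet_derivative_at[symmetric] smooth_on_linear bounded_linear_inner_left)
qed

text \<open>Coordinates of a tangent vector collected into a vector of the model space: the inverse
  of \<open>coord_vec\<close>, and the second component of the induced chart on the tangent
  bundle.\<close>

definition comps :: "('a \<Rightarrow> 'e) \<Rightarrow> 'a tvec \<Rightarrow> 'e" where
  "comps \<phi> v = (\<Sum>b\<in>Basis. v (\<lambda>q. \<phi> q \<bullet> b) *\<^sub>R b)"

lemma comps_inner: "b \<in> Basis \<Longrightarrow> comps \<phi> v \<bullet> b = v (\<lambda>q. \<phi> q \<bullet> b)"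
  by (simp add: comps_def inner_sum_left_Basis)

lemma comps_coord_vec: "(U, \<phi>) \<in> A \<Longrightarrow> p \<in> U \<Longrightarrow> comps \<phi> (coord_vec U \<phi> p x) = x"
  by (rule euclidean_eqI) (simp add: comps_inner coord_vec_coord)

lemma coord_vec_comps:
  assumes "(U, \<phi>) \<in> A" "p \<in> U" "v \<in> tangent_space A p"
  shows "coord_vec U \<phi> p (comps \<phi> v) = v"
  by (rule tangent_eqI[OF coord_vec_tangent assms(3) assms(1,2)])
    (use assms in \<open>simp_all add: comps_inner coord_vec_coord\<close>)

lemma coord_vec_linear:
  assumes "(U, \<phi>) \<in> A" "p \<in> U"
  shows "coord_vec U \<phi> p x f = (\<Sum>b\<in>Basis. (x \<bullet> b) * coord_vec U \<phi> p b f)"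
proof (cases "smooth_near A p f")
  case True
  then show ?thesis
    using linear_eq_sum_Basis[OF has_derivative_linear[OF chart_has_derivative[OF assms True]], of x]
    by (simp add: coord_vec_def)
qed (simp add: coord_vec_def)

lemma tangent_expand:
  assumes "(U, \<phi>) \<in> A" "p \<in> U" "v \<in> tangent_space A p"
  shows "v f = (\<Sum>b\<in>Basis. v (\<lambda>q. \<phi> q \<bullet> b) * coord_vec U \<phi> p b f)"
proof -
  have "v f = coord_vec U \<phi> p (comps \<phi> v) f" using coord_vec_comps[OF assms] by simp
  also have "\<dots> = (\<Sum>b\<in>Basis. v (\<lambda>q. \<phi> q \<bullet> b) * coord_vec U \<phi> p b f)"
    by (subst coord_vec_linear[OF assms(1,2)]) (simp add: comps_inner)
  finally show ?thesis .
qed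

lemma coord_vec_smooth:
  assumes c: "(U, \<phi>) \<in> A" "p \<in> U" and f: "smooth_near A p f"
  shows "smooth_near A p (\<lambda>q. coord_vec U \<phi> q x f)"
proof -
  have p: "p \<in> pts A" using c by (auto simp: pts_iff)
  obtain S where S: "open S" "\<phi> p \<in> S" "S \<subseteq> \<phi> ` U" "smooth_on S (f \<circ> inv_into U \<phi>)"
    using smooth_near_chartD[OF c f] .
  have "smooth_near A p (\<lambda>q. frechet_derivative (f \<circ> inv_into U \<phi>) (at (\<phi> q)) x)"
    by (rule smooth_near_chart[OF c S(1,2) smooth_on_frechet[OF S(4)]])
  moreover have "eventually (\<lambda>q. frechet_derivative (f \<circ> inv_into U \<phi>) (at (\<phi> q)) x = coord_vec U \<phi> q x f) (near p)"
    using smooth_near_eventually[OF f] by eventually_elim (simp add: coord_vec_def)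
  ultimately show ?thesis by (rule smooth_near_cong)
qed

end

section \<open>Vector fields and tensoriality\<close>

context atlas
begin

lemma vfield_open: "vfield_on A U X \<Longrightarrow> openin (mtop A) U"
  by (simp add: vfield_on_def)

lemma vfield_tangent: "vfield_on A U X \<Longrightarrow> p \<in> U \<Longrightarrow> X p \<in> tangent_space A p"
  by (simp add: vfield_on_def)

lemma vfield_smooth_near:
  assumes X: "vfield_on A U X" "p \<in> U" and f: "smooth_near A p f"
  shows "smooth_near A p (\<lambda>q. X q f)"
proof -
  obtain W where W: "p \<in> W" "smooth_fun_on A W f" using f by (auto simp: smooth_near_def)
  have "smooth_fun_on A (U \<inter> W) f"
    using W X vfield_open[OF X(1)] by (auto simp: smooth_fun_on_iff)
  then have "smooth_fun_on A (U \<inter> W) (\<lambda>q. X q f)"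
    using X by (auto simp: vfield_on_def)
  then show ?thesis using W X by (auto simp: smooth_fun_on_iff)
qed

lemma vfield_onI:
  assumes "openin (mtop A) U" "\<And>p. p \<in> U \<Longrightarrow> X p \<in> tangent_space A p"
    and "\<And>p f. p \<in> U \<Longrightarrow> smooth_near A p f \<Longrightarrow> smooth_near A p (\<lambda>q. X q f)"
  shows "vfield_on A U X"
  using assms unfolding vfield_on_def smooth_fun_on_iff by auto

text \<open>By \<open>tangent_expand\<close>, \<open>X q f\<close> is a combination of smooth
  functions whose coefficients are the values of \<open>X\<close> on coordinate functions, so
  smoothness of these coefficients in one chart around each point is enough.\<close>

lemma vfield_onI_coords:
  assumes o: "openin (mtop A) U" and t: "\<And>p. p \<in> U \<Longrightarrow> X p \<in> tangent_space A p"
    and s: "\<And>p. p \<in> U \<Longrightarrow> \<exists>V \<phi>. (V, \<phi>) \<in> A \<and> p \<in> V \<and> (\<forall>b\<in>Basis. smooth_near A p (\<lambda>q. X q (\<lambda>r. \<phi> r \<bullet> b)))"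
  shows "vfield_on A U X"
proof (rule vfield_onI[OF o t])
  fix p f assume p: "p \<in> U" and f: "smooth_near A p f"
  obtain V \<phi> where c: "(V, \<phi>) \<in> A" "p \<in> V"
    and X: "\<And>b. b \<in> Basis \<Longrightarrow> smooth_near A p (\<lambda>q. X q (\<lambda>r. \<phi> r \<bullet> b))" using s[OF p] by auto
  have "smooth_near A p (\<lambda>q. \<Sum>b\<in>Basis. X q (\<lambda>r. \<phi> r \<bullet> b) * coord_vec V \<phi> q b f)"
    by (rule smooth_near_sum[OF chart_pts[OF c] smooth_near_mult[OF X coord_vec_smooth[OF c f]]])
  moreover have "eventually (\<lambda>q. (\<Sum>b\<in>Basis. X q (\<lambda>r. \<phi> r \<bullet> b) * coord_vec V \<phi> q b f) = X q f) (near p)"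
    using eventually_near_open[OF o p] eventually_near_open[OF openin_chart[OF c(1)] c(2)]
    by eventually_elim (use tangent_expand[OF c(1) _ t] in metis)
  ultimately show "smooth_near A p (\<lambda>q. X q f)" by (rule smooth_near_cong)
qed

lemma vfield_subset: "vfield_on A U X \<Longrightarrow> openin (mtop A) V \<Longrightarrow> V \<subseteq> U \<Longrightarrow> vfield_on A V X"
  unfolding vfield_on_def by auto

lemma vfield_Int:
  assumes "vfield_on A U X" "openin (mtop A) V"
  shows "vfield_on A (U \<inter> V) X" "vfield_on A (V \<inter> U) X"
  using assms vfield_open by (auto intro!: vfield_subset[OF assms(1)])

lemma smooth_fun_Int:
  assumes "smooth_fun_on A U f" "openin (mtop A) V"
  shows "smooth_fun_on A (U \<inter> V) f" "smooth_fun_on A (V \<inter> U) f"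
  using assms by (auto simp: smooth_fun_on_iff)

lemma vfield_cong:
  assumes X: "vfield_on A U X" and eq: "\<And>q. q \<in> U \<Longrightarrow> X q = Y q"
  shows "vfield_on A U Y"
proof (rule vfield_onI[OF vfield_open[OF X]])
  fix p f assume p: "p \<in> U" "smooth_near A p f"
  have "eventually (\<lambda>q. X q f = Y q f) (near p)"
    using eventually_near_open[OF vfield_open[OF X] p(1)] by eventually_elim (simp add: eq)
  then show "smooth_near A p (\<lambda>q. Y q f)" using smooth_near_cong[OF vfield_smooth_near[OF X p]] by simp
qed (use vfield_tangent[OF X] eq in metis)

lemma vfield_add:
  assumes "vfield_on A U X" "vfield_on A U Y"
  shows "vfield_on A U (\<lambda>q. tadd (X q) (Y q))"
  by (rule vfield_onI[OF vfield_open[OF assms(1)]])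
    (auto simp: tadd_def[of "X q" "Y q" for q] intro!: tadd_tangent[unfolded tadd_def] vfield_tangent[OF assms(1)] vfield_tangent[OF assms(2)]
      smooth_near_add vfield_smooth_near[OF assms(1)] vfield_smooth_near[OF assms(2)])

lemma vfield_scale:
  assumes "smooth_fun_on A U f" "vfield_on A U X"
  shows "vfield_on A U (\<lambda>q. tscale (f q) (X q))"
  by (rule vfield_onI[OF vfield_open[OF assms(2)]])
    (use assms(1) in \<open>auto simp: tscale_def[of "f q" "X q" for q] smooth_fun_on_iff intro!: tscale_tangent[unfolded tscale_def] vfield_tangent[OF assms(2)]
      smooth_near_mult vfield_smooth_near[OF assms(2)]\<close>)

lemma smooth_fun_const: "openin (mtop A) U \<Longrightarrow> smooth_fun_on A U (\<lambda>q. c)"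
  by (auto simp: smooth_fun_on_iff intro: smooth_near_const openin_pts)

lemma vfield_zero: "openin (mtop A) U \<Longrightarrow> vfield_on A U (\<lambda>q. tzero)"
  by (rule vfield_onI) (auto simp: tzero_def tzero_tangent[unfolded tzero_def] intro: smooth_near_const openin_pts)

lemma vfield_sum:
  assumes "openin (mtop A) U" "\<And>i. i \<in> I \<Longrightarrow> vfield_on A U (X i)"
  shows "vfield_on A U (\<lambda>q. tsum (\<lambda>i. X i q) I)"
  by (rule vfield_onI[OF assms(1)])
    (use assms in \<open>auto simp: tsum_def[of "\<lambda>i. X i q" I for q] intro!: tsum_tangent[unfolded tsum_def] vfield_tangent[OF assms(2)]
      smooth_near_sum vfield_smooth_near[OF assms(2)] intro: openin_pts\<close>)

lemma vfield_diff:
  assumes "vfield_on A U X" "vfield_on A U Y"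
  shows "vfield_on A U (\<lambda>q. tdiff (X q) (Y q))"
  by (rule vfield_onI[OF vfield_open[OF assms(1)]])
    (auto simp: tdiff_def[of "X q" "Y q" for q] intro!: tdiff_tangent[unfolded tdiff_def] vfield_tangent[OF assms(1)] vfield_tangent[OF assms(2)]
      smooth_near_diff vfield_smooth_near[OF assms(1)] vfield_smooth_near[OF assms(2)])

lemma vfield_coord: "(V, \<phi>) \<in> A \<Longrightarrow> vfield_on A V (\<lambda>q. coord_vec V \<phi> q x)"
  by (intro vfield_onI openin_chart coord_vec_tangent coord_vec_smooth)

lemma vfield_extend:
  assumes "(V, \<phi>) \<in> A" "p \<in> V" "v \<in> tangent_space A p"
  shows "vfield_on A V (\<lambda>q. coord_vec V \<phi> q (comps \<phi> v))" "coord_vec V \<phi> p (comps \<phi> v) = v"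
  using vfield_coord[OF assms(1)] coord_vec_comps[OF assms] by auto

lemma vfield_extend_ex:
  assumes "p \<in> pts A" "v \<in> tangent_space A p"
  obtains U X where "p \<in> U" "vfield_on A U X" "X p = v"
  using assms vfield_extend pts_iff by metis

section \<open>Lie brackets of vector fields\<close>

lemma lie_bracket_apply:
  "smooth_near A p f \<Longrightarrow> lie_bracket A X Y p f = X p (\<lambda>q. Y q f) - Y p (\<lambda>q. X q f)"
  by (simp add: lie_bracket_def)

lemma vfield_apply_add:
  assumes X: "vfield_on A U X" and Y: "vfield_on A U Y" and p: "p \<in> U"
    and f: "smooth_near A p f" and h: "smooth_near A p h"
  shows "X p (\<lambda>q. Y q (\<lambda>r. f r + h r)) = X p (\<lambda>q. Y q f) + X p (\<lambda>q. Y q h)"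
proof -
  note o = vfield_open[OF X]
  have "X p (\<lambda>q. Y q (\<lambda>r. f r + h r)) = X p (\<lambda>q. Y q f + Y q h)"
  proof (rule tangent_cong[OF vfield_tangent[OF X p] openin_pts[OF o p]])
    show "eventually (\<lambda>q. Y q (\<lambda>r. f r + h r) = Y q f + Y q h) (near p)"
      using eventually_near_open[OF o p] smooth_near_eventually[OF f] smooth_near_eventually[OF h]
      by eventually_elim (rule tangent_add[OF vfield_tangent[OF Y]])
  qed
  then show ?thesis
    using tangent_add[OF vfield_tangent[OF X p] vfield_smooth_near[OF Y p f] vfield_smooth_near[OF Y p h]] by simp
qed

lemma vfield_apply_scale:
  assumes X: "vfield_on A U X" and Y: "vfield_on A U Y" and p: "p \<in> U" and f: "smooth_near A p f"
  shows "X p (\<lambda>q. Y q (\<lambda>r. c * f r)) = c * X p (\<lambda>q. Y q f)"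
proof -
  note o = vfield_open[OF X]
  have "X p (\<lambda>q. Y q (\<lambda>r. c * f r)) = X p (\<lambda>q. c * Y q f)"
  proof (rule tangent_cong[OF vfield_tangent[OF X p] openin_pts[OF o p]])
    show "eventually (\<lambda>q. Y q (\<lambda>r. c * f r) = c * Y q f) (near p)"
      using eventually_near_open[OF o p] smooth_near_eventually[OF f]
      by eventually_elim (rule tangent_scale[OF vfield_tangent[OF Y]])
  qed
  then show ?thesis
    using tangent_scale[OF vfield_tangent[OF X p] vfield_smooth_near[OF Y p f]] by simp
qed

text \<open>The mixed terms \<open>X p f * Y p h\<close> and \<open>X p h * Y p f\<close> are
  together symmetric in \<open>X\<close> and \<open>Y\<close>. They cancel in the commutator, which
  is why the bracket is again a derivation.\<close>

lemma vfield_apply_mult: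
  assumes X: "vfield_on A U X" and Y: "vfield_on A U Y" and p: "p \<in> U"
    and f: "smooth_near A p f" and h: "smooth_near A p h"
  shows "X p (\<lambda>q. Y q (\<lambda>r. f r * h r)) =
    f p * X p (\<lambda>q. Y q h) + X p f * Y p h + h p * X p (\<lambda>q. Y q f) + X p h * Y p f"
proof -
  note o = vfield_open[OF X]
  have "X p (\<lambda>q. Y q (\<lambda>r. f r * h r)) = X p (\<lambda>q. f q * Y q h + h q * Y q f)"
  proof (rule tangent_cong[OF vfield_tangent[OF X p] openin_pts[OF o p]])
    show "eventually (\<lambda>q. Y q (\<lambda>r. f r * h r) = f q * Y q h + h q * Y q f) (near p)"
      using eventually_near_open[OF o p] smooth_near_eventually[OF f] smooth_near_eventually[OF h]
      by eventually_elim (rule tangent_mult[OF vfield_tangent[OF Y]])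
  qed
  also have "\<dots> = X p (\<lambda>q. f q * Y q h) + X p (\<lambda>q. h q * Y q f)"
    by (intro tangent_add[OF vfield_tangent[OF X p]] smooth_near_mult f h vfield_smooth_near[OF Y p])
  finally show ?thesis
    by (simp add: tangent_mult[OF vfield_tangent[OF X p]] f h vfield_smooth_near[OF Y p])
qed

lemma vfield_bracket:
  assumes X: "vfield_on A U X" and Y: "vfield_on A U Y"
  shows "vfield_on A U (lie_bracket A X Y)"
proof (rule vfield_onI[OF vfield_open[OF X]])
  fix p assume p: "p \<in> U"
  have pA: "p \<in> pts A" using openin_pts[OF vfield_open[OF X] p] .
  have "lie_bracket A X Y p (\<lambda>r. c * f r) = c * lie_bracket A X Y p f" if f: "smooth_near A p f" for c f
    using vfield_apply_scale[OF X Y p f] vfield_apply_scale[OF Y X p f]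
      smooth_near_mult[OF smooth_near_const[OF pA] f, of c] f
    by (simp add: lie_bracket_apply algebra_simps)
  then show "lie_bracket A X Y p \<in> tangent_space A p"
    unfolding tangent_space_def
    using vfield_apply_add[OF X Y p] vfield_apply_add[OF Y X p] vfield_apply_mult[OF X Y p] vfield_apply_mult[OF Y X p]
    by (auto simp: lie_bracket_def smooth_near_add smooth_near_mult algebra_simps)
  fix f assume f: "smooth_near A p f"
  have "smooth_near A p (\<lambda>q. X q (\<lambda>r. Y r f) - Y q (\<lambda>r. X r f))"
    by (intro smooth_near_diff vfield_smooth_near[OF X p] vfield_smooth_near[OF Y p] f)
  moreover have "eventually (\<lambda>q. X q (\<lambda>r. Y r f) - Y q (\<lambda>r. X r f) = lie_bracket A X Y q f) (near p)"
    using smooth_near_eventually[OF f] by eventually_elim (simp add: lie_bracket_apply)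
  ultimately show "smooth_near A p (\<lambda>q. lie_bracket A X Y q f)" by (rule smooth_near_cong)
qed

lemma bracket_antisym: "lie_bracket A X Y p = tscale (- 1) (lie_bracket A Y X p)"
  by (auto simp: lie_bracket_def tscale_def)

lemma bracket_add_right:
  assumes X: "vfield_on A U X" and Y: "vfield_on A U Y" "vfield_on A U Z" and p: "p \<in> U"
  shows "lie_bracket A X (\<lambda>q. tadd (Y q) (Z q)) p = tadd (lie_bracket A X Y p) (lie_bracket A X Z p)"
proof
  fix f
  show "lie_bracket A X (\<lambda>q. tadd (Y q) (Z q)) p f = tadd (lie_bracket A X Y p) (lie_bracket A X Z p) f"
    using tangent_add[OF vfield_tangent[OF X p] vfield_smooth_near[OF Y(1) p] vfield_smooth_near[OF Y(2) p], of f f]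
    by (simp add: lie_bracket_def tadd_def)
qed

lemma bracket_scale_right:
  assumes X: "vfield_on A U X" and Y: "vfield_on A U Y" and f: "smooth_fun_on A U f" and p: "p \<in> U"
  shows "lie_bracket A X (\<lambda>q. tscale (f q) (Y q)) p =
    tadd (tscale (X p f) (Y p)) (tscale (f p) (lie_bracket A X Y p))"
proof
  fix h
  have f': "smooth_near A p f" using f p by (auto simp: smooth_fun_on_iff)
  show "lie_bracket A X (\<lambda>q. tscale (f q) (Y q)) p h =
    tadd (tscale (X p f) (Y p)) (tscale (f p) (lie_bracket A X Y p)) h"
  proof (cases "smooth_near A p h")
    case True
    then show ?thesis
      using tangent_mult[OF vfield_tangent[OF X p] f' vfield_smooth_near[OF Y p True]]
      by (simp add: lie_bracket_apply tadd_def tscale_def algebra_simps)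
  next
    case False
    then show ?thesis using tangent_not_smooth[OF vfield_tangent[OF Y p]]
      by (simp add: lie_bracket_def tadd_def tscale_def)
  qed
qed

lemma bracket_add_left:
  assumes "vfield_on A U X" "vfield_on A U Y" "vfield_on A U Z" "p \<in> U"
  shows "lie_bracket A (\<lambda>q. tadd (X q) (Y q)) Z p = tadd (lie_bracket A X Z p) (lie_bracket A Y Z p)"
  unfolding bracket_antisym[of _ Z] bracket_add_right[OF assms(3,1,2,4)]
  by (simp add: tadd_def tscale_def algebra_simps)

lemma bracket_scale_left:
  assumes "vfield_on A U X" "vfield_on A U Y" "smooth_fun_on A U f" "p \<in> U"
  shows "lie_bracket A (\<lambda>q. tscale (f q) (X q)) Y p =
    tdiff (tscale (f p) (lie_bracket A X Y p)) (tscale (Y p f) (X p))"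
  unfolding bracket_antisym[of _ Y] bracket_scale_right[OF assms(2,1,3,4)]
  by (rule ext) (simp add: tadd_def tscale_def tdiff_def algebra_simps)

text \<open>Formulated for functionals on fields rather than on vectors, since connections and forms
  built from them act on fields. Dependence on the value at \<open>p\<close> alone is then a
  theorem, \<open>tensorial_eq\<close>; the quantification over all open sets around
  \<open>p\<close> is what makes its proof local.\<close>

definition tensorial_at :: "'a \<Rightarrow> ('a vfield \<Rightarrow> real) \<Rightarrow> bool" where
  "tensorial_at p B \<longleftrightarrow>
     (\<forall>U X Y. p \<in> U \<and> vfield_on A U X \<and> vfield_on A U Y \<longrightarrow> B (\<lambda>q. tadd (X q) (Y q)) = B X + B Y) \<and>
     (\<forall>U f X. p \<in> U \<and> smooth_fun_on A U f \<and> vfield_on A U X \<longrightarrow> B (\<lambda>q. tscale (f q) (X q)) = f p * B X)"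

lemma tensorial_add:
  "tensorial_at p B \<Longrightarrow> p \<in> U \<Longrightarrow> vfield_on A U X \<Longrightarrow> vfield_on A U Y \<Longrightarrow>
    B (\<lambda>q. tadd (X q) (Y q)) = B X + B Y"
  unfolding tensorial_at_def by meson

lemma tensorial_scale:
  "tensorial_at p B \<Longrightarrow> p \<in> U \<Longrightarrow> smooth_fun_on A U f \<Longrightarrow> vfield_on A U X \<Longrightarrow>
    B (\<lambda>q. tscale (f q) (X q)) = f p * B X"
  unfolding tensorial_at_def by meson

lemma smooth_indicator:
  assumes "openin (mtop A) U"
  shows "smooth_fun_on A U (\<lambda>q. if q \<in> U then 1 else 0)"
  unfolding smooth_fun_on_iff
proof (intro conjI ballI assms)
  fix p assume p: "p \<in> U"
  show "smooth_near A p (\<lambda>q. if q \<in> U then 1 else 0)"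
  proof (rule smooth_near_cong[OF smooth_near_const[OF openin_pts[OF assms p], of 1]])
    show "eventually (\<lambda>q. 1 = (if q \<in> U then 1 else 0 :: real)) (near p)"
      using eventually_near_open[OF assms p] by eventually_elim simp
  qed
qed

text \<open>Multiplying by the indicator function of an open set shows that tensorial maps are local.\<close>

lemma tensorial_cong:
  assumes B: "tensorial_at p B" and p: "p \<in> U" and X: "vfield_on A U X" and eq: "\<And>q. q \<in> U \<Longrightarrow> X q = Y q"
  shows "B X = B Y"
proof -
  let ?c = "\<lambda>q. if q \<in> U then 1 else 0 :: real"
  note c = smooth_indicator[OF vfield_open[OF X]]
  have Y: "vfield_on A U Y" using vfield_cong[OF X eq] .
  have "(\<lambda>q. tscale (?c q) (X q)) = (\<lambda>q. tscale (?c q) (Y q))" using eq by (auto simp: tscale_def)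
  moreover have "B (\<lambda>q. tscale (?c q) (X q)) = B X" "B (\<lambda>q. tscale (?c q) (Y q)) = B Y"
    using tensorial_scale[OF B p c X] tensorial_scale[OF B p c Y] p by simp_all
  ultimately show ?thesis by metis
qed

lemma tensorial_sum:
  assumes B: "tensorial_at p B" and p: "p \<in> U" and o: "openin (mtop A) U"
    and X: "\<And>i. i \<in> I \<Longrightarrow> vfield_on A U (X i)" and "finite I"
  shows "B (\<lambda>q. tsum (\<lambda>i. X i q) I) = (\<Sum>i\<in>I. B (X i))"
  using \<open>finite I\<close> X
proof (induction I)
  case empty
  have "B (\<lambda>q. tscale 0 tzero) = 0 * B (\<lambda>q. tzero)"
    by (rule tensorial_scale[OF B p smooth_fun_const[OF o] vfield_zero[OF o]])
  then show ?case by (simp add: tsum_def tscale_def tzero_def)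
next
  case (insert i I)
  have "B (\<lambda>q. tsum (\<lambda>i. X i q) (insert i I)) = B (\<lambda>q. tadd (X i q) (tsum (\<lambda>i. X i q) I))"
    using insert by (simp add: tsum_def tadd_def)
  also have "\<dots> = B (X i) + B (\<lambda>q. tsum (\<lambda>i. X i q) I)"
    by (rule tensorial_add[OF B p _ vfield_sum[OF o]]) (use insert.prems in auto)
  finally show ?case using insert by simp
qed

text \<open>Locality replaces \<open>X\<close> by its expansion on \<open>U\<close>; linearity over
  smooth functions then moves the coefficients outside, evaluated at \<open>p\<close>.\<close>

lemma tensorial_frame:
  assumes B: "tensorial_at p B" and p: "p \<in> U" and X: "vfield_on A U X" and I: "finite I"
    and e: "\<And>i. i \<in> I \<Longrightarrow> vfield_on A U (e i)" and f: "\<And>i. i \<in> I \<Longrightarrow> smooth_fun_on A U (f i)"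
    and eq: "\<And>q. q \<in> U \<Longrightarrow> X q = tsum (\<lambda>i. tscale (f i q) (e i q)) I"
  shows "B X = (\<Sum>i\<in>I. f i p * B (e i))"
proof -
  have "B X = B (\<lambda>q. tsum (\<lambda>i. tscale (f i q) (e i q)) I)"
    by (rule tensorial_cong[OF B p X eq])
  also have "\<dots> = (\<Sum>i\<in>I. B (\<lambda>q. tscale (f i q) (e i q)))"
    by (rule tensorial_sum[OF B p vfield_open[OF X] vfield_scale[OF f e] I])
  also have "\<dots> = (\<Sum>i\<in>I. f i p * B (e i))"
    by (intro sum.cong refl tensorial_scale[OF B p] f e)
  finally show ?thesis .
qed

lemma tensorial_chart:
  assumes B: "tensorial_at p B" and Z: "p \<in> V" "vfield_on A V Z" and c: "(W, \<phi>) \<in> A" "p \<in> W"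
  shows "B Z = (\<Sum>b\<in>Basis. Z p (\<lambda>q. \<phi> q \<bullet> b) * B (\<lambda>q. coord_vec W \<phi> q b))"
proof (rule tensorial_frame[OF B, where U = "V \<inter> W"])
  show "vfield_on A (V \<inter> W) Z" using Z openin_chart[OF c(1)] by (auto intro: vfield_Int)
  fix b
  show "vfield_on A (V \<inter> W) (\<lambda>q. coord_vec W \<phi> q b)"
    using vfield_Int(2)[OF vfield_coord[OF c(1)] vfield_open[OF Z(2)]] .
  show "smooth_fun_on A (V \<inter> W) (\<lambda>q. Z q (\<lambda>r. \<phi> r \<bullet> b))"
    using vfield_open[OF Z(2)] openin_chart[OF c(1)]
    by (auto simp: smooth_fun_on_iff intro!: vfield_smooth_near[OF Z(2)] smooth_near_coord[OF c(1)])
  fix q assume "q \<in> V \<inter> W"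
  then show "Z q = tsum (\<lambda>b. tscale (Z q (\<lambda>r. \<phi> r \<bullet> b)) (coord_vec W \<phi> q b)) Basis"
    unfolding tsum_def tscale_def by (intro ext tangent_expand[OF c(1) _ vfield_tangent[OF Z(2)]]) auto
qed (use Z c in auto)

text \<open>Both fields expand in the same coordinate fields, and the coefficients at
  \<open>p\<close> see nothing but the common value at \<open>p\<close>.\<close>

lemma tensorial_eq:
  assumes B: "tensorial_at p B" and X: "p \<in> U" "vfield_on A U X" and Y: "p \<in> V" "vfield_on A V Y"
    and eq: "X p = Y p"
  shows "B X = B Y"
proof -
  obtain W \<phi> where c: "(W, \<phi>) \<in> A" "p \<in> W"
    using openin_pts[OF vfield_open[OF X(2)] X(1)] by (auto simp: pts_iff)
  show ?thesis using tensorial_chart[OF B X c] tensorial_chart[OF B Y c] eq by simp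
qed

lemma comps_add: "comps \<phi> (tadd v w) = comps \<phi> v + comps \<phi> w"
  by (simp add: comps_def tadd_def scaleR_add_left sum.distrib)

lemma comps_scale: "comps \<phi> (tscale c v) = c *\<^sub>R comps \<phi> v"
  by (simp add: comps_def tscale_def scaleR_sum_right)

lemma comps_sum: "comps \<phi> (tsum v I) = (\<Sum>i\<in>I. comps \<phi> (v i))"
  by (simp add: comps_def tsum_def scaleR_sum_left sum.swap[of _ Basis])

lemma comps_eq_0: "(U, \<phi>) \<in> A \<Longrightarrow> p \<in> U \<Longrightarrow> v \<in> tangent_space A p \<Longrightarrow> comps \<phi> v = 0 \<Longrightarrow> v = tzero"
  by (rule tangent_eqI[OF _ tzero_tangent]) (auto simp: comps_inner[symmetric] tzero_def)

end

section \<open>Riemannian metrics\<close>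

locale riemannian = atlas A for A :: "('a, 'e::euclidean_space) chart set" +
  fixes g :: "'a \<Rightarrow> 'a tvec \<Rightarrow> 'a tvec \<Rightarrow> real"
  assumes metric: "riemannian_metric A g"
begin

context
  fixes p assumes p: "p \<in> pts A"
begin

lemma g_sym: "x \<in> tangent_space A p \<Longrightarrow> y \<in> tangent_space A p \<Longrightarrow> g p x y = g p y x"
  using metric p unfolding riemannian_metric_def by blast

lemma g_add_left: "x \<in> tangent_space A p \<Longrightarrow> y \<in> tangent_space A p \<Longrightarrow> z \<in> tangent_space A p \<Longrightarrow>
    g p (tadd x y) z = g p x z + g p y z"
  using metric p unfolding riemannian_metric_def by blast

lemma g_scale_left: "x \<in> tangent_space A p \<Longrightarrow> y \<in> tangent_space A p \<Longrightarrow> g p (tscale c x) y = c * g p x y"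
  using metric p unfolding riemannian_metric_def by blast

lemma g_pos: "x \<in> tangent_space A p \<Longrightarrow> x \<noteq> tzero \<Longrightarrow> g p x x > 0"
  using metric p unfolding riemannian_metric_def by blast

lemma g_add_right: "x \<in> tangent_space A p \<Longrightarrow> y \<in> tangent_space A p \<Longrightarrow> z \<in> tangent_space A p \<Longrightarrow>
    g p z (tadd x y) = g p z x + g p z y"
  using g_add_left[of x y z] g_sym tadd_tangent by metis

lemma g_scale_right: "x \<in> tangent_space A p \<Longrightarrow> y \<in> tangent_space A p \<Longrightarrow> g p y (tscale c x) = c * g p y x"
  using g_scale_left[of x y] g_sym tscale_tangent by metis

lemma g_diff_left: 
  assumes "x \<in> tangent_space A p" "y \<in> tangent_space A p" "z \<in> tangent_space A p"
  shows "g p (tdiff x y) z = g p x z - g p y z"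
proof -
  have "tdiff x y = tadd x (tscale (- 1) y)" by (simp add: tdiff_def tadd_def tscale_def)
  then show ?thesis using assms by (simp add: g_add_left g_scale_left tscale_tangent)
qed

lemma g_diff_right: 
  assumes "x \<in> tangent_space A p" "y \<in> tangent_space A p" "z \<in> tangent_space A p"
  shows "g p z (tdiff x y) = g p z x - g p z y"
  using g_diff_left[OF assms] g_sym tdiff_tangent assms by metis

lemma g_zero_left: "x \<in> tangent_space A p \<Longrightarrow> g p tzero x = 0"
  using g_scale_left[of tzero x 0] tzero_tangent by (simp add: tscale_def tzero_def)

lemma g_sum_left:
  assumes "\<And>i. i \<in> I \<Longrightarrow> x i \<in> tangent_space A p" "z \<in> tangent_space A p"
  shows "g p (tsum x I) z = (\<Sum>i\<in>I. g p (x i) z)"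
  using assms(1)
proof (induction I rule: infinite_finite_induct)
  case (insert i I)
  then have "tsum x (insert i I) = tadd (x i) (tsum x I)" by (simp add: tsum_def tadd_def)
  then show ?case using insert assms(2) by (simp add: g_add_left tsum_tangent)
qed (use g_zero_left[OF assms(2)] in \<open>auto simp: tsum_def tzero_def\<close>)

lemma g_sum_right:
  assumes "\<And>i. i \<in> I \<Longrightarrow> x i \<in> tangent_space A p" "z \<in> tangent_space A p"
  shows "g p z (tsum x I) = (\<Sum>i\<in>I. g p z (x i))"
proof -
  have "g p z (tsum x I) = g p (tsum x I) z" using assms by (intro g_sym tsum_tangent) auto
  also have "\<dots> = (\<Sum>i\<in>I. g p (x i) z)" using assms by (rule g_sum_left)
  also have "\<dots> = (\<Sum>i\<in>I. g p z (x i))" using assms by (intro sum.cong g_sym) auto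
  finally show ?thesis .
qed

lemma g_eqI:
  assumes "x \<in> tangent_space A p" "y \<in> tangent_space A p" "\<And>z. z \<in> tangent_space A p \<Longrightarrow> g p x z = g p y z"
  shows "x = y"
proof -
  have "g p (tdiff x y) (tdiff x y) = 0"
    using assms by (simp add: g_diff_left tdiff_tangent)
  then have "tdiff x y = tzero" using g_pos[OF tdiff_tangent[OF assms(1,2)]] by force
  then have "x f - y f = 0" for f by (metis tdiff_def tzero_def)
  then show ?thesis by auto
qed

text \<open>A dimension count in the model space. The map \<open>L\<close> sends a coefficient
  vector to the coordinates of the combination of the \<open>e i\<close>; orthonormality makes it
  injective, hence surjective. So \<open>x\<close> is some combination of the \<open>e i\<close>,
  and pairing with \<open>e i\<close> identifies its coefficients.\<close>

lemma orthonormal_expand: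
  assumes e: "\<And>i. i < DIM('e) \<Longrightarrow> e i \<in> tangent_space A p"
    and on: "\<And>i j. i < DIM('e) \<Longrightarrow> j < DIM('e) \<Longrightarrow> g p (e i) (e j) = (if i = j then 1 else 0)"
    and x: "x \<in> tangent_space A p"
  shows "x = tsum (\<lambda>i. tscale (g p x (e i)) (e i)) {..<DIM('e)}"
proof -
  obtain U \<phi> where c: "(U, \<phi>) \<in> A" "p \<in> U" using p by (auto simp: pts_iff)
  obtain h where h: "bij_betw h {..<DIM('e)} (Basis :: 'e set)"
    using finite_same_card_bij[of "{..<DIM('e)}" "Basis :: 'e set"] by auto
  define F where "F a = tsum (\<lambda>i. tscale (a i) (e i)) {..<DIM('e)}" for a
  have F: "F a \<in> tangent_space A p" for a
    unfolding F_def using e by (intro tsum_tangent tscale_tangent) auto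
  have gF: "g p (F a) (e j) = a j" if "j < DIM('e)" for a j
  proof -
    have "g p (F a) (e j) = (\<Sum>i<DIM('e). a i * g p (e i) (e j))"
      unfolding F_def using e that by (subst g_sum_left) (auto intro!: tscale_tangent sum.cong simp: g_scale_left)
    also have "\<dots> = (\<Sum>i<DIM('e). if i = j then a i else 0)" using on that by (intro sum.cong) auto
    finally show ?thesis using that by simp
  qed
  define L where "L y = comps \<phi> (F (\<lambda>i. y \<bullet> h i))" for y :: 'e
  have L: "L y = (\<Sum>i<DIM('e). (y \<bullet> h i) *\<^sub>R comps \<phi> (e i))" for y
    by (simp add: L_def F_def comps_sum comps_scale)
  have lin: "linear L"
    by (rule linearI) (simp_all add: L inner_add_left scaleR_add_left sum.distrib scaleR_sum_right)
  have "inj L"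
    unfolding linear_injective_0[OF lin]
  proof (intro allI impI)
    fix y assume "L y = 0"
    then have "F (\<lambda>i. y \<bullet> h i) = tzero" unfolding L_def using comps_eq_0[OF c F] by auto
    then have "y \<bullet> h j = 0" if "j < DIM('e)" for j
      using gF[OF that, of "\<lambda>i. y \<bullet> h i"] g_zero_left[OF e[OF that]] by simp
    then have "y \<bullet> b = 0" if "b \<in> Basis" for b using h that by (metis bij_betw_def imageE lessThan_iff)
    then show "y = 0" using euclidean_all_zero_iff by blast
  qed
  then have "surj L" using linear_injective_imp_surjective[OF lin] by simp
  then obtain y where "L y = comps \<phi> x" by (metis surjD)
  then have xF: "x = F (\<lambda>i. y \<bullet> h i)"
    unfolding L_def using coord_vec_comps[OF c x] coord_vec_comps[OF c F] by metis
  have "g p x (e i) = y \<bullet> h i" if "i < DIM('e)" for i using gF[OF that] xF by simp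
  then have "tsum (\<lambda>i. tscale (g p x (e i)) (e i)) {..<DIM('e)} = F (\<lambda>i. y \<bullet> h i)"
    by (auto simp: F_def tsum_def tscale_def)
  then show ?thesis using xF by simp
qed

end

lemma g_smooth_near:
  assumes "vfield_on A U X" "vfield_on A U Y" "p \<in> U"
  shows "smooth_near A p (\<lambda>q. g q (X q) (Y q))"
  using metric assms unfolding riemannian_metric_def smooth_fun_on_iff by blast

lemma g_smooth_fun:
  assumes "vfield_on A U X" "vfield_on A U Y"
  shows "smooth_fun_on A U (\<lambda>q. g q (X q) (Y q))"
  using metric assms unfolding riemannian_metric_def by blast

text \<open>Gram--Schmidt, one vector field at a time.\<close>

lemma ex_partial_frame:
  assumes p: "p \<in> pts A" and k: "k \<le> DIM('e)"
  shows "\<exists>U E. p \<in> U \<and> openin (mtop A) U \<and> (\<forall>i<k. vfield_on A U (E i)) \<and>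
    (\<forall>i<k. \<forall>j<k. \<forall>q\<in>U. g q (E i q) (E j q) = (if i = j then 1 else 0))"
  using k
proof (induction k)
  case 0
  then show ?case using p topspace_mtop by (intro exI[of _ "pts A"]) (metis less_nat_zero_code openin_topspace)
next
  case (Suc k)
  then obtain U E where U: "p \<in> U" "openin (mtop A) U" and E: "\<And>i. i < k \<Longrightarrow> vfield_on A U (E i)"
    and on: "\<And>i j q. i < k \<Longrightarrow> j < k \<Longrightarrow> q \<in> U \<Longrightarrow> g q (E i q) (E j q) = (if i = j then 1 else 0)"
    by (metis Suc_leD)
  have UA: "q \<in> pts A" if "q \<in> U" for q using openin_pts[OF U(2) that] .
  obtain V \<phi> where c: "(V, \<phi>) \<in> A" "p \<in> V" using p by (auto simp: pts_iff)
  define res where "res q x = tdiff x (tsum (\<lambda>i. tscale (g q x (E i q)) (E i q)) {..<k})" for q x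
  \<comment> \<open>If every vector at \<open>p\<close> had zero residue after projection onto the
    first \<open>k\<close> frame vectors, then \<open>k\<close> vectors would span the model space
    although \<open>k\<close> is smaller than its dimension.\<close>
  have "\<exists>x\<in>tangent_space A p. res p x \<noteq> tzero"
  proof (rule ccontr)
    assume neg: "\<not> ?thesis"
    have "y \<in> span ((\<lambda>i. comps \<phi> (E i p)) ` {..<k})" for y
    proof -
      let ?x = "coord_vec V \<phi> p y"
      have "res p ?x f = 0" for f using neg coord_vec_tangent[OF c] by (metis tzero_def)
      then have "?x = tsum (\<lambda>i. tscale (g p ?x (E i p)) (E i p)) {..<k}"
        by (auto simp: res_def tdiff_def)
      then have "y = (\<Sum>i<k. g p ?x (E i p) *\<^sub>R comps \<phi> (E i p))"
        using comps_coord_vec[OF c, of y] comps_sum comps_scale by (metis (no_types, lifting) sum.cong)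
      also have "\<dots> \<in> span ((\<lambda>i. comps \<phi> (E i p)) ` {..<k})"
        by (intro span_sum span_scale span_base) auto
      finally show ?thesis .
    qed
    then have "DIM('e) \<le> card ((\<lambda>i. comps \<phi> (E i p)) ` {..<k})"
      using dim_le_card[of UNIV "(\<lambda>i. comps \<phi> (E i p)) ` {..<k}"] by auto
    also have "\<dots> \<le> k" using card_image_le[of "{..<k}"] by (metis card_lessThan finite_lessThan)
    finally show False using Suc.prems by simp
  qed
  then obtain x where x: "x \<in> tangent_space A p" "res p x \<noteq> tzero" by auto
  obtain V' X where X: "p \<in> V'" "vfield_on A V' X" "X p = x" using vfield_extend_ex[OF p x(1)] .
  let ?U = "U \<inter> V'"
  have oU: "openin (mtop A) ?U" using U(2) vfield_open[OF X(2)] by auto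
  have XU: "vfield_on A ?U X" using vfield_Int(2)[OF X(2) U(2)] .
  have EU: "vfield_on A ?U (E i)" if "i < k" for i
    using vfield_Int(1)[OF E[OF that] vfield_open[OF X(2)]] .
  define R where "R q = res q (X q)" for q
  have R: "vfield_on A ?U R"
    unfolding R_def res_def
    by (intro vfield_diff XU vfield_sum oU vfield_scale g_smooth_fun EU) auto
  \<comment> \<open>Positivity at \<open>p\<close> persists on a neighbourhood \<open>W\<close>, and
    there the normalising factor \<open>inverse (sqrt ...)\<close> is smooth.\<close>
  have "g p (R p) (R p) > 0"
    using g_pos[OF p vfield_tangent[OF R]] x X U by (auto simp: R_def)
  then have "eventually (\<lambda>q. g q (R q) (R q) \<in> {0<..}) (near p)"
    by (intro smooth_near_continuous[OF g_smooth_near[OF R R]]) (use U X in auto)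
  then have "eventually (\<lambda>q. g q (R q) (R q) > 0 \<and> q \<in> ?U) (near p)"
    using eventually_near_open[OF oU, of p] U X by (auto simp: eventually_conj_iff)
  then obtain W where W: "openin (mtop A) W" "p \<in> W" "\<And>q. q \<in> W \<Longrightarrow> g q (R q) (R q) > 0" "W \<subseteq> ?U"
    unfolding eventually_near[OF p] by blast
  have RW: "vfield_on A W R" using vfield_subset[OF R W(1,4)] .
  define n where "n q = inverse (sqrt (g q (R q) (R q)))" for q
  define N where "N q = tscale (n q) (R q)" for q
  have "smooth_fun_on A W n"
    unfolding smooth_fun_on_iff n_def
    by (intro conjI ballI W(1) smooth_near_inverse_sqrt g_smooth_near[OF RW RW] W(3))
  then have N: "vfield_on A W N" unfolding N_def by (rule vfield_scale[OF _ RW])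
  have EW: "vfield_on A W (E i)" if "i < k" for i using vfield_subset[OF EU[OF that] W(1,4)] .
  have XW: "vfield_on A W X" using vfield_subset[OF XU W(1,4)] .
  have NN: "g q (N q) (N q) = 1" if q: "q \<in> W" for q
  proof -
    have "g q (N q) (N q) = n q * (n q * g q (R q) (R q))"
      unfolding N_def using openin_pts[OF W(1) q] vfield_tangent[OF RW q]
      by (simp add: g_scale_left g_scale_right tscale_tangent)
    then show ?thesis
      using W(3)[OF q] unfolding n_def
      by (metis (no_types, lifting) abs_of_pos inverse_mult_distrib left_inverse mult.assoc order_less_irrefl real_sqrt_mult_self)
  qed
  have NE: "g q (N q) (E j q) = 0" if q: "q \<in> W" and j: "j < k" for q j
  proof -
    have qA: "q \<in> pts A" using openin_pts[OF W(1) q] .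
    have t: "E i q \<in> tangent_space A q" if "i < k" for i using vfield_tangent[OF EW[OF that] q] .
    have Xq: "X q \<in> tangent_space A q" using vfield_tangent[OF XW q] .
    have "g q (tsum (\<lambda>i. tscale (g q (X q) (E i q)) (E i q)) {..<k}) (E j q) =
       (\<Sum>i<k. g q (X q) (E i q) * g q (E i q) (E j q))"
      using t j by (subst g_sum_left[OF qA]) (auto intro!: tscale_tangent sum.cong simp: g_scale_left[OF qA])
    also have "\<dots> = (\<Sum>i<k. if i = j then g q (X q) (E i q) else 0)"
      using on j q W(4) by (intro sum.cong) auto
    also have "\<dots> = g q (X q) (E j q)" using j by simp
    finally have "g q (R q) (E j q) = 0"
      unfolding R_def res_def using t j Xq
      by (subst g_diff_left[OF qA]) (auto intro!: tsum_tangent tscale_tangent)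
    then show ?thesis unfolding N_def using g_scale_left[OF qA vfield_tangent[OF RW q] t[OF j]] by simp
  qed
  have EN: "g q (E j q) (N q) = 0" if q: "q \<in> W" and j: "j < k" for q j
    using NE[OF q j] g_sym[OF openin_pts[OF W(1) q] vfield_tangent[OF N q] vfield_tangent[OF EW[OF j] q]] by simp
  show ?case
  proof (intro exI[of _ W] exI[of _ "E(k := N)"] conjI allI impI ballI)
    fix i assume "i < Suc k"
    then show "vfield_on A W ((E(k := N)) i)" using N EW by (cases "i = k") auto
  next
    fix i j q assume "i < Suc k" "j < Suc k" "q \<in> W"
    then show "g q ((E(k := N)) i q) ((E(k := N)) j q) = (if i = j then 1 else 0)"
      using NN[of q] NE[of q] EN[of q] on[of i j q] W(4)
      by (cases "i = k"; cases "j = k") auto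
  qed (use W in auto)
qed

lemma ex_orthonormal_frame:
  assumes "p \<in> pts A" obtains U E where "p \<in> U" "orthonormal_frame_on A g U E"
  using ex_partial_frame[OF assms order_refl] unfolding orthonormal_frame_on_def by blast

section \<open>Calculus in a fixed local orthonormal frame\<close>

context
  fixes U E assumes frame: "orthonormal_frame_on A g U E"
begin

lemma frame_vfield: "i < DIM('e) \<Longrightarrow> vfield_on A U (E i)"
  using frame by (auto simp: orthonormal_frame_on_def)

lemma frame_open: "openin (mtop A) U"
  using vfield_open[OF frame_vfield[OF DIM_positive]] .

lemma frame_tangent: "i < DIM('e) \<Longrightarrow> q \<in> U \<Longrightarrow> E i q \<in> tangent_space A q"
  using vfield_tangent[OF frame_vfield] .

lemma frame_orthonormal:
  "i < DIM('e) \<Longrightarrow> j < DIM('e) \<Longrightarrow> q \<in> U \<Longrightarrow> g q (E i q) (E j q) = (if i = j then 1 else 0)"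
  using frame by (auto simp: orthonormal_frame_on_def)

lemma frame_expand:
  assumes "q \<in> U" "x \<in> tangent_space A q"
  shows "x = tsum (\<lambda>i. tscale (g q x (E i q)) (E i q)) {..<DIM('e)}"
  using assms frame_tangent frame_orthonormal openin_pts[OF frame_open]
  by (intro orthonormal_expand) auto

lemma frame_subset: "openin (mtop A) V \<Longrightarrow> V \<subseteq> U \<Longrightarrow> orthonormal_frame_on A g V E"
  using frame vfield_subset unfolding orthonormal_frame_on_def by (meson subsetD)

lemma tensorial_orthonormal_frame:
  assumes "tensorial_at p B" "p \<in> U" "p \<in> V" "vfield_on A V X"
  shows "B X = (\<Sum>i<DIM('e). g p (X p) (E i p) * B (E i))"
proof (rule tensorial_frame[OF assms(1), where U = "V \<inter> U" and f = "\<lambda>i q. g q (X q) (E i q)"])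
  note XV = vfield_Int(1)[OF assms(4) frame_open]
  show "vfield_on A (V \<inter> U) X" using XV .
  fix i assume "i \<in> {..<DIM('e)}"
  then show E: "vfield_on A (V \<inter> U) (E i)"
    using vfield_Int(2)[OF frame_vfield vfield_open[OF assms(4)]] by auto
  show "smooth_fun_on A (V \<inter> U) (\<lambda>q. g q (X q) (E i q))" using g_smooth_fun[OF XV E] .
qed (use assms frame_expand vfield_tangent[OF assms(4)] in auto)

end

end

section \<open>Connections\<close>

lemma tadd_apply: "tadd v w f = v f + w f"
  by (simp add: tadd_def)

lemma tscale_apply: "tscale c v f = c * v f"
  by (simp add: tscale_def)

lemma tdiff_apply: "tdiff v w f = v f - w f"
  by (simp add: tdiff_def)

lemma tsum_apply: "tsum v I f = (\<Sum>i\<in>I. v i f)"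
  by (simp add: tsum_def)

lemma tzero_apply: "tzero f = 0"
  by (simp add: tzero_def)

lemmas tvec_apply = tadd_apply tscale_apply tdiff_apply tsum_apply tzero_apply

context atlas
begin

lemma tensorialI:
  assumes "\<And>U X Y. p \<in> U \<Longrightarrow> vfield_on A U X \<Longrightarrow> vfield_on A U Y \<Longrightarrow> B (\<lambda>q. tadd (X q) (Y q)) = B X + B Y"
    and "\<And>U f X. p \<in> U \<Longrightarrow> smooth_fun_on A U f \<Longrightarrow> vfield_on A U X \<Longrightarrow> B (\<lambda>q. tscale (f q) (X q)) = f p * B X"
  shows "tensorial_at p B"
  unfolding tensorial_at_def using assms by auto

text \<open>The other arguments of a tensorial expression usually live on a fixed open set
  \<open>V\<close>. Restricting the test fields to \<open>U \<inter> V\<close> brings all arguments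
  to a common domain.\<close>

lemma tensorialI_within:
  assumes "openin (mtop A) V" "p \<in> V"
    and "\<And>U X Y. U \<subseteq> V \<Longrightarrow> p \<in> U \<Longrightarrow> vfield_on A U X \<Longrightarrow> vfield_on A U Y \<Longrightarrow>
      B (\<lambda>q. tadd (X q) (Y q)) = B X + B Y"
    and "\<And>U f X. U \<subseteq> V \<Longrightarrow> p \<in> U \<Longrightarrow> smooth_fun_on A U f \<Longrightarrow> vfield_on A U X \<Longrightarrow>
      B (\<lambda>q. tscale (f q) (X q)) = f p * B X"
  shows "tensorial_at p B"
proof (rule tensorialI)
  fix U X Y assume "p \<in> U" "vfield_on A U X" "vfield_on A U Y"
  then show "B (\<lambda>q. tadd (X q) (Y q)) = B X + B Y"
    using assms(1,2) by (intro assms(3)[of "U \<inter> V"] vfield_Int) auto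
next
  fix U f X assume "p \<in> U" "smooth_fun_on A U f" "vfield_on A U X"
  then show "B (\<lambda>q. tscale (f q) (X q)) = f p * B X"
    using assms(1,2) by (intro assms(4)[of "U \<inter> V"] vfield_Int smooth_fun_Int) auto
qed

lemma tensorial_diff: "tensorial_at p B \<Longrightarrow> tensorial_at p C \<Longrightarrow> tensorial_at p (\<lambda>X. B X - C X)"
  by (rule tensorialI) (simp_all add: tensorial_add tensorial_scale algebra_simps)

context
  fixes D assumes conn: "connection A D"
begin

lemma conn_vfield: "vfield_on A U X \<Longrightarrow> vfield_on A U Y \<Longrightarrow> vfield_on A U (D X Y)"
  using conn unfolding connection_def by meson

lemma conn_add1: "vfield_on A U X \<Longrightarrow> vfield_on A U X' \<Longrightarrow> vfield_on A U Y \<Longrightarrow> p \<in> U \<Longrightarrow>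
    D (\<lambda>q. tadd (X q) (X' q)) Y p = tadd (D X Y p) (D X' Y p)"
  using conn unfolding connection_def by meson

lemma conn_scale1: "smooth_fun_on A U f \<Longrightarrow> vfield_on A U X \<Longrightarrow> vfield_on A U Y \<Longrightarrow> p \<in> U \<Longrightarrow>
    D (\<lambda>q. tscale (f q) (X q)) Y p = tscale (f p) (D X Y p)"
  using conn unfolding connection_def by meson

lemma conn_add2: "vfield_on A U X \<Longrightarrow> vfield_on A U Y \<Longrightarrow> vfield_on A U Y' \<Longrightarrow> p \<in> U \<Longrightarrow>
    D X (\<lambda>q. tadd (Y q) (Y' q)) p = tadd (D X Y p) (D X Y' p)"
  using conn unfolding connection_def by meson

lemma conn_scale2: "smooth_fun_on A U f \<Longrightarrow> vfield_on A U X \<Longrightarrow> vfield_on A U Y \<Longrightarrow> p \<in> U \<Longrightarrow>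
    D X (\<lambda>q. tscale (f q) (Y q)) p = tadd (tscale (X p f) (Y p)) (tscale (f p) (D X Y p))"
  using conn unfolding connection_def by meson

lemma conn_tangent: "vfield_on A U X \<Longrightarrow> vfield_on A U Y \<Longrightarrow> p \<in> U \<Longrightarrow> D X Y p \<in> tangent_space A p"
  using vfield_tangent[OF conn_vfield] .

lemma conn_tensorial1:
  assumes "vfield_on A V Y" "p \<in> V"
  shows "tensorial_at p (\<lambda>X. D X Y p f)"
proof (rule tensorialI_within[OF vfield_open[OF assms(1)] assms(2)])
  fix U X X' assume *: "U \<subseteq> V" "p \<in> U" "vfield_on A U X" "vfield_on A U X'"
  have "vfield_on A U Y" using vfield_subset[OF assms(1) vfield_open[OF *(3)] *(1)] .
  from conn_add1[OF *(3,4) this *(2)]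
  show "D (\<lambda>q. tadd (X q) (X' q)) Y p f = D X Y p f + D X' Y p f" by (simp add: tvec_apply)
next
  fix U h X assume *: "U \<subseteq> V" "p \<in> U" "smooth_fun_on A U h" "vfield_on A U X"
  have "vfield_on A U Y" using vfield_subset[OF assms(1) vfield_open[OF *(4)] *(1)] .
  from conn_scale1[OF *(3,4) this *(2)]
  show "D (\<lambda>q. tscale (h q) (X q)) Y p f = h p * D X Y p f" by (simp add: tvec_apply)
qed

text \<open>A connection is not tensorial in its second slot, but it is local. For the indicator
  function of \<open>U\<close> the Leibniz term vanishes, because \<open>X p\<close> kills a
  function that is constant near \<open>p\<close>.\<close>

lemma conn_cong2:
  assumes X: "vfield_on A U X" and Y: "vfield_on A U Y" and eq: "\<And>q. q \<in> U \<Longrightarrow> Y q = Y' q" and p: "p \<in> U"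
  shows "D X Y p = D X Y' p"
proof -
  let ?c = "\<lambda>q. if q \<in> U then 1 else 0 :: real"
  note c = smooth_indicator[OF vfield_open[OF X]]
  have Y': "vfield_on A U Y'" using vfield_cong[OF Y eq] .
  have "X p ?c = X p (\<lambda>q. 1)"
  proof (rule tangent_cong[OF vfield_tangent[OF X p] openin_pts[OF vfield_open[OF X] p]])
    show "eventually (\<lambda>q. ?c q = 1) (near p)"
      using eventually_near_open[OF vfield_open[OF X] p] by eventually_elim simp
  qed
  then have 0: "X p ?c = 0"
    using tangent_const[OF vfield_tangent[OF X p] openin_pts[OF vfield_open[OF X] p]] by simp
  have "(\<lambda>q. tscale (?c q) (Y q)) = (\<lambda>q. tscale (?c q) (Y' q))" using eq by (auto simp: tscale_def)
  moreover have "D X (\<lambda>q. tscale (?c q) (Y q)) p = D X Y p"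
    unfolding conn_scale2[OF c X Y p] 0 using p by (simp add: tadd_def tscale_def)
  moreover have "D X (\<lambda>q. tscale (?c q) (Y' q)) p = D X Y' p"
    unfolding conn_scale2[OF c X Y' p] 0 using p by (simp add: tadd_def tscale_def)
  ultimately show ?thesis by metis
qed

lemma conn_sum2:
  assumes X: "vfield_on A U X" and p: "p \<in> U" and "finite I"
    and f: "\<And>i. i \<in> I \<Longrightarrow> smooth_fun_on A U (f i)" and e: "\<And>i. i \<in> I \<Longrightarrow> vfield_on A U (e i)"
  shows "D X (\<lambda>q. tsum (\<lambda>i. tscale (f i q) (e i q)) I) p =
    tsum (\<lambda>i. tadd (tscale (X p (f i)) (e i p)) (tscale (f i p) (D X (e i) p))) I"
  using \<open>finite I\<close> f e
proof (induction I)
  case empty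
  note o = vfield_open[OF X]
  have "D X (\<lambda>q. tscale 0 tzero) p = tadd (tscale (X p (\<lambda>q. 0)) tzero) (tscale 0 (D X (\<lambda>q. tzero) p))"
    by (rule conn_scale2[OF smooth_fun_const[OF o] X vfield_zero[OF o] p])
  then show ?case by (simp add: tsum_def tscale_def tzero_def tadd_def)
next
  case (insert i I)
  have ins: "tsum v (insert i I) = tadd (v i) (tsum v I)" for v :: "_ \<Rightarrow> 'a tvec"
    using insert by (simp add: tsum_def tadd_def)
  have "D X (\<lambda>q. tadd (tscale (f i q) (e i q)) (tsum (\<lambda>i. tscale (f i q) (e i q)) I)) p =
    tadd (D X (\<lambda>q. tscale (f i q) (e i q)) p) (D X (\<lambda>q. tsum (\<lambda>i. tscale (f i q) (e i q)) I) p)"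
    using insert.prems by (intro conn_add2[OF X _ _ p] vfield_scale vfield_sum vfield_open[OF X]) auto
  then show ?case
    unfolding ins using insert conn_scale2[OF _ X _ p] by simp
qed

end

text \<open>The Leibniz term \<open>X p h * Y p f\<close> is the same for both connections and
  cancels in the difference.\<close>

lemma conn_diff_tensorial2:
  assumes D: "connection A D" and D': "connection A D'" and X: "vfield_on A V X" "p \<in> V"
  shows "tensorial_at p (\<lambda>Y. D X Y p f - D' X Y p f)"
proof (rule tensorialI_within[OF vfield_open[OF X(1)] X(2)])
  fix U Y Y' assume *: "U \<subseteq> V" "p \<in> U" "vfield_on A U Y" "vfield_on A U Y'"
  have "vfield_on A U X" using vfield_subset[OF X(1) vfield_open[OF *(3)] *(1)] .
  from conn_add2[OF D this *(3,4,2)] conn_add2[OF D' this *(3,4,2)]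
  show "D X (\<lambda>q. tadd (Y q) (Y' q)) p f - D' X (\<lambda>q. tadd (Y q) (Y' q)) p f =
      D X Y p f - D' X Y p f + (D X Y' p f - D' X Y' p f)" by (simp add: tvec_apply)
next
  fix U h Y assume *: "U \<subseteq> V" "p \<in> U" "smooth_fun_on A U h" "vfield_on A U Y"
  have "vfield_on A U X" using vfield_subset[OF X(1) vfield_open[OF *(4)] *(1)] .
  from conn_scale2[OF D *(3) this *(4,2)] conn_scale2[OF D' *(3) this *(4,2)]
  show "D X (\<lambda>q. tscale (h q) (Y q)) p f - D' X (\<lambda>q. tscale (h q) (Y q)) p f = h p * (D X Y p f - D' X Y p f)"
    by (simp add: tvec_apply algebra_simps)
qed

section \<open>Covariant derivatives of bilinear forms\<close>

text \<open>Stated without symmetry or skew-symmetry, so that it covers the metric as well as the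
  fundamental form.\<close>

definition smooth_form2 :: "('a \<Rightarrow> 'a tvec \<Rightarrow> 'a tvec \<Rightarrow> real) \<Rightarrow> bool" where
  "smooth_form2 w \<longleftrightarrow>
     (\<forall>p\<in>pts A. \<forall>x\<in>tangent_space A p. \<forall>y\<in>tangent_space A p.
        (\<forall>z\<in>tangent_space A p. w p (tadd x y) z = w p x z + w p y z \<and> w p z (tadd x y) = w p z x + w p z y) \<and>
        (\<forall>c. w p (tscale c x) y = c * w p x y \<and> w p x (tscale c y) = c * w p x y)) \<and>
     (\<forall>U X Y. vfield_on A U X \<and> vfield_on A U Y \<longrightarrow> smooth_fun_on A U (\<lambda>p. w p (X p) (Y p)))"

context
  fixes w p and U :: "'a set" assumes w: "smooth_form2 w" and p: "p \<in> U"
begin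

lemma form2_add:
  assumes "vfield_on A U X" "vfield_on A U Y" "vfield_on A U Z" "q \<in> U"
  shows "w q (tadd (X q) (Y q)) (Z q) = w q (X q) (Z q) + w q (Y q) (Z q)"
    and "w q (Z q) (tadd (X q) (Y q)) = w q (Z q) (X q) + w q (Z q) (Y q)"
  using w openin_pts[OF vfield_open[OF assms(1)] assms(4)] assms(1-3)[THEN vfield_tangent, OF assms(4)]
  unfolding smooth_form2_def by blast+

lemma form2_scale:
  assumes "vfield_on A U X" "vfield_on A U Y" "q \<in> U"
  shows "w q (tscale c (X q)) (Y q) = c * w q (X q) (Y q)"
    and "w q (X q) (tscale c (Y q)) = c * w q (X q) (Y q)"
  using w openin_pts[OF vfield_open[OF assms(1)] assms(3)] assms(1-2)[THEN vfield_tangent, OF assms(3)]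
  unfolding smooth_form2_def by blast+

lemma form2_smooth:
  assumes "vfield_on A U X" "vfield_on A U Y"
  shows "smooth_near A p (\<lambda>q. w q (X q) (Y q))"
  using w assms p unfolding smooth_form2_def smooth_fun_on_iff by blast

lemma dform2_add:
  assumes X: "vfield_on A U X" and Y: "vfield_on A U Y" and Z: "vfield_on A U Z" and V: "vfield_on A U V"
  shows "V p (\<lambda>q. w q (tadd (X q) (Y q)) (Z q)) = V p (\<lambda>q. w q (X q) (Z q)) + V p (\<lambda>q. w q (Y q) (Z q))"
    and "V p (\<lambda>q. w q (Z q) (tadd (X q) (Y q))) = V p (\<lambda>q. w q (Z q) (X q)) + V p (\<lambda>q. w q (Z q) (Y q))"
proof -
  note ev = eventually_near_open[OF vfield_open[OF X] p]
  note pA = openin_pts[OF vfield_open[OF X] p]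
  note t = vfield_tangent[OF V p]
  have "V p (\<lambda>q. w q (tadd (X q) (Y q)) (Z q)) = V p (\<lambda>q. w q (X q) (Z q) + w q (Y q) (Z q))"
    by (rule tangent_cong[OF t pA], use ev in eventually_elim) (rule form2_add[OF X Y Z])
  then show "V p (\<lambda>q. w q (tadd (X q) (Y q)) (Z q)) = V p (\<lambda>q. w q (X q) (Z q)) + V p (\<lambda>q. w q (Y q) (Z q))"
    using tangent_add[OF t form2_smooth[OF X Z] form2_smooth[OF Y Z]] by simp
  have "V p (\<lambda>q. w q (Z q) (tadd (X q) (Y q))) = V p (\<lambda>q. w q (Z q) (X q) + w q (Z q) (Y q))"
    by (rule tangent_cong[OF t pA], use ev in eventually_elim) (rule form2_add[OF X Y Z])
  then show "V p (\<lambda>q. w q (Z q) (tadd (X q) (Y q))) = V p (\<lambda>q. w q (Z q) (X q)) + V p (\<lambda>q. w q (Z q) (Y q))"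
    using tangent_add[OF t form2_smooth[OF Z X] form2_smooth[OF Z Y]] by simp
qed

lemma dform2_scale:
  assumes X: "vfield_on A U X" and Y: "vfield_on A U Y" and V: "vfield_on A U V" and f: "smooth_fun_on A U f"
  shows "V p (\<lambda>q. w q (tscale (f q) (X q)) (Y q)) = f p * V p (\<lambda>q. w q (X q) (Y q)) + V p f * w p (X p) (Y p)"
    and "V p (\<lambda>q. w q (X q) (tscale (f q) (Y q))) = f p * V p (\<lambda>q. w q (X q) (Y q)) + V p f * w p (X p) (Y p)"
proof -
  note ev = eventually_near_open[OF vfield_open[OF X] p]
  note pA = openin_pts[OF vfield_open[OF X] p]
  note t = vfield_tangent[OF V p]
  have fp: "smooth_near A p f" using f p by (auto simp: smooth_fun_on_iff)
  have "V p (\<lambda>q. w q (tscale (f q) (X q)) (Y q)) = V p (\<lambda>q. f q * w q (X q) (Y q))"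
    by (rule tangent_cong[OF t pA], use ev in eventually_elim) (rule form2_scale[OF X Y])
  then show "V p (\<lambda>q. w q (tscale (f q) (X q)) (Y q)) = f p * V p (\<lambda>q. w q (X q) (Y q)) + V p f * w p (X p) (Y p)"
    using tangent_mult[OF t fp form2_smooth[OF X Y]] by simp
  have "V p (\<lambda>q. w q (X q) (tscale (f q) (Y q))) = V p (\<lambda>q. f q * w q (X q) (Y q))"
    by (rule tangent_cong[OF t pA], use ev in eventually_elim) (rule form2_scale[OF X Y])
  then show "V p (\<lambda>q. w q (X q) (tscale (f q) (Y q))) = f p * V p (\<lambda>q. w q (X q) (Y q)) + V p f * w p (X p) (Y p)"
    using tangent_mult[OF t fp form2_smooth[OF X Y]] by simp
qed

end

lemma form2_tangent:
  assumes "smooth_form2 w" "p \<in> pts A" "x \<in> tangent_space A p" "y \<in> tangent_space A p" "z \<in> tangent_space A p"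
  shows "w p (tadd x y) z = w p x z + w p y z" "w p z (tadd x y) = w p z x + w p z y"
  using assms unfolding smooth_form2_def by blast+

lemma form2_tangent_scale:
  assumes "smooth_form2 w" "p \<in> pts A" "x \<in> tangent_space A p" "z \<in> tangent_space A p"
  shows "w p (tscale c x) z = c * w p x z" "w p x (tscale c z) = c * w p x z"
  using assms unfolding smooth_form2_def by blast+

context
  fixes D w assumes conn: "connection A D" and w: "smooth_form2 w"
begin

lemma cov_deriv_tensorial1:
  assumes X: "vfield_on A V X" and Y: "vfield_on A V Y" and p: "p \<in> V"
  shows "tensorial_at p (\<lambda>Z. cov_deriv_form2 D w Z X Y p)"
proof (rule tensorialI_within[OF vfield_open[OF X] p])
  fix U Z Z' assume *: "U \<subseteq> V" "p \<in> U" "vfield_on A U Z" "vfield_on A U Z'"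
  note XU = vfield_subset[OF X vfield_open[OF *(3)] *(1)] and YU = vfield_subset[OF Y vfield_open[OF *(3)] *(1)]
  note pA = openin_pts[OF vfield_open[OF X] p]
  show "cov_deriv_form2 D w (\<lambda>q. tadd (Z q) (Z' q)) X Y p = cov_deriv_form2 D w Z X Y p + cov_deriv_form2 D w Z' X Y p"
    unfolding cov_deriv_form2_def conn_add1[OF conn *(3,4) XU *(2)] conn_add1[OF conn *(3,4) YU *(2)]
    by (simp add: tvec_apply form2_tangent[OF w pA] form2_tangent_scale[OF w pA] conn_tangent[OF conn *(3) XU *(2)] conn_tangent[OF conn *(3) YU *(2)]
      conn_tangent[OF conn *(4) XU *(2)] conn_tangent[OF conn *(4) YU *(2)] vfield_tangent[OF X p] vfield_tangent[OF Y p])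
next
  fix U f Z assume *: "U \<subseteq> V" "p \<in> U" "smooth_fun_on A U f" "vfield_on A U Z"
  note XU = vfield_subset[OF X vfield_open[OF *(4)] *(1)] and YU = vfield_subset[OF Y vfield_open[OF *(4)] *(1)]
  note pA = openin_pts[OF vfield_open[OF X] p]
  show "cov_deriv_form2 D w (\<lambda>q. tscale (f q) (Z q)) X Y p = f p * cov_deriv_form2 D w Z X Y p"
    unfolding cov_deriv_form2_def conn_scale1[OF conn *(3,4) XU *(2)] conn_scale1[OF conn *(3,4) YU *(2)]
    by (simp add: tvec_apply form2_tangent[OF w pA] form2_tangent_scale[OF w pA] conn_tangent[OF conn *(4) XU *(2)] conn_tangent[OF conn *(4) YU *(2)]
      vfield_tangent[OF X p] vfield_tangent[OF Y p] algebra_simps)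
qed

text \<open>Scaling \<open>X\<close> by \<open>f\<close> creates the term
  \<open>Z p f * w p (X p) (Y p)\<close> twice: from differentiating the function
  \<open>w q (X q) (Y q)\<close> and, with the opposite sign, from the Leibniz rule of
  \<open>D\<close>.\<close>

lemma cov_deriv_tensorial2:
  assumes Z: "vfield_on A V Z" and Y: "vfield_on A V Y" and p: "p \<in> V"
  shows "tensorial_at p (\<lambda>X. cov_deriv_form2 D w Z X Y p)"
proof (rule tensorialI_within[OF vfield_open[OF Z] p])
  fix U X X' assume *: "U \<subseteq> V" "p \<in> U" "vfield_on A U X" "vfield_on A U X'"
  note ZU = vfield_subset[OF Z vfield_open[OF *(3)] *(1)] and YU = vfield_subset[OF Y vfield_open[OF *(3)] *(1)]
  note pA = openin_pts[OF vfield_open[OF Z] p]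
  show "cov_deriv_form2 D w Z (\<lambda>q. tadd (X q) (X' q)) Y p = cov_deriv_form2 D w Z X Y p + cov_deriv_form2 D w Z X' Y p"
    unfolding cov_deriv_form2_def conn_add2[OF conn ZU *(3,4) *(2)] dform2_add[OF w *(2) *(3,4) YU ZU]
    by (simp add: form2_tangent[OF w pA] form2_tangent_scale[OF w pA] conn_tangent[OF conn ZU *(3) *(2)] conn_tangent[OF conn ZU *(4) *(2)]
      conn_tangent[OF conn ZU YU *(2)] *(3,4)[THEN vfield_tangent, OF *(2)] vfield_tangent[OF Y p])
next
  fix U f X assume *: "U \<subseteq> V" "p \<in> U" "smooth_fun_on A U f" "vfield_on A U X"
  note ZU = vfield_subset[OF Z vfield_open[OF *(4)] *(1)] and YU = vfield_subset[OF Y vfield_open[OF *(4)] *(1)]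
  note pA = openin_pts[OF vfield_open[OF Z] p]
  show "cov_deriv_form2 D w Z (\<lambda>q. tscale (f q) (X q)) Y p = f p * cov_deriv_form2 D w Z X Y p"
    unfolding cov_deriv_form2_def conn_scale2[OF conn *(3) ZU *(4) *(2)] dform2_scale[OF w *(2) *(4) YU ZU *(3)]
    by (simp add: form2_tangent[OF w pA] form2_tangent_scale[OF w pA] conn_tangent[OF conn ZU *(4) *(2)] tscale_tangent
      conn_tangent[OF conn ZU YU *(2)] *(4)[THEN vfield_tangent, OF *(2)] vfield_tangent[OF Y p] algebra_simps)
qed

end

lemma cov_deriv_tensorial3:
  assumes D: "connection A D" and w: "smooth_form2 w"
    and Z: "vfield_on A V Z" and Y: "vfield_on A V Y" and p: "p \<in> V"
  shows "tensorial_at p (\<lambda>X. cov_deriv_form2 D w Z Y X p)"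
proof -
  \<comment> \<open>Transposing the form interchanges the last two slots of the covariant derivative
    and reduces this slot to the previous one.\<close>
  let ?w = "\<lambda>p x y. w p y x"
  have "smooth_form2 ?w"
    using w unfolding smooth_form2_def by (intro conjI ballI allI impI; blast)
  moreover have "cov_deriv_form2 D w Z Y X p = cov_deriv_form2 D ?w Z X Y p" for X
    by (simp add: cov_deriv_form2_def)
  ultimately show ?thesis using cov_deriv_tensorial2[OF D _ Z Y p] by presburger
qed

end

section \<open>The Levi-Civita connection\<close>

context riemannian
begin

lemma metric_form2: "smooth_form2 g"
  unfolding smooth_form2_def
  by (intro conjI ballI allI impI; (elim conjE)?)
    (simp_all add: g_add_left g_add_right g_scale_left g_scale_right g_smooth_fun)

text \<open>The right-hand side of the Koszul formula, that is,
  \<open>2 * g p (D X Y p) (Z p)\<close> for the Levi-Civita connection D. Here it comes before the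
  connection and serves to construct it.\<close>

definition koszul :: "'a vfield \<Rightarrow> 'a vfield \<Rightarrow> 'a vfield \<Rightarrow> 'a \<Rightarrow> real" where
  "koszul X Y Z p = X p (\<lambda>q. g q (Y q) (Z q)) + Y p (\<lambda>q. g q (Z q) (X q)) - Z p (\<lambda>q. g q (X q) (Y q))
     + g p (lie_bracket A X Y p) (Z p) - g p (lie_bracket A Y Z p) (X p) + g p (lie_bracket A Z X p) (Y p)"

lemma dg_sym:
  assumes X: "vfield_on A U X" and Y: "vfield_on A U Y" and Z: "vfield_on A U Z" and p: "p \<in> U"
  shows "Z p (\<lambda>q. g q (X q) (Y q)) = Z p (\<lambda>q. g q (Y q) (X q))"
proof (rule tangent_cong[OF vfield_tangent[OF Z p] openin_pts[OF vfield_open[OF X] p]])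
  show "eventually (\<lambda>q. g q (X q) (Y q) = g q (Y q) (X q)) (near p)"
    using eventually_near_open[OF vfield_open[OF X] p]
    by eventually_elim (use g_sym openin_pts[OF vfield_open[OF X]] vfield_tangent[OF X] vfield_tangent[OF Y] in auto)
qed

section \<open>Algebraic properties of the Koszul expression\<close>

context
  fixes U p assumes p: "p \<in> U" and o: "openin (mtop A) U"
begin

lemmas koszul_simps = dform2_add[OF metric_form2 p] dform2_scale[OF metric_form2 p]
  g_add_left[OF openin_pts[OF o p]] g_add_right[OF openin_pts[OF o p]]
  g_diff_left[OF openin_pts[OF o p]] g_diff_right[OF openin_pts[OF o p]]
  g_scale_left[OF openin_pts[OF o p]] g_scale_right[OF openin_pts[OF o p]]
  bracket_add_left[of U] bracket_add_right[of U] bracket_scale_left[of U] bracket_scale_right[of U]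
  vfield_tangent[of U] vfield_tangent[OF vfield_bracket[of U]] tscale_tangent tadd_tangent p

lemma koszul_add1:
  "vfield_on A U X \<Longrightarrow> vfield_on A U X' \<Longrightarrow> vfield_on A U Y \<Longrightarrow> vfield_on A U Z \<Longrightarrow>
    koszul (\<lambda>q. tadd (X q) (X' q)) Y Z p = koszul X Y Z p + koszul X' Y Z p"
  by (simp add: koszul_def koszul_simps tadd_apply)

lemma koszul_add2:
  "vfield_on A U X \<Longrightarrow> vfield_on A U Y \<Longrightarrow> vfield_on A U Y' \<Longrightarrow> vfield_on A U Z \<Longrightarrow>
    koszul X (\<lambda>q. tadd (Y q) (Y' q)) Z p = koszul X Y Z p + koszul X Y' Z p"
  by (simp add: koszul_def koszul_simps tadd_apply)

lemma koszul_add3: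
  "vfield_on A U X \<Longrightarrow> vfield_on A U Y \<Longrightarrow> vfield_on A U Z \<Longrightarrow> vfield_on A U Z' \<Longrightarrow>
    koszul X Y (\<lambda>q. tadd (Z q) (Z' q)) p = koszul X Y Z p + koszul X Y Z' p"
  by (simp add: koszul_def koszul_simps tadd_apply)

lemma koszul_scale1:
  assumes "vfield_on A U X" "vfield_on A U Y" "vfield_on A U Z" "smooth_fun_on A U f"
  shows "koszul (\<lambda>q. tscale (f q) (X q)) Y Z p = f p * koszul X Y Z p"
  using assms g_sym[OF openin_pts[OF o p] assms(1)[THEN vfield_tangent, OF p] assms(3)[THEN vfield_tangent, OF p]]
  by (simp add: koszul_def koszul_simps tscale_apply algebra_simps)

text \<open>The inhomogeneous term is twice the Leibniz term; halving the expression turns it into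
  the product rule of a connection.\<close>

lemma koszul_scale2:
  assumes "vfield_on A U X" "vfield_on A U Y" "vfield_on A U Z" "smooth_fun_on A U f"
  shows "koszul X (\<lambda>q. tscale (f q) (Y q)) Z p = f p * koszul X Y Z p + 2 * X p f * g p (Y p) (Z p)"
  using assms g_sym[OF openin_pts[OF o p] assms(1)[THEN vfield_tangent, OF p] assms(2)[THEN vfield_tangent, OF p]]
  by (simp add: koszul_def koszul_simps tscale_apply algebra_simps)

lemma koszul_scale3:
  assumes "vfield_on A U X" "vfield_on A U Y" "vfield_on A U Z" "smooth_fun_on A U f"
  shows "koszul X Y (\<lambda>q. tscale (f q) (Z q)) p = f p * koszul X Y Z p"
  using assms g_sym[OF openin_pts[OF o p] assms(3)[THEN vfield_tangent, OF p] assms(2)[THEN vfield_tangent, OF p]]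
  by (simp add: koszul_def koszul_simps tscale_apply algebra_simps)

text \<open>Apart from the term with \<open>lie_bracket A X Y\<close>, the Koszul expression is
  symmetric in \<open>X\<close> and \<open>Y\<close>. The identity becomes vanishing torsion for
  \<open>lc\<close>.\<close>

lemma koszul_torsion:
  assumes X: "vfield_on A U X" and Y: "vfield_on A U Y" and Z: "vfield_on A U Z"
  shows "koszul X Y Z p - koszul Y X Z p = 2 * g p (lie_bracket A X Y p) (Z p)"
  using assms dg_sym[OF X Y Z p] dg_sym[OF Z Y X p] dg_sym[OF X Z Y p] bracket_antisym[of Y X p]
    bracket_antisym[of X Z p] bracket_antisym[of Z Y p]
  by (simp add: koszul_def koszul_simps)

text \<open>Apart from the derivative of \<open>g q (Y q) (Z q)\<close> along \<open>X\<close>, the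
  Koszul expression is skew in \<open>Y\<close> and \<open>Z\<close>. The identity becomes
  compatibility of \<open>lc\<close> with the metric.\<close>

lemma koszul_metric:
  assumes X: "vfield_on A U X" and Y: "vfield_on A U Y" and Z: "vfield_on A U Z"
  shows "koszul X Y Z p + koszul X Z Y p = 2 * X p (\<lambda>q. g q (Y q) (Z q))"
  using assms dg_sym[OF X Y Z p] dg_sym[OF Z Y X p] dg_sym[OF X Z Y p] bracket_antisym[of Y X p]
    bracket_antisym[of X Z p] bracket_antisym[of Z Y p]
  by (simp add: koszul_def koszul_simps)

lemma koszul_smooth:
  assumes "vfield_on A U X" "vfield_on A U Y" "vfield_on A U Z"
  shows "smooth_near A p (koszul X Y Z)"
proof -
  have d: "smooth_near A p (\<lambda>q. V q (\<lambda>r. g r (W r) (W' r)))"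
    if "vfield_on A U V" "vfield_on A U W" "vfield_on A U W'" for V W W'
    using vfield_smooth_near[OF that(1) p g_smooth_near[OF that(2,3) p]] .
  have b: "smooth_near A p (\<lambda>q. g q (lie_bracket A V W q) (W' q))"
    if "vfield_on A U V" "vfield_on A U W" "vfield_on A U W'" for V W W'
    using g_smooth_near[OF vfield_bracket[OF that(1,2)] that(3) p] .
  show ?thesis
    unfolding koszul_def[abs_def] by (intro smooth_near_add smooth_near_diff d b assms)
qed

end

lemma koszul_tensorial3:
  assumes X: "vfield_on A V X" and Y: "vfield_on A V Y" and p: "p \<in> V"
  shows "tensorial_at p (\<lambda>Z. koszul X Y Z p)"
proof (rule tensorialI_within[OF vfield_open[OF X] p])
  fix U Z Z' assume *: "U \<subseteq> V" "p \<in> U" "vfield_on A U Z" "vfield_on A U Z'"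
  note o = vfield_open[OF *(3)]
  show "koszul X Y (\<lambda>q. tadd (Z q) (Z' q)) p = koszul X Y Z p + koszul X Y Z' p"
    using koszul_add3[OF *(2) o vfield_subset[OF X o *(1)] vfield_subset[OF Y o *(1)] *(3,4)] .
next
  fix U f Z assume *: "U \<subseteq> V" "p \<in> U" "smooth_fun_on A U f" "vfield_on A U Z"
  note o = vfield_open[OF *(4)]
  show "koszul X Y (\<lambda>q. tscale (f q) (Z q)) p = f p * koszul X Y Z p"
    using koszul_scale3[OF *(2) o vfield_subset[OF X o *(1)] vfield_subset[OF Y o *(1)] *(4,3)] .
qed

section \<open>Construction of the Levi-Civita connection from the Koszul expression\<close>

definition frame_at :: "'a \<Rightarrow> nat \<Rightarrow> 'a vfield" where
  "frame_at p = (SOME E. \<exists>U. p \<in> U \<and> orthonormal_frame_on A g U E)"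

text \<open>The vector dual to half the Koszul expression. The frame \<open>frame_at p\<close> is
  chosen separately at every point, so smoothness cannot be read off here; \<open>lc_koszul\<close>
  gives a description free of the choice.\<close>

definition lc :: "'a vfield \<Rightarrow> 'a vfield \<Rightarrow> 'a vfield" where
  "lc X Y p = tsum (\<lambda>i. tscale (koszul X Y (frame_at p i) p / 2) (frame_at p i p)) {..<DIM('e)}"

text \<open>Tensoriality of \<open>koszul\<close> in its last slot makes the pairing with an
  arbitrary field agree with its frame expansion at \<open>p\<close>.\<close>

lemma lc_props:
  assumes X: "vfield_on A U X" and Y: "vfield_on A U Y" and p: "p \<in> U"
  shows lc_tangent: "lc X Y p \<in> tangent_space A p"
    and lc_koszul: "\<And>Z V. vfield_on A V Z \<Longrightarrow> p \<in> V \<Longrightarrow> g p (lc X Y p) (Z p) = koszul X Y Z p / 2"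
proof -
  note pA = openin_pts[OF vfield_open[OF X] p]
  obtain W E where "p \<in> W" "orthonormal_frame_on A g W E" using ex_orthonormal_frame[OF pA] .
  then have "\<exists>E U. p \<in> U \<and> orthonormal_frame_on A g U E" by auto
  then have "\<exists>U. p \<in> U \<and> orthonormal_frame_on A g U (frame_at p)"
    unfolding frame_at_def by (rule someI_ex)
  then obtain V where V: "p \<in> V" "orthonormal_frame_on A g V (frame_at p)" by auto
  have t: "frame_at p i p \<in> tangent_space A p" if "i < DIM('e)" for i
    using frame_tangent[OF V(2) that V(1)] .
  show "lc X Y p \<in> tangent_space A p"
    unfolding lc_def using t by (intro tsum_tangent tscale_tangent) auto
  fix Z V' assume Z: "vfield_on A V' Z" "p \<in> V'"
  have Zp: "Z p \<in> tangent_space A p" using vfield_tangent[OF Z] .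
  have "g p (lc X Y p) (Z p) = (\<Sum>i<DIM('e). koszul X Y (frame_at p i) p / 2 * g p (frame_at p i p) (Z p))"
    unfolding lc_def using t Zp
    by (subst g_sum_left[OF pA]) (auto intro!: tscale_tangent sum.cong simp: g_scale_left[OF pA])
  also have "\<dots> = (\<Sum>i<DIM('e). g p (Z p) (frame_at p i p) * koszul X Y (frame_at p i) p) / 2"
    unfolding sum_divide_distrib using g_sym[OF pA Zp t] by (intro sum.cong) auto
  also have "\<dots> = koszul X Y Z p / 2"
    using tensorial_orthonormal_frame[OF V(2) koszul_tensorial3[OF X Y p] V(1) Z(2,1)] by simp
  finally show "g p (lc X Y p) (Z p) = koszul X Y Z p / 2" .
qed

lemma g_vfield_eqI:
  assumes "p \<in> pts A" "x \<in> tangent_space A p" "y \<in> tangent_space A p" "openin (mtop A) V" "p \<in> V"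
    and "\<And>U Z. vfield_on A U Z \<Longrightarrow> p \<in> U \<Longrightarrow> U \<subseteq> V \<Longrightarrow> g p x (Z p) = g p y (Z p)"
  shows "x = y"
proof (rule g_eqI[OF assms(1-3)])
  fix z assume "z \<in> tangent_space A p"
  then obtain U Z where Z: "p \<in> U" "vfield_on A U Z" "Z p = z" using vfield_extend_ex[OF assms(1)] by metis
  then show "g p x z = g p y z" using assms(6)[OF vfield_Int(1)[OF Z(2) assms(4)]] assms(5) by auto
qed

text \<open>The pointwise frames need not fit together, so an orthonormal frame \<open>E\<close> is
  fixed near \<open>p\<close>. By \<open>lc_koszul\<close> the components of \<open>lc X Y\<close>
  in \<open>E\<close> are halves of smooth Koszul expressions.\<close>

lemma lc_vfield:
  assumes X: "vfield_on A U X" and Y: "vfield_on A U Y"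
  shows "vfield_on A U (lc X Y)"
proof (rule vfield_onI[OF vfield_open[OF X] lc_tangent[OF X Y]])
  fix p f assume p: "p \<in> U" and f: "smooth_near A p f"
  note pA = openin_pts[OF vfield_open[OF X] p]
  obtain V E where V: "p \<in> V" "orthonormal_frame_on A g V E" using ex_orthonormal_frame[OF pA] .
  have W: "p \<in> U \<inter> V" "openin (mtop A) (U \<inter> V)" using p V frame_open[OF V(2)] vfield_open[OF X] by auto
  have sm: "smooth_near A p (\<lambda>q. \<Sum>i<DIM('e). koszul X Y (E i) q * (1/2) * E i q f)"
  proof (intro smooth_near_sum pA smooth_near_mult smooth_near_const)
    fix i assume "i \<in> {..<DIM('e)}"
    then have E: "vfield_on A V (E i)" using frame_vfield[OF V(2)] by auto
    show "smooth_near A p (koszul X Y (E i))"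
      using frame_open[OF V(2)] vfield_open[OF X]
      by (intro koszul_smooth[OF W] vfield_Int[OF X] vfield_Int[OF Y] vfield_Int[OF E])
    show "smooth_near A p (\<lambda>q. E i q f)" by (rule vfield_smooth_near[OF E V(1) f])
  qed
  have ev: "eventually (\<lambda>q. (\<Sum>i<DIM('e). koszul X Y (E i) q * (1/2) * E i q f) = lc X Y q f) (near p)"
    using eventually_near_open[OF W(2,1)]
  proof eventually_elim
    case (elim q)
    then have q: "q \<in> U" "q \<in> V" by auto
    have "lc X Y q = tsum (\<lambda>i. tscale (g q (lc X Y q) (E i q)) (E i q)) {..<DIM('e)}"
      by (rule frame_expand[OF V(2) q(2) lc_tangent[OF X Y q(1)]])
    then have "lc X Y q f = tsum (\<lambda>i. tscale (g q (lc X Y q) (E i q)) (E i q)) {..<DIM('e)} f" by simp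
    also have "\<dots> = (\<Sum>i<DIM('e). koszul X Y (E i) q * (1/2) * E i q f)"
      unfolding tvec_apply
      by (rule sum.cong[OF refl]) (simp add: lc_koszul[OF X Y q(1) frame_vfield[OF V(2)] q(2)])
    finally show ?case by simp
  qed
  show "smooth_near A p (\<lambda>q. lc X Y q f)" using smooth_near_cong[OF sm ev] .
qed

text \<open>The metric is nondegenerate, so each vector identity may be tested against a field
  \<open>Z\<close>, where \<open>lc_koszul\<close> turns it into one of the identities for
  \<open>koszul\<close>. Metric compatibility is such a scalar identity from the outset.\<close>

lemma lc_works: "connection A lc \<and> torsion_free A lc \<and> metric_connection A g lc"
proof -
  have 1: "lc (\<lambda>q. tadd (X q) (X' q)) Y p = tadd (lc X Y p) (lc X' Y p)"
    if X: "vfield_on A U X" "vfield_on A U X'" and Y: "vfield_on A U Y" and p: "p \<in> U" for U X X' Y p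
  proof -
    note o = vfield_open[OF Y]
    note pA = openin_pts[OF o p]
    note t = lc_tangent[OF X(1) Y p] lc_tangent[OF X(2) Y p] lc_tangent[OF vfield_add[OF X] Y p]
    show ?thesis
    proof (rule g_vfield_eqI[OF pA t(3) tadd_tangent[OF t(1,2)] o p])
      fix V Z assume V: "vfield_on A V Z" "p \<in> V" "V \<subseteq> U"
      note s = vfield_subset[OF _ vfield_open[OF V(1)] V(3)]
      show "g p (lc (\<lambda>q. tadd (X q) (X' q)) Y p) (Z p) = g p (tadd (lc X Y p) (lc X' Y p)) (Z p)"
        using lc_koszul[OF vfield_add[OF X] Y p V(1,2)] lc_koszul[OF X(1) Y p V(1,2)] lc_koszul[OF X(2) Y p V(1,2)]
          koszul_add1[OF V(2) vfield_open[OF V(1)] s[OF X(1)] s[OF X(2)] s[OF Y] V(1)]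
        by (simp add: g_add_left[OF pA t(1,2) vfield_tangent[OF V(1,2)]])
    qed
  qed
  have 2: "lc X (\<lambda>q. tadd (Y q) (Y' q)) p = tadd (lc X Y p) (lc X Y' p)"
    if X: "vfield_on A U X" and Y: "vfield_on A U Y" "vfield_on A U Y'" and p: "p \<in> U" for U X Y Y' p
  proof -
    note o = vfield_open[OF X]
    note pA = openin_pts[OF o p]
    note t = lc_tangent[OF X Y(1) p] lc_tangent[OF X Y(2) p] lc_tangent[OF X vfield_add[OF Y] p]
    show ?thesis
    proof (rule g_vfield_eqI[OF pA t(3) tadd_tangent[OF t(1,2)] o p])
      fix V Z assume V: "vfield_on A V Z" "p \<in> V" "V \<subseteq> U"
      note s = vfield_subset[OF _ vfield_open[OF V(1)] V(3)]
      show "g p (lc X (\<lambda>q. tadd (Y q) (Y' q)) p) (Z p) = g p (tadd (lc X Y p) (lc X Y' p)) (Z p)"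
        using lc_koszul[OF X vfield_add[OF Y] p V(1,2)] lc_koszul[OF X Y(1) p V(1,2)] lc_koszul[OF X Y(2) p V(1,2)]
          koszul_add2[OF V(2) vfield_open[OF V(1)] s[OF X] s[OF Y(1)] s[OF Y(2)] V(1)]
        by (simp add: g_add_left[OF pA t(1,2) vfield_tangent[OF V(1,2)]])
    qed
  qed
  have 3: "lc (\<lambda>q. tscale (f q) (X q)) Y p = tscale (f p) (lc X Y p)"
    if f: "smooth_fun_on A U f" and X: "vfield_on A U X" and Y: "vfield_on A U Y" and p: "p \<in> U" for U f X Y p
  proof -
    note o = vfield_open[OF X]
    note pA = openin_pts[OF o p]
    note t = lc_tangent[OF X Y p] lc_tangent[OF vfield_scale[OF f X] Y p]
    show ?thesis
    proof (rule g_vfield_eqI[OF pA t(2) tscale_tangent[OF t(1)] o p])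
      fix V Z assume V: "vfield_on A V Z" "p \<in> V" "V \<subseteq> U"
      note s = vfield_subset[OF _ vfield_open[OF V(1)] V(3)]
      have fV: "smooth_fun_on A V f" using f V(3) vfield_open[OF V(1)] by (auto simp: smooth_fun_on_iff)
      show "g p (lc (\<lambda>q. tscale (f q) (X q)) Y p) (Z p) = g p (tscale (f p) (lc X Y p)) (Z p)"
        unfolding g_scale_left[OF pA t(1) vfield_tangent[OF V(1,2)]] lc_koszul[OF X Y p V(1,2)]
          lc_koszul[OF vfield_scale[OF f X] Y p V(1,2)]
          koszul_scale1[OF V(2) vfield_open[OF V(1)] s[OF X] s[OF Y] V(1) fV] by simp
    qed
  qed
  have 4: "lc X (\<lambda>q. tscale (f q) (Y q)) p = tadd (tscale (X p f) (Y p)) (tscale (f p) (lc X Y p))"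
    if f: "smooth_fun_on A U f" and X: "vfield_on A U X" and Y: "vfield_on A U Y" and p: "p \<in> U" for U f X Y p
  proof -
    note o = vfield_open[OF X]
    note pA = openin_pts[OF o p]
    note t = lc_tangent[OF X Y p] lc_tangent[OF X vfield_scale[OF f Y] p]
    show ?thesis
    proof (rule g_vfield_eqI[OF pA t(2) tadd_tangent[OF tscale_tangent[OF vfield_tangent[OF Y p]] tscale_tangent[OF t(1)]] o p])
      fix V Z assume V: "vfield_on A V Z" "p \<in> V" "V \<subseteq> U"
      note s = vfield_subset[OF _ vfield_open[OF V(1)] V(3)]
      have fV: "smooth_fun_on A V f" using f V(3) vfield_open[OF V(1)] by (auto simp: smooth_fun_on_iff)
      show "g p (lc X (\<lambda>q. tscale (f q) (Y q)) p) (Z p) = g p (tadd (tscale (X p f) (Y p)) (tscale (f p) (lc X Y p))) (Z p)"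
        unfolding lc_koszul[OF X vfield_scale[OF f Y] p V(1,2)]
          koszul_scale2[OF V(2) vfield_open[OF V(1)] s[OF X] s[OF Y] V(1) fV]
        by (simp add: g_scale_left[OF pA] g_add_left[OF pA] t(1) vfield_tangent[OF V(1,2)] tscale_tangent
            vfield_tangent[OF Y p] lc_koszul[OF X Y p V(1,2)] add_divide_distrib)
    qed
  qed
  have "connection A lc"
    unfolding connection_def
    by (intro conjI allI impI ballI; elim conjE)
      (rule lc_vfield 1 3 2 4, assumption, assumption, assumption?, assumption?)+
  moreover have "torsion_free A lc"
    unfolding torsion_free_def
  proof (intro allI impI ballI, elim conjE)
    fix U X Y p assume X: "vfield_on A U X" and Y: "vfield_on A U Y" and p: "p \<in> U"
    note o = vfield_open[OF X]
    note pA = openin_pts[OF o p]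
    note t = lc_tangent[OF X Y p] lc_tangent[OF Y X p]
    show "tdiff (lc X Y p) (lc Y X p) = lie_bracket A X Y p"
    proof (rule g_vfield_eqI[OF pA tdiff_tangent[OF t] vfield_tangent[OF vfield_bracket[OF X Y] p] o p])
      fix V Z assume V: "vfield_on A V Z" "p \<in> V" "V \<subseteq> U"
      note s = vfield_subset[OF _ vfield_open[OF V(1)] V(3)]
      show "g p (tdiff (lc X Y p) (lc Y X p)) (Z p) = g p (lie_bracket A X Y p) (Z p)"
        using lc_koszul[OF X Y p V(1,2)] lc_koszul[OF Y X p V(1,2)]
          koszul_torsion[OF V(2) vfield_open[OF V(1)] s[OF X] s[OF Y] V(1)]
        by (simp add: g_diff_left[OF pA] t vfield_tangent[OF V(1,2)])
    qed
  qed
  moreover have "metric_connection A g lc"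
    unfolding metric_connection_def
  proof (intro allI impI ballI, elim conjE)
    fix U X Y Z p assume X: "vfield_on A U X" and Y: "vfield_on A U Y" and Z: "vfield_on A U Z" and p: "p \<in> U"
    note o = vfield_open[OF X]
    note pA = openin_pts[OF o p]
    show "X p (\<lambda>q. g q (Y q) (Z q)) = g p (lc X Y p) (Z p) + g p (Y p) (lc X Z p)"
      using lc_koszul[OF X Y p Z p] lc_koszul[OF X Z p Y p] koszul_metric[OF p o X Y Z]
        g_sym[OF pA vfield_tangent[OF Y p] lc_tangent[OF X Z p]] by simp
  qed
  ultimately show ?thesis by simp
qed

text \<open>\<open>lc\<close> witnesses that the choice operator in \<open>levi_civita\<close> is
  not vacuous. All later arguments rely on the three defining properties, not on the formula for
  \<open>lc\<close>.\<close>

lemma levi_civita_works: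
  "connection A (levi_civita A g)" "torsion_free A (levi_civita A g)" "metric_connection A g (levi_civita A g)"
proof -
  have "connection A (levi_civita A g) \<and> torsion_free A (levi_civita A g) \<and> metric_connection A g (levi_civita A g)"
    unfolding levi_civita_def 
    by (rule someI[where P = "\<lambda>D. connection A D \<and> torsion_free A D \<and> metric_connection A g D"], rule lc_works)
  then show "connection A (levi_civita A g)" "torsion_free A (levi_civita A g)"
    "metric_connection A g (levi_civita A g)" by simp_all
qed

section \<open>Traces\<close>

lemma parseval:
  assumes fr: "orthonormal_frame_on A g U E" and p: "p \<in> U" and x: "x \<in> tangent_space A p" and y: "y \<in> tangent_space A p"
  shows "(\<Sum>i<DIM('e). g p x (E i p) * g p (E i p) y) = g p x y"
proof -
  note pA = openin_pts[OF frame_open[OF fr] p]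
  have "g p x y = g p (tsum (\<lambda>i. tscale (g p x (E i p)) (E i p)) {..<DIM('e)}) y"
    using frame_expand[OF fr p x] by simp
  also have "\<dots> = (\<Sum>i<DIM('e). g p x (E i p) * g p (E i p) y)"
    using frame_tangent[OF fr _ p] y
    by (subst g_sum_left[OF pA]) (auto intro!: tscale_tangent sum.cong simp: g_scale_left[OF pA])
  finally show ?thesis by simp
qed

definition bitensorial_at :: "'a \<Rightarrow> ('a vfield \<Rightarrow> 'a vfield \<Rightarrow> real) \<Rightarrow> bool" where
  "bitensorial_at p B \<longleftrightarrow> (\<forall>U X. p \<in> U \<and> vfield_on A U X \<longrightarrow>
     tensorial_at p (\<lambda>Y. B Y X) \<and> tensorial_at p (\<lambda>Y. B X Y))"

text \<open>Two orthonormal frames differ at \<open>p\<close> by the matrix with entries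
  \<open>g p (F i p) (E a p)\<close>. Parseval's identity says that this matrix is orthogonal, so
  the double expansion collapses to the diagonal.\<close>

lemma trace_frame_independent:
  assumes B: "bitensorial_at p B"
    and E: "orthonormal_frame_on A g U E" "p \<in> U" and F: "orthonormal_frame_on A g V F" "p \<in> V"
  shows "(\<Sum>i<DIM('e). B (F i) (F i)) = (\<Sum>i<DIM('e). B (E i) (E i))"
proof -
  let ?n = "{..<DIM('e)}"
  note pA = openin_pts[OF frame_open[OF E(1)] E(2)]
  have Ft: "F i p \<in> tangent_space A p" and Et: "E i p \<in> tangent_space A p" if "i < DIM('e)" for i
    using frame_tangent[OF F(1) that F(2)] frame_tangent[OF E(1) that E(2)] .
  have "B (F i) (F i) = (\<Sum>a\<in>?n. \<Sum>b\<in>?n. g p (F i p) (E a p) * g p (F i p) (E b p) * B (E a) (E b))"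
    if i: "i < DIM('e)" for i
  proof -
    have Fi: "vfield_on A V (F i)" using frame_vfield[OF F(1) i] .
    have "B (F i) (F i) = (\<Sum>a\<in>?n. g p (F i p) (E a p) * B (E a) (F i))"
      using B F(2) Fi unfolding bitensorial_at_def
      by (intro tensorial_orthonormal_frame[OF E(1) _ E(2) F(2) Fi, of "\<lambda>X. B X (F i)"]) blast
    also have "\<dots> = (\<Sum>a\<in>?n. g p (F i p) (E a p) * (\<Sum>b\<in>?n. g p (F i p) (E b p) * B (E a) (E b)))"
    proof (intro sum.cong refl arg_cong2[where f = "(*)"])
      fix a assume "a \<in> ?n"
      then have "tensorial_at p (\<lambda>Y. B (E a) Y)"
        using B E(2) frame_vfield[OF E(1)] unfolding bitensorial_at_def by blast
      then show "B (E a) (F i) = (\<Sum>b\<in>?n. g p (F i p) (E b p) * B (E a) (E b))"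
        by (rule tensorial_orthonormal_frame[OF E(1) _ E(2) F(2) Fi])
    qed
    finally show ?thesis by (simp add: sum_distrib_left mult.assoc)
  qed
  then have "(\<Sum>i\<in>?n. B (F i) (F i)) =
      (\<Sum>i\<in>?n. \<Sum>a\<in>?n. \<Sum>b\<in>?n. g p (F i p) (E a p) * g p (F i p) (E b p) * B (E a) (E b))"
    by simp
  also have "\<dots> = (\<Sum>a\<in>?n. \<Sum>b\<in>?n. \<Sum>i\<in>?n. g p (F i p) (E a p) * g p (F i p) (E b p) * B (E a) (E b))"
    by (subst sum.swap, rule sum.cong[OF refl], subst sum.swap) simp
  also have "\<dots> = (\<Sum>a\<in>?n. \<Sum>b\<in>?n. (if a = b then 1 else 0) * B (E a) (E b))"
  proof (intro sum.cong refl)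
    fix a b assume ab: "a \<in> ?n" "b \<in> ?n"
    then have "(\<Sum>i\<in>?n. g p (F i p) (E a p) * g p (F i p) (E b p)) = (if a = b then 1 else 0)"
      using parseval[OF F Et Et, of a b] frame_orthonormal[OF E(1) _ _ E(2), of a b] g_sym[OF pA Et Ft, of a] by simp
    then show "(\<Sum>i\<in>?n. g p (F i p) (E a p) * g p (F i p) (E b p) * B (E a) (E b)) =
       (if a = b then 1 else 0) * B (E a) (E b)"
      unfolding sum_distrib_right[symmetric] by simp
  qed
  also have "\<dots> = (\<Sum>a\<in>?n. B (E a) (E a))"
  proof (rule sum.cong[OF refl])
    fix a assume "a \<in> ?n"
    then show "(\<Sum>b\<in>?n. (if a = b then 1 else 0) * B (E a) (E b)) = B (E a) (E a)"
      using sum.delta'[of ?n a "\<lambda>b. B (E a) (E b)"] by (simp add: if_distrib[of "\<lambda>x. x * _"] cong: if_cong)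
  qed
  finally show ?thesis .
qed

lemma metric_trace_eq:
  assumes B: "\<And>f. bitensorial_at p (\<lambda>X Y. B X Y p f)" and E: "orthonormal_frame_on A g U E" "p \<in> U"
  shows "metric_trace A g B p = tsum (\<lambda>i. B (E i) (E i) p) {..<DIM('e)}"
  unfolding metric_trace_def
proof (rule the_equality)
  show "\<forall>V F. p \<in> V \<and> orthonormal_frame_on A g V F \<longrightarrow>
      tsum (\<lambda>i. B (E i) (E i) p) {..<DIM('e)} = tsum (\<lambda>i. B (F i) (F i) p) {..<DIM('e)}"
    unfolding tsum_def using trace_frame_independent[OF B E] by fastforce
qed (use E in auto)

lemma codiff2_eq:
  assumes w: "smooth_form2 w" and E: "orthonormal_frame_on A g U E" "p \<in> U" and X: "vfield_on A V X" "p \<in> V"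
  shows "codiff2 A g w p (X p) = - (\<Sum>i<DIM('e). cov_deriv_form2 (levi_civita A g) w (E i) (E i) X p)"
  unfolding codiff2_def
proof (rule the_equality)
  let ?C = "\<lambda>X Y Z. cov_deriv_form2 (levi_civita A g) w X Y Z p"
  have bt: "bitensorial_at p (\<lambda>Y Z. ?C Y Z X)" if X: "vfield_on A V X" "p \<in> V" for X V
    unfolding bitensorial_at_def
  proof (intro allI impI, elim conjE)
    fix U Y assume Y: "p \<in> U" "vfield_on A U Y"
    have p: "p \<in> U \<inter> V" using X Y by auto
    note XY = vfield_Int(1)[OF Y(2) vfield_open[OF X(1)]] vfield_Int(2)[OF X(1) vfield_open[OF Y(2)]]
    show "tensorial_at p (\<lambda>Z. ?C Z Y X) \<and> tensorial_at p (\<lambda>Z. ?C Y Z X)"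
      using cov_deriv_tensorial1[OF levi_civita_works(1) w XY p] cov_deriv_tensorial2[OF levi_civita_works(1) w XY p] by simp
  qed
  have indep: "?C (E i) (E i) X = ?C (E i) (E i) Y"
    if Y: "vfield_on A V' Y" "p \<in> V'" "Y p = X p" and i: "i < DIM('e)" for Y V' i
    using tensorial_eq[OF cov_deriv_tensorial3[OF levi_civita_works(1) w frame_vfield[OF E(1) i] frame_vfield[OF E(1) i] E(2)]
        X(2,1) Y(2,1)] Y(3) by simp
  show "\<forall>V' F Y. p \<in> V' \<and> orthonormal_frame_on A g V' F \<and> vfield_on A V' Y \<and> Y p = X p \<longrightarrow>
      - (\<Sum>i<DIM('e). ?C (E i) (E i) X) = - (\<Sum>i<DIM('e). ?C (F i) (F i) Y)"
  proof (intro allI impI, elim conjE)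
    fix V' F Y assume F: "p \<in> V'" "orthonormal_frame_on A g V' F" and Y: "vfield_on A V' Y" "Y p = X p"
    have "(\<Sum>i<DIM('e). ?C (F i) (F i) Y) = (\<Sum>i<DIM('e). ?C (E i) (E i) Y)"
      by (rule trace_frame_independent[OF bt[OF Y(1) F(1)] E F(2,1)])
    also have "\<dots> = (\<Sum>i<DIM('e). ?C (E i) (E i) X)" using indep[OF Y(1) F(1) Y(2)] by simp
    finally show "- (\<Sum>i<DIM('e). ?C (E i) (E i) X) = - (\<Sum>i<DIM('e). ?C (F i) (F i) Y)" by simp
  qed
  fix c assume c: "\<forall>V' F Y. p \<in> V' \<and> orthonormal_frame_on A g V' F \<and> vfield_on A V' Y \<and> Y p = X p \<longrightarrow>
      c = - (\<Sum>i<DIM('e). ?C (F i) (F i) Y)"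
  \<comment> \<open>\<open>codiff2\<close> asks for the frame and the extension on one open set,
    whereas here they come with different domains. The restriction to \<open>U \<inter> V\<close> is
    the instance that determines \<open>c\<close>.\<close>
  have "p \<in> U \<inter> V \<and> orthonormal_frame_on A g (U \<inter> V) E \<and> vfield_on A (U \<inter> V) X \<and> X p = X p"
    using E X frame_open[OF E(1)] vfield_open[OF X(1)] by (auto intro!: frame_subset[OF E(1)] vfield_Int)
  then show "c = - (\<Sum>i<DIM('e). ?C (E i) (E i) X)" using c by blast
qed

end

section \<open>The Koszul forms\<close>

text \<open>Here \<open>B X\<close> is a tangent vector, and tensoriality of all its values
  \<open>B X f\<close> amounts to linearity of \<open>B\<close> over smooth functions; pairing with
  a fixed vector preserves it.\<close>

lemma (in riemannian) tensorial_g: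
  assumes p: "p \<in> pts A" and y: "y \<in> tangent_space A p" and B: "\<And>f. tensorial_at p (\<lambda>X. B X f)"
    and t: "\<And>U X. p \<in> U \<Longrightarrow> vfield_on A U X \<Longrightarrow> B X \<in> tangent_space A p"
  shows "tensorial_at p (\<lambda>X. g p y (B X))"
proof (rule tensorialI)
  fix U X Y assume *: "p \<in> U" "vfield_on A U X" "vfield_on A U Y"
  have "B (\<lambda>q. tadd (X q) (Y q)) = tadd (B X) (B Y)"
    by (rule ext) (simp add: tvec_apply tensorial_add[OF B *])
  then show "g p y (B (\<lambda>q. tadd (X q) (Y q))) = g p y (B X) + g p y (B Y)"
    using g_add_right[OF p t[OF *(1,2)] t[OF *(1,3)] y] by simp
next
  fix U f X assume *: "p \<in> U" "smooth_fun_on A U f" "vfield_on A U X"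
  have "B (\<lambda>q. tscale (f q) (X q)) = tscale (f p) (B X)"
    by (rule ext) (simp add: tvec_apply tensorial_scale[OF B *])
  then show "g p y (B (\<lambda>q. tscale (f q) (X q))) = f p * g p y (B X)"
    using g_scale_right[OF p t[OF *(1,3)] y] by simp
qed

locale affine_riemann = riemannian A g
  for A :: "('a, 'e::euclidean_space) chart set" and g +
  fixes nab :: "'a vfield \<Rightarrow> 'a vfield \<Rightarrow> 'a vfield"
  assumes nab: "connection A nab" and nab_torsion: "torsion_free A nab" and nab_flat: "flat A nab"
begin

abbreviation LC :: "'a vfield \<Rightarrow> 'a vfield \<Rightarrow> 'a vfield" where
  "LC \<equiv> levi_civita A g"

abbreviation dt :: "'a vfield \<Rightarrow> 'a vfield \<Rightarrow> 'a vfield" where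
  "dt \<equiv> diff_tensor A nab g"

lemma torsion_eq:
  assumes "torsion_free A D" "vfield_on A U X" "vfield_on A U Y" "p \<in> U"
  shows "D X Y p f - D Y X p f = lie_bracket A X Y p f"
proof -
  have "tdiff (D X Y p) (D Y X p) = lie_bracket A X Y p"
    using assms unfolding torsion_free_def by blast
  then show ?thesis by (metis tdiff_apply)
qed

lemma dt_sym:
  assumes "vfield_on A U X" "vfield_on A U Y" "p \<in> U"
  shows "dt X Y p = dt Y X p"
  using torsion_eq[OF nab_torsion assms] torsion_eq[OF levi_civita_works(2) assms]
  by (intro ext) (simp add: diff_tensor_def tvec_apply algebra_simps)

lemma dt_tangent:
  assumes "vfield_on A U X" "vfield_on A V Y" "p \<in> U" "p \<in> V"
  shows "dt X Y p \<in> tangent_space A p"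
proof -
  note XY = vfield_Int(1)[OF assms(1) vfield_open[OF assms(2)]] vfield_Int(2)[OF assms(2) vfield_open[OF assms(1)]]
  have p: "p \<in> U \<inter> V" using assms(3,4) by blast
  show ?thesis
    unfolding diff_tensor_def
    by (rule tdiff_tangent[OF conn_tangent[OF levi_civita_works(1) XY p] conn_tangent[OF nab XY p]])
qed

lemma dt_tensorial1:
  assumes "vfield_on A V Y" "p \<in> V" shows "tensorial_at p (\<lambda>X. dt X Y p f)"
  unfolding diff_tensor_def tvec_apply
  by (intro tensorial_diff conn_tensorial1[OF _ assms] nab levi_civita_works(1))

lemma dt_tensorial2:
  assumes "vfield_on A V X" "p \<in> V" shows "tensorial_at p (\<lambda>Y. dt X Y p f)"
  unfolding diff_tensor_def tvec_apply
  by (rule conn_diff_tensorial2[OF levi_civita_works(1) nab assms])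

lemma dt_bitensorial: "bitensorial_at p (\<lambda>X Y. dt X Y p f)"
  unfolding bitensorial_at_def
proof (intro allI impI)
  fix U X assume X: "p \<in> U \<and> vfield_on A U X"
  show "tensorial_at p (\<lambda>Y. dt Y X p f) \<and> tensorial_at p (\<lambda>Y. dt X Y p f)"
    using dt_tensorial1[of U X p f] dt_tensorial2[of U X p f] X by simp
qed

section \<open>The adjoint of the difference tensor\<close>

abbreviation adj :: "'a vfield \<Rightarrow> 'a vfield \<Rightarrow> 'a vfield" where
  "adj \<equiv> adjoint_tensor A g dt"

text \<open>Riesz representation at the point \<open>p\<close>: the functional is tensorial in
  \<open>Z\<close>, so the vector \<open>?w\<close> built from its values on an orthonormal frame
  represents it, and nondegeneracy of the metric gives uniqueness. This is what gives the definite
  description in \<open>adjoint_tensor\<close> its meaning.\<close>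

lemma adj_props:
  assumes X: "vfield_on A U X" and Y: "vfield_on A U' Y" and p: "p \<in> U" "p \<in> U'"
  shows adj_tangent: "adj X Y p \<in> tangent_space A p"
    and adj_g: "\<And>V Z. p \<in> V \<Longrightarrow> vfield_on A V Z \<Longrightarrow> g p (adj X Y p) (Z p) = g p (Y p) (dt X Z p)"
proof -
  let ?P = "\<lambda>w. w \<in> tangent_space A p \<and> (\<forall>V Z. p \<in> V \<and> vfield_on A V Z \<longrightarrow> g p w (Z p) = g p (Y p) (dt X Z p))"
  note pA = openin_pts[OF vfield_open[OF X] p(1)]
  obtain V E where V: "p \<in> V" "orthonormal_frame_on A g V E" using ex_orthonormal_frame[OF pA] .
  have Et: "E i p \<in> tangent_space A p" if "i < DIM('e)" for i using frame_tangent[OF V(2) that V(1)] .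
  have Yt: "Y p \<in> tangent_space A p" using vfield_tangent[OF Y p(2)] .
  have ten: "tensorial_at p (\<lambda>Z. g p (Y p) (dt X Z p))"
    by (rule tensorial_g[OF pA Yt dt_tensorial2[OF X p(1)] dt_tangent[OF X _ p(1)]])
  let ?w = "tsum (\<lambda>i. tscale (g p (Y p) (dt X (E i) p)) (E i p)) {..<DIM('e)}"
  have ex: "?P ?w"
  proof (intro conjI allI impI, use Et in \<open>auto intro!: tsum_tangent tscale_tangent\<close>)
    fix V' Z assume Z: "p \<in> V'" "vfield_on A V' Z"
    have Zt: "Z p \<in> tangent_space A p" using vfield_tangent[OF Z(2,1)] .
    have "g p ?w (Z p) = (\<Sum>i<DIM('e). g p (Z p) (E i p) * g p (Y p) (dt X (E i) p))"
      using Et Zt g_sym[OF pA Zt Et]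
      by (subst g_sum_left[OF pA]) (auto intro!: tscale_tangent sum.cong simp: g_scale_left[OF pA])
    then show "g p ?w (Z p) = g p (Y p) (dt X Z p)"
      using tensorial_orthonormal_frame[OF V(2) ten V(1) Z] by simp
  qed
  have uniq: "w = w'" if "?P w" "?P w'" for w w'
    using that vfield_open[OF X] p by (intro g_vfield_eqI[OF pA, of w w' U]) auto
  have "\<exists>!w. ?P w" by (rule ex_ex1I, rule exI, rule ex, rule uniq)
  from theI'[OF this] have P: "?P (adj X Y p)" unfolding adjoint_tensor_def .
  from P show "adj X Y p \<in> tangent_space A p" by blast
  fix V Z assume "p \<in> V" "vfield_on A V Z"
  with P show "g p (adj X Y p) (Z p) = g p (Y p) (dt X Z p)" by blast
qed

lemma adj_tensorial1:
  assumes Y: "vfield_on A V Y" "p \<in> V" shows "tensorial_at p (\<lambda>X. adj X Y p f)"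
proof (rule tensorialI)
  fix U X X' assume *: "p \<in> U" "vfield_on A U X" "vfield_on A U X'"
  note pA = openin_pts[OF vfield_open[OF Y(1)] Y(2)]
  note a = vfield_add[OF *(2,3)]
  have "adj (\<lambda>q. tadd (X q) (X' q)) Y p = tadd (adj X Y p) (adj X' Y p)"
  proof (rule g_vfield_eqI[OF pA adj_tangent[OF a Y(1) *(1) Y(2)] _ vfield_open[OF *(2)] *(1)])
    show "tadd (adj X Y p) (adj X' Y p) \<in> tangent_space A p"
      by (intro tadd_tangent adj_tangent[OF *(2) Y(1) *(1) Y(2)] adj_tangent[OF *(3) Y(1) *(1) Y(2)])
    fix V Z assume Z: "vfield_on A V Z" "p \<in> V"
    have "dt (\<lambda>q. tadd (X q) (X' q)) Z p = tadd (dt X Z p) (dt X' Z p)"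
      using tensorial_add[OF dt_tensorial1[OF Z] *] by (intro ext) (simp add: tvec_apply)
    then show "g p (adj (\<lambda>q. tadd (X q) (X' q)) Y p) (Z p) = g p (tadd (adj X Y p) (adj X' Y p)) (Z p)"
      using adj_g[OF a Y(1) *(1) Y(2) Z(2,1)] adj_g[OF *(2) Y(1) *(1) Y(2) Z(2,1)] adj_g[OF *(3) Y(1) *(1) Y(2) Z(2,1)]
      by (simp add: g_add_left[OF pA] g_add_right[OF pA] adj_tangent[OF *(2) Y(1) *(1) Y(2)] adj_tangent[OF *(3) Y(1) *(1) Y(2)]
        dt_tangent[OF *(2) Z(1) *(1) Z(2)] dt_tangent[OF *(3) Z(1) *(1) Z(2)] vfield_tangent[OF Y] vfield_tangent[OF Z])
  qed
  then show "adj (\<lambda>q. tadd (X q) (X' q)) Y p f = adj X Y p f + adj X' Y p f" by (simp add: tvec_apply)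
next
  fix U h X assume *: "p \<in> U" "smooth_fun_on A U h" "vfield_on A U X"
  note pA = openin_pts[OF vfield_open[OF Y(1)] Y(2)]
  note a = vfield_scale[OF *(2,3)]
  have "adj (\<lambda>q. tscale (h q) (X q)) Y p = tscale (h p) (adj X Y p)"
  proof (rule g_vfield_eqI[OF pA adj_tangent[OF a Y(1) *(1) Y(2)] _ vfield_open[OF *(3)] *(1)])
    show "tscale (h p) (adj X Y p) \<in> tangent_space A p"
      by (intro tscale_tangent adj_tangent[OF *(3) Y(1) *(1) Y(2)])
    fix V Z assume Z: "vfield_on A V Z" "p \<in> V"
    have "dt (\<lambda>q. tscale (h q) (X q)) Z p = tscale (h p) (dt X Z p)"
      using tensorial_scale[OF dt_tensorial1[OF Z] *] by (intro ext) (simp add: tvec_apply)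
    then show "g p (adj (\<lambda>q. tscale (h q) (X q)) Y p) (Z p) = g p (tscale (h p) (adj X Y p)) (Z p)"
      using adj_g[OF a Y(1) *(1) Y(2) Z(2,1)] adj_g[OF *(3) Y(1) *(1) Y(2) Z(2,1)]
      by (simp add: g_scale_left[OF pA] g_scale_right[OF pA] adj_tangent[OF *(3) Y(1) *(1) Y(2)]
        dt_tangent[OF *(3) Z(1) *(1) Z(2)] vfield_tangent[OF Y] vfield_tangent[OF Z])
  qed
  then show "adj (\<lambda>q. tscale (h q) (X q)) Y p f = h p * adj X Y p f" by (simp add: tvec_apply)
qed

lemma adj_tensorial2:
  assumes X: "vfield_on A V X" "p \<in> V" shows "tensorial_at p (\<lambda>Y. adj X Y p f)"
proof (rule tensorialI)
  fix U Y Y' assume *: "p \<in> U" "vfield_on A U Y" "vfield_on A U Y'"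
  note pA = openin_pts[OF vfield_open[OF X(1)] X(2)]
  note a = vfield_add[OF *(2,3)]
  have "adj X (\<lambda>q. tadd (Y q) (Y' q)) p = tadd (adj X Y p) (adj X Y' p)"
  proof (rule g_vfield_eqI[OF pA adj_tangent[OF X(1) a X(2) *(1)] _ vfield_open[OF *(2)] *(1)])
    show "tadd (adj X Y p) (adj X Y' p) \<in> tangent_space A p"
      by (intro tadd_tangent adj_tangent[OF X(1) *(2) X(2) *(1)] adj_tangent[OF X(1) *(3) X(2) *(1)])
    fix V Z assume Z: "vfield_on A V Z" "p \<in> V"
    show "g p (adj X (\<lambda>q. tadd (Y q) (Y' q)) p) (Z p) = g p (tadd (adj X Y p) (adj X Y' p)) (Z p)"
      using adj_g[OF X(1) a X(2) *(1) Z(2,1)] adj_g[OF X(1) *(2) X(2) *(1) Z(2,1)] adj_g[OF X(1) *(3) X(2) *(1) Z(2,1)]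
      by (simp add: g_add_left[OF pA] adj_tangent[OF X(1) *(2) X(2) *(1)] adj_tangent[OF X(1) *(3) X(2) *(1)]
        dt_tangent[OF X(1) Z(1) X(2) Z(2)] *(2,3)[THEN vfield_tangent, OF *(1)] vfield_tangent[OF Z])
  qed
  then show "adj X (\<lambda>q. tadd (Y q) (Y' q)) p f = adj X Y p f + adj X Y' p f" by (simp add: tvec_apply)
next
  fix U h Y assume *: "p \<in> U" "smooth_fun_on A U h" "vfield_on A U Y"
  note pA = openin_pts[OF vfield_open[OF X(1)] X(2)]
  note a = vfield_scale[OF *(2,3)]
  have "adj X (\<lambda>q. tscale (h q) (Y q)) p = tscale (h p) (adj X Y p)"
  proof (rule g_vfield_eqI[OF pA adj_tangent[OF X(1) a X(2) *(1)] _ vfield_open[OF *(3)] *(1)])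
    show "tscale (h p) (adj X Y p) \<in> tangent_space A p"
      by (intro tscale_tangent adj_tangent[OF X(1) *(3) X(2) *(1)])
    fix V Z assume Z: "vfield_on A V Z" "p \<in> V"
    show "g p (adj X (\<lambda>q. tscale (h q) (Y q)) p) (Z p) = g p (tscale (h p) (adj X Y p)) (Z p)"
      using adj_g[OF X(1) a X(2) *(1) Z(2,1)] adj_g[OF X(1) *(3) X(2) *(1) Z(2,1)]
      by (simp add: g_scale_left[OF pA] adj_tangent[OF X(1) *(3) X(2) *(1)]
        dt_tangent[OF X(1) Z(1) X(2) Z(2)] vfield_tangent[OF *(3,1)] vfield_tangent[OF Z])
  qed
  then show "adj X (\<lambda>q. tscale (h q) (Y q)) p f = h p * adj X Y p f" by (simp add: tvec_apply)
qed

lemma adj_bitensorial: "bitensorial_at p (\<lambda>X Y. adj X Y p f)"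
  unfolding bitensorial_at_def
proof (intro allI impI)
  fix U X assume X: "p \<in> U \<and> vfield_on A U X"
  show "tensorial_at p (\<lambda>Y. adj Y X p f) \<and> tensorial_at p (\<lambda>Y. adj X Y p f)"
    using adj_tensorial1[of U X p f] adj_tensorial2[of U X p f] X by simp
qed

section \<open>The Koszul forms in an orthonormal frame\<close>

abbreviation al :: "'a \<Rightarrow> 'a tvec \<Rightarrow> real" where
  "al \<equiv> koszul_alpha A nab g"

abbreviation xi :: "'a \<Rightarrow> 'a tvec \<Rightarrow> real" where
  "xi \<equiv> koszul_xi A nab g"

context
  fixes U E p assumes E: "orthonormal_frame_on A g U E" and p: "p \<in> U"
begin

lemma trace_dt: "metric_trace A g dt p = tsum (\<lambda>i. dt (E i) (E i) p) {..<DIM('e)}"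
  by (rule metric_trace_eq[where B = dt, OF dt_bitensorial E p])

lemma trace_adj: "metric_trace A g adj p = tsum (\<lambda>i. adj (E i) (E i) p) {..<DIM('e)}"
  by (rule metric_trace_eq[where B = adj, OF adj_bitensorial E p])

lemma trace_adj_diff_dt:
  "metric_trace A g (\<lambda>X Y q. tdiff (adj X Y q) (dt X Y q)) p = tdiff (metric_trace A g adj p) (metric_trace A g dt p)"
proof -
  have "bitensorial_at p (\<lambda>X Y. tdiff (adj X Y p) (dt X Y p) f)" for f
    unfolding bitensorial_at_def tvec_apply
  proof (intro allI impI)
    fix U X assume X: "p \<in> U \<and> vfield_on A U X"
    show "tensorial_at p (\<lambda>Y. adj Y X p f - dt Y X p f) \<and> tensorial_at p (\<lambda>Y. adj X Y p f - dt X Y p f)"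
      using tensorial_diff[OF adj_tensorial1[of U X p f] dt_tensorial1[of U X p f]]
        tensorial_diff[OF adj_tensorial2[of U X p f] dt_tensorial2[of U X p f]] X by simp
  qed
  from metric_trace_eq[where B = "\<lambda>X Y q. tdiff (adj X Y q) (dt X Y q)", OF this E p] show ?thesis
    unfolding trace_dt trace_adj by (simp add: tsum_def tdiff_def sum_subtractf)
qed

lemma trace_tangent:
  "metric_trace A g dt p \<in> tangent_space A p" "metric_trace A g adj p \<in> tangent_space A p"
proof -
  have v: "vfield_on A U (E i)" if "i < DIM('e)" for i using frame_vfield[OF E that] .
  show "metric_trace A g dt p \<in> tangent_space A p"
    unfolding trace_dt by (rule tsum_tangent, rule dt_tangent[OF v v p p]) simp_all
  show "metric_trace A g adj p \<in> tangent_space A p"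
    unfolding trace_adj by (rule tsum_tangent, rule adj_tangent[OF v v p p]) simp_all
qed

lemma koszul_xi_frame:
  assumes x: "x \<in> tangent_space A p"
  shows "xi p x = (\<Sum>i<DIM('e). g p (LC (E i) (E i) p) x - g p (nab (E i) (E i) p) x)"
proof -
  note pA = openin_pts[OF frame_open[OF E] p]
  have v: "vfield_on A U (E i)" if "i < DIM('e)" for i using frame_vfield[OF E that] .
  have "xi p x = (\<Sum>i<DIM('e). g p (dt (E i) (E i) p) x)"
    unfolding koszul_xi_def trace_dt by (rule g_sum_left[OF pA dt_tangent[OF v v p p] x]) simp_all
  also have "\<dots> = (\<Sum>i<DIM('e). g p (LC (E i) (E i) p) x - g p (nab (E i) (E i) p) x)"
    unfolding diff_tensor_def
    by (rule sum.cong[OF refl],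
        rule g_diff_left[OF pA conn_tangent[OF levi_civita_works(1) v v p] conn_tangent[OF nab v v p] x]) auto
  finally show ?thesis .
qed

text \<open>Differentiate the constant function \<open>g q (E i q) (E i q) = 1\<close> along
  \<open>X\<close>.\<close>

lemma LC_unit:
  assumes X: "vfield_on A V X" "p \<in> V" and i: "i < DIM('e)"
  shows "g p (LC X (E i) p) (E i p) = 0"
proof -
  note pA = openin_pts[OF frame_open[OF E] p]
  note XU = vfield_Int(2)[OF X(1) frame_open[OF E]] vfield_Int(1)[OF frame_vfield[OF E i] vfield_open[OF X(1)]]
  have pU: "p \<in> U \<inter> V" using p X(2) by blast
  have "X p (\<lambda>q. g q (E i q) (E i q)) = X p (\<lambda>q. 1)"
  proof (rule tangent_cong[OF vfield_tangent[OF X] pA])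
    show "eventually (\<lambda>q. g q (E i q) (E i q) = 1) (near p)"
      using eventually_near_open[OF frame_open[OF E] p] by eventually_elim (simp add: frame_orthonormal[OF E] i)
  qed
  then have "X p (\<lambda>q. g q (E i q) (E i q)) = 0" using tangent_const[OF vfield_tangent[OF X] pA] by simp
  moreover have "X p (\<lambda>q. g q (E i q) (E i q)) = g p (LC X (E i) p) (E i p) + g p (E i p) (LC X (E i) p)"
    using levi_civita_works(3) XU pU unfolding metric_connection_def by blast
  moreover have "g p (E i p) (LC X (E i) p) = g p (LC X (E i) p) (E i p)"
    by (rule g_sym[OF pA frame_tangent[OF E i p] conn_tangent[OF levi_civita_works(1) XU pU]])
  ultimately show ?thesis by simp
qed

text \<open>Both \<open>D\<close> and the flat connection are torsion-free, so \<open>\<gamma>\<close> is symmetric and \<open>\<alpha>(X)\<close> is the trace of \<open>\<gamma>\<^sub>X\<close>.\<close>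

lemma koszul_alpha_frame:
  assumes X: "vfield_on A V X" "p \<in> V"
  shows "al p (X p) = - (\<Sum>i<DIM('e). g p (nab X (E i) p) (E i p))"
proof -
  note pA = openin_pts[OF frame_open[OF E] p]
  have v: "vfield_on A U (E i)" if "i < DIM('e)" for i using frame_vfield[OF E that] .
  have t: "E i p \<in> tangent_space A p" if "i < DIM('e)" for i using frame_tangent[OF E that p] .
  have "al p (X p) = (\<Sum>i<DIM('e). g p (adj (E i) (E i) p) (X p))"
    unfolding koszul_alpha_def trace_adj
    by (rule g_sum_left[OF pA adj_tangent[OF v v p p] vfield_tangent[OF X]]) simp_all
  also have "\<dots> = (\<Sum>i<DIM('e). - g p (nab X (E i) p) (E i p))"
  proof (rule sum.cong[OF refl])
    fix i assume "i \<in> {..<DIM('e)}"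
    then have i: "i < DIM('e)" by simp
    note XU = vfield_Int(2)[OF X(1) frame_open[OF E]] vfield_Int(1)[OF v[OF i] vfield_open[OF X(1)]]
    have pU: "p \<in> U \<inter> V" using p X(2) by blast
    note c = conn_tangent[OF nab XU pU] conn_tangent[OF levi_civita_works(1) XU pU]
    have "g p (adj (E i) (E i) p) (X p) = g p (E i p) (dt (E i) X p)"
      by (rule adj_g[OF v[OF i] v[OF i] p p X(2,1)])
    also have "\<dots> = g p (E i p) (dt X (E i) p)" using dt_sym[OF XU pU] by simp
    also have "\<dots> = g p (dt X (E i) p) (E i p)" by (rule g_sym[OF pA t[OF i] dt_tangent[OF XU pU pU]])
    also have "\<dots> = - g p (nab X (E i) p) (E i p)"
      unfolding diff_tensor_def g_diff_left[OF pA c(2,1) t[OF i]] LC_unit[OF X i] by simp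
    finally show "g p (adj (E i) (E i) p) (X p) = - g p (nab X (E i) p) (E i p)" .
  qed
  finally show ?thesis by (simp add: sum_negf)
qed

end

text \<open>Represents \<alpha> - \<xi> by a single vector. Nondegeneracy then yields the trace
  criterion, and later Parseval's identity can be applied to this vector.\<close>

lemma koszul_diff:
  assumes "p \<in> pts A" "x \<in> tangent_space A p"
  shows "al p x - xi p x = g p (metric_trace A g (\<lambda>X Y q. tdiff (adj X Y q) (dt X Y q)) p) x"
proof -
  obtain U E where E: "p \<in> U" "orthonormal_frame_on A g U E" using ex_orthonormal_frame[OF assms(1)] .
  show ?thesis
    unfolding koszul_alpha_def koszul_xi_def trace_adj_diff_dt[OF E(2,1)]
    using g_diff_left[OF assms(1) trace_tangent(2,1)[OF E(2,1)] assms(2)] by simp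
qed

lemma koszul_forms_eq_iff:
  "form_eq A al xi \<longleftrightarrow> (\<forall>p\<in>pts A. metric_trace A g (\<lambda>X Y q. tdiff (adj X Y q) (dt X Y q)) p = tzero)"
proof
  assume eq: "form_eq A al xi"
  show "\<forall>p\<in>pts A. metric_trace A g (\<lambda>X Y q. tdiff (adj X Y q) (dt X Y q)) p = tzero"
  proof
    fix p assume p: "p \<in> pts A"
    obtain U E where E: "p \<in> U" "orthonormal_frame_on A g U E" using ex_orthonormal_frame[OF p] .
    have t: "metric_trace A g (\<lambda>X Y q. tdiff (adj X Y q) (dt X Y q)) p \<in> tangent_space A p"
      unfolding trace_adj_diff_dt[OF E(2,1)] by (intro tdiff_tangent trace_tangent[OF E(2,1)])
    show "metric_trace A g (\<lambda>X Y q. tdiff (adj X Y q) (dt X Y q)) p = tzero"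
    proof (rule g_eqI[OF p t tzero_tangent])
      fix z assume z: "z \<in> tangent_space A p"
      show "g p (metric_trace A g (\<lambda>X Y q. tdiff (adj X Y q) (dt X Y q)) p) z = g p tzero z"
        using koszul_diff[OF p z] eq p z g_zero_left[OF p z] by (simp add: form_eq_def)
    qed
  qed
next
  assume 0: "\<forall>p\<in>pts A. metric_trace A g (\<lambda>X Y q. tdiff (adj X Y q) (dt X Y q)) p = tzero"
  show "form_eq A al xi"
    unfolding form_eq_def
  proof (intro ballI)
    fix p x assume p: "p \<in> pts A" "x \<in> tangent_space A p"
    show "al p x = xi p x" using koszul_diff[OF p] 0 p g_zero_left[OF p] by simp
  qed
qed

lemma koszul_forms_linear:
  assumes "p \<in> pts A" "x \<in> tangent_space A p" "y \<in> tangent_space A p"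
  shows "al p (tadd x y) = al p x + al p y" "al p (tscale c x) = c * al p x"
    "xi p (tadd x y) = xi p x + xi p y" "xi p (tscale c x) = c * xi p x"
proof -
  obtain U E where E: "p \<in> U" "orthonormal_frame_on A g U E" using ex_orthonormal_frame[OF assms(1)] .
  note t = trace_tangent[OF E(2,1)]
  show "al p (tadd x y) = al p x + al p y" "al p (tscale c x) = c * al p x"
    "xi p (tadd x y) = xi p x + xi p y" "xi p (tscale c x) = c * xi p x"
    unfolding koszul_alpha_def koszul_xi_def
    using g_add_right[OF assms] g_scale_right[OF assms(1,2)] t by simp_all
qed

lemma koszul_alpha_smooth:
  assumes X: "vfield_on A V X" and p: "p \<in> V"
  shows "smooth_near A p (\<lambda>q. al q (X q))"
proof -
  note pA = openin_pts[OF vfield_open[OF X] p]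
  obtain U E where E: "p \<in> U" "orthonormal_frame_on A g U E" using ex_orthonormal_frame[OF pA] .
  have W: "p \<in> U \<inter> V" "openin (mtop A) (U \<inter> V)" using E p frame_open[OF E(2)] vfield_open[OF X] by auto
  have XW: "vfield_on A (U \<inter> V) X" using vfield_Int(2)[OF X frame_open[OF E(2)]] .
  have "smooth_near A p (\<lambda>q. - (\<Sum>i<DIM('e). g q (nab X (E i) q) (E i q)))"
  proof (intro smooth_near_uminus smooth_near_sum pA)
    fix i assume "i \<in> {..<DIM('e)}"
    then have EW: "vfield_on A (U \<inter> V) (E i)" using vfield_Int(1)[OF frame_vfield[OF E(2)] vfield_open[OF X]] by auto
    show "smooth_near A p (\<lambda>q. g q (nab X (E i) q) (E i q))"
      by (rule g_smooth_near[OF conn_vfield[OF nab XW EW] EW W(1)])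
  qed
  moreover have "eventually (\<lambda>q. - (\<Sum>i<DIM('e). g q (nab X (E i) q) (E i q)) = al q (X q)) (near p)"
    using eventually_near_open[OF W(2,1)] by eventually_elim (use koszul_alpha_frame[OF E(2) _ X] in auto)
  ultimately show ?thesis by (rule smooth_near_cong)
qed

lemma koszul_xi_smooth:
  assumes X: "vfield_on A V X" and p: "p \<in> V"
  shows "smooth_near A p (\<lambda>q. xi q (X q))"
proof -
  note pA = openin_pts[OF vfield_open[OF X] p]
  obtain U E where E: "p \<in> U" "orthonormal_frame_on A g U E" using ex_orthonormal_frame[OF pA] .
  have W: "p \<in> U \<inter> V" "openin (mtop A) (U \<inter> V)" using E p frame_open[OF E(2)] vfield_open[OF X] by auto
  have XW: "vfield_on A (U \<inter> V) X" using vfield_Int(2)[OF X frame_open[OF E(2)]] .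
  have "smooth_near A p (\<lambda>q. \<Sum>i<DIM('e). g q (LC (E i) (E i) q) (X q) - g q (nab (E i) (E i) q) (X q))"
  proof (intro smooth_near_diff smooth_near_sum pA)
    fix i assume "i \<in> {..<DIM('e)}"
    then have EW: "vfield_on A (U \<inter> V) (E i)" using vfield_Int(1)[OF frame_vfield[OF E(2)] vfield_open[OF X]] by auto
    show "smooth_near A p (\<lambda>q. g q (nab (E i) (E i) q) (X q))"
      by (rule g_smooth_near[OF conn_vfield[OF nab EW EW] XW W(1)])
    show "smooth_near A p (\<lambda>q. g q (LC (E i) (E i) q) (X q))"
      by (rule g_smooth_near[OF conn_vfield[OF levi_civita_works(1) EW EW] XW W(1)])
  qed
  moreover have "eventually (\<lambda>q. (\<Sum>i<DIM('e). g q (LC (E i) (E i) q) (X q) - g q (nab (E i) (E i) q) (X q)) = xi q (X q)) (near p)"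
    using eventually_near_open[OF W(2,1)]
    by eventually_elim (rule koszul_xi_frame[OF E(2) _ vfield_tangent[OF X], symmetric]; blast)
  ultimately show ?thesis by (rule smooth_near_cong)
qed

text \<open>In an orthonormal frame the connection matrix \<open>a\<close> of \<open>nab\<close> satisfies \<open>da + a \<and> a = 0\<close> by flatness,
  and \<open>\<alpha>\<close> is minus its trace; the trace of \<open>a \<and> a\<close> vanishes.\<close>

lemma koszul_alpha_closed: "closed_form A al"
  unfolding closed_form_def
proof (intro allI impI ballI, elim conjE)
  fix V X Y p assume X: "vfield_on A V X" and Y: "vfield_on A V Y" and p: "p \<in> V"
  let ?n = "{..<DIM('e)}"
  note pA = openin_pts[OF vfield_open[OF X] p]
  obtain U E where E: "p \<in> U" "orthonormal_frame_on A g U E" using ex_orthonormal_frame[OF pA] .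
  let ?W = "U \<inter> V"
  have W: "p \<in> ?W" "openin (mtop A) ?W" using E p frame_open[OF E(2)] vfield_open[OF X] by auto
  have EW: "vfield_on A ?W (E i)" if "i \<in> ?n" for i
    using that vfield_Int(1)[OF frame_vfield[OF E(2)] vfield_open[OF X]] by auto
  have Et: "E i p \<in> tangent_space A p" if "i \<in> ?n" for i using vfield_tangent[OF EW[OF that] W(1)] .
  \<comment> \<open>The connection matrix of \<open>nab\<close> in the frame \<open>E\<close>,
    evaluated on the field \<open>Z\<close>: the component along \<open>E j\<close> of the
    derivative of \<open>E i\<close>.\<close>
  define a where "a Z i j q = g q (nab Z (E i) q) (E j q)" for Z i j q
  have a_smooth: "smooth_fun_on A ?W (a Z i j)" if "vfield_on A ?W Z" "i \<in> ?n" "j \<in> ?n" for Z i j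
    unfolding a_def[abs_def] by (rule g_smooth_fun[OF conn_vfield[OF nab that(1) EW[OF that(2)]] EW[OF that(3)]])
  \<comment> \<open>The expansion \<open>exp\<close> of \<open>nab Y (E i)\<close> holds on all of
    \<open>?W\<close>, so \<open>nab X\<close> may be applied to it. Pairing with \<open>E i\<close>
    isolates the derivative of the diagonal entry and leaves a quadratic term.\<close>
  have key: "X p (\<lambda>q. a Y i i q) = g p (nab X (nab Y (E i)) p) (E i p) - (\<Sum>j\<in>?n. a Y i j p * a X j i p)"
    if X: "vfield_on A ?W X" and Y: "vfield_on A ?W Y" and i: "i \<in> ?n" for X Y i
  proof -
    have exp: "nab Y (E i) q = tsum (\<lambda>j. tscale (a Y i j q) (E j q)) ?n" if "q \<in> ?W" for q
      unfolding a_def using frame_expand[OF E(2) _ conn_tangent[OF nab Y EW[OF i] that]] that by simp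
    have "nab X (nab Y (E i)) p = nab X (\<lambda>q. tsum (\<lambda>j. tscale (a Y i j q) (E j q)) ?n) p"
      by (rule conn_cong2[OF nab X conn_vfield[OF nab Y EW[OF i]] exp W(1)])
    also have "\<dots> = tsum (\<lambda>j. tadd (tscale (X p (a Y i j)) (E j p)) (tscale (a Y i j p) (nab X (E j) p))) ?n"
      by (rule conn_sum2[OF nab X W(1) _ a_smooth[OF Y i] EW]) auto
    finally have "g p (nab X (nab Y (E i)) p) (E i p) =
        g p (tsum (\<lambda>j. tadd (tscale (X p (a Y i j)) (E j p)) (tscale (a Y i j p) (nab X (E j) p))) ?n) (E i p)" by simp
    also have "\<dots> = (\<Sum>j\<in>?n. g p (tadd (tscale (X p (a Y i j)) (E j p)) (tscale (a Y i j p) (nab X (E j) p))) (E i p))"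
      by (intro g_sum_left[OF pA] tadd_tangent tscale_tangent Et conn_tangent[OF nab X EW W(1)] i)
    also have "\<dots> = (\<Sum>j\<in>?n. X p (a Y i j) * (if j = i then 1 else 0) + a Y i j p * a X j i p)"
    proof (rule sum.cong[OF refl])
      fix j assume j: "j \<in> ?n"
      note c = conn_tangent[OF nab X EW[OF j] W(1)]
      show "g p (tadd (tscale (X p (a Y i j)) (E j p)) (tscale (a Y i j p) (nab X (E j) p))) (E i p) =
          X p (a Y i j) * (if j = i then 1 else 0) + a Y i j p * a X j i p"
        using i j frame_orthonormal[OF E(2) _ _ E(1), of j i]
        by (simp add: g_add_left[OF pA] g_scale_left[OF pA] tscale_tangent Et c a_def)
    qed
    also have "\<dots> = X p (a Y i i) + (\<Sum>j\<in>?n. a Y i j p * a X j i p)"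
      using i by (simp add: sum.distrib if_distrib[of "\<lambda>x. _ * x"] cong: if_cong)
    finally show ?thesis by simp
  qed
  have XW: "vfield_on A ?W X" and YW: "vfield_on A ?W Y"
    using vfield_Int(2)[OF X frame_open[OF E(2)]] vfield_Int(2)[OF Y frame_open[OF E(2)]] .
  note BW = vfield_bracket[OF XW YW]
  have al_a: "Z p (\<lambda>q. al q (Z' q)) = - (\<Sum>i\<in>?n. Z p (\<lambda>q. a Z' i i q))"
    if Z: "vfield_on A ?W Z" and Z': "vfield_on A ?W Z'" for Z Z'
  proof -
    have s: "smooth_near A p (\<lambda>q. a Z' i i q)" if "i \<in> ?n" for i
      using a_smooth[OF Z' that that] W(1) by (auto simp: smooth_fun_on_iff)
    have "Z p (\<lambda>q. al q (Z' q)) = Z p (\<lambda>q. - 1 * (\<Sum>i\<in>?n. a Z' i i q))"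
    proof (rule tangent_cong[OF vfield_tangent[OF Z W(1)] pA])
      show "eventually (\<lambda>q. al q (Z' q) = - 1 * (\<Sum>i\<in>?n. a Z' i i q)) (near p)"
        using eventually_near_open[OF W(2,1)]
        by eventually_elim (use koszul_alpha_frame[OF E(2) _ Z'] in \<open>auto simp: a_def\<close>)
    qed
    also have "\<dots> = - 1 * Z p (\<lambda>q. \<Sum>i\<in>?n. a Z' i i q)"
      by (rule tangent_scale[OF vfield_tangent[OF Z W(1)] smooth_near_sum[OF pA s]])
    also have "Z p (\<lambda>q. \<Sum>i\<in>?n. a Z' i i q) = (\<Sum>i\<in>?n. Z p (\<lambda>q. a Z' i i q))"
      by (rule tangent_sum[OF vfield_tangent[OF Z W(1)] pA s])
    finally show ?thesis by simp
  qed
  have curv: "g p (nab X (nab Y (E i)) p) (E i p) - g p (nab Y (nab X (E i)) p) (E i p) = a (lie_bracket A X Y) i i p"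
    if i: "i \<in> ?n" for i
  proof -
    note Ei = EW[OF i]
    note t = conn_tangent[OF nab XW conn_vfield[OF nab YW Ei] W(1)] conn_tangent[OF nab YW conn_vfield[OF nab XW Ei] W(1)]
    have "tdiff (tdiff (nab X (nab Y (E i)) p) (nab Y (nab X (E i)) p)) (nab (lie_bracket A X Y) (E i) p) = tzero"
      using nab_flat XW YW Ei W(1) unfolding flat_def by blast
    then have "tdiff (nab X (nab Y (E i)) p) (nab Y (nab X (E i)) p) f = nab (lie_bracket A X Y) (E i) p f" for f
      by (metis tdiff_apply tzero_apply right_minus_eq)
    then have "tdiff (nab X (nab Y (E i)) p) (nab Y (nab X (E i)) p) = nab (lie_bracket A X Y) (E i) p" by blast
    then show ?thesis unfolding a_def using g_diff_left[OF pA t Et[OF i]] by simp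
  qed
  \<comment> \<open>Exchanging the summation indices exchanges the roles of \<open>X\<close> and
    \<open>Y\<close>, so the quadratic terms cancel after antisymmetrisation.\<close>
  have "(\<Sum>i\<in>?n. \<Sum>j\<in>?n. a Y i j p * a X j i p) = (\<Sum>i\<in>?n. \<Sum>j\<in>?n. a X i j p * a Y j i p)"
    by (subst sum.swap) (simp add: mult.commute)
  then have "X p (\<lambda>q. al q (Y q)) - Y p (\<lambda>q. al q (X q)) =
      - (\<Sum>i\<in>?n. g p (nab X (nab Y (E i)) p) (E i p) - g p (nab Y (nab X (E i)) p) (E i p))"
    unfolding al_a[OF XW YW] al_a[OF YW XW] using key[OF XW YW] key[OF YW XW]
    by (simp add: sum_subtractf)
  also have "\<dots> = - (\<Sum>i\<in>?n. a (lie_bracket A X Y) i i p)" using curv by simp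
  also have "\<dots> = al p (lie_bracket A X Y p)"
    unfolding a_def using koszul_alpha_frame[OF E(2,1) BW W(1)] by simp
  finally show "ext_deriv A al X Y p = 0" unfolding ext_deriv_def by simp
qed

text \<open>As \<alpha> is closed, d(\<alpha> - \<xi>) = - d\<xi>. Smoothness of both forms along
  fields is what permits a derivation to be split over the difference.\<close>

lemma koszul_diff_closed_iff: "closed_form A (\<lambda>p x. al p x - xi p x) \<longleftrightarrow> closed_form A xi"
proof -
  have neg: "ext_deriv A (\<lambda>p x. al p x - xi p x) X Y p = - ext_deriv A xi X Y p"
    if X: "vfield_on A U X" and Y: "vfield_on A U Y" and p: "p \<in> U" for U X Y p
  proof -
    have "ext_deriv A al X Y p = 0"
      using koszul_alpha_closed X Y p unfolding closed_form_def by blast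
    then show ?thesis
      unfolding ext_deriv_def
      using tangent_diff[OF vfield_tangent[OF X p] koszul_alpha_smooth[OF Y p] koszul_xi_smooth[OF Y p]]
        tangent_diff[OF vfield_tangent[OF Y p] koszul_alpha_smooth[OF X p] koszul_xi_smooth[OF X p]] by simp
  qed
  show ?thesis
    unfolding closed_form_def
  proof (intro iffI allI impI ballI)
    fix U X Y p
    assume c: "\<forall>U X Y. vfield_on A U X \<and> vfield_on A U Y \<longrightarrow> (\<forall>p\<in>U. ext_deriv A (\<lambda>p x. al p x - xi p x) X Y p = 0)"
      and XY: "vfield_on A U X \<and> vfield_on A U Y" and p: "p \<in> U"
    from c XY p have "ext_deriv A (\<lambda>p x. al p x - xi p x) X Y p = 0" by blast
    then show "ext_deriv A xi X Y p = 0" using neg[of U X Y p] XY p by simp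
  next
    fix U X Y p
    assume c: "\<forall>U X Y. vfield_on A U X \<and> vfield_on A U Y \<longrightarrow> (\<forall>p\<in>U. ext_deriv A xi X Y p = 0)"
      and XY: "vfield_on A U X \<and> vfield_on A U Y" and p: "p \<in> U"
    from c XY p have "ext_deriv A xi X Y p = 0" by blast
    then show "ext_deriv A (\<lambda>p x. al p x - xi p x) X Y p = 0" using neg[of U X Y p] XY p by simp
  qed
qed

end

section \<open>The tangent bundle\<close>

lemma smooth_on_Pair:
  fixes f :: "'d::euclidean_space \<Rightarrow> 'e::euclidean_space" and h :: "'d \<Rightarrow> 'f::euclidean_space"
  assumes "open S" "smooth_on S f" "smooth_on S h"
  shows "smooth_on S (\<lambda>x. (f x, h x))"
proof (rule smooth_on_componentwise[OF assms(1)])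
  fix b :: "'e \<times> 'f"
  have "smooth_on S (\<lambda>x. f x \<bullet> fst b + h x \<bullet> snd b)"
    by (intro smooth_on_add smooth_on_bilinear[OF bounded_bilinear_inner] assms smooth_on_const)
  then show "smooth_on S (\<lambda>x. (f x, h x) \<bullet> b)" by (simp add: inner_prod_def)
qed

context atlas
begin

text \<open>Together with \<open>tmap\<close>, the two components of
  \<open>tangent_chart A (U, \<phi>)\<close>, written with \<open>comps\<close> so that
  \<open>coord_vec\<close> provides the inverse.\<close>

definition tdom :: "'a set \<Rightarrow> 'a tpoint set" where
  "tdom U = {(p, v). p \<in> U \<and> v \<in> tangent_space A p}"

definition tmap :: "('a \<Rightarrow> 'e) \<Rightarrow> 'a tpoint \<Rightarrow> 'e \<times> 'e" where
  "tmap \<phi> = (\<lambda>(p, v). (\<phi> p, comps \<phi> v))"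

lemma tdom_iff: "(p, v) \<in> tdom U \<longleftrightarrow> p \<in> U \<and> v \<in> tangent_space A p"
  by (simp add: tdom_def)

lemma tangent_bundle_iff:
  "(T, \<Phi>) \<in> tangent_bundle A \<longleftrightarrow> (\<exists>U \<phi>. (U, \<phi>) \<in> A \<and> T = tdom U \<and> \<Phi> = tmap \<phi>)"
proof -
  have eq: "tangent_chart A (U, \<phi>) = (tdom U, tmap \<phi>)" for U \<phi>
    by (simp add: tangent_chart_def tdom_def tmap_def comps_def split_beta)
  show ?thesis
  proof
    assume "(T, \<Phi>) \<in> tangent_bundle A"
    then obtain c where c: "(T, \<Phi>) = tangent_chart A c" "c \<in> A" unfolding tangent_bundle_def by (rule imageE)
    obtain U \<phi> where "c = (U, \<phi>)" by (cases c)
    with c have "(U, \<phi>) \<in> A" "(T, \<Phi>) = tangent_chart A (U, \<phi>)" by simp_all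
    then show "\<exists>U \<phi>. (U, \<phi>) \<in> A \<and> T = tdom U \<and> \<Phi> = tmap \<phi>" unfolding eq by blast
  next
    assume "\<exists>U \<phi>. (U, \<phi>) \<in> A \<and> T = tdom U \<and> \<Phi> = tmap \<phi>"
    then obtain U \<phi> where c: "(U, \<phi>) \<in> A" "T = tdom U" "\<Phi> = tmap \<phi>" by blast
    show "(T, \<Phi>) \<in> tangent_bundle A"
      unfolding tangent_bundle_def by (rule image_eqI[OF _ c(1)]) (simp add: eq c)
  qed
qed

lemma tangent_chart_mem: "(U, \<phi>) \<in> A \<Longrightarrow> (tdom U, tmap \<phi>) \<in> tangent_bundle A"
  unfolding tangent_bundle_iff by blast

lemma tmap_inv:
  assumes c: "(U, \<phi>) \<in> A"
  shows "inj_on (tmap \<phi>) (tdom U)" "u \<in> tdom U \<Longrightarrow> inv_into (tdom U) (tmap \<phi>) (tmap \<phi> u) = u"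
    and "p \<in> U \<Longrightarrow> tmap \<phi> (p, coord_vec U \<phi> p y) = (\<phi> p, y)"
    and "p \<in> U \<Longrightarrow> inv_into (tdom U) (tmap \<phi>) (\<phi> p, y) = (p, coord_vec U \<phi> p y)"
proof -
  show i: "inj_on (tmap \<phi>) (tdom U)"
  proof (rule inj_onI)
    fix u u' assume u: "u \<in> tdom U" "u' \<in> tdom U" "tmap \<phi> u = tmap \<phi> u'"
    obtain p v p' v' where uv: "u = (p, v)" "u' = (p', v')" by (cases u, cases u')
    then have "p = p'" using u inj_onD[OF chart_inj[OF c]] by (auto simp: tdom_iff tmap_def)
    moreover have "v = v'"
      using u uv \<open>p = p'\<close> coord_vec_comps[OF c] by (auto simp: tdom_iff tmap_def) (metis)
    ultimately show "u = u'" using uv by simp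
  qed
  show "inv_into (tdom U) (tmap \<phi>) (tmap \<phi> u) = u" if "u \<in> tdom U" for u using inv_into_f_f[OF i that] .
  show m: "tmap \<phi> (p, coord_vec U \<phi> p y) = (\<phi> p, y)" if "p \<in> U" for p y
    using comps_coord_vec[OF c that] by (simp add: tmap_def)
  show "inv_into (tdom U) (tmap \<phi>) (\<phi> p, y) = (p, coord_vec U \<phi> p y)" if "p \<in> U" for p y
    using inv_into_f_f[OF i, of "(p, coord_vec U \<phi> p y)"] m[OF that] coord_vec_tangent[OF c that] that
    by (simp add: tdom_iff)
qed

lemma tmap_image: "(U, \<phi>) \<in> A \<Longrightarrow> W \<subseteq> U \<Longrightarrow> tmap \<phi> ` tdom W = \<phi> ` W \<times> UNIV"
proof
  assume c: "(U, \<phi>) \<in> A" and W: "W \<subseteq> U"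
  show "tmap \<phi> ` tdom W \<subseteq> \<phi> ` W \<times> UNIV" by (auto simp: tmap_def tdom_iff)
  show "\<phi> ` W \<times> UNIV \<subseteq> tmap \<phi> ` tdom W"
  proof clarify
    fix p y assume p: "p \<in> W"
    then have "(\<phi> p, y) = tmap \<phi> (p, coord_vec U \<phi> p y)" "(p, coord_vec U \<phi> p y) \<in> tdom W"
      using tmap_inv(3)[OF c] W coord_vec_tangent[OF c] by (auto simp: tdom_iff)
    then show "(\<phi> p, y) \<in> tmap \<phi> ` tdom W" by (rule image_eqI)
  qed
qed

lemma tdom_Int: "tdom U \<inter> tdom V = tdom (U \<inter> V)"
  by (auto simp: tdom_iff)

text \<open>The transition map is \<open>(x, y)\<close> to \<open>(t x, Dt x y)\<close> for the
  transition map \<open>t\<close> of the base. The second component is written through partial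
  derivatives in constant directions, which are smooth by \<open>smooth_on_frechet\<close>.\<close>

lemma transition_tangent_smooth:
  assumes c: "(U, \<phi>) \<in> A" and d: "(V, \<psi>) \<in> A"
  shows "smooth_on (\<phi> ` (U \<inter> V) \<times> UNIV) (tmap \<psi> \<circ> inv_into (tdom U) (tmap \<phi>))"
proof -
  let ?S = "\<phi> ` (U \<inter> V)"
  have S: "open ?S" "open (?S \<times> (UNIV :: 'e set))" using overlap_open[OF c d] open_Times by auto
  let ?t = "\<psi> \<circ> inv_into U \<phi>"
  let ?k = "\<lambda>b. (\<lambda>q. \<psi> q \<bullet> b) \<circ> inv_into U \<phi>"
  have k: "smooth_on ?S (?k b)" for b
  proof -
    have "smooth_on ?S (\<lambda>x. ?t x \<bullet> b)"
      by (rule smooth_on_bilinear[OF bounded_bilinear_inner S(1) transition_smooth[OF c d] smooth_on_const[OF S(1)]])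
    then show ?thesis by (simp add: o_def)
  qed
  have fst: "smooth_on (?S \<times> (UNIV :: 'e set)) (\<lambda>z. h (fst z))" if "smooth_on ?S h" for h :: "'e \<Rightarrow> 'z::real_normed_vector"
    by (rule smooth_on_compose[OF S(2,1) _ _ that]) (auto intro: smooth_on_linear[OF S(2)] bounded_linear_fst)
  have "smooth_on (?S \<times> (UNIV :: 'e set)) (\<lambda>z. (?t (fst z),
      \<Sum>b\<in>Basis. (\<Sum>c\<in>Basis. (snd z \<bullet> c) * frechet_derivative (?k b) (at (fst z)) c) *\<^sub>R b))"
    by (intro smooth_on_Pair smooth_on_sum smooth_on_bilinear[OF bounded_bilinear_scaleR] S smooth_on_const
        smooth_on_bilinear[OF bounded_bilinear_mult] fst transition_smooth[OF c d] smooth_on_frechet k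
        smooth_on_bilinear[OF bounded_bilinear_inner] smooth_on_linear[OF S(2) bounded_linear_snd])
  then show ?thesis
  proof (rule smooth_on_cong[OF S(2)])
    fix z assume "z \<in> ?S \<times> (UNIV :: 'e set)"
    then obtain p y where z: "z = (\<phi> p, y)" "p \<in> U" "p \<in> V" by auto
    have "coord_vec U \<phi> p y (\<lambda>q. \<psi> q \<bullet> b) = (\<Sum>c\<in>Basis. (y \<bullet> c) * frechet_derivative (?k b) (at (\<phi> p)) c)" for b
      by (subst coord_vec_linear[OF c z(2)]) (simp add: coord_vec_def smooth_near_coord[OF d z(3)])
    then show "(?t (fst z), \<Sum>b\<in>Basis. (\<Sum>c\<in>Basis. (snd z \<bullet> c) * frechet_derivative (?k b) (at (fst z)) c) *\<^sub>R b) =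
       (tmap \<psi> \<circ> inv_into (tdom U) (tmap \<phi>)) z"
      unfolding z(1) o_apply tmap_inv(4)[OF c z(2)]
      using chart_inv[OF c z(2)] by (simp add: tmap_def[of \<psi>] comps_def)
  qed
qed

lemma smooth_atlas_tangent_bundle: "smooth_atlas (tangent_bundle A)"
  unfolding smooth_atlas_def
proof (intro conjI ballI; clarify)
  fix T \<Phi> assume "(T, \<Phi>) \<in> tangent_bundle A"
  then obtain U \<phi> where c: "(U, \<phi>) \<in> A" "T = tdom U" "\<Phi> = tmap \<phi>" by (auto simp: tangent_bundle_iff)
  then show "inj_on \<Phi> T \<and> open (\<Phi> ` T)"
    using tmap_inv(1)[OF c(1)] tmap_image[OF c(1) order_refl] chart_open[OF c(1)] by (auto intro: open_Times)
next
  fix T \<Phi> T' \<Psi> assume "(T, \<Phi>) \<in> tangent_bundle A" "(T', \<Psi>) \<in> tangent_bundle A"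
  then obtain U \<phi> V \<psi> where c: "(U, \<phi>) \<in> A" "T = tdom U" "\<Phi> = tmap \<phi>" and d: "(V, \<psi>) \<in> A" "T' = tdom V" "\<Psi> = tmap \<psi>"
    by (auto simp: tangent_bundle_iff)
  have "\<Phi> ` (T \<inter> T') = \<phi> ` (U \<inter> V) \<times> UNIV" using tmap_image[OF c(1), of "U \<inter> V"] c d by (simp add: tdom_Int)
  then show "open (\<Phi> ` (T \<inter> T')) \<and> smooth_on (\<Phi> ` (T \<inter> T')) (\<Psi> \<circ> inv_into T \<Phi>)"
    using transition_tangent_smooth[OF c(1) d(1)] overlap_open[OF c(1) d(1)] c d by (auto intro: open_Times)
qed

end

section \<open>Functions, tangent vectors and sections on the tangent bundle\<close>

context affine_riemann
begin

abbreviation TB :: "('a tpoint, 'e \<times> 'e) chart set" where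
  "TB \<equiv> tangent_bundle A"

sublocale TM: atlas TB
  by unfold_locales (rule smooth_atlas_tangent_bundle)

lemma TM_pts_iff: "(p, v) \<in> pts TB \<longleftrightarrow> p \<in> pts A \<and> v \<in> tangent_space A p"
proof
  assume "(p, v) \<in> pts TB"
  then obtain T \<Phi> where "(T, \<Phi>) \<in> TB" "(p, v) \<in> T" unfolding TM.pts_iff by blast
  then show "p \<in> pts A \<and> v \<in> tangent_space A p"
    unfolding tangent_bundle_iff by (auto simp: tdom_iff chart_pts)
next
  assume pv: "p \<in> pts A \<and> v \<in> tangent_space A p"
  then obtain U \<phi> where c: "(U, \<phi>) \<in> A" "p \<in> U" unfolding pts_iff by blast
  show "(p, v) \<in> pts TB"
    by (rule TM.chart_pts[OF tangent_chart_mem[OF c(1)]]) (use c pv in \<open>simp add: tdom_iff\<close>)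
qed

lemma tdom_open:
  assumes W: "openin (mtop A) W" shows "openin (mtop TB) (tdom W)"
  unfolding TM.openin_mtop_iff
proof (intro conjI allI impI)
  show "tdom W \<subseteq> pts TB" using openin_pts[OF W] by (auto simp: tdom_iff TM_pts_iff)
  fix T \<Phi> assume "(T, \<Phi>) \<in> TB"
  then obtain U \<phi> where c: "(U, \<phi>) \<in> A" "T = tdom U" "\<Phi> = tmap \<phi>" by (auto simp: tangent_bundle_iff)
  have "open (\<phi> ` (W \<inter> U))" using W c(1) by (auto simp: openin_mtop_iff)
  then show "open (\<Phi> ` (tdom W \<inter> T))"
    using tmap_image[OF c(1), of "W \<inter> U"] c by (auto simp: tdom_Int intro: open_Times)
qed

lemma eventually_base:
  assumes u: "(p, v) \<in> pts TB" and ev: "eventually P (near p)"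
  shows "eventually (\<lambda>u. P (fst u)) (TM.near (p, v))"
proof -
  have p: "p \<in> pts A" using u by (simp add: TM_pts_iff)
  obtain W where W: "openin (mtop A) W" "p \<in> W" "\<And>q. q \<in> W \<Longrightarrow> P q"
    using ev unfolding eventually_near[OF p] by blast
  have "eventually (\<lambda>u. u \<in> tdom W) (TM.near (p, v))"
    by (rule TM.eventually_near_open[OF tdom_open[OF W(1)]]) (use W u in \<open>auto simp: tdom_iff TM_pts_iff\<close>)
  then show ?thesis by eventually_elim (use W(3) in \<open>auto simp: tdom_iff\<close>)
qed

lemma smooth_base:
  assumes u: "(p, v) \<in> pts TB" and f: "smooth_near A p f"
  shows "smooth_near TB (p, v) (\<lambda>u. f (fst u))"
proof -
  obtain U \<phi> where c: "(U, \<phi>) \<in> A" "p \<in> U" using smooth_near_pts[OF f] by (auto simp: pts_iff)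
  obtain S where S: "open S" "\<phi> p \<in> S" "S \<subseteq> \<phi> ` U" "smooth_on S (f \<circ> inv_into U \<phi>)"
    using smooth_near_chartD[OF c f] .
  have uT: "(p, v) \<in> tdom U" using u c by (simp add: tdom_iff TM_pts_iff)
  have o: "open (S \<times> (UNIV :: 'e set))" using S(1) by (simp add: open_Times)
  have "smooth_on (S \<times> (UNIV :: 'e set)) (\<lambda>z. (f \<circ> inv_into U \<phi>) (fst z))"
    by (rule smooth_on_compose[OF o S(1) _ _ S(4)]) (auto intro: smooth_on_linear[OF o] bounded_linear_fst)
  then have "smooth_near TB (p, v) (\<lambda>u. (f \<circ> inv_into U \<phi>) (fst (tmap \<phi> u)))"
    by (intro TM.smooth_near_chart[OF tangent_chart_mem[OF c(1)] uT o]) (use S in \<open>auto simp: tmap_def\<close>)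
  moreover have "eventually (\<lambda>u. (f \<circ> inv_into U \<phi>) (fst (tmap \<phi> u)) = f (fst u)) (TM.near (p, v))"
    using TM.eventually_near_open[OF TM.openin_chart[OF tangent_chart_mem[OF c(1)]] uT]
    by eventually_elim (auto simp: tmap_def tdom_iff chart_inv[OF c(1)])
  ultimately show ?thesis by (rule TM.smooth_near_cong)
qed

text \<open>The function \<open>(q, w)\<close> to \<open>w f\<close> is the differential of
  \<open>f\<close> seen as a fibrewise linear function. Together with the pullbacks of
  \<open>smooth_base\<close> such functions include the coordinates of the induced charts, so they
  suffice to test vectors on the tangent bundle.\<close>

lemma smooth_lin:
  assumes u: "(p, v) \<in> pts TB" and f: "smooth_near A p f"
  shows "smooth_near TB (p, v) (\<lambda>u. snd u f)"
proof -
  obtain U \<phi> where c: "(U, \<phi>) \<in> A" "p \<in> U" using smooth_near_pts[OF f] by (auto simp: pts_iff)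
  have uT: "(p, v) \<in> tdom U" using u c by (simp add: tdom_iff TM_pts_iff)
  have co: "smooth_near TB (p, v) (\<lambda>u. snd u (\<lambda>q. \<phi> q \<bullet> b))" if "b \<in> Basis" for b
    using TM.smooth_near_coord[OF tangent_chart_mem[OF c(1)] uT, of "(0, b)"] that
    by (simp add: tmap_def split_beta comps_inner)
  have "smooth_near TB (p, v) (\<lambda>u. \<Sum>b\<in>Basis. snd u (\<lambda>q. \<phi> q \<bullet> b) * coord_vec U \<phi> (fst u) b f)"
    by (rule TM.smooth_near_sum[OF u TM.smooth_near_mult[OF co smooth_base[OF u coord_vec_smooth[OF c f]]]])
  moreover have "eventually (\<lambda>u. (\<Sum>b\<in>Basis. snd u (\<lambda>q. \<phi> q \<bullet> b) * coord_vec U \<phi> (fst u) b f) = snd u f) (TM.near (p, v))"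
    using TM.eventually_near_open[OF TM.openin_chart[OF tangent_chart_mem[OF c(1)]] uT]
    by eventually_elim (rule tangent_expand[OF c(1), symmetric]; auto simp: tdom_def)
  ultimately show ?thesis by (rule TM.smooth_near_cong)
qed

text \<open>A basis vector of the product space is \<open>(b, 0)\<close> or \<open>(0, b)\<close>;
  the corresponding coordinate of the induced chart is the pullback of a coordinate of the base or
  the fibrewise linear function of that coordinate.\<close>

lemma TM_tangent_eqI_chart:
  assumes "w \<in> tangent_space TB (p, v)" "w' \<in> tangent_space TB (p, v)" "(p, v) \<in> pts TB"
    and c: "(U, \<phi>) \<in> A" "p \<in> U"
    and base: "\<And>b. b \<in> Basis \<Longrightarrow> w (\<lambda>u. \<phi> (fst u) \<bullet> b) = w' (\<lambda>u. \<phi> (fst u) \<bullet> b)"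
    and lin: "\<And>b. b \<in> Basis \<Longrightarrow> w (\<lambda>u. snd u (\<lambda>q. \<phi> q \<bullet> b)) = w' (\<lambda>u. snd u (\<lambda>q. \<phi> q \<bullet> b))"
  shows "w = w'"
proof -
  have uT: "(p, v) \<in> tdom U" using assms(3) c by (simp add: tdom_iff TM_pts_iff)
  show ?thesis
  proof (rule TM.tangent_eqI[OF assms(1,2) tangent_chart_mem[OF c(1)] uT])
    fix b :: "'e \<times> 'e" assume "b \<in> Basis"
    then consider b' where "b' \<in> Basis" "b = (b', 0)" | b' where "b' \<in> Basis" "b = (0, b')"
      by (auto simp: Basis_prod_def)
    then show "w (\<lambda>u. tmap \<phi> u \<bullet> b) = w' (\<lambda>u. tmap \<phi> u \<bullet> b)"
    proof cases
      case 1
      then show ?thesis using base[of b'] by (simp add: tmap_def split_beta)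
    next
      case 2
      then show ?thesis using lin[of b'] by (simp add: tmap_def split_beta comps_inner)
    qed
  qed
qed

lemma TM_tangent_eqI:
  assumes "w \<in> tangent_space TB (p, v)" "w' \<in> tangent_space TB (p, v)" "(p, v) \<in> pts TB"
    and "\<And>f. smooth_near A p f \<Longrightarrow> w (\<lambda>u. f (fst u)) = w' (\<lambda>u. f (fst u))"
    and "\<And>f. smooth_near A p f \<Longrightarrow> w (\<lambda>u. snd u f) = w' (\<lambda>u. snd u f)"
  shows "w = w'"
proof -
  obtain U \<phi> where c: "(U, \<phi>) \<in> A" "p \<in> U" using assms(3) by (auto simp: TM_pts_iff pts_iff)
  show ?thesis
    by (rule TM_tangent_eqI_chart[OF assms(1-3) c]; rule assms(4,5); rule smooth_near_coord[OF c])
qed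

text \<open>In charts the section is the graph \<open>?s\<close> of the components of
  \<open>Y\<close>, and the claim is smoothness of the composition with \<open>F\<close> in the
  induced chart.\<close>

lemma section_smooth:
  assumes Y: "vfield_on A U Y" and p: "p \<in> U" and F: "smooth_near TB (p, Y p) F"
  shows "smooth_near A p (\<lambda>q. F (q, Y q))"
proof -
  obtain V \<phi> where c: "(V, \<phi>) \<in> A" "p \<in> V" using openin_pts[OF vfield_open[OF Y] p] by (auto simp: pts_iff)
  have uT: "(p, Y p) \<in> tdom V" using c vfield_tangent[OF Y p] by (simp add: tdom_iff)
  obtain S where S: "open S" "tmap \<phi> (p, Y p) \<in> S" "S \<subseteq> tmap \<phi> ` tdom V" "smooth_on S (F \<circ> inv_into (tdom V) (tmap \<phi>))"
    using TM.smooth_near_chartD[OF tangent_chart_mem[OF c(1)] uT F] .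
  let ?O = "\<phi> ` (U \<inter> V)"
  have o: "open ?O" using vfield_open[OF Y] c by (auto simp: openin_mtop_iff)
  have comp: "smooth_on ?O ((\<lambda>q. Y q (\<lambda>r. \<phi> r \<bullet> b)) \<circ> inv_into V \<phi>)" for b
  proof -
    have "smooth_fun_on A (U \<inter> V) (\<lambda>q. Y q (\<lambda>r. \<phi> r \<bullet> b))"
      using vfield_open[OF Y] openin_chart[OF c(1)]
      by (auto simp: smooth_fun_on_iff intro!: vfield_smooth_near[OF Y] smooth_near_coord[OF c(1)])
    then have "smooth_on (\<phi> ` (U \<inter> V \<inter> V)) ((\<lambda>q. Y q (\<lambda>r. \<phi> r \<bullet> b)) \<circ> inv_into V \<phi>)"
      using c(1) unfolding smooth_fun_on_def by blast
    then show ?thesis by (simp add: Int_assoc)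
  qed
  let ?s = "\<lambda>x. (x, \<Sum>b\<in>Basis. ((\<lambda>q. Y q (\<lambda>r. \<phi> r \<bullet> b)) \<circ> inv_into V \<phi>) x *\<^sub>R b)"
  have s: "smooth_on ?O ?s"
    by (intro smooth_on_Pair o smooth_on_linear[OF o] bounded_linear_ident smooth_on_sum
        smooth_on_bilinear[OF bounded_bilinear_scaleR] smooth_on_const comp)
  have s_eq: "?s (\<phi> q) = tmap \<phi> (q, Y q)" if "q \<in> V" for q
    by (simp add: tmap_def comps_def chart_inv[OF c(1) that])
  have o': "open (?O \<inter> ?s -` S)"
    using smooth_on_continuous[OF s] o S(1) by (rule continuous_open_preimage)
  have "smooth_on (?O \<inter> ?s -` S) (\<lambda>x. (F \<circ> inv_into (tdom V) (tmap \<phi>)) (?s x))"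
    by (rule smooth_on_compose[OF o' S(1) _ smooth_on_subset[OF s] S(4)]) auto
  then have "smooth_on (?O \<inter> ?s -` S) ((\<lambda>q. F (q, Y q)) \<circ> inv_into V \<phi>)"
  proof (rule smooth_on_cong[OF o'])
    fix x assume "x \<in> ?O \<inter> ?s -` S"
    then obtain q where q: "x = \<phi> q" "q \<in> U" "q \<in> V" by auto
    have "inv_into (tdom V) (tmap \<phi>) (tmap \<phi> (q, Y q)) = (q, Y q)"
      by (rule tmap_inv(2)[OF c(1)]) (use q vfield_tangent[OF Y] in \<open>auto simp: tdom_iff\<close>)
    then have "(F \<circ> inv_into (tdom V) (tmap \<phi>)) (?s (\<phi> q)) = F (q, Y q)"
      unfolding s_eq[OF q(3)] by simp
    then show "(F \<circ> inv_into (tdom V) (tmap \<phi>)) (?s x) = ((\<lambda>q. F (q, Y q)) \<circ> inv_into V \<phi>) x"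
      using q(1) chart_inv[OF c(1) q(3)] by simp
  qed
  moreover have "\<phi> p \<in> ?O \<inter> ?s -` S" using p c S(2) s_eq[OF c(2)] by simp
  ultimately show ?thesis by (intro smooth_near_chartI[OF c o'])
qed

section \<open>Vertical and horizontal lifts\<close>

abbreviation vl :: "'a tpoint \<Rightarrow> 'a tvec \<Rightarrow> 'a tpoint tvec" where
  "vl \<equiv> vertical_lift A"

abbreviation hl :: "'a tpoint \<Rightarrow> 'a tvec \<Rightarrow> 'a tpoint tvec" where
  "hl \<equiv> horizontal_lift A nab"

text \<open>The curve \<open>tadd v (tscale t x)\<close> is a straight line in the induced chart
  with velocity \<open>(0, comps \<phi> x)\<close>. Hence the vertical lift is a coordinate vector
  of that chart, and coordinate vectors are tangent.\<close>

lemma vl_tangent: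
  assumes u: "(p, v) \<in> pts TB" and x: "x \<in> tangent_space A p"
  shows "vl (p, v) x \<in> tangent_space TB (p, v)"
proof -
  obtain U \<phi> where c: "(U, \<phi>) \<in> A" "p \<in> U" using u by (auto simp: TM_pts_iff pts_iff)
  have v: "v \<in> tangent_space A p" and uT: "(p, v) \<in> tdom U" using u c by (auto simp: tdom_iff TM_pts_iff)
  note C = tangent_chart_mem[OF c(1)]
  have "vl (p, v) x = TM.coord_vec (tdom U) (tmap \<phi>) (p, v) (0, comps \<phi> x)"
  proof
    fix F
    show "vl (p, v) x F = TM.coord_vec (tdom U) (tmap \<phi>) (p, v) (0, comps \<phi> x) F"
    proof (cases "smooth_near TB (p, v) F")
      case True
      let ?k = "F \<circ> inv_into (tdom U) (tmap \<phi>)"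
      have D: "(?k has_derivative frechet_derivative ?k (at (tmap \<phi> (p, v)))) (at (tmap \<phi> (p, v)))"
        by (rule TM.chart_has_derivative[OF C uT True])
      have eq: "F (p, tadd v (tscale t x)) = ?k (tmap \<phi> (p, v) + t *\<^sub>R (0, comps \<phi> x))" for t
      proof -
        have "(p, tadd v (tscale t x)) \<in> tdom U" using v x c by (auto simp: tdom_iff intro: tadd_tangent tscale_tangent)
        moreover have "tmap \<phi> (p, tadd v (tscale t x)) = tmap \<phi> (p, v) + t *\<^sub>R (0, comps \<phi> x)"
          by (simp add: tmap_def comps_add comps_scale)
        ultimately show ?thesis using tmap_inv(2)[OF c(1), of "(p, tadd v (tscale t x))"] by simp
      qed
      have "((\<lambda>t. tmap \<phi> (p, v) + t *\<^sub>R (0, comps \<phi> x)) has_derivative (\<lambda>t. t *\<^sub>R (0, comps \<phi> x))) (at 0)"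
        by (auto intro!: derivative_eq_intros)
      moreover have "tmap \<phi> (p, v) + 0 *\<^sub>R (0, comps \<phi> x) = tmap \<phi> (p, v)"
        by (simp only: scaleR_zero_left add_0_right)
      then have "(?k has_derivative frechet_derivative ?k (at (tmap \<phi> (p, v))))
          (at (tmap \<phi> (p, v) + 0 *\<^sub>R (0, comps \<phi> x)))" using D by (simp only:)
      ultimately have "((\<lambda>t. F (p, tadd v (tscale t x))) has_derivative
          (\<lambda>t. frechet_derivative ?k (at (tmap \<phi> (p, v))) (t *\<^sub>R (0, comps \<phi> x)))) (at 0)"
        unfolding eq using diff_chain_at by (force simp: o_def)
      moreover have "(\<lambda>t. frechet_derivative ?k (at (tmap \<phi> (p, v))) (t *\<^sub>R (0, comps \<phi> x))) =
          (*) (frechet_derivative ?k (at (tmap \<phi> (p, v))) (0, comps \<phi> x))"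
        by (rule ext) (simp only: linear_cmul[OF has_derivative_linear[OF D]] real_scaleR_def mult.commute)
      ultimately have "((\<lambda>t. F (p, tadd v (tscale t x))) has_field_derivative
          frechet_derivative ?k (at (tmap \<phi> (p, v))) (0, comps \<phi> x)) (at 0)"
        unfolding has_field_derivative_def by simp
      from DERIV_imp_deriv[OF this] show ?thesis
        using True by (simp add: vertical_lift_def TM.coord_vec_def)
    qed (simp add: vertical_lift_def TM.coord_vec_def)
  qed
  then show ?thesis using TM.coord_vec_tangent[OF C uT] by simp
qed

lemma vl_base: "vl u x (\<lambda>u. f (fst u)) = 0"
  by (simp add: vertical_lift_def)

lemma vl_lin:
  assumes u: "(p, v) \<in> pts TB" and f: "smooth_near A p f"
  shows "vl (p, v) x (\<lambda>u. snd u f) = x f"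
proof -
  have "((\<lambda>t. v f + t * x f) has_field_derivative x f) (at 0)" by (auto intro!: derivative_eq_intros)
  then show ?thesis
    using smooth_lin[OF u f] by (simp add: vertical_lift_def tvec_apply DERIV_imp_deriv)
qed

text \<open>The second covariant derivative of \<open>f\<close>. It is also the value of the
  horizontal lift of \<open>X p\<close> at \<open>(p, Y p)\<close> on the fibrewise linear function
  of \<open>f\<close>, which is the property that drives the bracket computations.\<close>

definition hess :: "'a \<Rightarrow> ('a \<Rightarrow> real) \<Rightarrow> 'a vfield \<Rightarrow> 'a vfield \<Rightarrow> real" where
  "hess p f X Y = X p (\<lambda>q. Y q f) - nab X Y p f"

lemma hess_tensorial1:
  assumes "vfield_on A V Y" "p \<in> V" shows "tensorial_at p (\<lambda>X. hess p f X Y)"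
  unfolding hess_def
  by (rule tensorial_diff[OF _ conn_tensorial1[OF nab assms]], rule tensorialI) (simp_all add: tvec_apply)

text \<open>The Leibniz terms of \<open>X p (\<lambda>q. Y q f)\<close> and of
  \<open>nab X Y p f\<close> coincide and cancel.\<close>

lemma hess_tensorial2:
  assumes X: "vfield_on A V X" "p \<in> V" and f: "smooth_near A p f"
  shows "tensorial_at p (\<lambda>Y. hess p f X Y)"
  unfolding hess_def
proof (rule tensorialI_within[OF vfield_open[OF X(1)] X(2)])
  fix U Y Y' assume *: "U \<subseteq> V" "p \<in> U" "vfield_on A U Y" "vfield_on A U Y'"
  have XU: "vfield_on A U X" using vfield_subset[OF X(1) vfield_open[OF *(3)] *(1)] .
  show "X p (\<lambda>q. tadd (Y q) (Y' q) f) - nab X (\<lambda>q. tadd (Y q) (Y' q)) p f =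
      X p (\<lambda>q. Y q f) - nab X Y p f + (X p (\<lambda>q. Y' q f) - nab X Y' p f)"
    unfolding conn_add2[OF nab XU *(3,4,2)] tvec_apply
    using tangent_add[OF vfield_tangent[OF X] vfield_smooth_near[OF *(3,2) f] vfield_smooth_near[OF *(4,2) f]] by simp
next
  fix U h Y assume *: "U \<subseteq> V" "p \<in> U" "smooth_fun_on A U h" "vfield_on A U Y"
  have XU: "vfield_on A U X" using vfield_subset[OF X(1) vfield_open[OF *(4)] *(1)] .
  have h: "smooth_near A p h" using *(2,3) by (auto simp: smooth_fun_on_iff)
  show "X p (\<lambda>q. tscale (h q) (Y q) f) - nab X (\<lambda>q. tscale (h q) (Y q)) p f = h p * (X p (\<lambda>q. Y q f) - nab X Y p f)"
    unfolding conn_scale2[OF nab *(3) XU *(4,2)] tvec_apply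
    using tangent_mult[OF vfield_tangent[OF X] h vfield_smooth_near[OF *(4,2) f]] by (simp add: algebra_simps)
qed

lemma hess_eq:
  assumes "vfield_on A U X" "vfield_on A U Y" "p \<in> U" "vfield_on A V X'" "vfield_on A V Y'" "p \<in> V"
    and "X p = X' p" "Y p = Y' p" and f: "smooth_near A p f"
  shows "hess p f X Y = hess p f X' Y'"
  using tensorial_eq[OF hess_tensorial1[OF assms(2,3)] assms(3,1,6,4,7), of f]
    tensorial_eq[OF hess_tensorial2[OF assms(4,6) f] assms(3,2,6,5,8)] by simp

text \<open>On smooth \<open>F\<close> the vector \<open>w\<close> acts as \<open>X p\<close> does
  on the function \<open>q\<close> to \<open>F (q, Y q)\<close>, so the derivation laws are
  inherited from \<open>X p\<close>.\<close>

lemma horizontal_space_props: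
  assumes w: "w = differential TB (\<lambda>q. (q, Y q)) p (X p)"
    and X: "vfield_on A U X" and Y: "vfield_on A U Y" and p: "p \<in> U"
  shows "w \<in> tangent_space TB (p, Y p)"
    and "smooth_near A p f \<Longrightarrow> w (\<lambda>u. f (fst u)) = X p f"
    and "smooth_near A p f \<Longrightarrow> w (\<lambda>u. snd u f) = X p (\<lambda>q. Y q f)"
proof -
  have u: "(p, Y p) \<in> pts TB" using openin_pts[OF vfield_open[OF X] p] vfield_tangent[OF Y p] by (simp add: TM_pts_iff)
  have ws: "w F = X p (\<lambda>q. F (q, Y q))" if "smooth_near TB (p, Y p) F" for F
    using that unfolding w differential_def by (simp add: o_def)
  note s = section_smooth[OF Y p] and t = vfield_tangent[OF X p]
  show "w \<in> tangent_space TB (p, Y p)"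
    unfolding tangent_space_def
  proof (intro CollectI conjI allI impI)
    fix F assume "\<not> smooth_near TB (p, Y p) F"
    then show "w F = 0" unfolding w differential_def by simp
  next
    fix F G assume FG: "smooth_near TB (p, Y p) F \<and> smooth_near TB (p, Y p) G"
    then show "w (\<lambda>q. F q + G q) = w F + w G"
      using tangent_add[OF t s s, of F G] TM.smooth_near_add[of "(p, Y p)" F G] by (simp add: ws)
    show "w (\<lambda>q. F q * G q) = F (p, Y p) * w G + G (p, Y p) * w F"
      using FG tangent_mult[OF t s s, of F G] TM.smooth_near_mult[of "(p, Y p)" F G] by (simp add: ws)
  next
    fix F k assume F: "smooth_near TB (p, Y p) F"
    then show "w (\<lambda>q. k * F q) = k * w F"
      using tangent_scale[OF t s, of F k] TM.smooth_near_mult[OF TM.smooth_near_const[OF u] F, of k] by (simp add: ws)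
  qed
  show "w (\<lambda>u. f (fst u)) = X p f" if "smooth_near A p f" using ws[OF smooth_base[OF u that]] by simp
  show "w (\<lambda>u. snd u f) = X p (\<lambda>q. Y q f)" if "smooth_near A p f" using ws[OF smooth_lin[OF u that]] by simp
qed

lemma ex_parallel_extension:
  assumes p: "p \<in> pts A" and v: "v \<in> tangent_space A p" and x: "x \<in> tangent_space A p"
  obtains U X Y where "vfield_on A U X" "vfield_on A U Y" "p \<in> U" "X p = x" "Y p = v" "nab X Y p = tzero"
proof -
  obtain V \<phi> where c: "(V, \<phi>) \<in> A" "p \<in> V" using p by (auto simp: pts_iff)
  define X where "X q = coord_vec V \<phi> q (comps \<phi> x)" for q
  define Y0 where "Y0 q = coord_vec V \<phi> q (comps \<phi> v)" for q
  define e where "e b q = coord_vec V \<phi> q b" for b q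
  define N where "N b q = coord_vec V \<phi> q (comps \<phi> (nab (e b) Y0 p))" for b q
  \<comment> \<open>A first-order correction of the constant-coefficient extension
    \<open>Y0\<close>. The functions \<open>f b\<close> vanish at \<open>p\<close>, so the value
    \<open>v\<close> is kept, and their derivatives there are minus those of the coordinates, so the
    Leibniz terms cancel the derivatives of \<open>Y0\<close> in all coordinate directions.\<close>
  define f where "f b q = \<phi> p \<bullet> b - \<phi> q \<bullet> b" for b q
  define Y where "Y q = tadd (Y0 q) (tsum (\<lambda>b. tscale (f b q) (N b q)) Basis)" for q
  have X: "vfield_on A V X" "X p = x" and Y0: "vfield_on A V Y0" "Y0 p = v" and e: "vfield_on A V (e b)" for b
    unfolding X_def[abs_def] Y0_def[abs_def] e_def[abs_def]
    using vfield_extend[OF c x] vfield_extend[OF c v] vfield_coord[OF c(1)] by auto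
  have N: "vfield_on A V (N b)" "N b p = nab (e b) Y0 p" for b
    unfolding N_def[abs_def] using vfield_extend[OF c conn_tangent[OF nab e Y0(1) c(2)]] by auto
  have f: "smooth_fun_on A V (f b)" for b
    unfolding smooth_fun_on_iff f_def[abs_def]
    using openin_chart[OF c(1)] by (auto intro!: smooth_near_diff smooth_near_const smooth_near_coord[OF c(1)] intro: openin_pts)
  have S: "vfield_on A V (\<lambda>q. tsum (\<lambda>b. tscale (f b q) (N b q)) Basis)"
    by (intro vfield_sum openin_chart[OF c(1)] vfield_scale f N)
  have Y: "vfield_on A V Y" unfolding Y_def[abs_def] by (rule vfield_add[OF Y0(1) S])
  have fp: "f b p = 0" for b by (simp add: f_def)
  have Xf: "X p (f b) = - x (\<lambda>q. \<phi> q \<bullet> b)" for b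
    unfolding f_def[abs_def] X(2)
    using tangent_diff[OF x smooth_near_const[OF p] smooth_near_coord[OF c]] tangent_const[OF x p] by simp
  have Yp: "Y p = v" unfolding Y_def Y0(2) fp by (simp add: tadd_def tsum_def tscale_def)
  have "nab X Y p h = 0" for h
  proof -
    have "nab X Y p = tadd (nab X Y0 p) (tsum (\<lambda>b. tadd (tscale (X p (f b)) (N b p)) (tscale (f b p) (nab X (N b) p))) Basis)"
      unfolding Y_def[abs_def] conn_add2[OF nab X(1) Y0(1) S c(2)]
      by (subst conn_sum2[OF nab X(1) c(2) _ f N(1)]) auto
    then have "nab X Y p h = nab X Y0 p h - (\<Sum>b\<in>Basis. x (\<lambda>q. \<phi> q \<bullet> b) * nab (e b) Y0 p h)"
      unfolding fp Xf N(2) by (simp add: tvec_apply sum_negf)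
    moreover have "nab X Y0 p h = (\<Sum>b\<in>Basis. X p (\<lambda>q. \<phi> q \<bullet> b) * nab (e b) Y0 p h)"
    proof (rule tensorial_frame[OF conn_tensorial1[OF nab Y0(1) c(2)] c(2) X(1) _ e,
          where f = "\<lambda>b q. X q (\<lambda>r. \<phi> r \<bullet> b)"])
      show "smooth_fun_on A V (\<lambda>q. X q (\<lambda>r. \<phi> r \<bullet> b))" for b
        using openin_chart[OF c(1)]
        by (auto simp: smooth_fun_on_iff intro!: vfield_smooth_near[OF X(1)] smooth_near_coord[OF c(1)])
      show "X q = tsum (\<lambda>b. tscale (X q (\<lambda>r. \<phi> r \<bullet> b)) (e b q)) Basis" if "q \<in> V" for q
        unfolding tsum_def tscale_def e_def
        by (intro ext tangent_expand[OF c(1) that vfield_tangent[OF X(1) that]])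
    qed simp
    ultimately show ?thesis using X(2) by simp
  qed
  then have "nab X Y p = tzero" by (auto simp: tzero_def)
  then show ?thesis using that X Y c(2) Yp by blast
qed

text \<open>For a section \<open>Y\<close> with \<open>nab X Y p = tzero\<close>, the number
  \<open>X p (\<lambda>q. Y q f)\<close> is \<open>hess p f X Y\<close>, and this is tensorial in
  both fields. So every candidate for the lift has the same values on pullbacks and on fibrewise
  linear functions, whatever section it comes from; a parallel extension provides one.\<close>

lemma hl_props:
  assumes u: "(p, v) \<in> pts TB" and x: "x \<in> tangent_space A p"
  shows hl_tangent: "hl (p, v) x \<in> tangent_space TB (p, v)"
    and hl_base: "\<And>f. smooth_near A p f \<Longrightarrow> hl (p, v) x (\<lambda>u. f (fst u)) = x f"
    and hl_lin: "\<And>f U X Y. smooth_near A p f \<Longrightarrow> vfield_on A U X \<Longrightarrow> vfield_on A U Y \<Longrightarrow> p \<in> U \<Longrightarrow>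
      X p = x \<Longrightarrow> Y p = v \<Longrightarrow> hl (p, v) x (\<lambda>u. snd u f) = hess p f X Y"
proof -
  have p: "p \<in> pts A" and v: "v \<in> tangent_space A p" using u by (auto simp: TM_pts_iff)
  let ?P = "\<lambda>w. w \<in> horizontal_space A nab (p, v) \<and> differential A fst (p, v) w = x"
  let ?Q = "\<lambda>w. w \<in> tangent_space TB (p, v) \<and> (\<forall>f. smooth_near A p f \<longrightarrow> w (\<lambda>u. f (fst u)) = x f) \<and>
    (\<forall>f U X Y. smooth_near A p f \<and> vfield_on A U X \<and> vfield_on A U Y \<and> p \<in> U \<and> X p = x \<and> Y p = v \<longrightarrow>
      w (\<lambda>u. snd u f) = hess p f X Y)"
  have PQ: "?Q w" if P: "?P w" for w
  proof -
    obtain U X Y where XY: "vfield_on A U X" "vfield_on A U Y" "p \<in> U" "Y p = v" "nab X Y p = tzero"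
      and w: "w = differential TB (\<lambda>q. (q, Y q)) p (X p)"
      using P unfolding horizontal_space_def by auto
    note W = horizontal_space_props[OF w XY(1-3)]
    have "X p f = x f" for f
    proof (cases "smooth_near A p f")
      case True
      have "x f = differential A fst (p, v) w f" using P by simp
      also have "\<dots> = w (\<lambda>u. f (fst u))" using True by (simp add: differential_def o_def)
      finally show ?thesis using W(2)[OF True] by simp
    next
      case False
      then show ?thesis using tangent_not_smooth[OF x] tangent_not_smooth[OF vfield_tangent[OF XY(1,3)]] by simp
    qed
    then have Xp: "X p = x" by auto
    show ?thesis
    proof (intro conjI allI impI; (elim conjE)?)
      show "w \<in> tangent_space TB (p, v)" using W(1) XY(4) by simp
      fix f assume f: "smooth_near A p f"
      show "w (\<lambda>u. f (fst u)) = x f" using W(2)[OF f] Xp by simp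
      fix U' X' Y' assume XY': "vfield_on A U' X'" "vfield_on A U' Y'" "p \<in> U'" "X' p = x" "Y' p = v"
      have "w (\<lambda>u. snd u f) = hess p f X Y" unfolding W(3)[OF f] hess_def XY(5) by (simp add: tzero_apply)
      also have "\<dots> = hess p f X' Y'"
        by (rule hess_eq[OF XY(1-3) XY'(1-3) _ _ f]) (use Xp XY(4) XY' in auto)
      finally show "w (\<lambda>u. snd u f) = hess p f X' Y'" .
    qed
  qed
  obtain U X Y where XY: "vfield_on A U X" "vfield_on A U Y" "p \<in> U" "X p = x" "Y p = v" "nab X Y p = tzero"
    using ex_parallel_extension[OF p v x] .
  let ?w = "differential TB (\<lambda>q. (q, Y q)) p (X p)"
  have ex: "?P ?w"
  proof
    show "?w \<in> horizontal_space A nab (p, v)"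
      unfolding horizontal_space_def
      by (intro CollectI exI[of _ U] exI[of _ X] exI[of _ Y]) (use XY in simp)
    show "differential A fst (p, v) ?w = x"
    proof
      fix f
      show "differential A fst (p, v) ?w f = x f"
        using horizontal_space_props(2)[OF refl XY(1-3), of f] XY(4) tangent_not_smooth[OF x, of f]
        by (simp add: differential_def[of A] o_def)
    qed
  qed
  have uniq: "w = w'" if "?P w" "?P w'" for w w'
  proof (rule TM_tangent_eqI[OF _ _ u])
    note Q = PQ[OF that(1)] PQ[OF that(2)]
    show "w \<in> tangent_space TB (p, v)" "w' \<in> tangent_space TB (p, v)" using Q by auto
    fix f assume f: "smooth_near A p f"
    show "w (\<lambda>u. f (fst u)) = w' (\<lambda>u. f (fst u))" using Q f by auto
    have "w (\<lambda>u. snd u f) = hess p f X Y" "w' (\<lambda>u. snd u f) = hess p f X Y" using Q f XY by blast+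
    then show "w (\<lambda>u. snd u f) = w' (\<lambda>u. snd u f)" by simp
  qed
  have "\<exists>!w. ?P w" by (rule ex_ex1I, rule exI, rule ex, rule uniq)
  from theI'[OF this] have "?P (hl (p, v) x)" unfolding horizontal_lift_def .
  from PQ[OF this] show "hl (p, v) x \<in> tangent_space TB (p, v)"
    "\<And>f. smooth_near A p f \<Longrightarrow> hl (p, v) x (\<lambda>u. f (fst u)) = x f"
    "\<And>f U X Y. smooth_near A p f \<Longrightarrow> vfield_on A U X \<Longrightarrow> vfield_on A U Y \<Longrightarrow> p \<in> U \<Longrightarrow>
      X p = x \<Longrightarrow> Y p = v \<Longrightarrow> hl (p, v) x (\<lambda>u. snd u f) = hess p f X Y"
    by blast+
qed

end

section \<open>The canonical Hermitian structure\<close>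

context affine_riemann
begin

lemma tangent_ext:
  assumes "x \<in> tangent_space A p" "y \<in> tangent_space A p" "\<And>f. smooth_near A p f \<Longrightarrow> x f = y f"
  shows "x = y"
proof
  fix f show "x f = y f"
    using assms(3)[of f] tangent_not_smooth[OF assms(1), of f] tangent_not_smooth[OF assms(2), of f]
    by (cases "smooth_near A p f") auto
qed

section \<open>The splitting into horizontal and vertical vectors\<close>

context
  fixes p v assumes u: "(p, v) \<in> pts TB"
begin

lemma base_pts: "p \<in> pts A" and fibre_tangent: "v \<in> tangent_space A p"
  using u by (auto simp: TM_pts_iff)

lemma hl_add:
  assumes x: "x \<in> tangent_space A p" and y: "y \<in> tangent_space A p"
  shows "hl (p, v) (tadd x y) = tadd (hl (p, v) x) (hl (p, v) y)"
proof -
  obtain V \<phi> where c: "(V, \<phi>) \<in> A" "p \<in> V" using base_pts by (auto simp: pts_iff)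
  note X = vfield_extend[OF c x] and Y = vfield_extend[OF c y] and Z = vfield_extend[OF c fibre_tangent]
  note xy = tadd_tangent[OF x y]
  show ?thesis
  proof (rule TM_tangent_eqI[OF hl_tangent[OF u xy] TM.tadd_tangent[OF hl_tangent[OF u x] hl_tangent[OF u y]] u])
    fix f assume f: "smooth_near A p f"
    show "hl (p, v) (tadd x y) (\<lambda>u. f (fst u)) = tadd (hl (p, v) x) (hl (p, v) y) (\<lambda>u. f (fst u))"
      by (simp add: tadd_apply hl_base[OF u x f] hl_base[OF u y f] hl_base[OF u xy f])
    show "hl (p, v) (tadd x y) (\<lambda>u. snd u f) = tadd (hl (p, v) x) (hl (p, v) y) (\<lambda>u. snd u f)"
      using hl_lin[OF u xy f vfield_add[OF X(1) Y(1)] Z(1) c(2) _ Z(2)] X(2) Y(2)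
        hl_lin[OF u x f X(1) Z(1) c(2) X(2) Z(2)] hl_lin[OF u y f Y(1) Z(1) c(2) Y(2) Z(2)]
        tensorial_add[OF hess_tensorial1[OF Z(1) c(2)] c(2) X(1) Y(1), of f]
        tadd_apply[of "hl (p, v) x" "hl (p, v) y" "\<lambda>u. snd u f"] by simp
  qed
qed

lemma hl_scale:
  assumes x: "x \<in> tangent_space A p"
  shows "hl (p, v) (tscale k x) = tscale k (hl (p, v) x)"
proof -
  obtain V \<phi> where c: "(V, \<phi>) \<in> A" "p \<in> V" using base_pts by (auto simp: pts_iff)
  note X = vfield_extend[OF c x] and Z = vfield_extend[OF c fibre_tangent]
  note kx = tscale_tangent[OF x, of k]
  note k = smooth_fun_const[OF openin_chart[OF c(1)], of k]
  show ?thesis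
  proof (rule TM_tangent_eqI[OF hl_tangent[OF u kx] TM.tscale_tangent[OF hl_tangent[OF u x]] u])
    fix f assume f: "smooth_near A p f"
    show "hl (p, v) (tscale k x) (\<lambda>u. f (fst u)) = tscale k (hl (p, v) x) (\<lambda>u. f (fst u))"
      by (simp add: tscale_apply hl_base[OF u x f] hl_base[OF u kx f])
    show "hl (p, v) (tscale k x) (\<lambda>u. snd u f) = tscale k (hl (p, v) x) (\<lambda>u. snd u f)"
      using hl_lin[OF u kx f vfield_scale[OF k X(1)] Z(1) c(2) _ Z(2)] X(2)
        hl_lin[OF u x f X(1) Z(1) c(2) X(2) Z(2)]
        tensorial_scale[OF hess_tensorial1[OF Z(1) c(2)] c(2) k X(1), of f]
        tscale_apply[of k "hl (p, v) x" "\<lambda>u. snd u f"] by simp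
  qed
qed

lemma vl_add:
  assumes x: "x \<in> tangent_space A p" and y: "y \<in> tangent_space A p"
  shows "vl (p, v) (tadd x y) = tadd (vl (p, v) x) (vl (p, v) y)"
  by (rule TM_tangent_eqI[OF vl_tangent[OF u tadd_tangent[OF x y]] TM.tadd_tangent[OF vl_tangent[OF u x] vl_tangent[OF u y]] u])
    (simp_all add: tadd_apply vl_base vl_lin[OF u])

lemma vl_scale:
  assumes x: "x \<in> tangent_space A p"
  shows "vl (p, v) (tscale k x) = tscale k (vl (p, v) x)"
  by (rule TM_tangent_eqI[OF vl_tangent[OF u tscale_tangent[OF x]] TM.tscale_tangent[OF vl_tangent[OF u x]] u])
    (simp_all add: tscale_apply vl_base vl_lin[OF u])

lemma lift_zero: "hl (p, v) tzero = tzero" "vl (p, v) tzero = tzero"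
  using hl_scale[OF tzero_tangent, of 0] vl_scale[OF tzero_tangent, of 0] by (simp_all add: tscale_def tzero_def)

lemma dpi_apply: "smooth_near A p f \<Longrightarrow> differential A fst (p, v) w f = w (\<lambda>u. f (fst u))"
  by (simp add: differential_def o_def)

lemma dpi_tangent:
  assumes w: "w \<in> tangent_space TB (p, v)"
  shows "differential A fst (p, v) w \<in> tangent_space A p"
  unfolding tangent_space_def
proof (intro CollectI conjI allI impI)
  fix f assume "\<not> smooth_near A p f"
  then show "differential A fst (p, v) w f = 0" by (simp add: differential_def)
next
  fix f h assume fh: "smooth_near A p f \<and> smooth_near A p h"
  then have f: "smooth_near A p f" and h: "smooth_near A p h" by auto
  show "differential A fst (p, v) w (\<lambda>q. f q + h q) = differential A fst (p, v) w f + differential A fst (p, v) w h"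
    using TM.tangent_add[OF w smooth_base[OF u f] smooth_base[OF u h]]
    by (simp add: dpi_apply f h smooth_near_add)
  show "differential A fst (p, v) w (\<lambda>q. f q * h q) = f p * differential A fst (p, v) w h + h p * differential A fst (p, v) w f"
    using TM.tangent_mult[OF w smooth_base[OF u f] smooth_base[OF u h]]
    by (simp add: dpi_apply f h smooth_near_mult)
next
  fix f k assume f: "smooth_near A p f"
  show "differential A fst (p, v) w (\<lambda>q. k * f q) = k * differential A fst (p, v) w f"
    using TM.tangent_scale[OF w smooth_base[OF u f], of k]
    by (simp add: dpi_apply f smooth_near_mult[OF smooth_near_const[OF base_pts] f])
qed

lemma dpi_lift:
  assumes x: "x \<in> tangent_space A p" and y: "y \<in> tangent_space A p"
  shows "differential A fst (p, v) (tadd (hl (p, v) x) (vl (p, v) y)) = x"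
  by (rule tangent_ext[OF dpi_tangent[OF TM.tadd_tangent[OF hl_tangent[OF u x] vl_tangent[OF u y]]] x])
    (simp add: dpi_apply tadd_apply hl_base[OF u x] vl_base)

lemma lift_decompose:
  assumes w: "w \<in> tangent_space TB (p, v)"
  shows "\<exists>y\<in>tangent_space A p. w = tadd (hl (p, v) (differential A fst (p, v) w)) (vl (p, v) y)"
proof -
  obtain V \<phi> where c: "(V, \<phi>) \<in> A" "p \<in> V" using base_pts by (auto simp: pts_iff)
  let ?x = "differential A fst (p, v) w"
  note x = dpi_tangent[OF w]
  \<comment> \<open>The vertical part is what the horizontal lift of the projection leaves over in
    the fibre coordinates.\<close>
  let ?y = "coord_vec V \<phi> p (\<Sum>b\<in>Basis. (w (\<lambda>u. snd u (\<lambda>q. \<phi> q \<bullet> b)) - hl (p, v) ?x (\<lambda>u. snd u (\<lambda>q. \<phi> q \<bullet> b))) *\<^sub>R b)"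
  have y: "?y \<in> tangent_space A p" using coord_vec_tangent[OF c] .
  have "w = tadd (hl (p, v) ?x) (vl (p, v) ?y)"
  proof (rule TM_tangent_eqI_chart[OF w TM.tadd_tangent[OF hl_tangent[OF u x] vl_tangent[OF u y]] u c])
    fix b :: 'e assume b: "b \<in> Basis"
    note s = smooth_near_coord[OF c, of b]
    show "w (\<lambda>u. \<phi> (fst u) \<bullet> b) = tadd (hl (p, v) ?x) (vl (p, v) ?y) (\<lambda>u. \<phi> (fst u) \<bullet> b)"
      using hl_base[OF u x s] vl_base[of "(p, v)" ?y "\<lambda>q. \<phi> q \<bullet> b"] dpi_apply[OF s, of w] by (simp add: tadd_apply)
    show "w (\<lambda>u. snd u (\<lambda>q. \<phi> q \<bullet> b)) = tadd (hl (p, v) ?x) (vl (p, v) ?y) (\<lambda>u. snd u (\<lambda>q. \<phi> q \<bullet> b))"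
      using b by (simp add: tadd_apply vl_lin[OF u s] coord_vec_coord[OF c] inner_sum_left_Basis)
  qed
  with y show ?thesis by blast
qed

lemma lift_inj:
  assumes "x \<in> tangent_space A p" "y \<in> tangent_space A p" "x' \<in> tangent_space A p" "y' \<in> tangent_space A p"
    and eq: "tadd (hl (p, v) x) (vl (p, v) y) = tadd (hl (p, v) x') (vl (p, v) y')"
  shows "x = x'" "y = y'"
proof -
  show x: "x = x'" using dpi_lift[OF assms(1,2)] dpi_lift[OF assms(3,4)] eq by simp
  show "y = y'"
  proof (rule tangent_ext[OF assms(2,4)])
    fix f assume f: "smooth_near A p f"
    show "y f = y' f"
      using fun_cong[OF eq, of "\<lambda>u. snd u f"] x by (simp add: tadd_apply vl_lin[OF u f])
  qed
qed

lemma canonical_J_lift: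
  assumes x: "x \<in> tangent_space A p" and y: "y \<in> tangent_space A p"
  shows "canonical_J A nab (p, v) (tadd (hl (p, v) x) (vl (p, v) y)) = tdiff (vl (p, v) x) (hl (p, v) y)"
  unfolding canonical_J_def
proof (rule the_equality)
  show "\<exists>x'\<in>tangent_space A (fst (p, v)). \<exists>y'\<in>tangent_space A (fst (p, v)).
      tadd (hl (p, v) x) (vl (p, v) y) = tadd (hl (p, v) x') (vl (p, v) y') \<and>
      tdiff (vl (p, v) x) (hl (p, v) y) = tdiff (vl (p, v) x') (hl (p, v) y')"
    using x y by auto
  fix w assume "\<exists>x'\<in>tangent_space A (fst (p, v)). \<exists>y'\<in>tangent_space A (fst (p, v)).
      tadd (hl (p, v) x) (vl (p, v) y) = tadd (hl (p, v) x') (vl (p, v) y') \<and> w = tdiff (vl (p, v) x') (hl (p, v) y')"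
  then obtain x' y' where "x' \<in> tangent_space A p" "y' \<in> tangent_space A p"
    "tadd (hl (p, v) x) (vl (p, v) y) = tadd (hl (p, v) x') (vl (p, v) y')" "w = tdiff (vl (p, v) x') (hl (p, v) y')"
    by auto
  then show "w = tdiff (vl (p, v) x) (hl (p, v) y)" using lift_inj[OF x y] by metis
qed

lemma canonical_g_lift:
  assumes x: "x \<in> tangent_space A p" and y: "y \<in> tangent_space A p"
    and x': "x' \<in> tangent_space A p" and y': "y' \<in> tangent_space A p"
  shows "canonical_g A nab g (p, v) (tadd (hl (p, v) x) (vl (p, v) y)) (tadd (hl (p, v) x') (vl (p, v) y')) = g p x x' + g p y y'"
  unfolding canonical_g_def
proof (rule the_equality)
  show "\<exists>a\<in>tangent_space A (fst (p, v)). \<exists>b\<in>tangent_space A (fst (p, v)).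
      \<exists>a'\<in>tangent_space A (fst (p, v)). \<exists>b'\<in>tangent_space A (fst (p, v)).
      tadd (hl (p, v) x) (vl (p, v) y) = tadd (hl (p, v) a) (vl (p, v) b) \<and>
      tadd (hl (p, v) x') (vl (p, v) y') = tadd (hl (p, v) a') (vl (p, v) b') \<and>
      g p x x' + g p y y' = g (fst (p, v)) a a' + g (fst (p, v)) b b'"
    unfolding fst_conv
    by (rule bexI[OF _ x], rule bexI[OF _ y], rule bexI[OF _ x'], rule bexI[OF _ y']) simp
  fix r assume "\<exists>a\<in>tangent_space A (fst (p, v)). \<exists>b\<in>tangent_space A (fst (p, v)).
      \<exists>a'\<in>tangent_space A (fst (p, v)). \<exists>b'\<in>tangent_space A (fst (p, v)).
      tadd (hl (p, v) x) (vl (p, v) y) = tadd (hl (p, v) a) (vl (p, v) b) \<and>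
      tadd (hl (p, v) x') (vl (p, v) y') = tadd (hl (p, v) a') (vl (p, v) b') \<and>
      r = g (fst (p, v)) a a' + g (fst (p, v)) b b'"
  then obtain a b a' b' where ab: "a \<in> tangent_space A p" "b \<in> tangent_space A p" "a' \<in> tangent_space A p" "b' \<in> tangent_space A p"
    and eq: "tadd (hl (p, v) x) (vl (p, v) y) = tadd (hl (p, v) a) (vl (p, v) b)"
      "tadd (hl (p, v) x') (vl (p, v) y') = tadd (hl (p, v) a') (vl (p, v) b')"
      and r: "r = g p a a' + g p b b'"
    unfolding fst_conv by (elim bexE conjE)
  show "r = g p x x' + g p y y'"
    unfolding r lift_inj[OF x y ab(1,2) eq(1)] lift_inj[OF x' y' ab(3,4) eq(2)] ..
qed

end

definition dpi :: "'a tpoint \<Rightarrow> 'a tpoint tvec \<Rightarrow> 'a tvec" where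
  "dpi u w = differential A fst u w"

text \<open>The connection map of \<open>nab\<close>, which identifies the vertical part of a vector
  with a tangent vector of the base. The choice is unique by \<open>lift_inj\<close>.\<close>

definition vpart :: "'a tpoint \<Rightarrow> 'a tpoint tvec \<Rightarrow> 'a tvec" where
  "vpart u w = (SOME y. y \<in> tangent_space A (fst u) \<and> w = tadd (hl u (dpi u w)) (vl u y))"

abbreviation g1 :: "'a tpoint \<Rightarrow> 'a tpoint tvec \<Rightarrow> 'a tpoint tvec \<Rightarrow> real" where
  "g1 \<equiv> canonical_g A nab g"

abbreviation J1 :: "'a tpoint \<Rightarrow> 'a tpoint tvec \<Rightarrow> 'a tpoint tvec" where
  "J1 \<equiv> canonical_J A nab"

abbreviation \<omega>1 :: "'a tpoint \<Rightarrow> 'a tpoint tvec \<Rightarrow> 'a tpoint tvec \<Rightarrow> real" where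
  "\<omega>1 \<equiv> fundamental_form J1 g1"

context
  fixes u assumes u: "u \<in> pts TB"
begin

lemma pair_pts: "(fst u, snd u) \<in> pts TB"
  using u by simp

lemma parts_tangent:
  assumes w: "w \<in> tangent_space TB u"
  shows "dpi u w \<in> tangent_space A (fst u)" "vpart u w \<in> tangent_space A (fst u)"
    and parts: "w = tadd (hl u (dpi u w)) (vl u (vpart u w))"
proof -
  have w': "w \<in> tangent_space TB (fst u, snd u)" using w by simp
  show "dpi u w \<in> tangent_space A (fst u)" using dpi_tangent[OF pair_pts w'] by (simp add: dpi_def)
  have "\<exists>y. y \<in> tangent_space A (fst u) \<and> w = tadd (hl u (dpi u w)) (vl u y)"
    using lift_decompose[OF pair_pts w'] by (simp add: dpi_def) blast
  then have "vpart u w \<in> tangent_space A (fst u) \<and> w = tadd (hl u (dpi u w)) (vl u (vpart u w))"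
    unfolding vpart_def by (rule someI_ex)
  then show "vpart u w \<in> tangent_space A (fst u)" "w = tadd (hl u (dpi u w)) (vl u (vpart u w))" by auto
qed

lemma lift_tangent:
  assumes "x \<in> tangent_space A (fst u)"
  shows "hl u x \<in> tangent_space TB u" "vl u x \<in> tangent_space TB u"
  using hl_tangent[OF pair_pts assms] vl_tangent[OF pair_pts assms] by simp_all

lemma parts_eq:
  assumes x: "x \<in> tangent_space A (fst u)" and y: "y \<in> tangent_space A (fst u)"
  shows "dpi u (tadd (hl u x) (vl u y)) = x" "vpart u (tadd (hl u x) (vl u y)) = y"
proof -
  have w: "tadd (hl u x) (vl u y) \<in> tangent_space TB u"
    using lift_tangent[OF x] lift_tangent[OF y] by (intro TM.tadd_tangent)
  note i = lift_inj[OF pair_pts x y parts_tangent(1,2)[OF w]]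
  show "dpi u (tadd (hl u x) (vl u y)) = x" "vpart u (tadd (hl u x) (vl u y)) = y"
    using i parts[OF w] by simp_all
qed

lemma lift_as_sum:
  assumes x: "x \<in> tangent_space A (fst u)"
  shows "hl u x = tadd (hl u x) (vl u tzero)" "vl u x = tadd (hl u tzero) (vl u x)"
  using lift_zero[OF pair_pts] by (simp_all add: tadd_def tzero_def)

lemma parts_lift:
  assumes x: "x \<in> tangent_space A (fst u)"
  shows "dpi u (hl u x) = x" "vpart u (hl u x) = tzero" "dpi u (vl u x) = tzero" "vpart u (vl u x) = x"
  using parts_eq[OF x tzero_tangent] parts_eq[OF tzero_tangent x] lift_as_sum[OF x] by metis+

lemma parts_add:
  assumes w: "w \<in> tangent_space TB u" "w' \<in> tangent_space TB u"
  shows "dpi u (tadd w w') = tadd (dpi u w) (dpi u w')" "vpart u (tadd w w') = tadd (vpart u w) (vpart u w')"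
proof -
  note t = parts_tangent(1,2)[OF w(1)] parts_tangent(1,2)[OF w(2)]
  have "tadd w w' = tadd (tadd (hl u (dpi u w)) (vl u (vpart u w))) (tadd (hl u (dpi u w')) (vl u (vpart u w')))"
    using parts[OF w(1)] parts[OF w(2)] by simp
  also have "\<dots> = tadd (hl u (tadd (dpi u w) (dpi u w'))) (vl u (tadd (vpart u w) (vpart u w')))"
    using hl_add[OF pair_pts t(1,3)] vl_add[OF pair_pts t(2,4)] by (simp add: tadd_def add_ac)
  finally have eq: "tadd w w' = tadd (hl u (tadd (dpi u w) (dpi u w'))) (vl u (tadd (vpart u w) (vpart u w')))" .
  show "dpi u (tadd w w') = tadd (dpi u w) (dpi u w')" "vpart u (tadd w w') = tadd (vpart u w) (vpart u w')"
    unfolding eq using parts_eq[OF tadd_tangent[OF t(1,3)] tadd_tangent[OF t(2,4)]] by auto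
qed

lemma parts_scale:
  assumes w: "w \<in> tangent_space TB u"
  shows "dpi u (tscale k w) = tscale k (dpi u w)" "vpart u (tscale k w) = tscale k (vpart u w)"
proof -
  note t = parts_tangent(1,2)[OF w]
  have "tscale k w = tscale k (tadd (hl u (dpi u w)) (vl u (vpart u w)))"
    using parts[OF w] by simp
  also have "\<dots> = tadd (hl u (tscale k (dpi u w))) (vl u (tscale k (vpart u w)))"
    using hl_scale[OF pair_pts t(1), of k] vl_scale[OF pair_pts t(2), of k] by (simp add: tadd_def tscale_def algebra_simps)
  finally have eq: "tscale k w = tadd (hl u (tscale k (dpi u w))) (vl u (tscale k (vpart u w)))" .
  show "dpi u (tscale k w) = tscale k (dpi u w)" "vpart u (tscale k w) = tscale k (vpart u w)"
    unfolding eq using parts_eq[OF tscale_tangent[OF t(1)] tscale_tangent[OF t(2)]] by auto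
qed

lemma vpart_apply:
  assumes w: "w \<in> tangent_space TB u" and f: "smooth_near A (fst u) f"
  shows "vpart u w f = w (\<lambda>u. snd u f) - hl u (dpi u w) (\<lambda>u. snd u f)"
  using fun_cong[OF parts[OF w], of "\<lambda>u. snd u f"] vl_lin[OF pair_pts f] by (simp add: tadd_apply)

text \<open>A formula of Sasaki type: projection and connection map carry the whole metric, so the
  definite description can be forgotten from here on.\<close>

lemma g1_eq:
  assumes w: "w \<in> tangent_space TB u" "w' \<in> tangent_space TB u"
  shows "g1 u w w' = g (fst u) (dpi u w) (dpi u w') + g (fst u) (vpart u w) (vpart u w')"
  using canonical_g_lift[OF pair_pts parts_tangent(1,2)[OF w(1)] parts_tangent(1,2)[OF w(2)]]
    parts[OF w(1), symmetric] parts[OF w(2), symmetric] by simp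

lemma J1_tangent_eq:
  assumes w: "w \<in> tangent_space TB u"
  shows "J1 u w = tdiff (vl u (dpi u w)) (hl u (vpart u w))"
  using canonical_J_lift[OF pair_pts parts_tangent(1,2)[OF w]] parts[OF w, symmetric] by simp

lemma J1_parts:
  assumes w: "w \<in> tangent_space TB u"
  shows "J1 u w \<in> tangent_space TB u" "dpi u (J1 u w) = tscale (- 1) (vpart u w)" "vpart u (J1 u w) = dpi u w"
proof -
  note t = parts_tangent(1,2)[OF w]
  have eq: "J1 u w = tadd (hl u (tscale (- 1) (vpart u w))) (vl u (dpi u w))"
    unfolding J1_tangent_eq[OF w] using hl_scale[OF pair_pts t(2), of "- 1"] by (simp add: tdiff_def tadd_def tscale_def)
  note tm = tscale_tangent[OF t(2), of "- 1"]
  show "J1 u w \<in> tangent_space TB u" "dpi u (J1 u w) = tscale (- 1) (vpart u w)" "vpart u (J1 u w) = dpi u w"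
    unfolding eq using parts_eq[OF tm t(1)] TM.tadd_tangent[OF lift_tangent(1)[OF tm] lift_tangent(2)[OF t(1)]] by auto
qed

lemma \<omega>1_eq:
  assumes w: "w \<in> tangent_space TB u" "w' \<in> tangent_space TB u"
  shows "\<omega>1 u w w' = g (fst u) (dpi u w) (vpart u w') - g (fst u) (vpart u w) (dpi u w')"
proof -
  have p: "fst u \<in> pts A" using base_pts[OF pair_pts] .
  show ?thesis
    unfolding fundamental_form_def g1_eq[OF J1_parts(1)[OF w(1)] w(2)] J1_parts(2,3)[OF w(1)]
    by (simp add: g_scale_left[OF p] parts_tangent(1,2) w)
qed

lemma J1_lift:
  assumes x: "x \<in> tangent_space A (fst u)"
  shows "J1 u (hl u x) = vl u x" "J1 u (vl u x) = tscale (- 1) (hl u x)"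
  unfolding J1_tangent_eq[OF lift_tangent(1)[OF x]] J1_tangent_eq[OF lift_tangent(2)[OF x]] parts_lift[OF x] lift_zero[OF pair_pts, simplified]
  by (simp_all add: tdiff_def tzero_def tscale_def)

end

section \<open>Smoothness on the tangent bundle\<close>

lemma tangent_chart_expand:
  assumes "(V, \<phi>) \<in> A" "p \<in> V" "v \<in> tangent_space A p"
  shows "v = tsum (\<lambda>b. tscale (v (\<lambda>q. \<phi> q \<bullet> b)) (coord_vec V \<phi> p b)) Basis"
  unfolding tsum_def tscale_def by (intro ext tangent_expand[OF assms])

lemma hess_smooth:
  assumes X: "vfield_on A U X" and Y: "vfield_on A U Y" and p: "p \<in> U" and f: "smooth_near A p f"
  shows "smooth_near A p (\<lambda>q. hess q f X Y)"
  unfolding hess_def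
  by (rule smooth_near_diff[OF vfield_smooth_near[OF X p vfield_smooth_near[OF Y p f]]
        vfield_smooth_near[OF conn_vfield[OF nab X Y] p f]])

lemma hl_lin_field:
  assumes u: "(p, v) \<in> pts TB" and X: "vfield_on A U X" "p \<in> U" and c: "(V, \<phi>) \<in> A" "p \<in> V" and f: "smooth_near A p f"
  shows "hl (p, v) (X p) (\<lambda>u. snd u f) = (\<Sum>b\<in>Basis. v (\<lambda>q. \<phi> q \<bullet> b) * hess p f X (\<lambda>q. coord_vec V \<phi> q b))"
proof -
  note Z = vfield_extend[OF c fibre_tangent[OF u]]
  have W: "p \<in> U \<inter> V" using X c by blast
  have "hl (p, v) (X p) (\<lambda>u. snd u f) = hess p f X (\<lambda>q. coord_vec V \<phi> q (comps \<phi> v))"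
    by (rule hl_lin[OF u vfield_tangent[OF X] f vfield_Int(1)[OF X(1) openin_chart[OF c(1)]]
          vfield_Int(2)[OF Z(1) vfield_open[OF X(1)]] W refl Z(2)])
  also have "\<dots> = (\<Sum>b\<in>Basis. v (\<lambda>q. \<phi> q \<bullet> b) * hess p f X (\<lambda>q. coord_vec V \<phi> q b))"
    using tensorial_chart[OF hess_tensorial2[OF X f] c(2) Z(1) c] unfolding Z(2) .
  finally show ?thesis .
qed

text \<open>Bilinear in the coordinates of \<open>v\<close> and \<open>x\<close>, with coefficients
  depending on the base point alone. For a coordinate function \<open>f\<close> of this chart the
  coefficients are minus the Christoffel symbols of \<open>nab\<close>.\<close>

lemma hl_lin_chart:
  assumes u: "(p, v) \<in> pts TB" and x: "x \<in> tangent_space A p" and c: "(V, \<phi>) \<in> A" "p \<in> V" and f: "smooth_near A p f"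
  shows "hl (p, v) x (\<lambda>u. snd u f) = (\<Sum>b\<in>Basis. \<Sum>d\<in>Basis.
    v (\<lambda>q. \<phi> q \<bullet> b) * (x (\<lambda>q. \<phi> q \<bullet> d) * hess p f (\<lambda>q. coord_vec V \<phi> q d) (\<lambda>q. coord_vec V \<phi> q b)))"
proof -
  note X = vfield_extend[OF c x]
  have "hess p f (\<lambda>q. coord_vec V \<phi> q (comps \<phi> x)) (\<lambda>q. coord_vec V \<phi> q b) =
      (\<Sum>d\<in>Basis. x (\<lambda>q. \<phi> q \<bullet> d) * hess p f (\<lambda>q. coord_vec V \<phi> q d) (\<lambda>q. coord_vec V \<phi> q b))" for b
    using tensorial_chart[OF hess_tensorial1[OF vfield_coord[OF c(1)] c(2)] c(2) X(1) c, of f b] unfolding X(2) .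
  then show ?thesis
    using hl_lin_field[OF u X(1) c(2) c f] unfolding X(2) by (simp add: sum_distrib_left)
qed

section \<open>Smooth vector fields along the bundle projection\<close>

context
  fixes p v V \<phi> assumes u: "(p, v) \<in> pts TB" and c: "(V, \<phi>) \<in> A" "p \<in> V"
begin

text \<open>Smoothness near \<open>(p, v)\<close> of a section of the pullback of the tangent bundle
  of the base under the projection. The projection and the vertical part of a field on the tangent
  bundle are of this kind; in general they are not fields on the base.\<close>

definition smooth_along :: "('a tpoint \<Rightarrow> 'a tvec) \<Rightarrow> bool" where
  "smooth_along \<xi> \<longleftrightarrow> eventually (\<lambda>u'. \<xi> u' \<in> tangent_space A (fst u')) (TM.near (p, v)) \<and>
     (\<forall>b\<in>Basis. smooth_near TB (p, v) (\<lambda>u'. \<xi> u' (\<lambda>q. \<phi> q \<bullet> b)))"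

lemma near_chart: "eventually (\<lambda>u'. u' \<in> pts TB \<and> fst u' \<in> pts A \<and> fst u' \<in> V \<and> snd u' \<in> tangent_space A (fst u')) (TM.near (p, v))"
proof -
  have "eventually (\<lambda>u'. u' \<in> tdom V) (TM.near (p, v))"
    by (rule TM.eventually_near_open[OF tdom_open[OF openin_chart[OF c(1)]]])
      (use c fibre_tangent[OF u] in \<open>simp add: tdom_iff\<close>)
  then show ?thesis
  proof eventually_elim
    case (elim u')
    obtain q w where "u' = (q, w)" by (cases u')
    with elim show ?case by (simp add: tdom_iff TM_pts_iff chart_pts[OF c(1)])
  qed
qed

lemma smooth_along_g:
  assumes \<xi>: "smooth_along \<xi>" and \<eta>: "smooth_along \<eta>"
  shows "smooth_near TB (p, v) (\<lambda>u'. g (fst u') (\<xi> u') (\<eta> u'))"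
proof -
  let ?e = "\<lambda>b q. coord_vec V \<phi> q b"
  have "smooth_near TB (p, v) (\<lambda>u'. \<Sum>b\<in>Basis. \<Sum>d\<in>Basis. \<xi> u' (\<lambda>q. \<phi> q \<bullet> b) * (\<eta> u' (\<lambda>q. \<phi> q \<bullet> d) * g (fst u') (?e b (fst u')) (?e d (fst u'))))"
  proof (intro TM.smooth_near_sum u TM.smooth_near_mult)
    fix b d :: 'e assume "b \<in> Basis" "d \<in> Basis"
    then show "smooth_near TB (p, v) (\<lambda>u'. \<xi> u' (\<lambda>q. \<phi> q \<bullet> b))" "smooth_near TB (p, v) (\<lambda>u'. \<eta> u' (\<lambda>q. \<phi> q \<bullet> d))"
      using \<xi> \<eta> by (auto simp: smooth_along_def)
    show "smooth_near TB (p, v) (\<lambda>u'. g (fst u') (?e b (fst u')) (?e d (fst u')))"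
      by (rule smooth_base[OF u g_smooth_near[OF vfield_coord[OF c(1)] vfield_coord[OF c(1)] c(2)]])
  qed
  moreover have "eventually (\<lambda>u'. (\<Sum>b\<in>Basis. \<Sum>d\<in>Basis. \<xi> u' (\<lambda>q. \<phi> q \<bullet> b) * (\<eta> u' (\<lambda>q. \<phi> q \<bullet> d) * g (fst u') (?e b (fst u')) (?e d (fst u')))) =
      g (fst u') (\<xi> u') (\<eta> u')) (TM.near (p, v))"
    using near_chart \<xi>[unfolded smooth_along_def, THEN conjunct1] \<eta>[unfolded smooth_along_def, THEN conjunct1]
  proof eventually_elim
    case (elim u')
    let ?q = "fst u'"
    have q: "?q \<in> pts A" "?q \<in> V" using elim by auto
    have et: "?e b ?q \<in> tangent_space A ?q" for b using coord_vec_tangent[OF c(1) q(2)] .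
    have 1: "g ?q (\<xi> u') z = (\<Sum>b\<in>Basis. \<xi> u' (\<lambda>q. \<phi> q \<bullet> b) * g ?q (?e b ?q) z)" if z: "z \<in> tangent_space A ?q" for z
    proof -
      have "g ?q (\<xi> u') z = g ?q (tsum (\<lambda>b. tscale (\<xi> u' (\<lambda>q. \<phi> q \<bullet> b)) (?e b ?q)) Basis) z"
        using tangent_chart_expand[OF c(1) q(2) elim(2)] by simp
      also have "\<dots> = (\<Sum>b\<in>Basis. g ?q (tscale (\<xi> u' (\<lambda>q. \<phi> q \<bullet> b)) (?e b ?q)) z)"
        by (rule g_sum_left[OF q(1) tscale_tangent[OF et] z])
      finally show ?thesis by (simp add: g_scale_left[OF q(1) et z])
    qed
    have 2: "g ?q z (\<eta> u') = (\<Sum>b\<in>Basis. \<eta> u' (\<lambda>q. \<phi> q \<bullet> b) * g ?q z (?e b ?q))" if z: "z \<in> tangent_space A ?q" for z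
    proof -
      have "g ?q z (\<eta> u') = g ?q z (tsum (\<lambda>b. tscale (\<eta> u' (\<lambda>q. \<phi> q \<bullet> b)) (?e b ?q)) Basis)"
        using tangent_chart_expand[OF c(1) q(2) elim(3)] by simp
      also have "\<dots> = (\<Sum>b\<in>Basis. g ?q z (tscale (\<eta> u' (\<lambda>q. \<phi> q \<bullet> b)) (?e b ?q)))"
        by (rule g_sum_right[OF q(1) tscale_tangent[OF et] z])
      finally show ?thesis by (simp add: g_scale_right[OF q(1) et z])
    qed
    show ?case unfolding 1[OF elim(3)] 2[OF et] by (simp add: sum_distrib_left)
  qed
  ultimately show ?thesis by (rule TM.smooth_near_cong)
qed

lemma smooth_along_hl:
  assumes \<xi>: "smooth_along \<xi>" and f: "smooth_near A p f"
  shows "smooth_near TB (p, v) (\<lambda>u'. hl u' (\<xi> u') (\<lambda>u. snd u f))"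
proof -
  let ?e = "\<lambda>b q. coord_vec V \<phi> q b"
  have "smooth_near TB (p, v) (\<lambda>u'. \<Sum>b\<in>Basis. \<Sum>d\<in>Basis. snd u' (\<lambda>q. \<phi> q \<bullet> b) * (\<xi> u' (\<lambda>q. \<phi> q \<bullet> d) * hess (fst u') f (?e d) (?e b)))"
  proof (intro TM.smooth_near_sum u TM.smooth_near_mult)
    fix b d :: 'e assume "b \<in> Basis" "d \<in> Basis"
    then show "smooth_near TB (p, v) (\<lambda>u'. \<xi> u' (\<lambda>q. \<phi> q \<bullet> d))"
      using \<xi> by (auto simp: smooth_along_def)
    show "smooth_near TB (p, v) (\<lambda>u'. snd u' (\<lambda>q. \<phi> q \<bullet> b))" by (rule smooth_lin[OF u smooth_near_coord[OF c]])
    show "smooth_near TB (p, v) (\<lambda>u'. hess (fst u') f (?e d) (?e b))"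
      by (rule smooth_base[OF u hess_smooth[OF vfield_coord[OF c(1)] vfield_coord[OF c(1)] c(2) f]])
  qed
  moreover have "eventually (\<lambda>u'. (\<Sum>b\<in>Basis. \<Sum>d\<in>Basis. snd u' (\<lambda>q. \<phi> q \<bullet> b) * (\<xi> u' (\<lambda>q. \<phi> q \<bullet> d) * hess (fst u') f (?e d) (?e b))) =
      hl u' (\<xi> u') (\<lambda>u. snd u f)) (TM.near (p, v))"
    using near_chart \<xi>[unfolded smooth_along_def, THEN conjunct1] eventually_base[OF u smooth_near_eventually[OF f]]
  proof eventually_elim
    case (elim u')
    have "(fst u', snd u') \<in> pts TB" "fst u' \<in> V" using elim by auto
    from hl_lin_chart[OF this(1) elim(2) c(1) this(2) elim(3)] show ?case by simp
  qed
  ultimately show ?thesis by (rule TM.smooth_near_cong)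
qed

text \<open>The projection comes first: by \<open>vpart_apply\<close> the vertical part is the
  action on fibre coordinates minus that of the horizontal lift of the projection, and this lift is
  smooth by \<open>smooth_along_hl\<close>.\<close>

lemma smooth_along_parts:
  assumes W: "vfield_on TB S W" "(p, v) \<in> S"
  shows "smooth_along (\<lambda>u'. dpi u' (W u'))" "smooth_along (\<lambda>u'. vpart u' (W u'))"
proof -
  have ev: "eventually (\<lambda>u'. u' \<in> pts TB \<and> W u' \<in> tangent_space TB u') (TM.near (p, v))"
    using TM.eventually_near_open[OF TM.vfield_open[OF W(1)] W(2)]
    by eventually_elim (use TM.vfield_tangent[OF W(1)] TM.openin_pts[OF TM.vfield_open[OF W(1)]] in blast)
  have near: "eventually (\<lambda>u'. smooth_near A (fst u') (\<lambda>q. \<phi> q \<bullet> b)) (TM.near (p, v))" for b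
    by (rule eventually_base[OF u smooth_near_eventually[OF smooth_near_coord[OF c]]])
  show 1: "smooth_along (\<lambda>u'. dpi u' (W u'))"
    unfolding smooth_along_def
  proof (intro conjI ballI)
    show "eventually (\<lambda>u'. dpi u' (W u') \<in> tangent_space A (fst u')) (TM.near (p, v))"
      using ev by eventually_elim (use parts_tangent(1) in blast)
    fix b :: 'e
    have "smooth_near TB (p, v) (\<lambda>u'. W u' (\<lambda>u. \<phi> (fst u) \<bullet> b))"
      by (rule TM.vfield_smooth_near[OF W smooth_base[OF u smooth_near_coord[OF c]]])
    moreover have "eventually (\<lambda>u'. W u' (\<lambda>u. \<phi> (fst u) \<bullet> b) = dpi u' (W u') (\<lambda>q. \<phi> q \<bullet> b)) (TM.near (p, v))"
      using near[of b] by eventually_elim (simp add: dpi_def differential_def o_def)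
    ultimately show "smooth_near TB (p, v) (\<lambda>u'. dpi u' (W u') (\<lambda>q. \<phi> q \<bullet> b))" by (rule TM.smooth_near_cong)
  qed
  show "smooth_along (\<lambda>u'. vpart u' (W u'))"
    unfolding smooth_along_def
  proof (intro conjI ballI)
    show "eventually (\<lambda>u'. vpart u' (W u') \<in> tangent_space A (fst u')) (TM.near (p, v))"
      using ev by eventually_elim (use parts_tangent(2) in blast)
    fix b :: 'e
    note s = smooth_near_coord[OF c, of b]
    have "smooth_near TB (p, v) (\<lambda>u'. W u' (\<lambda>u. snd u (\<lambda>q. \<phi> q \<bullet> b)) - hl u' (dpi u' (W u')) (\<lambda>u. snd u (\<lambda>q. \<phi> q \<bullet> b)))"
      by (rule TM.smooth_near_diff[OF TM.vfield_smooth_near[OF W smooth_lin[OF u s]] smooth_along_hl[OF 1 s]])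
    moreover have "eventually (\<lambda>u'. W u' (\<lambda>u. snd u (\<lambda>q. \<phi> q \<bullet> b)) - hl u' (dpi u' (W u')) (\<lambda>u. snd u (\<lambda>q. \<phi> q \<bullet> b)) =
        vpart u' (W u') (\<lambda>q. \<phi> q \<bullet> b)) (TM.near (p, v))"
      using near[of b] ev by eventually_elim (use vpart_apply in auto)
    ultimately show "smooth_near TB (p, v) (\<lambda>u'. vpart u' (W u') (\<lambda>q. \<phi> q \<bullet> b))" by (rule TM.smooth_near_cong)
  qed
qed

lemma smooth_along_base:
  assumes X: "vfield_on A U X" "p \<in> U"
  shows "smooth_along (\<lambda>u'. X (fst u'))"
  unfolding smooth_along_def
proof (intro conjI ballI)
  show "eventually (\<lambda>u'. X (fst u') \<in> tangent_space A (fst u')) (TM.near (p, v))"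
    using eventually_base[OF u eventually_near_open[OF vfield_open[OF X(1)] X(2)]]
    by eventually_elim (rule vfield_tangent[OF X(1)])
  show "smooth_near TB (p, v) (\<lambda>u'. X (fst u') (\<lambda>q. \<phi> q \<bullet> b))" for b
    by (rule smooth_base[OF u vfield_smooth_near[OF X smooth_near_coord[OF c]]])
qed

end

lemma pts_chart:
  assumes "u \<in> pts TB"
  obtains p v V \<phi> where "u = (p, v)" "(p, v) \<in> pts TB" "(V, \<phi>) \<in> A" "p \<in> V"
proof -
  obtain p v where uv: "u = (p, v)" by (cases u)
  then have "p \<in> pts A" using assms by (simp add: TM_pts_iff)
  then obtain V \<phi> where "(V, \<phi>) \<in> A" "p \<in> V" unfolding pts_iff by blast
  then show ?thesis using that uv assms by blast
qed

lemma canonical_metric: "riemannian_metric TB g1"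
  unfolding riemannian_metric_def
proof (intro conjI ballI allI impI)
  fix u w w' assume u: "u \<in> pts TB" and w: "w \<in> tangent_space TB u" "w' \<in> tangent_space TB u"
  have p: "fst u \<in> pts A" using base_pts[OF pair_pts[OF u]] .
  note t = parts_tangent(1,2)[OF u w(1)] parts_tangent(1,2)[OF u w(2)]
  show "g1 u w w' = g1 u w' w"
    using t by (simp add: g1_eq[OF u] w g_sym[OF p])
  show "g1 u (tadd w w') z = g1 u w z + g1 u w' z" if z: "z \<in> tangent_space TB u" for z
    using t parts_tangent(1,2)[OF u z] by (simp add: g1_eq[OF u] w z TM.tadd_tangent parts_add[OF u w] g_add_left[OF p])
  show "g1 u (tscale k w) w' = k * g1 u w w'" for k
    using t by (simp add: g1_eq[OF u] w TM.tscale_tangent parts_scale[OF u w(1)] g_scale_left[OF p] algebra_simps)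
  show "0 < g1 u w w" if "w \<noteq> tzero"
  proof -
    have "dpi u w \<noteq> tzero \<or> vpart u w \<noteq> tzero"
    proof (rule ccontr)
      assume "\<not> ?thesis"
      then have "w = tadd (hl u tzero) (vl u tzero)" using parts[OF u w(1)] by simp
      then show False using that lift_zero[OF pair_pts[OF u]] by (simp add: tadd_def tzero_def)
    qed
    moreover have "0 \<le> g (fst u) x x" if "x \<in> tangent_space A (fst u)" for x
      using g_pos[OF p that] g_zero_left[OF p tzero_tangent] by (cases "x = tzero") auto
    ultimately show ?thesis
      unfolding g1_eq[OF u w(1) w(1)] using g_pos[OF p t(1)] g_pos[OF p t(2)] t
      by (metis add_nonneg_pos add_pos_nonneg)
  qed
next
  fix S W W' assume "vfield_on TB S W \<and> vfield_on TB S W'"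
  then have W: "vfield_on TB S W" "vfield_on TB S W'" by auto
  show "smooth_fun_on TB S (\<lambda>u. g1 u (W u) (W' u))"
    unfolding TM.smooth_fun_on_iff
  proof (intro conjI ballI TM.vfield_open[OF W(1)])
    fix u assume uS: "u \<in> S"
    obtain p v V \<phi> where uv: "u = (p, v)" "(p, v) \<in> pts TB" "(V, \<phi>) \<in> A" "p \<in> V"
      using pts_chart[OF TM.openin_pts[OF TM.vfield_open[OF W(1)] uS]] .
    note sp = smooth_along_parts[OF uv(2-4)]
    have "smooth_near TB (p, v) (\<lambda>u. g (fst u) (dpi u (W u)) (dpi u (W' u)) + g (fst u) (vpart u (W u)) (vpart u (W' u)))"
      using uS uv(1) by (intro TM.smooth_near_add smooth_along_g[OF uv(2-4)] sp[OF W(1)] sp[OF W(2)]) auto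
    moreover have "eventually (\<lambda>u. g (fst u) (dpi u (W u)) (dpi u (W' u)) + g (fst u) (vpart u (W u)) (vpart u (W' u)) = g1 u (W u) (W' u)) (TM.near (p, v))"
      using TM.eventually_near_open[OF TM.vfield_open[OF W(1)] uS] unfolding uv(1)
    proof eventually_elim
      case (elim u)
      show ?case
        by (rule g1_eq[OF TM.openin_pts[OF TM.vfield_open[OF W(1)] elim]
              TM.vfield_tangent[OF W(1) elim] TM.vfield_tangent[OF W(2) elim], symmetric])
    qed
    ultimately show "smooth_near TB u (\<lambda>u. g1 u (W u) (W' u))" unfolding uv(1) by (rule TM.smooth_near_cong)
  qed
qed

text \<open>From here the Levi-Civita connection, orthonormal frames and the codifferential formula
  are available on the tangent bundle as well.\<close>

sublocale TM: riemannian TB g1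
  by unfold_locales (rule canonical_metric)

lemma \<omega>1_smooth_form: "TM.smooth_form2 \<omega>1"
  unfolding TM.smooth_form2_def
proof (intro conjI ballI allI impI)
  fix u w w' assume u: "u \<in> pts TB" and w: "w \<in> tangent_space TB u" "w' \<in> tangent_space TB u"
  have p: "fst u \<in> pts A" using base_pts[OF pair_pts[OF u]] .
  note t = parts_tangent(1,2)[OF u w(1)] parts_tangent(1,2)[OF u w(2)]
  show "\<omega>1 u (tadd w w') z = \<omega>1 u w z + \<omega>1 u w' z" if z: "z \<in> tangent_space TB u" for z
    using t parts_tangent(1,2)[OF u z]
    by (simp add: \<omega>1_eq[OF u] w z TM.tadd_tangent parts_add[OF u w] g_add_left[OF p])
  show "\<omega>1 u z (tadd w w') = \<omega>1 u z w + \<omega>1 u z w'" if z: "z \<in> tangent_space TB u" for z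
    using t parts_tangent(1,2)[OF u z]
    by (simp add: \<omega>1_eq[OF u] w z TM.tadd_tangent parts_add[OF u w] g_add_right[OF p])
  show "\<omega>1 u (tscale k w) w' = k * \<omega>1 u w w'" for k
    using t by (simp add: \<omega>1_eq[OF u] w TM.tscale_tangent parts_scale[OF u w(1)] g_scale_left[OF p] algebra_simps)
  show "\<omega>1 u w (tscale k w') = k * \<omega>1 u w w'" for k
    using t by (simp add: \<omega>1_eq[OF u] w TM.tscale_tangent parts_scale[OF u w(2)] g_scale_right[OF p] algebra_simps)
next
  fix S W W' assume "vfield_on TB S W \<and> vfield_on TB S W'"
  then have W: "vfield_on TB S W" "vfield_on TB S W'" by auto
  show "smooth_fun_on TB S (\<lambda>u. \<omega>1 u (W u) (W' u))"
    unfolding TM.smooth_fun_on_iff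
  proof (intro conjI ballI TM.vfield_open[OF W(1)])
    fix u assume uS: "u \<in> S"
    obtain p v V \<phi> where uv: "u = (p, v)" "(p, v) \<in> pts TB" "(V, \<phi>) \<in> A" "p \<in> V"
      using pts_chart[OF TM.openin_pts[OF TM.vfield_open[OF W(1)] uS]] .
    note sp = smooth_along_parts[OF uv(2-4)]
    have "smooth_near TB (p, v) (\<lambda>u. g (fst u) (dpi u (W u)) (vpart u (W' u)) - g (fst u) (vpart u (W u)) (dpi u (W' u)))"
      using uS uv(1) by (intro TM.smooth_near_diff smooth_along_g[OF uv(2-4)] sp[OF W(1)] sp[OF W(2)]) auto
    moreover have "eventually (\<lambda>u. g (fst u) (dpi u (W u)) (vpart u (W' u)) - g (fst u) (vpart u (W u)) (dpi u (W' u)) = \<omega>1 u (W u) (W' u)) (TM.near (p, v))"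
      using TM.eventually_near_open[OF TM.vfield_open[OF W(1)] uS] unfolding uv(1)
    proof eventually_elim
      case (elim u)
      show ?case
        by (rule \<omega>1_eq[OF TM.openin_pts[OF TM.vfield_open[OF W(1)] elim]
              TM.vfield_tangent[OF W(1) elim] TM.vfield_tangent[OF W(2) elim], symmetric])
    qed
    ultimately show "smooth_near TB u (\<lambda>u. \<omega>1 u (W u) (W' u))" unfolding uv(1) by (rule TM.smooth_near_cong)
  qed
qed

section \<open>Lifted vector fields and their brackets\<close>

definition hlift :: "'a vfield \<Rightarrow> 'a tpoint vfield" where
  "hlift X u = hl u (X (fst u))"

definition vlift :: "'a vfield \<Rightarrow> 'a tpoint vfield" where
  "vlift X u = vl u (X (fst u))"

lemma tdom_pts: "openin (mtop A) U \<Longrightarrow> u \<in> tdom U \<Longrightarrow> u \<in> pts TB \<and> fst u \<in> U"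
  by (cases u) (simp add: tdom_iff TM_pts_iff openin_pts)

text \<open>Smoothness is tested on the coordinates of an induced chart, where the lifts have
  explicit values. The one that is not merely pulled back from the base is that of the horizontal
  lift on a fibre coordinate, which \<open>smooth_along_hl\<close> treats.\<close>

lemma
  assumes X: "vfield_on A U X"
  shows hlift_vfield: "vfield_on TB (tdom U) (hlift X)" and vlift_vfield: "vfield_on TB (tdom U) (vlift X)"
proof -
  note o = vfield_open[OF X]
  have t: "hlift X u \<in> tangent_space TB u" "vlift X u \<in> tangent_space TB u" if "u \<in> tdom U" for u
    using lift_tangent[of u "X (fst u)"] tdom_pts[OF o that] vfield_tangent[OF X] by (auto simp: hlift_def vlift_def)
  have *: "\<exists>T \<Phi>. (T, \<Phi>) \<in> TB \<and> u \<in> T \<and> (\<forall>b\<in>Basis. smooth_near TB u (\<lambda>u'. hlift X u' (\<lambda>r. \<Phi> r \<bullet> b))) \<and>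
      (\<forall>b\<in>Basis. smooth_near TB u (\<lambda>u'. vlift X u' (\<lambda>r. \<Phi> r \<bullet> b)))" if "u \<in> tdom U" for u
  proof -
    have uT: "u \<in> pts TB" "fst u \<in> U" using tdom_pts[OF o that] by auto
    obtain p v V \<phi> where uv: "u = (p, v)" "(p, v) \<in> pts TB" "(V, \<phi>) \<in> A" "p \<in> V" using pts_chart[OF uT(1)] .
    have pU: "p \<in> U" using uT uv(1) by simp
    note c = uv(3,4) and u = uv(2)
    have evU: "eventually (\<lambda>u'. u' \<in> tdom U) (TM.near (p, v))"
      using TM.eventually_near_open[OF tdom_open[OF o] that] unfolding uv(1) .
    have near: "eventually (\<lambda>u'. smooth_near A (fst u') (\<lambda>q. \<phi> q \<bullet> b)) (TM.near (p, v))" for b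
      by (rule eventually_base[OF u smooth_near_eventually[OF smooth_near_coord[OF c]]])
    have h1: "smooth_near TB (p, v) (\<lambda>u'. hlift X u' (\<lambda>u. \<phi> (fst u) \<bullet> b))" for b
    proof (rule TM.smooth_near_cong[OF smooth_base[OF u vfield_smooth_near[OF X pU smooth_near_coord[OF c, of b]]]])
      show "eventually (\<lambda>u'. X (fst u') (\<lambda>r. \<phi> r \<bullet> b) = hlift X u' (\<lambda>u. \<phi> (fst u) \<bullet> b)) (TM.near (p, v))"
        using evU near[of b]
      proof eventually_elim
        case (elim u')
        have "(fst u', snd u') \<in> pts TB" "fst u' \<in> U" using tdom_pts[OF o elim(1)] by auto
        from hl_base[OF this(1) vfield_tangent[OF X this(2)] elim(2)] show ?case by (simp add: hlift_def)
      qed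
    qed
    have h2: "smooth_near TB (p, v) (\<lambda>u'. hlift X u' (\<lambda>u. snd u (\<lambda>q. \<phi> q \<bullet> b)))" for b
      unfolding hlift_def by (rule smooth_along_hl[OF u c smooth_along_base[OF u c X pU] smooth_near_coord[OF c]])
    have v1: "smooth_near TB (p, v) (\<lambda>u'. vlift X u' (\<lambda>u. \<phi> (fst u) \<bullet> b))" for b
      unfolding vlift_def using vl_base[where f = "\<lambda>q. \<phi> q \<bullet> b"] by (simp add: TM.smooth_near_const[OF u])
    have v2: "smooth_near TB (p, v) (\<lambda>u'. vlift X u' (\<lambda>u. snd u (\<lambda>q. \<phi> q \<bullet> b)))" for b
    proof (rule TM.smooth_near_cong[OF smooth_base[OF u vfield_smooth_near[OF X pU smooth_near_coord[OF c, of b]]]])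
      show "eventually (\<lambda>u'. X (fst u') (\<lambda>r. \<phi> r \<bullet> b) = vlift X u' (\<lambda>u. snd u (\<lambda>q. \<phi> q \<bullet> b))) (TM.near (p, v))"
        using evU near[of b]
      proof eventually_elim
        case (elim u')
        have "(fst u', snd u') \<in> pts TB" using tdom_pts[OF o elim(1)] by auto
        from vl_lin[OF this elim(2)] show ?case by (simp add: vlift_def)
      qed
    qed
    have "smooth_near TB u (\<lambda>u'. hlift X u' (\<lambda>r. tmap \<phi> r \<bullet> b)) \<and> smooth_near TB u (\<lambda>u'. vlift X u' (\<lambda>r. tmap \<phi> r \<bullet> b))"
      if "b \<in> Basis" for b
    proof -
      consider b' where "b' \<in> Basis" "b = (b', 0)" | b' where "b' \<in> Basis" "b = (0, b')"
        using \<open>b \<in> Basis\<close> by (auto simp: Basis_prod_def)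
      then show ?thesis
      proof cases
        case 1
        then show ?thesis using h1[of b'] v1[of b'] by (simp add: uv(1) tmap_def split_beta)
      next
        case 2
        then show ?thesis using h2[of b'] v2[of b'] by (simp add: uv(1) tmap_def split_beta comps_inner)
      qed
    qed
    then show ?thesis
      using tangent_chart_mem[OF c(1)] fibre_tangent[OF u] c(2)
      by (intro exI[of _ "tdom V"] exI[of _ "tmap \<phi>"]) (auto simp: uv(1) tdom_iff)
  qed
  show "vfield_on TB (tdom U) (hlift X)"
    by (rule TM.vfield_onI_coords[OF tdom_open[OF o] t(1)]) (use * in meson)+
  show "vfield_on TB (tdom U) (vlift X)"
    by (rule TM.vfield_onI_coords[OF tdom_open[OF o] t(2)]) (use * in meson)+
qed

section \<open>Lifted fields acting on pullbacks and on fibrewise linear functions\<close>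

context
  fixes U X p v assumes X: "vfield_on A U X" and u: "(p, v) \<in> pts TB" and p: "p \<in> U"
begin

lemma point_tdom: "(p, v) \<in> tdom U"
  using p fibre_tangent[OF u] by (simp add: tdom_iff)

lemma near_U: "eventually (\<lambda>u'. (fst u', snd u') \<in> pts TB \<and> fst u' \<in> U) (TM.near (p, v))"
  using TM.eventually_near_open[OF tdom_open[OF vfield_open[OF X]] point_tdom]
  by eventually_elim (use tdom_pts[OF vfield_open[OF X]] in auto)

lemma hlift_base_near:
  assumes f: "smooth_near A p f"
  shows "eventually (\<lambda>u'. hlift X u' (\<lambda>u. f (fst u)) = X (fst u') f) (TM.near (p, v))"
  using near_U eventually_base[OF u smooth_near_eventually[OF f]]
proof eventually_elim
  case (elim u')
  then show ?case using hl_base[of "fst u'" "snd u'" "X (fst u')" f] vfield_tangent[OF X] by (simp add: hlift_def)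
qed

lemma vlift_lin_near:
  assumes f: "smooth_near A p f"
  shows "eventually (\<lambda>u'. vlift X u' (\<lambda>u. snd u f) = X (fst u') f) (TM.near (p, v))"
  using near_U eventually_base[OF u smooth_near_eventually[OF f]]
proof eventually_elim
  case (elim u')
  then show ?case using vl_lin[of "fst u'" "snd u'" f "X (fst u')"] by (simp add: vlift_def)
qed

lemma lift_at_tangent: "hlift X (p, v) \<in> tangent_space TB (p, v)" "vlift X (p, v) \<in> tangent_space TB (p, v)"
  using TM.vfield_tangent[OF hlift_vfield[OF X] point_tdom] TM.vfield_tangent[OF vlift_vfield[OF X] point_tdom] .

lemma hlift_of_base:
  assumes f: "smooth_near A p f" shows "hlift X (p, v) (\<lambda>u. f (fst u)) = X p f"
  using TM.near_self[OF u hlift_base_near[OF f]] by simp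

lemma vlift_of_base: "vlift X (p, v) (\<lambda>u. f (fst u)) = 0"
  by (simp add: vlift_def vl_base)

lemma vlift_of_lin:
  assumes f: "smooth_near A p f" shows "vlift X (p, v) (\<lambda>u. snd u f) = X p f"
  using TM.near_self[OF u vlift_lin_near[OF f]] by simp

end

text \<open>On a pullback both iterated derivatives vanish. On the fibrewise linear function of
  \<open>f\<close>, differentiating first along the vertical lift and then along the horizontal one
  gives \<open>X p (\<lambda>q. Y q f)\<close>. In the other order the horizontal lift leaves the
  fibrewise linear function \<open>hess\<close> of \<open>f\<close> in direction \<open>X\<close>,
  and the vertical lift evaluates it on \<open>Y\<close>. The difference is
  \<open>nab X Y p f\<close>.\<close>

lemma bracket_hlift_vlift:
  assumes X: "vfield_on A U X" and Y: "vfield_on A U Y" and u: "(p, v) \<in> pts TB" and p: "p \<in> U"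
  shows "lie_bracket TB (hlift X) (vlift Y) (p, v) = vl (p, v) (nab X Y p)"
proof -
  note Xh = hlift_vfield[OF X] and Yv = vlift_vfield[OF Y] and uT = point_tdom[OF X u p]
  note Xt = lift_at_tangent[OF X u p] and Yt = lift_at_tangent[OF Y u p]
  note nt = conn_tangent[OF nab X Y p]
  obtain V \<phi> where c: "(V, \<phi>) \<in> A" "p \<in> V" using base_pts[OF u] by (auto simp: pts_iff)
  show ?thesis
  proof (rule TM_tangent_eqI[OF TM.vfield_tangent[OF TM.vfield_bracket[OF Xh Yv] uT] vl_tangent[OF u nt] u])
    fix f assume f: "smooth_near A p f"
    have "vlift Y (p, v) (\<lambda>u'. hlift X u' (\<lambda>u. f (fst u))) = vlift Y (p, v) (\<lambda>u'. X (fst u') f)"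
      by (rule TM.tangent_cong[OF Yt(2) u hlift_base_near[OF X u p f]])
    also have "\<dots> = 0" by (rule vlift_of_base[OF Y u p])
    finally have 1: "vlift Y (p, v) (\<lambda>u'. hlift X u' (\<lambda>u. f (fst u))) = 0" .
    have 2: "hlift X (p, v) (\<lambda>u'. vlift Y u' (\<lambda>u. f (fst u))) = 0"
      by (simp add: vlift_def vl_base TM.tangent_const[OF Xt(1) u])
    show "lie_bracket TB (hlift X) (vlift Y) (p, v) (\<lambda>u. f (fst u)) = vl (p, v) (nab X Y p) (\<lambda>u. f (fst u))"
      unfolding TM.lie_bracket_apply[OF smooth_base[OF u f]] 1 2 by (simp add: vl_base)
    have "hlift X (p, v) (\<lambda>u'. vlift Y u' (\<lambda>u. snd u f)) = hlift X (p, v) (\<lambda>u'. Y (fst u') f)"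
      by (rule TM.tangent_cong[OF Xt(1) u vlift_lin_near[OF Y u p f]])
    also have "\<dots> = X p (\<lambda>q. Y q f)" by (rule hlift_of_base[OF X u p vfield_smooth_near[OF Y p f]])
    finally have 3: "hlift X (p, v) (\<lambda>u'. vlift Y u' (\<lambda>u. snd u f)) = X p (\<lambda>q. Y q f)" .
    let ?H = "\<lambda>b q. hess q f X (\<lambda>q. coord_vec V \<phi> q b)"
    have H: "smooth_near A p (?H b)" for b
      by (rule hess_smooth[OF vfield_Int(1)[OF X openin_chart[OF c(1)]]
            vfield_Int(2)[OF vfield_coord[OF c(1)] vfield_open[OF X]] _ f]) (use p c in blast)
    have H0: "vlift Y (p, v) (\<lambda>u. ?H b (fst u)) = 0" for b by (rule vlift_of_base[OF Y u p])
    note sc = smooth_near_coord[OF c]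
    have "vlift Y (p, v) (\<lambda>u'. hlift X u' (\<lambda>u. snd u f)) =
        vlift Y (p, v) (\<lambda>u'. \<Sum>b\<in>Basis. snd u' (\<lambda>q. \<phi> q \<bullet> b) * ?H b (fst u'))"
    proof (rule TM.tangent_cong[OF Yt(2) u])
      show "eventually (\<lambda>u'. hlift X u' (\<lambda>u. snd u f) = (\<Sum>b\<in>Basis. snd u' (\<lambda>q. \<phi> q \<bullet> b) * ?H b (fst u'))) (TM.near (p, v))"
        using near_U[OF X u p] near_chart[OF u c] eventually_base[OF u smooth_near_eventually[OF f]]
      proof eventually_elim
        case (elim u')
        then show ?case using hl_lin_field[of "fst u'" "snd u'" U X V \<phi> f] X c(1) by (simp add: hlift_def)
      qed
    qed
    also have "\<dots> = (\<Sum>b\<in>Basis. vlift Y (p, v) (\<lambda>u'. snd u' (\<lambda>q. \<phi> q \<bullet> b) * ?H b (fst u')))"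
      by (rule TM.tangent_sum[OF Yt(2) u TM.smooth_near_mult[OF smooth_lin[OF u sc] smooth_base[OF u H]]])
    also have "\<dots> = (\<Sum>b\<in>Basis. Y p (\<lambda>q. \<phi> q \<bullet> b) * ?H b p)"
      unfolding TM.tangent_mult[OF Yt(2) smooth_lin[OF u sc] smooth_base[OF u H]]
        vlift_of_lin[OF Y u p sc] by (simp add: H0 mult.commute)
    also have "\<dots> = hess p f X Y"
      by (rule tensorial_chart[OF hess_tensorial2[OF X p f] p Y c, symmetric])
    finally have 4: "vlift Y (p, v) (\<lambda>u'. hlift X u' (\<lambda>u. snd u f)) = hess p f X Y" .
    show "lie_bracket TB (hlift X) (vlift Y) (p, v) (\<lambda>u. snd u f) = vl (p, v) (nab X Y p) (\<lambda>u. snd u f)"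
      unfolding TM.lie_bracket_apply[OF smooth_lin[OF u f]] 3 4 vl_lin[OF u f] hess_def by simp
  qed
qed

text \<open>A vertical lift sends pullbacks to zero and fibrewise linear functions to pullbacks, so
  two of them in succession annihilate both kinds of functions.\<close>

lemma bracket_vlift_vlift:
  assumes X: "vfield_on A U X" and Y: "vfield_on A U Y" and u: "(p, v) \<in> pts TB" and p: "p \<in> U"
  shows "lie_bracket TB (vlift X) (vlift Y) (p, v) = tzero"
proof -
  note Xv = vlift_vfield[OF X] and Yv = vlift_vfield[OF Y] and uT = point_tdom[OF X u p]
  have 1: "vlift X (p, v) (\<lambda>u'. vlift Y u' (\<lambda>u. f (fst u))) = 0"
    and 2: "smooth_near A p f \<Longrightarrow> vlift X (p, v) (\<lambda>u'. vlift Y u' (\<lambda>u. snd u f)) = 0"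
    if X: "vfield_on A U X" and Y: "vfield_on A U Y" for f X Y
  proof -
    note Xt = lift_at_tangent[OF X u p]
    show "vlift X (p, v) (\<lambda>u'. vlift Y u' (\<lambda>u. f (fst u))) = 0"
      by (simp add: vlift_def[of Y] vl_base TM.tangent_const[OF Xt(2) u])
    assume f: "smooth_near A p f"
    show "vlift X (p, v) (\<lambda>u'. vlift Y u' (\<lambda>u. snd u f)) = 0"
      using TM.tangent_cong[OF Xt(2) u vlift_lin_near[OF Y u p f]] vlift_of_base[OF X u p, of "\<lambda>q. Y q f"] by simp
  qed
  show ?thesis
    by (rule TM_tangent_eqI[OF TM.vfield_tangent[OF TM.vfield_bracket[OF Xv Yv] uT] TM.tzero_tangent u])
      (simp_all add: TM.lie_bracket_apply smooth_base[OF u] smooth_lin[OF u] 1[OF X Y] 1[OF Y X] 2[OF X Y] 2[OF Y X] tzero_apply)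
qed

text \<open>The horizontal lift of a field is related to it by the projection, and brackets of
  related fields are related.\<close>

lemma dpi_bracket_hlift:
  assumes X: "vfield_on A U X" and Y: "vfield_on A U Y" and u: "(p, v) \<in> pts TB" and p: "p \<in> U"
  shows "dpi (p, v) (lie_bracket TB (hlift X) (hlift Y) (p, v)) = lie_bracket A X Y p"
proof (rule tangent_ext[OF _ vfield_tangent[OF vfield_bracket[OF X Y] p]])
  note Xh = hlift_vfield[OF X] and Yh = hlift_vfield[OF Y] and uT = point_tdom[OF X u p]
  show "dpi (p, v) (lie_bracket TB (hlift X) (hlift Y) (p, v)) \<in> tangent_space A p"
    using parts_tangent(1)[OF u TM.vfield_tangent[OF TM.vfield_bracket[OF Xh Yh] uT]] by simp
  fix f assume f: "smooth_near A p f"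
  have 1: "hlift X (p, v) (\<lambda>u'. hlift Y u' (\<lambda>u. f (fst u))) = X p (\<lambda>q. Y q f)"
    if X: "vfield_on A U X" and Y: "vfield_on A U Y" for X Y
    using TM.tangent_cong[OF lift_at_tangent(1)[OF X u p] u hlift_base_near[OF Y u p f]]
      hlift_of_base[OF X u p vfield_smooth_near[OF Y p f]] by simp
  show "dpi (p, v) (lie_bracket TB (hlift X) (hlift Y) (p, v)) f = lie_bracket A X Y p f"
    unfolding dpi_def dpi_apply[OF u f] TM.lie_bracket_apply[OF smooth_base[OF u f]] lie_bracket_apply[OF f] 1[OF X Y] 1[OF Y X] ..
qed

end

section \<open>The Lee form\<close>

lemma sum_lessThan_add: "(\<Sum>a<(n::nat) + m. h a) = (\<Sum>i<n. h i) + (\<Sum>i<m. h (i + n) :: 'b::comm_monoid_add)"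
  by (induction m) (simp_all add: add_ac)

context riemannian
begin

context
  fixes U E p assumes E: "orthonormal_frame_on A g U E" and p: "p \<in> U"
begin

lemma frame_skew:
  assumes Z: "vfield_on A U Z" and i: "i < DIM('e)" and j: "j < DIM('e)"
  shows "g p (E i p) (levi_civita A g Z (E j) p) = - g p (levi_civita A g Z (E i) p) (E j p)"
proof -
  note pA = openin_pts[OF frame_open[OF E] p]
  have "Z p (\<lambda>q. g q (E i q) (E j q)) = Z p (\<lambda>q. if i = j then 1 else 0)"
  proof (rule tangent_cong[OF vfield_tangent[OF Z p] pA])
    show "eventually (\<lambda>q. g q (E i q) (E j q) = (if i = j then 1 else 0)) (near p)"
      using eventually_near_open[OF frame_open[OF E] p] by eventually_elim (rule frame_orthonormal[OF E i j])
  qed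
  then have "Z p (\<lambda>q. g q (E i q) (E j q)) = 0" using tangent_const[OF vfield_tangent[OF Z p] pA] by simp
  moreover have "Z p (\<lambda>q. g q (E i q) (E j q)) =
      g p (levi_civita A g Z (E i) p) (E j p) + g p (E i p) (levi_civita A g Z (E j) p)"
    using levi_civita_works(3) Z frame_vfield[OF E i] frame_vfield[OF E j] p
    unfolding metric_connection_def by blast
  ultimately show ?thesis by simp
qed

lemma frame_bracket:
  assumes i: "i < DIM('e)" and j: "j < DIM('e)"
  shows "tdiff (levi_civita A g (E i) (E j) p) (levi_civita A g (E j) (E i) p) = lie_bracket A (E i) (E j) p"
  using levi_civita_works(2) frame_vfield[OF E i] frame_vfield[OF E j] p unfolding torsion_free_def by blast

text \<open>The Koszul formula on the diagonal of an orthonormal frame: skew-symmetry moves the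
  derivative onto \<open>E k\<close>, and vanishing torsion exchanges \<open>E i\<close> and
  \<open>E k\<close> at the cost of a bracket, the exchanged term being zero because
  \<open>E i\<close> has constant length. It is applied on the base and on the tangent
  bundle.\<close>

lemma frame_LC_diag:
  assumes i: "i < DIM('e)" and k: "k < DIM('e)"
  shows "g p (levi_civita A g (E i) (E i) p) (E k p) = g p (lie_bracket A (E k) (E i) p) (E i p)"
proof -
  note pA = openin_pts[OF frame_open[OF E] p]
  note v = frame_vfield[OF E i] frame_vfield[OF E k] and t = frame_tangent[OF E i p] frame_tangent[OF E k p]
  note c = conn_tangent[OF levi_civita_works(1) _ _ p]
  have "g p (levi_civita A g (E k) (E i) p) (E i p) = 0"
    using frame_skew[OF v(2) i i] g_sym[OF pA t(1) c[OF v(2,1)]] by simp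
  moreover have "g p (levi_civita A g (E i) (E k) p) (E i p) = - g p (levi_civita A g (E i) (E i) p) (E k p)"
    using frame_skew[OF v(1) i k] g_sym[OF pA t(1) c[OF v(1,2)]] by simp
  ultimately show ?thesis
    unfolding frame_bracket[OF k i, symmetric] g_diff_left[OF pA c[OF v(2,1)] c[OF v(1,2)] t(1)] by simp
qed

end

end

context affine_riemann
begin

lemma g1_lift:
  assumes u: "u \<in> pts TB" and x: "x \<in> tangent_space A (fst u)" and w: "w \<in> tangent_space TB u"
  shows "g1 u w (hl u x) = g (fst u) (dpi u w) x" "g1 u w (vl u x) = g (fst u) (vpart u w) x"
proof -
  have p: "fst u \<in> pts A" using base_pts[OF pair_pts[OF u]] .
  have z: "g (fst u) y tzero = 0" if "y \<in> tangent_space A (fst u)" for y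
    using g_sym[OF p that tzero_tangent] g_zero_left[OF p that] by simp
  show "g1 u w (hl u x) = g (fst u) (dpi u w) x" "g1 u w (vl u x) = g (fst u) (vpart u w) x"
    using z[OF parts_tangent(1)[OF u w]] z[OF parts_tangent(2)[OF u w]]
    by (simp_all add: g1_eq[OF u w] lift_tangent[OF u x] parts_lift[OF u x])
qed

lemma \<omega>1_J:
  assumes u: "u \<in> pts TB" and w: "w \<in> tangent_space TB u" "w' \<in> tangent_space TB u"
  shows "\<omega>1 u w w' = - g1 u w (J1 u w')"
proof -
  have p: "fst u \<in> pts A" using base_pts[OF pair_pts[OF u]] .
  show ?thesis
    unfolding \<omega>1_eq[OF u w] g1_eq[OF u w(1) J1_parts(1)[OF u w(2)]] J1_parts(2,3)[OF u w(2)]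
    by (simp add: g_scale_right[OF p] parts_tangent(1,2)[OF u] w)
qed

lemma koszul_diff_linear:
  assumes "p \<in> pts A" "x \<in> tangent_space A p" "y \<in> tangent_space A p"
  shows "al p (tadd x y) - xi p (tadd x y) = (al p x - xi p x) + (al p y - xi p y)"
    "al p (tscale k x) - xi p (tscale k x) = k * (al p x - xi p x)"
  using koszul_forms_linear[OF assms] by (simp_all add: algebra_simps)

section \<open>The Lee form in the frame of lifts\<close>

definition lift_frame :: "(nat \<Rightarrow> 'a vfield) \<Rightarrow> nat \<Rightarrow> 'a tpoint vfield" where
  "lift_frame E i = (if i < DIM('e) then hlift (E i) else vlift (E (i - DIM('e))))"

text \<open>Indices below \<open>DIM('e)\<close> number the horizontal lifts, and adding
  \<open>DIM('e)\<close> passes to the vertical lift of the same field. Up to the sign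
  \<open>psign i\<close>, \<open>J1\<close> carries member \<open>i\<close> of the lifted frame to
  member \<open>partner i\<close>.\<close>

definition partner :: "nat \<Rightarrow> nat" where
  "partner i = (if i < DIM('e) then i + DIM('e) else i - DIM('e))"

definition psign :: "nat \<Rightarrow> real" where
  "psign i = (if i < DIM('e) then 1 else - 1)"

lemma partner_less: "i < DIM('e \<times> 'e) \<Longrightarrow> partner i < DIM('e \<times> 'e)"
  by (auto simp: partner_def)

abbreviation LC1 :: "'a tpoint vfield \<Rightarrow> 'a tpoint vfield \<Rightarrow> 'a tpoint vfield" where
  "LC1 \<equiv> levi_civita TB g1"

context
  fixes U E assumes E: "orthonormal_frame_on A g U E"
begin

abbreviation e1 :: "nat \<Rightarrow> 'a tpoint vfield" where
  "e1 \<equiv> lift_frame E"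

lemma lift_frame_orthonormal: "orthonormal_frame_on TB g1 (tdom U) (lift_frame E)"
  unfolding orthonormal_frame_on_def
proof (intro conjI allI impI ballI)
  fix i assume "i < DIM('e \<times> 'e)"
  then show "vfield_on TB (tdom U) (lift_frame E i)"
    using hlift_vfield[OF frame_vfield[OF E, of i]] vlift_vfield[OF frame_vfield[OF E, of "i - DIM('e)"]]
    by (auto simp: lift_frame_def)
next
  fix i j u assume i: "i < DIM('e \<times> 'e)" and j: "j < DIM('e \<times> 'e)" and "u \<in> tdom U"
  then have u: "u \<in> pts TB" and p: "fst u \<in> U" using tdom_pts[OF frame_open[OF E]] by auto
  have pA: "fst u \<in> pts A" using base_pts[OF pair_pts[OF u]] .
  have t: "E i (fst u) \<in> tangent_space A (fst u)" if "i < DIM('e)" for i using frame_tangent[OF E that p] .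
  note on = frame_orthonormal[OF E _ _ p]
  have z: "g (fst u) tzero (E i (fst u)) = 0" if "i < DIM('e)" for i using g_zero_left[OF pA t[OF that]] .
  consider "i < DIM('e)" "j < DIM('e)" | "i < DIM('e)" "\<not> j < DIM('e)"
    | "\<not> i < DIM('e)" "j < DIM('e)" | "\<not> i < DIM('e)" "\<not> j < DIM('e)" by blast
  then show "g1 u (lift_frame E i u) (lift_frame E j u) = (if i = j then 1 else 0)"
  proof cases
    case 1
    then show ?thesis
      by (simp add: lift_frame_def hlift_def g1_lift[OF u t lift_tangent(1)[OF u t]] parts_lift[OF u t] on)
  next
    case 2
    then have j': "j - DIM('e) < DIM('e)" using j by simp
    show ?thesis using 2
      by (simp add: lift_frame_def hlift_def vlift_def g1_lift[OF u t[OF j'] lift_tangent(1)[OF u t]] parts_lift[OF u t] z[OF j'])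
  next
    case 3
    then have i': "i - DIM('e) < DIM('e)" using i by simp
    show ?thesis using 3
      by (simp add: lift_frame_def hlift_def vlift_def g1_lift[OF u t lift_tangent(2)[OF u t[OF i']]] parts_lift[OF u t[OF i']] z)
  next
    case 4
    then have i': "i - DIM('e) < DIM('e)" "j - DIM('e) < DIM('e)" using i j by simp_all
    show ?thesis using 4
      by (auto simp: lift_frame_def vlift_def g1_lift[OF u t[OF i'(2)] lift_tangent(2)[OF u t[OF i'(1)]]] parts_lift[OF u t[OF i'(1)]] on[OF i'])
  qed
qed

lemma J1_lift_frame:
  assumes u: "u \<in> tdom U" and i: "i < DIM('e \<times> 'e)"
  shows "J1 u (lift_frame E i u) = tscale (psign i) (lift_frame E (partner i) u)"
proof -
  have uP: "u \<in> pts TB" and p: "fst u \<in> U" using tdom_pts[OF frame_open[OF E] u] by auto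
  have t: "E i (fst u) \<in> tangent_space A (fst u)" if "i < DIM('e)" for i using frame_tangent[OF E that p] .
  show ?thesis
  proof (cases "i < DIM('e)")
    case True
    then show ?thesis
      using J1_lift(1)[OF uP t[OF True]] by (simp add: lift_frame_def partner_def psign_def hlift_def vlift_def tscale_def)
  next
    case False
    then have i': "i - DIM('e) < DIM('e)" using i by simp
    show ?thesis
      using False i' J1_lift(2)[OF uP t[OF i']] by (simp add: lift_frame_def partner_def psign_def hlift_def vlift_def)
  qed
qed

context
  fixes p v assumes p: "p \<in> U" and u: "(p, v) \<in> pts TB"
begin

lemma frame_point_tdom: "(p, v) \<in> tdom U"
  using p fibre_tangent[OF u] by (simp add: tdom_iff)

text \<open>In the lifted frame the coefficients of \<open>\<omega>1\<close> are constant, so the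
  differentiated term drops out. In the next term \<open>J1\<close> is moved to \<open>e1 c\<close>
  and \<open>frame_LC_diag\<close> replaces the connection by a bracket; in the last one
  skew-symmetry moves the derivative from \<open>e1 c\<close> to the partner of
  \<open>e1 a\<close>.\<close>

lemma cov_deriv_lift_frame:
  assumes a: "a < DIM('e \<times> 'e)" and c: "c < DIM('e \<times> 'e)"
  shows "cov_deriv_form2 LC1 \<omega>1 (e1 a) (e1 a) (e1 c) (p, v) =
    psign c * g1 (p, v) (lie_bracket TB (e1 (partner c)) (e1 a) (p, v)) (e1 a (p, v)) +
    psign a * g1 (p, v) (LC1 (e1 a) (e1 (partner a)) (p, v)) (e1 c (p, v))"
proof -
  let ?u = "(p, v)"
  note F = lift_frame_orthonormal
  note vf = TM.frame_vfield[OF F] and tf = TM.frame_tangent[OF F]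
  note a' = partner_less[OF a] and c' = partner_less[OF c]
  note D = TM.conn_tangent[OF TM.levi_civita_works(1) vf vf frame_point_tdom]
  have const: "\<omega>1 u' (e1 a u') (e1 c u') = psign a * (if partner a = c then 1 else 0)" if "u' \<in> tdom U" for u'
  proof -
    have u'P: "u' \<in> pts TB" using tdom_pts[OF frame_open[OF E] that] by auto
    show ?thesis
      unfolding fundamental_form_def J1_lift_frame[OF that a] TM.g_scale_left[OF u'P tf[OF a' that] tf[OF c that]]
        TM.frame_orthonormal[OF F a' c that] ..
  qed
  have "e1 a ?u (\<lambda>u'. \<omega>1 u' (e1 a u') (e1 c u')) = e1 a ?u (\<lambda>u'. psign a * (if partner a = c then 1 else 0))"
  proof (rule TM.tangent_cong[OF tf[OF a frame_point_tdom] u])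
    show "eventually (\<lambda>u'. \<omega>1 u' (e1 a u') (e1 c u') = psign a * (if partner a = c then 1 else 0)) (TM.near ?u)"
      using TM.eventually_near_open[OF TM.frame_open[OF F] frame_point_tdom] by eventually_elim (rule const)
  qed
  also have "\<dots> = 0" by (rule TM.tangent_const[OF tf[OF a frame_point_tdom] u])
  finally have 1: "e1 a ?u (\<lambda>u'. \<omega>1 u' (e1 a u') (e1 c u')) = 0" .
  have 2: "\<omega>1 ?u (LC1 (e1 a) (e1 a) ?u) (e1 c ?u) = - (psign c * g1 ?u (LC1 (e1 a) (e1 a) ?u) (e1 (partner c) ?u))"
    unfolding \<omega>1_J[OF u D[OF a a] tf[OF c frame_point_tdom]] J1_lift_frame[OF frame_point_tdom c] TM.g_scale_right[OF u tf[OF c' frame_point_tdom] D[OF a a]] ..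
  have 3: "\<omega>1 ?u (e1 a ?u) (LC1 (e1 a) (e1 c) ?u) = - (psign a * g1 ?u (LC1 (e1 a) (e1 (partner a)) ?u) (e1 c ?u))"
    unfolding fundamental_form_def J1_lift_frame[OF frame_point_tdom a] TM.g_scale_left[OF u tf[OF a' frame_point_tdom] D[OF a c]]
      TM.frame_skew[OF F frame_point_tdom vf[OF a] a' c] by simp
  show ?thesis
    unfolding cov_deriv_form2_def 1 2 3 TM.frame_LC_diag[OF F frame_point_tdom a c'] by simp
qed

text \<open>In the Lee form the argument \<open>e1 c\<close> arises from applying \<open>J1\<close>.
  A vertical \<open>e1 c\<close> therefore carries the values on horizontal vectors, and a
  horizontal one the values on vertical vectors.\<close>

lemma sum_cov_deriv_lift_frame:
  assumes c: "c < DIM('e \<times> 'e)"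
  shows "(\<Sum>a<DIM('e \<times> 'e). cov_deriv_form2 LC1 \<omega>1 (e1 a) (e1 a) (e1 c) (p, v)) =
    (if c < DIM('e) then 0 else al p (E (c - DIM('e)) p) - xi p (E (c - DIM('e)) p))"
proof -
  let ?u = "(p, v)" and ?n = "DIM('e)"
  note F = lift_frame_orthonormal
  note vf = TM.frame_vfield[OF F] and tf = TM.frame_tangent[OF F]
  note pA = base_pts[OF u]
  have v: "vfield_on A U (E i)" and t: "E i p \<in> tangent_space A p" if "i < ?n" for i
    using frame_vfield[OF E that] frame_tangent[OF E that p] by auto
  have t': "E i (fst ?u) \<in> tangent_space A (fst ?u)" if "i < ?n" for i using t[OF that] by simp
  have h: "e1 i = hlift (E i)" "e1 (i + ?n) = vlift (E i)" if "i < ?n" for i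
    using that by (simp_all add: lift_frame_def)
  have b: "lie_bracket TB W W' ?u \<in> tangent_space TB ?u" if "vfield_on TB (tdom U) W" "vfield_on TB (tdom U) W'" for W W'
    using TM.vfield_tangent[OF TM.vfield_bracket[OF that] frame_point_tdom] .
  have nt: "nab (E i) (E j) p \<in> tangent_space A (fst ?u)" if "i < ?n" "j < ?n" for i j
    using conn_tangent[OF nab v[OF that(1)] v[OF that(2)] p] by simp
  have hv: "lie_bracket TB (e1 i) (e1 (j + ?n)) ?u = vl ?u (nab (E i) (E j) p)" if "i < ?n" "j < ?n" for i j
    unfolding h[OF that(1)] h[OF that(2)] by (rule bracket_hlift_vlift[OF v[OF that(1)] v[OF that(2)] u p])
  have split: "(\<Sum>a<DIM('e \<times> 'e). f a) = (\<Sum>i<?n. f i + f (i + ?n))" for f :: "nat \<Rightarrow> real"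
    using sum_lessThan_add[of f ?n ?n] by (simp add: sum.distrib)
  let ?B = "\<lambda>c a. g1 ?u (lie_bracket TB (e1 (partner c)) (e1 a) ?u) (e1 a ?u)"
  \<comment> \<open>The indices \<open>i\<close> and \<open>i + ?n\<close> are partners of each
    other with opposite signs. Their terms form the difference of two covariant derivatives in
    exchanged order, which is a bracket because the torsion vanishes.\<close>
  have "(\<Sum>a<DIM('e \<times> 'e). psign a * g1 ?u (LC1 (e1 a) (e1 (partner a)) ?u) (e1 c ?u)) =
      (\<Sum>i<?n. g1 ?u (vl ?u (nab (E i) (E i) p)) (e1 c ?u))"
    unfolding split
  proof (rule sum.cong[OF refl])
    fix i assume "i \<in> {..<?n}"
    then have i: "i < ?n" "i < DIM('e \<times> 'e)" "i + ?n < DIM('e \<times> 'e)" by auto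
    note D = TM.conn_tangent[OF TM.levi_civita_works(1) vf vf frame_point_tdom]
    have "psign i * g1 ?u (LC1 (e1 i) (e1 (partner i)) ?u) (e1 c ?u) +
        psign (i + ?n) * g1 ?u (LC1 (e1 (i + ?n)) (e1 (partner (i + ?n))) ?u) (e1 c ?u) =
        g1 ?u (LC1 (e1 i) (e1 (i + ?n)) ?u) (e1 c ?u) - g1 ?u (LC1 (e1 (i + ?n)) (e1 i) ?u) (e1 c ?u)"
      using i by (simp add: psign_def partner_def)
    also have "\<dots> = g1 ?u (lie_bracket TB (e1 i) (e1 (i + ?n)) ?u) (e1 c ?u)"
      unfolding TM.frame_bracket[OF F frame_point_tdom i(2,3), symmetric] TM.g_diff_left[OF u D[OF i(2,3)] D[OF i(3,2)] tf[OF c frame_point_tdom]] ..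
    finally show "psign i * g1 ?u (LC1 (e1 i) (e1 (partner i)) ?u) (e1 c ?u) +
        psign (i + ?n) * g1 ?u (LC1 (e1 (i + ?n)) (e1 (partner (i + ?n))) ?u) (e1 c ?u) =
        g1 ?u (vl ?u (nab (E i) (E i) p)) (e1 c ?u)" unfolding hv[OF i(1) i(1)] .
  qed
  then have S: "(\<Sum>a<DIM('e \<times> 'e). cov_deriv_form2 LC1 \<omega>1 (e1 a) (e1 a) (e1 c) ?u) =
      psign c * (\<Sum>i<?n. ?B c i + ?B c (i + ?n)) + (\<Sum>i<?n. g1 ?u (vl ?u (nab (E i) (E i) p)) (e1 c ?u))"
    using cov_deriv_lift_frame[OF _ c] split[of "?B c"] by (simp add: sum.distrib sum_distrib_left[symmetric])
  show ?thesis
  proof (cases "c < ?n")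
    case True
    \<comment> \<open>For horizontal \<open>e1 c\<close> the brackets are vertical vectors paired
      with horizontal ones, or brackets of two vertical lifts.\<close>
    have "?B c i = 0" "?B c (i + ?n) = 0" if i: "i < ?n" for i
    proof -
      have "lie_bracket TB (e1 (c + ?n)) (e1 i) ?u = tscale (- 1) (vl ?u (nab (E i) (E c) p))"
        using TM.bracket_antisym[of "e1 (c + ?n)" "e1 i" ?u] hv[OF i True] by simp
      then show "?B c i = 0"
        using True i lift_tangent(2)[OF u nt[OF i True]] g1_lift(1)[OF u t'[OF i] lift_tangent(2)[OF u nt[OF i True]]]
          TM.g_scale_left[OF u lift_tangent(2)[OF u nt[OF i True]] lift_tangent(1)[OF u t'[OF i]], of "- 1"]
        by (simp add: partner_def h hlift_def parts_lift[OF u nt[OF i True]] g_zero_left[OF pA t])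
      have "lie_bracket TB (e1 (c + ?n)) (e1 (i + ?n)) ?u = tzero"
        unfolding h[OF True] h[OF i] by (rule bracket_vlift_vlift[OF v[OF True] v[OF i] u p])
      then show "?B c (i + ?n) = 0"
        using True TM.g_zero_left[OF u tf[OF _ frame_point_tdom], of "i + ?n"] i by (simp add: partner_def)
    qed
    moreover have "g1 ?u (vl ?u (nab (E i) (E i) p)) (e1 c ?u) = 0" if i: "i < ?n" for i
      using g1_lift(1)[OF u t'[OF True] lift_tangent(2)[OF u nt[OF i i]]]
      by (simp add: h[OF True] hlift_def parts_lift[OF u nt[OF i i]] g_zero_left[OF pA t[OF True]])
    ultimately show ?thesis unfolding S using True by simp
  next
    case False
    define k where "k = c - ?n"
    have k: "k < ?n" and ck: "c = k + ?n" using c False by (auto simp: k_def)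
    have B1: "?B c i = g p (LC (E i) (E i) p) (E k p)" if i: "i < ?n" for i
    proof -
      \<comment> \<open>Pairing with a horizontal vector sees just the projection of the bracket of
        horizontal lifts. \<open>frame_LC_diag\<close>, read backwards on the base, then produces
        the Levi-Civita term of \<xi>.\<close>
      have "?B c i = g p (dpi ?u (lie_bracket TB (hlift (E k)) (hlift (E i)) ?u)) (E i p)"
        using g1_lift(1)[OF u t'[OF i] b[OF hlift_vfield[OF v[OF k]] hlift_vfield[OF v[OF i]]]]
        by (simp add: ck partner_def h[OF k] h[OF i] hlift_def[of "E i" ?u])
      also have "\<dots> = g p (lie_bracket A (E k) (E i) p) (E i p)"
        unfolding dpi_bracket_hlift[OF v[OF k] v[OF i] u p] ..
      finally show ?thesis unfolding frame_LC_diag[OF E p i k] .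
    qed
    have B2: "?B c (i + ?n) = g p (nab (E k) (E i) p) (E i p)" if i: "i < ?n" for i
      using g1_lift(2)[OF u t'[OF i] lift_tangent(2)[OF u nt[OF k i]]] hv[OF k i]
      by (simp add: ck partner_def h(2)[OF i] vlift_def parts_lift[OF u nt[OF k i]])
    have B3: "g1 ?u (vl ?u (nab (E i) (E i) p)) (e1 c ?u) = g p (nab (E i) (E i) p) (E k p)" if i: "i < ?n" for i
      using g1_lift(2)[OF u t'[OF k] lift_tangent(2)[OF u nt[OF i i]]]
      by (simp add: ck h(2)[OF k] vlift_def parts_lift[OF u nt[OF i i]])
    have "(\<Sum>a<DIM('e \<times> 'e). cov_deriv_form2 LC1 \<omega>1 (e1 a) (e1 a) (e1 c) ?u) =
        - (\<Sum>i<?n. g p (LC (E i) (E i) p) (E k p) + g p (nab (E k) (E i) p) (E i p)) + (\<Sum>i<?n. g p (nab (E i) (E i) p) (E k p))"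
      unfolding S using B1 B2 B3 False by (simp add: psign_def)
    \<comment> \<open>The derivatives of \<open>E i\<close> along itself, taken with
      \<open>LC\<close> and with \<open>nab\<close>, combine to -\<xi>; the derivatives along
      \<open>E k\<close> give \<alpha>.\<close>
    also have "\<dots> = al p (E k p) - xi p (E k p)"
      unfolding koszul_alpha_frame[OF E p v[OF k] p] koszul_xi_frame[OF E p t[OF k]]
      by (simp add: sum.distrib sum_subtractf)
    finally show ?thesis using False by (simp add: k_def)
  qed
qed

end

end

abbreviation \<theta>1 :: "'a tpoint \<Rightarrow> 'a tpoint tvec \<Rightarrow> real" where
  "\<theta>1 \<equiv> lee_form TB J1 g1"

text \<open>The two minus signs of the definitions cancel, and \<open>J1 u w\<close> is expanded in
  the lifted frame. Its horizontal members contribute nothing; along the vertical ones the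
  coefficients are the pairings of \<open>dpi u w\<close> with \<open>E k\<close>, because
  \<open>J1\<close> turns the horizontal part of \<open>w\<close> into a vertical one. Parseval's
  identity sums the result.\<close>

lemma lee_form_eq:
  assumes u: "u \<in> pts TB" and w: "w \<in> tangent_space TB u"
  shows "\<theta>1 u w = al (fst u) (dpi u w) - xi (fst u) (dpi u w)"
proof -
  obtain p v where uv: "u = (p, v)" by (cases u)
  note u' = u[unfolded uv] and w' = w[unfolded uv]
  note pA = base_pts[OF u']
  let ?u = "(p, v)" and ?n = "DIM('e)"
  obtain U E where E: "p \<in> U" "orthonormal_frame_on A g U E" using ex_orthonormal_frame[OF pA] .
  note F = lift_frame_orthonormal[OF E(2)] and uF = frame_point_tdom[OF E(2,1) u']
  obtain S X where X: "?u \<in> S" "vfield_on TB S X" "X ?u = J1 ?u w" using TM.vfield_extend_ex[OF u' J1_parts(1)[OF u' w']] .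
  let ?C = "\<lambda>a X. cov_deriv_form2 LC1 \<omega>1 (lift_frame E a) (lift_frame E a) X ?u"
  have ten: "TM.tensorial_at ?u (?C a)" if "a < DIM('e \<times> 'e)" for a
    using TM.cov_deriv_tensorial3[OF TM.levi_civita_works(1) \<omega>1_smooth_form TM.frame_vfield[OF F that] TM.frame_vfield[OF F that] uF] .
  have t: "E i p \<in> tangent_space A p" if "i < ?n" for i using frame_tangent[OF E(2) that E(1)] .
  define T where "T = metric_trace A g (\<lambda>X Y q. tdiff (adj X Y q) (dt X Y q)) p"
  have T: "T \<in> tangent_space A p"
    unfolding T_def trace_adj_diff_dt[OF E(2,1)] by (intro tdiff_tangent trace_tangent[OF E(2,1)])
  have beta: "al p x - xi p x = g p T x" if "x \<in> tangent_space A p" for x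
    using koszul_diff[OF pA that] by (simp add: T_def)
  note x = parts_tangent(1)[OF u' w', unfolded fst_conv]
  have "\<theta>1 ?u w = (\<Sum>a<DIM('e \<times> 'e). ?C a X)"
    unfolding lee_form_def X(3)[symmetric] TM.codiff2_eq[OF \<omega>1_smooth_form F uF X(2,1)] by simp
  also have "\<dots> = (\<Sum>a<DIM('e \<times> 'e). \<Sum>c<DIM('e \<times> 'e). g1 ?u (X ?u) (lift_frame E c ?u) * ?C a (lift_frame E c))"
    by (rule sum.cong[OF refl], rule TM.tensorial_orthonormal_frame[OF F ten uF X(1,2)]) simp
  also have "\<dots> = (\<Sum>c<DIM('e \<times> 'e). g1 ?u (X ?u) (lift_frame E c ?u) * (\<Sum>a<DIM('e \<times> 'e). ?C a (lift_frame E c)))"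
    by (subst sum.swap) (simp add: sum_distrib_left)
  also have "\<dots> = (\<Sum>c<DIM('e \<times> 'e). g1 ?u (X ?u) (lift_frame E c ?u) *
      (if c < ?n then 0 else al p (E (c - ?n) p) - xi p (E (c - ?n) p)))"
    by (rule sum.cong[OF refl]) (simp only: lessThan_iff sum_cov_deriv_lift_frame[OF E(2,1) u'])
  also have "\<dots> = (\<Sum>k<?n. g1 ?u (J1 ?u w) (vlift (E k) ?u) * (al p (E k p) - xi p (E k p)))"
    using sum_lessThan_add[of "\<lambda>c. g1 ?u (X ?u) (lift_frame E c ?u) *
      (if c < ?n then 0 else al p (E (c - ?n) p) - xi p (E (c - ?n) p))" ?n ?n]
    by (simp add: X(3) lift_frame_def)
  also have "\<dots> = (\<Sum>k<?n. g p T (E k p) * g p (E k p) (dpi ?u w))"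
  proof (rule sum.cong[OF refl])
    fix k assume "k \<in> {..<?n}"
    then have k: "k < ?n" by simp
    have "g1 ?u (J1 ?u w) (vlift (E k) ?u) = g p (dpi ?u w) (E k p)"
      using g1_lift(2)[OF u' _ J1_parts(1)[OF u' w'], of "E k p"] t[OF k] J1_parts(3)[OF u' w'] by (simp add: vlift_def)
    then show "g1 ?u (J1 ?u w) (vlift (E k) ?u) * (al p (E k p) - xi p (E k p)) = g p T (E k p) * g p (E k p) (dpi ?u w)"
      using beta[OF t[OF k]] g_sym[OF pA x t[OF k]] by simp
  qed
  also have "\<dots> = g p T (dpi ?u w)" by (rule parseval[OF E(2,1) T x])
  also have "\<dots> = al p (dpi ?u w) - xi p (dpi ?u w)" using beta[OF x] by simp
  finally show ?thesis unfolding uv by simp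
qed

lemma lee_form_pullback: "form_eq TB \<theta>1 (pullback_form A fst (\<lambda>p x. al p x - xi p x))"
  unfolding form_eq_def pullback_form_def using lee_form_eq by (auto simp: dpi_def)

text \<open>The zero section supplies a point of the bundle over each \<open>p\<close>; evaluating
  on horizontal lifts there brings identities down to the base.\<close>

lemma zero_section_pts: "p \<in> pts A \<Longrightarrow> (p, tzero) \<in> pts TB"
  by (simp add: TM_pts_iff tzero_tangent)

lemma balanced_iff: "balanced TB J1 g1 \<longleftrightarrow> form_eq A al xi"
proof
  assume b: "balanced TB J1 g1"
  show "form_eq A al xi"
    unfolding form_eq_def
  proof (intro ballI)
    fix p x assume p: "p \<in> pts A" and x: "x \<in> tangent_space A p"
    note u = zero_section_pts[OF p]
    have x': "x \<in> tangent_space A (fst (p, tzero :: 'a tvec))" using x by simp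
    have "\<theta>1 (p, tzero) (hl (p, tzero) x) = 0"
      using b u lift_tangent(1)[OF u x'] unfolding balanced_def form_eq_def by blast
    then show "al p x = xi p x"
      using lee_form_eq[OF u lift_tangent(1)[OF u x']] parts_lift(1)[OF u x'] by simp
  qed
next
  assume eq: "form_eq A al xi"
  show "balanced TB J1 g1"
    unfolding balanced_def form_eq_def
  proof (intro ballI)
    fix u w assume u: "u \<in> pts TB" and w: "w \<in> tangent_space TB u"
    show "\<theta>1 u w = 0"
      using lee_form_eq[OF u w] eq base_pts[OF pair_pts[OF u]] parts_tangent(1)[OF u w] unfolding form_eq_def by simp
  qed
qed

end

section \<open>Exterior derivatives of one-forms\<close>

context atlas
begin

definition smooth_form1 :: "('a \<Rightarrow> 'a tvec \<Rightarrow> real) \<Rightarrow> bool" where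
  "smooth_form1 \<eta> \<longleftrightarrow>
     (\<forall>p\<in>pts A. \<forall>x\<in>tangent_space A p. \<forall>y\<in>tangent_space A p.
        \<eta> p (tadd x y) = \<eta> p x + \<eta> p y \<and> (\<forall>c. \<eta> p (tscale c x) = c * \<eta> p x)) \<and>
     (\<forall>U X. vfield_on A U X \<longrightarrow> smooth_fun_on A U (\<lambda>q. \<eta> q (X q)))"

context
  fixes \<eta> assumes \<eta>: "smooth_form1 \<eta>"
begin

lemma form1_add: "p \<in> pts A \<Longrightarrow> x \<in> tangent_space A p \<Longrightarrow> y \<in> tangent_space A p \<Longrightarrow> \<eta> p (tadd x y) = \<eta> p x + \<eta> p y"
  using \<eta> unfolding smooth_form1_def by blast

lemma form1_scale: "p \<in> pts A \<Longrightarrow> x \<in> tangent_space A p \<Longrightarrow> \<eta> p (tscale c x) = c * \<eta> p x"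
  using \<eta> unfolding smooth_form1_def by blast

lemma form1_smooth: "vfield_on A U X \<Longrightarrow> p \<in> U \<Longrightarrow> smooth_near A p (\<lambda>q. \<eta> q (X q))"
  using \<eta> unfolding smooth_form1_def smooth_fun_on_iff by blast

lemma form1_diff:
  assumes "p \<in> pts A" "x \<in> tangent_space A p" "y \<in> tangent_space A p"
  shows "\<eta> p (tdiff x y) = \<eta> p x - \<eta> p y"
proof -
  have "tdiff x y = tadd x (tscale (- 1) y)" by (simp add: tdiff_def tadd_def tscale_def)
  then show ?thesis using form1_add[OF assms(1,2) tscale_tangent[OF assms(3)]] form1_scale[OF assms(1,3)] by simp
qed

lemma ext_deriv_antisym:
  assumes X: "vfield_on A U X" and Y: "vfield_on A U Y" and p: "p \<in> U"
  shows "ext_deriv A \<eta> X Y p = - ext_deriv A \<eta> Y X p"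
  unfolding ext_deriv_def bracket_antisym[of X Y p]
    form1_scale[OF openin_pts[OF vfield_open[OF X] p] vfield_tangent[OF vfield_bracket[OF Y X] p]] by simp

text \<open>Scaling \<open>X\<close> by \<open>f\<close> creates the term
  \<open>Y p f * \<eta> p (X p)\<close> both in the derivative along \<open>Y\<close> and in the
  bracket, with cancelling signs.\<close>

lemma ext_deriv_tensorial1:
  assumes Y: "vfield_on A V Y" "p \<in> V"
  shows "tensorial_at p (\<lambda>X. ext_deriv A \<eta> X Y p)"
proof (rule tensorialI_within[OF vfield_open[OF Y(1)] Y(2)])
  fix U X X' assume *: "U \<subseteq> V" "p \<in> U" "vfield_on A U X" "vfield_on A U X'"
  note o = vfield_open[OF *(3)] and pA = openin_pts[OF vfield_open[OF Y(1)] Y(2)]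
  have YU: "vfield_on A U Y" using vfield_subset[OF Y(1) o *(1)] .
  have "Y p (\<lambda>q. \<eta> q (tadd (X q) (X' q))) = Y p (\<lambda>q. \<eta> q (X q) + \<eta> q (X' q))"
  proof (rule tangent_cong[OF vfield_tangent[OF Y] pA])
    show "eventually (\<lambda>q. \<eta> q (tadd (X q) (X' q)) = \<eta> q (X q) + \<eta> q (X' q)) (near p)"
      using eventually_near_open[OF o *(2)]
    proof eventually_elim
      case (elim q)
      show ?case by (rule form1_add[OF openin_pts[OF o elim] vfield_tangent[OF *(3) elim] vfield_tangent[OF *(4) elim]])
    qed
  qed
  also have "\<dots> = Y p (\<lambda>q. \<eta> q (X q)) + Y p (\<lambda>q. \<eta> q (X' q))"
    by (rule tangent_add[OF vfield_tangent[OF Y] form1_smooth[OF *(3,2)] form1_smooth[OF *(4,2)]])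
  finally show "ext_deriv A \<eta> (\<lambda>q. tadd (X q) (X' q)) Y p = ext_deriv A \<eta> X Y p + ext_deriv A \<eta> X' Y p"
    unfolding ext_deriv_def bracket_add_left[OF *(3,4) YU *(2)]
      form1_add[OF pA vfield_tangent[OF vfield_bracket[OF *(3) YU] *(2)] vfield_tangent[OF vfield_bracket[OF *(4) YU] *(2)]]
    by (simp add: tadd_apply[of "X p" "X' p" "\<lambda>q. \<eta> q (Y q)"])
next
  fix U f X assume *: "U \<subseteq> V" "p \<in> U" "smooth_fun_on A U f" "vfield_on A U X"
  note o = vfield_open[OF *(4)] and pA = openin_pts[OF vfield_open[OF Y(1)] Y(2)]
  have YU: "vfield_on A U Y" using vfield_subset[OF Y(1) o *(1)] .
  have f: "smooth_near A p f" using *(2,3) by (auto simp: smooth_fun_on_iff)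
  have "Y p (\<lambda>q. \<eta> q (tscale (f q) (X q))) = Y p (\<lambda>q. f q * \<eta> q (X q))"
  proof (rule tangent_cong[OF vfield_tangent[OF Y] pA])
    show "eventually (\<lambda>q. \<eta> q (tscale (f q) (X q)) = f q * \<eta> q (X q)) (near p)"
      using eventually_near_open[OF o *(2)]
    proof eventually_elim
      case (elim q)
      show ?case by (rule form1_scale[OF openin_pts[OF o elim] vfield_tangent[OF *(4) elim]])
    qed
  qed
  also have "\<dots> = f p * Y p (\<lambda>q. \<eta> q (X q)) + \<eta> p (X p) * Y p f"
    by (rule tangent_mult[OF vfield_tangent[OF Y] f form1_smooth[OF *(4,2)]])
  finally have d: "Y p (\<lambda>q. \<eta> q (tscale (f q) (X q))) = f p * Y p (\<lambda>q. \<eta> q (X q)) + \<eta> p (X p) * Y p f" .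
  note bt = vfield_tangent[OF vfield_bracket[OF *(4) YU] *(2)] and Xt = vfield_tangent[OF *(4,2)]
  have b: "\<eta> p (lie_bracket A (\<lambda>q. tscale (f q) (X q)) Y p) = f p * \<eta> p (lie_bracket A X Y p) - Y p f * \<eta> p (X p)"
    unfolding bracket_scale_left[OF *(4) YU *(3,2)] form1_diff[OF pA tscale_tangent[OF bt] tscale_tangent[OF Xt]]
      form1_scale[OF pA bt] form1_scale[OF pA Xt] ..
  show "ext_deriv A \<eta> (\<lambda>q. tscale (f q) (X q)) Y p = f p * ext_deriv A \<eta> X Y p"
    unfolding ext_deriv_def d b by (simp add: tscale_apply[of "f p" "X p" "\<lambda>q. \<eta> q (Y q)"] algebra_simps)
qed

end

end

context riemannian
begin

text \<open>Reduces closedness to a frame. On the tangent bundle this replaces arbitrary fields,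
  which need not be lifts, by the lifted frame, whose brackets are under control.\<close>

lemma ext_deriv_zero_frame:
  assumes \<eta>: "smooth_form1 \<eta>" and E: "orthonormal_frame_on A g U E" and p: "p \<in> U"
    and 0: "\<And>i j. i < DIM('e) \<Longrightarrow> j < DIM('e) \<Longrightarrow> ext_deriv A \<eta> (E i) (E j) p = 0"
    and X: "vfield_on A V X" and Y: "vfield_on A V Y" and pV: "p \<in> V"
  shows "ext_deriv A \<eta> X Y p = 0"
proof -
  have *: "ext_deriv A \<eta> (E i) Y p = 0" if i: "i < DIM('e)" for i
  proof -
    have W: "p \<in> U \<inter> V" using p pV by blast
    have "ext_deriv A \<eta> (E i) Y p = - ext_deriv A \<eta> Y (E i) p"
      by (rule ext_deriv_antisym[OF \<eta> vfield_Int(1)[OF frame_vfield[OF E i] vfield_open[OF Y]] vfield_Int(2)[OF Y frame_open[OF E]] W])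
    also have "ext_deriv A \<eta> Y (E i) p = (\<Sum>j<DIM('e). g p (Y p) (E j p) * ext_deriv A \<eta> (E j) (E i) p)"
      by (rule tensorial_orthonormal_frame[OF E ext_deriv_tensorial1[OF \<eta> frame_vfield[OF E i] p] p pV Y])
    finally show ?thesis using 0[OF _ i] by simp
  qed
  have "ext_deriv A \<eta> X Y p = (\<Sum>i<DIM('e). g p (X p) (E i p) * ext_deriv A \<eta> (E i) Y p)"
    by (rule tensorial_orthonormal_frame[OF E ext_deriv_tensorial1[OF \<eta> Y pV] p pV X])
  then show ?thesis using * by simp
qed

end

section \<open>Closedness of the Lee form\<close>

context affine_riemann
begin

abbreviation \<beta> :: "'a \<Rightarrow> 'a tvec \<Rightarrow> real" where
  "\<beta> \<equiv> \<lambda>p x. al p x - xi p x"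

lemma \<beta>_smooth: "vfield_on A U X \<Longrightarrow> p \<in> U \<Longrightarrow> smooth_near A p (\<lambda>q. \<beta> q (X q))"
  by (rule smooth_near_diff[OF koszul_alpha_smooth koszul_xi_smooth])

text \<open>For an arbitrary field \<open>W\<close> the projection \<open>dpi u (W u)\<close> varies
  along the fibres, so the value is not a pullback. It is expanded in coordinate fields: the
  components are smooth along the projection, and \<alpha> - \<xi> on the coordinate fields is
  pulled back from the base.\<close>

lemma lee_form_smooth: "TM.smooth_form1 \<theta>1"
  unfolding TM.smooth_form1_def
proof (intro conjI ballI allI impI)
  fix u w w' assume u: "u \<in> pts TB" and w: "w \<in> tangent_space TB u" "w' \<in> tangent_space TB u"
  note l = koszul_diff_linear[OF base_pts[OF pair_pts[OF u]] parts_tangent(1)[OF u w(1)] parts_tangent(1)[OF u w(2)]]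
  show "\<theta>1 u (tadd w w') = \<theta>1 u w + \<theta>1 u w'"
    unfolding lee_form_eq[OF u TM.tadd_tangent[OF w]] lee_form_eq[OF u w(1)] lee_form_eq[OF u w(2)] parts_add[OF u w] l(1) ..
  show "\<theta>1 u (tscale k w) = k * \<theta>1 u w" for k
    unfolding lee_form_eq[OF u TM.tscale_tangent[OF w(1)]] lee_form_eq[OF u w(1)] parts_scale[OF u w(1)] l(2) ..
next
  fix S W assume W: "vfield_on TB S W"
  show "smooth_fun_on TB S (\<lambda>u. \<theta>1 u (W u))"
    unfolding TM.smooth_fun_on_iff
  proof (intro conjI ballI TM.vfield_open[OF W])
    fix u assume uS: "u \<in> S"
    obtain p v V \<phi> where uv: "u = (p, v)" "(p, v) \<in> pts TB" "(V, \<phi>) \<in> A" "p \<in> V"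
      using pts_chart[OF TM.openin_pts[OF TM.vfield_open[OF W] uS]] .
    note u = uv(2) and c = uv(3,4) and uS' = uS[unfolded uv(1)]
    let ?e = "\<lambda>b q. coord_vec V \<phi> q b"
    have co: "smooth_near TB (p, v) (\<lambda>u'. dpi u' (W u') (\<lambda>q. \<phi> q \<bullet> b))" if "b \<in> Basis" for b
      using smooth_along_parts(1)[OF u c W uS'] that unfolding smooth_along_def[OF u c] by blast
    have "smooth_near TB (p, v) (\<lambda>u'. \<Sum>b\<in>Basis. dpi u' (W u') (\<lambda>q. \<phi> q \<bullet> b) * \<beta> (fst u') (?e b (fst u')))"
      by (rule TM.smooth_near_sum[OF u TM.smooth_near_mult[OF co smooth_base[OF u \<beta>_smooth[OF vfield_coord[OF c(1)] c(2)]]]])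
    moreover have "eventually (\<lambda>u'. (\<Sum>b\<in>Basis. dpi u' (W u') (\<lambda>q. \<phi> q \<bullet> b) * \<beta> (fst u') (?e b (fst u'))) = \<theta>1 u' (W u')) (TM.near (p, v))"
      using near_chart[OF u c] TM.eventually_near_open[OF TM.vfield_open[OF W] uS']
    proof eventually_elim
      case (elim u')
      let ?q = "fst u'" and ?x = "dpi u' (W u')"
      have u': "u' \<in> pts TB" and q: "?q \<in> pts A" "?q \<in> V" using elim by auto
      note Wt = TM.vfield_tangent[OF W elim(2)]
      note x = parts_tangent(1)[OF u' Wt]
      let ?T = "metric_trace A g (\<lambda>X Y q. tdiff (adj X Y q) (dt X Y q)) ?q"
      have T: "?T \<in> tangent_space A ?q"
      proof -
        obtain U E where E: "?q \<in> U" "orthonormal_frame_on A g U E" using ex_orthonormal_frame[OF q(1)] .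
        show ?thesis unfolding trace_adj_diff_dt[OF E(2,1)] by (intro tdiff_tangent trace_tangent[OF E(2,1)])
      qed
      have et: "?e b ?q \<in> tangent_space A ?q" for b using coord_vec_tangent[OF c(1) q(2)] .
      have "\<beta> ?q ?x = g ?q ?T (tsum (\<lambda>b. tscale (?x (\<lambda>q. \<phi> q \<bullet> b)) (?e b ?q)) Basis)"
        using koszul_diff[OF q(1) x] tangent_chart_expand[OF c(1) q(2) x] by simp
      also have "\<dots> = (\<Sum>b\<in>Basis. g ?q ?T (tscale (?x (\<lambda>q. \<phi> q \<bullet> b)) (?e b ?q)))"
        by (rule g_sum_right[OF q(1) tscale_tangent[OF et] T])
      also have "\<dots> = (\<Sum>b\<in>Basis. ?x (\<lambda>q. \<phi> q \<bullet> b) * \<beta> ?q (?e b ?q))"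
        unfolding koszul_diff[OF q(1) et] g_scale_right[OF q(1) et T] ..
      finally show ?case unfolding lee_form_eq[OF u' Wt] by simp
    qed
    ultimately show "smooth_near TB u (\<lambda>u. \<theta>1 u (W u))" unfolding uv(1) by (rule TM.smooth_near_cong)
  qed
qed

context
  fixes U X Y p v assumes X: "vfield_on A U X" and Y: "vfield_on A U Y" and u: "(p, v) \<in> pts TB" and p: "p \<in> U"
begin

lemma lee_form_lift_near:
  "eventually (\<lambda>u'. \<theta>1 u' (hlift X u') = \<beta> (fst u') (X (fst u'))) (TM.near (p, v))"
  "eventually (\<lambda>u'. \<theta>1 u' (vlift X u') = 0) (TM.near (p, v))"
proof -
  have *: "\<theta>1 u' (hlift X u') = \<beta> (fst u') (X (fst u')) \<and> \<theta>1 u' (vlift X u') = 0"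
    if u: "(fst u', snd u') \<in> pts TB \<and> fst u' \<in> U" for u'
  proof -
    have u': "u' \<in> pts TB" and x: "X (fst u') \<in> tangent_space A (fst u')" using that vfield_tangent[OF X] by auto
    have "al (fst u') tzero - xi (fst u') tzero = 0"
      using koszul_diff_linear(2)[OF base_pts[OF pair_pts[OF u']] tzero_tangent tzero_tangent, of 0] by (simp add: tscale_def tzero_def)
    then show ?thesis
      unfolding hlift_def vlift_def lee_form_eq[OF u' lift_tangent(1)[OF u' x]] lee_form_eq[OF u' lift_tangent(2)[OF u' x]]
        parts_lift[OF u' x] by simp
  qed
  show "eventually (\<lambda>u'. \<theta>1 u' (hlift X u') = \<beta> (fst u') (X (fst u'))) (TM.near (p, v))"
    "eventually (\<lambda>u'. \<theta>1 u' (vlift X u') = 0) (TM.near (p, v))"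
    using near_U[OF X u p] by (eventually_elim, use * in blast)+
qed

end

text \<open>On lifts \<open>\<theta>1\<close> takes values that are zero or pulled back from the
  base, and vertical lifts kill these. What remains is governed by the brackets, of which
  \<open>\<theta>1\<close> sees the projections alone.\<close>

lemma ext_deriv_lee_form_lift:
  assumes X: "vfield_on A U X" and Y: "vfield_on A U Y" and u: "(p, v) \<in> pts TB" and p: "p \<in> U"
  shows "ext_deriv TB \<theta>1 (hlift X) (hlift Y) (p, v) = ext_deriv A \<beta> X Y p"
    and "ext_deriv TB \<theta>1 (hlift X) (vlift Y) (p, v) = 0"
    and "ext_deriv TB \<theta>1 (vlift X) (vlift Y) (p, v) = 0"
proof -
  note uT = point_tdom[OF X u p]
  have hh: "hlift X (p, v) (\<lambda>u'. \<theta>1 u' (hlift Y u')) = X p (\<lambda>q. \<beta> q (Y q))"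
    and h0: "hlift X (p, v) (\<lambda>u'. \<theta>1 u' (vlift Y u')) = 0"
    and v0: "vlift X (p, v) (\<lambda>u'. \<theta>1 u' (vlift Y u')) = 0"
    and vh: "vlift X (p, v) (\<lambda>u'. \<theta>1 u' (hlift Y u')) = 0"
    if X: "vfield_on A U X" and Y: "vfield_on A U Y" for X Y
  proof -
    note t = lift_at_tangent[OF X u p] and l = lee_form_lift_near[OF Y Y u p]
    show "hlift X (p, v) (\<lambda>u'. \<theta>1 u' (hlift Y u')) = X p (\<lambda>q. \<beta> q (Y q))"
      using TM.tangent_cong[OF t(1) u l(1)] hlift_of_base[OF X u p \<beta>_smooth[OF Y p]] by simp
    show "hlift X (p, v) (\<lambda>u'. \<theta>1 u' (vlift Y u')) = 0" "vlift X (p, v) (\<lambda>u'. \<theta>1 u' (vlift Y u')) = 0"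
      using TM.tangent_cong[OF t(1) u l(2)] TM.tangent_cong[OF t(2) u l(2)] TM.tangent_const[OF t(1) u] TM.tangent_const[OF t(2) u]
      by simp_all
    show "vlift X (p, v) (\<lambda>u'. \<theta>1 u' (hlift Y u')) = 0"
      using TM.tangent_cong[OF t(2) u l(1)] vlift_of_base[OF X u p, of "\<lambda>q. \<beta> q (Y q)"] by simp
  qed
  note b = TM.vfield_tangent[OF TM.vfield_bracket uT]
  have z: "al p tzero - xi p tzero = 0"
    using koszul_diff_linear(2)[OF base_pts[OF u] tzero_tangent tzero_tangent, of 0] by (simp add: tscale_def tzero_def)
  have nt: "nab X Y p \<in> tangent_space A (fst (p, v))" using conn_tangent[OF nab X Y p] by simp
  have bz: "\<theta>1 (p, v) tzero = 0"
    using TM.form1_scale[OF lee_form_smooth u TM.tzero_tangent, of 0] by (simp add: tscale_def tzero_def)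
  have bh: "\<theta>1 (p, v) (lie_bracket TB (hlift X) (hlift Y) (p, v)) = \<beta> p (lie_bracket A X Y p)"
    unfolding lee_form_eq[OF u b[OF hlift_vfield[OF X] hlift_vfield[OF Y]]] dpi_bracket_hlift[OF X Y u p] by simp
  have bv: "\<theta>1 (p, v) (lie_bracket TB (hlift X) (vlift Y) (p, v)) = 0"
    unfolding bracket_hlift_vlift[OF X Y u p] lee_form_eq[OF u lift_tangent(2)[OF u nt]] parts_lift(3)[OF u nt] using z by simp
  show "ext_deriv TB \<theta>1 (hlift X) (hlift Y) (p, v) = ext_deriv A \<beta> X Y p"
    unfolding ext_deriv_def hh[OF X Y] hh[OF Y X] bh ..
  show "ext_deriv TB \<theta>1 (hlift X) (vlift Y) (p, v) = 0"
    unfolding ext_deriv_def h0[OF X Y] vh[OF Y X] bv by simp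
  show "ext_deriv TB \<theta>1 (vlift X) (vlift Y) (p, v) = 0"
    unfolding ext_deriv_def v0[OF X Y] v0[OF Y X] bracket_vlift_vlift[OF X Y u p] bz by simp
qed

text \<open>Horizontal lifts along the zero section recover the exterior derivative of
  \<open>\<beta>\<close>. Conversely, closedness upstairs is tested on a lifted frame, where pairs
  containing a vertical member contribute zero.\<close>

lemma lee_form_closed_iff: "closed_form TB \<theta>1 \<longleftrightarrow> closed_form A \<beta>"
proof
  assume cl: "closed_form TB \<theta>1"
  show "closed_form A \<beta>"
    unfolding closed_form_def
  proof (intro allI impI ballI, elim conjE)
    fix U X Y p assume X: "vfield_on A U X" and Y: "vfield_on A U Y" and p: "p \<in> U"
    note u = zero_section_pts[OF openin_pts[OF vfield_open[OF X] p]]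
    have "ext_deriv TB \<theta>1 (hlift X) (hlift Y) (p, tzero) = 0"
      using cl hlift_vfield[OF X] hlift_vfield[OF Y] point_tdom[OF X u p] unfolding closed_form_def by blast
    then show "ext_deriv A \<beta> X Y p = 0" unfolding ext_deriv_lee_form_lift(1)[OF X Y u p] .
  qed
next
  assume cl: "closed_form A \<beta>"
  show "closed_form TB \<theta>1"
    unfolding closed_form_def
  proof (intro allI impI ballI, elim conjE)
    fix S W W' u assume W: "vfield_on TB S W" and W': "vfield_on TB S W'" and uS: "u \<in> S"
    obtain p v where uv: "u = (p, v)" by (cases u)
    have u: "(p, v) \<in> pts TB" using TM.openin_pts[OF TM.vfield_open[OF W] uS] uv by simp
    obtain U E where E: "p \<in> U" "orthonormal_frame_on A g U E" using ex_orthonormal_frame[OF base_pts[OF u]] .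
    note F = lift_frame_orthonormal[OF E(2)] and uF = frame_point_tdom[OF E(2,1) u]
    have v: "vfield_on A U (E i)" if "i < DIM('e)" for i using frame_vfield[OF E(2) that] .
    have *: "ext_deriv TB \<theta>1 (lift_frame E i) (lift_frame E j) (p, v) = 0"
      if i: "i < DIM('e \<times> 'e)" and j: "j < DIM('e \<times> 'e)" for i j
    proof -
      let ?i = "i - DIM('e)" and ?j = "j - DIM('e)"
      consider "i < DIM('e)" "j < DIM('e)" | "i < DIM('e)" "\<not> j < DIM('e)" "?j < DIM('e)"
        | "\<not> i < DIM('e)" "j < DIM('e)" "?i < DIM('e)" | "\<not> i < DIM('e)" "\<not> j < DIM('e)" "?i < DIM('e)" "?j < DIM('e)"
        using i j by fastforce
      then show ?thesis
      proof cases
        case 1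
        have "ext_deriv A \<beta> (E i) (E j) p = 0" using cl v[OF 1(1)] v[OF 1(2)] E(1) unfolding closed_form_def by blast
        then show ?thesis using 1 ext_deriv_lee_form_lift(1)[OF v v u E(1), of i j] by (simp add: lift_frame_def)
      next
        case 2
        then show ?thesis using ext_deriv_lee_form_lift(2)[OF v v u E(1), of i ?j] by (simp add: lift_frame_def)
      next
        case 3
        then show ?thesis
          using ext_deriv_lee_form_lift(2)[OF v v u E(1), of j ?i]
            TM.ext_deriv_antisym[OF lee_form_smooth vlift_vfield[OF v] hlift_vfield[OF v] uF, of ?i j]
          by (simp add: lift_frame_def)
      next
        case 4
        then show ?thesis using ext_deriv_lee_form_lift(3)[OF v v u E(1), of ?i ?j] by (simp add: lift_frame_def)
      qed
    qed
    show "ext_deriv TB \<theta>1 W W' u = 0"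
      unfolding uv by (rule TM.ext_deriv_zero_frame[OF lee_form_smooth F uF * W W']) (use uS uv in simp_all)
  qed
qed

end

theorem proposition3p4:
  fixes A :: "('a, 'e::euclidean_space) chart set"
    and nab :: "'a vfield \<Rightarrow> 'a vfield \<Rightarrow> 'a vfield"
    and g :: "'a \<Rightarrow> 'a tvec \<Rightarrow> 'a tvec \<Rightarrow> real"
  assumes "affine_riemann_manifold A nab g"
  shows
    "form_eq (tangent_bundle A)
       (lee_form (tangent_bundle A) (canonical_J A nab) (canonical_g A nab g))
       (pullback_form A fst (\<lambda>p x. koszul_alpha A nab g p x - koszul_xi A nab g p x))
     \<and> (balanced (tangent_bundle A) (canonical_J A nab) (canonical_g A nab g)
          \<longleftrightarrow> form_eq A (koszul_alpha A nab g) (koszul_xi A nab g))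
     \<and> (form_eq A (koszul_alpha A nab g) (koszul_xi A nab g)
          \<longleftrightarrow> (\<forall>p\<in>pts A.
                metric_trace A g
                  (\<lambda>X Y q. tdiff (adjoint_tensor A g (diff_tensor A nab g) X Y q)
                                 (diff_tensor A nab g X Y q)) p = tzero))
     \<and> (locally_conformally_balanced (tangent_bundle A) (canonical_J A nab) (canonical_g A nab g)
          \<longleftrightarrow> closed_form A (koszul_xi A nab g))"
proof -
  interpret affine_riemann A g nab
    using assms unfolding affine_riemann_manifold_def manifold_def by unfold_locales auto
  show ?thesis
    unfolding locally_conformally_balanced_def lee_form_closed_iff koszul_diff_closed_iff
    using lee_form_pullback balanced_iff koszul_forms_eq_iff by blast
qed

end
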